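(* Let $k$ be a field of characteristic zero, let $R$ be a commutative affine Hopf $k$-algebra with coproduct $\Delta$, and let $\delta$ be a $k$-linear derivation on $R$ that is an $a$-coderivation for some group-like element $a\in R$. Then $(R,\delta)$ satisfies the $\delta$-DME.
   Context: An affine $k$-algebra is a finitely generated commutative $k$-algebra that is an integral domain. An element $a\in R$ is group-like if $a\ne0$ and $\Delta(a)=a\otimes a$. A $k$-linear map $\delta:R\to R$ is an $a$-coderivation if for all $r\in R$, writing $\Delta(r)=\sum r_1\otimes r_2$ in Sweedler notation, $$\Delta(\delta r)=\sum\left(\delta r_1\otimes r_2+a r_1\otimes\delta r_2\right).$$ Let $R$ be an affine $k$-algebra with a $k$-linear derivation $\delta$. A $\delta$-ideal is an ideal $I$ with $\delta(I)\subseteq I$. We say $(R,\delta)$ satisfies the $\delta$-DME if for every prime $\delta$-ideal $P$ of $R$ the following are equivalent: (i) $P$ is $\delta$-primitive: there is a maximal ideal $\mathfrak m$ of $R$ such that $P$ is maximal among the prime $\delta$-ideals contained in $\mathfrak m$; (ii) $P$ is $\delta$-locally-closed: the intersection of all the prime $\delta$-ideals of $R$ that properly contain $P$ is a proper extension of $P$ (the empty intersection being $R$); (iii) $P$ is $\delta$-rational: the field of constants $\operatorname{Frac}(R/P)^\delta$ is algebraic over $k$ (contained in $k^{\mathrm{alg}}$). *)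

theory Defs
  imports "HOL-Algebra.Algebra"
begin

section \<open>Algebras over a field\<close>

definition k_linear ::
    "('k, 'm) ring_scheme \<Rightarrow> ('k, 'a, 'n) module_scheme \<Rightarrow> ('k, 'b, 'p) module_scheme \<Rightarrow> ('a \<Rightarrow> 'b) \<Rightarrow> bool"
  where "k_linear K A B f \<longleftrightarrow>
    f \<in> carrier A \<rightarrow> carrier B \<and>
    (\<forall>x\<in>carrier A. \<forall>y\<in>carrier A. f (x \<oplus>\<^bsub>A\<^esub> y) = f x \<oplus>\<^bsub>B\<^esub> f y) \<and>
    (\<forall>c\<in>carrier K. \<forall>x\<in>carrier A. f (c \<odot>\<^bsub>A\<^esub> x) = c \<odot>\<^bsub>B\<^esub> f x)"

definition char_zero :: "('k, 'm) ring_scheme \<Rightarrow> bool"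
  where "char_zero K \<longleftrightarrow> (\<forall>n::nat. n > 0 \<longrightarrow> add_pow K n \<one>\<^bsub>K\<^esub> \<noteq> \<zero>\<^bsub>K\<^esub>)"

definition scalars :: "('k, 'm) ring_scheme \<Rightarrow> ('k, 'a, 'n) module_scheme \<Rightarrow> 'a set"
  where "scalars K A = (\<lambda>c. c \<odot>\<^bsub>A\<^esub> \<one>\<^bsub>A\<^esub>) ` carrier K"

text \<open>The subalgebra generated by \<open>U\<close> is the subring generated by \<open>U\<close> and the scalars.\<close>

definition affine_algebra :: "('k, 'm) ring_scheme \<Rightarrow> ('k, 'a, 'n) module_scheme \<Rightarrow> bool"
  where "affine_algebra K A \<longleftrightarrow>
    field K \<and> algebra K A \<and> domain A \<and>
    (\<exists>U. finite U \<and> U \<subseteq> carrier A \<and> generate_ring A (scalars K A \<union> U) = carrier A)"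


section \<open>Tensor products of commutative algebras\<close>

text \<open>The monoid algebra \<open>K[M]\<close>: finitely supported functions on \<open>M\<close> under convolution.\<close>

definition monoid_algebra ::
    "('k, 'm) ring_scheme \<Rightarrow> ('x, 'n) monoid_scheme \<Rightarrow> ('k, 'x \<Rightarrow> 'k) module"
  where "monoid_algebra K M =
    \<lparr> carrier = {f. (\<forall>x. f x \<in> carrier K) \<and> (\<forall>x. x \<notin> carrier M \<longrightarrow> f x = \<zero>\<^bsub>K\<^esub>) \<and>
                    finite {x. f x \<noteq> \<zero>\<^bsub>K\<^esub>}},
      monoid.mult = (\<lambda>f g z. \<Oplus>\<^bsub>K\<^esub> p \<in> {(x, y). x \<in> carrier M \<and> y \<in> carrier M \<and>
                f x \<noteq> \<zero>\<^bsub>K\<^esub> \<and> g y \<noteq> \<zero>\<^bsub>K\<^esub> \<and> x \<otimes>\<^bsub>M\<^esub> y = z}. f (fst p) \<otimes>\<^bsub>K\<^esub> g (snd p)),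
      one = (\<lambda>x. if x = \<one>\<^bsub>M\<^esub> then \<one>\<^bsub>K\<^esub> else \<zero>\<^bsub>K\<^esub>),
      ring.zero = (\<lambda>x. \<zero>\<^bsub>K\<^esub>),
      add = (\<lambda>f g x. f x \<oplus>\<^bsub>K\<^esub> g x),
      smult = (\<lambda>c f x. c \<otimes>\<^bsub>K\<^esub> f x) \<rparr>"

text \<open>The free \<open>K\<close>-module on pairs \<open>(a, b)\<close>, with the product
  \<open>(a, b) (a', b') = (a a', b b')\<close> of basis elements.\<close>

definition free_pairs ::
    "('k, 'm) ring_scheme \<Rightarrow> ('k, 'a, 'n) module_scheme \<Rightarrow> ('k, 'b, 'p) module_scheme
      \<Rightarrow> ('k, 'a \<times> 'b \<Rightarrow> 'k) module"
  where "free_pairs K A B = monoid_algebra K (A \<times>\<times> B)"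

definition basis_pair :: "('k, 'm) ring_scheme \<Rightarrow> 'a \<Rightarrow> 'b \<Rightarrow> ('a \<times> 'b \<Rightarrow> 'k)"
  where "basis_pair K a b = (\<lambda>p. if p = (a, b) then \<one>\<^bsub>K\<^esub> else \<zero>\<^bsub>K\<^esub>)"

definition bilinear_relations ::
    "('k, 'm) ring_scheme \<Rightarrow> ('k, 'a, 'n) module_scheme \<Rightarrow> ('k, 'b, 'p) module_scheme
      \<Rightarrow> ('a \<times> 'b \<Rightarrow> 'k) set"
  where "bilinear_relations K A B =
    {basis_pair K (a \<oplus>\<^bsub>A\<^esub> a') b \<ominus>\<^bsub>free_pairs K A B\<^esub>
       (basis_pair K a b \<oplus>\<^bsub>free_pairs K A B\<^esub> basis_pair K a' b) | a a' b.
       a \<in> carrier A \<and> a' \<in> carrier A \<and> b \<in> carrier B} \<union>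
    {basis_pair K a (b \<oplus>\<^bsub>B\<^esub> b') \<ominus>\<^bsub>free_pairs K A B\<^esub>
       (basis_pair K a b \<oplus>\<^bsub>free_pairs K A B\<^esub> basis_pair K a b') | a b b'.
       a \<in> carrier A \<and> b \<in> carrier B \<and> b' \<in> carrier B} \<union>
    {basis_pair K (c \<odot>\<^bsub>A\<^esub> a) b \<ominus>\<^bsub>free_pairs K A B\<^esub>
       (c \<odot>\<^bsub>free_pairs K A B\<^esub> basis_pair K a b) | c a b.
       c \<in> carrier K \<and> a \<in> carrier A \<and> b \<in> carrier B} \<union>
    {basis_pair K a (c \<odot>\<^bsub>B\<^esub> b) \<ominus>\<^bsub>free_pairs K A B\<^esub>
       (c \<odot>\<^bsub>free_pairs K A B\<^esub> basis_pair K a b) | c a b.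
       c \<in> carrier K \<and> a \<in> carrier A \<and> b \<in> carrier B}"

text \<open>A basis pair times a bilinear relation is again a bilinear relation, so the \<open>K\<close>-submodule
  generated by the relations is already an ideal. The ideal generated by them is therefore that
  submodule, and the quotient ring below is the usual tensor product.\<close>

definition tensor_ideal ::
    "('k, 'm) ring_scheme \<Rightarrow> ('k, 'a, 'n) module_scheme \<Rightarrow> ('k, 'b, 'p) module_scheme
      \<Rightarrow> ('a \<times> 'b \<Rightarrow> 'k) set"
  where "tensor_ideal K A B = genideal (free_pairs K A B) (bilinear_relations K A B)"

definition tensor ::
    "('k, 'm) ring_scheme \<Rightarrow> ('k, 'a, 'n) module_scheme \<Rightarrow> ('k, 'b, 'p) module_scheme
      \<Rightarrow> ('k, ('a \<times> 'b \<Rightarrow> 'k) set) module"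
  where "tensor K A B =
    ring.extend (free_pairs K A B Quot tensor_ideal K A B)
      (module.fields (\<lambda>c U. \<Union>f\<in>U. tensor_ideal K A B +>\<^bsub>free_pairs K A B\<^esub>
                                     (c \<odot>\<^bsub>free_pairs K A B\<^esub> f)))"

definition pure_tensor ::
    "('k, 'm) ring_scheme \<Rightarrow> ('k, 'a, 'n) module_scheme \<Rightarrow> ('k, 'b, 'p) module_scheme
      \<Rightarrow> 'a \<Rightarrow> 'b \<Rightarrow> ('a \<times> 'b \<Rightarrow> 'k) set"
  where "pure_tensor K A B a b = tensor_ideal K A B +>\<^bsub>free_pairs K A B\<^esub> basis_pair K a b"

text \<open>The linear map \<open>A \<otimes> B \<rightarrow> C\<close> induced by a bilinear map \<open>\<phi>\<close>. In Sweedler notation,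
  \<open>tensor_lift K A B C \<phi> (\<Delta> r)\<close> is \<open>\<Sum> \<phi> r\<^sub>1 r\<^sub>2\<close>. The value is independent of the representative of the
  coset \<open>U\<close> when \<open>\<phi>\<close> is \<open>K\<close>-bilinear, and only such \<open>\<phi>\<close> are used below.\<close>

definition tensor_lift ::
    "('k, 'm) ring_scheme \<Rightarrow> ('k, 'a, 'n) module_scheme \<Rightarrow> ('k, 'b, 'p) module_scheme
      \<Rightarrow> ('k, 'c, 'q) module_scheme \<Rightarrow> ('a \<Rightarrow> 'b \<Rightarrow> 'c) \<Rightarrow> ('a \<times> 'b \<Rightarrow> 'k) set \<Rightarrow> 'c"
  where "tensor_lift K A B C \<phi> U =
    the_elem ((\<lambda>f. \<Oplus>\<^bsub>C\<^esub> p \<in> {p. f p \<noteq> \<zero>\<^bsub>K\<^esub>}. f p \<odot>\<^bsub>C\<^esub> \<phi> (fst p) (snd p)) ` U)"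


section \<open>Commutative Hopf algebras\<close>

text \<open>Coassociativity compares the two iterated coproducts in \<open>(R \<otimes> R) \<otimes> R\<close>, to which
  \<open>R \<otimes> (R \<otimes> R)\<close> is carried by \<open>r \<otimes> (s \<otimes> t) \<mapsto> (r \<otimes> s) \<otimes> t\<close>.\<close>

definition hopf_algebra ::
    "('k, 'm) ring_scheme \<Rightarrow> ('k, 'r, 'n) module_scheme \<Rightarrow> ('r \<Rightarrow> ('r \<times> 'r \<Rightarrow> 'k) set)
      \<Rightarrow> ('r \<Rightarrow> 'k) \<Rightarrow> ('r \<Rightarrow> 'r) \<Rightarrow> bool"
  where "hopf_algebra K R \<Delta> \<epsilon> S \<longleftrightarrow>
    field K \<and> algebra K R \<and>
    \<Delta> \<in> ring_hom R (tensor K R R) \<and> k_linear K R (tensor K R R) \<Delta> \<and>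
    \<epsilon> \<in> ring_hom R K \<and> (\<forall>c\<in>carrier K. \<forall>r\<in>carrier R. \<epsilon> (c \<odot>\<^bsub>R\<^esub> r) = c \<otimes>\<^bsub>K\<^esub> \<epsilon> r) \<and>
    (\<forall>r\<in>carrier R.
      tensor_lift K R R (tensor K (tensor K R R) R)
        (\<lambda>x y. pure_tensor K (tensor K R R) R (\<Delta> x) y) (\<Delta> r) =
      tensor_lift K R R (tensor K (tensor K R R) R)
        (\<lambda>x y. tensor_lift K R R (tensor K (tensor K R R) R)
          (\<lambda>s t. pure_tensor K (tensor K R R) R (pure_tensor K R R x s) t) (\<Delta> y)) (\<Delta> r)) \<and>
    (\<forall>r\<in>carrier R.
      tensor_lift K R R R (\<lambda>x y. \<epsilon> x \<odot>\<^bsub>R\<^esub> y) (\<Delta> r) = r \<and>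
      tensor_lift K R R R (\<lambda>x y. \<epsilon> y \<odot>\<^bsub>R\<^esub> x) (\<Delta> r) = r) \<and>
    k_linear K R R S \<and>
    (\<forall>r\<in>carrier R.
      tensor_lift K R R R (\<lambda>x y. S x \<otimes>\<^bsub>R\<^esub> y) (\<Delta> r) = \<epsilon> r \<odot>\<^bsub>R\<^esub> \<one>\<^bsub>R\<^esub> \<and>
      tensor_lift K R R R (\<lambda>x y. x \<otimes>\<^bsub>R\<^esub> S y) (\<Delta> r) = \<epsilon> r \<odot>\<^bsub>R\<^esub> \<one>\<^bsub>R\<^esub>)"

definition group_like ::
    "('k, 'm) ring_scheme \<Rightarrow> ('k, 'r, 'n) module_scheme \<Rightarrow> ('r \<Rightarrow> ('r \<times> 'r \<Rightarrow> 'k) set) \<Rightarrow> 'r \<Rightarrow> bool"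
  where "group_like K R \<Delta> a \<longleftrightarrow>
    a \<in> carrier R \<and> a \<noteq> \<zero>\<^bsub>R\<^esub> \<and> \<Delta> a = pure_tensor K R R a a"

definition coderivation ::
    "('k, 'm) ring_scheme \<Rightarrow> ('k, 'r, 'n) module_scheme \<Rightarrow> ('r \<Rightarrow> ('r \<times> 'r \<Rightarrow> 'k) set) \<Rightarrow> 'r
      \<Rightarrow> ('r \<Rightarrow> 'r) \<Rightarrow> bool"
  where "coderivation K R \<Delta> a \<delta> \<longleftrightarrow>
    k_linear K R R \<delta> \<and>
    (\<forall>r\<in>carrier R. \<Delta> (\<delta> r) =
      tensor_lift K R R (tensor K R R)
        (\<lambda>x y. pure_tensor K R R (\<delta> x) y \<oplus>\<^bsub>tensor K R R\<^esub> pure_tensor K R R (a \<otimes>\<^bsub>R\<^esub> x) (\<delta> y))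
        (\<Delta> r))"


section \<open>Differential ideals\<close>

definition k_derivation ::
    "('k, 'm) ring_scheme \<Rightarrow> ('k, 'r, 'n) module_scheme \<Rightarrow> ('r \<Rightarrow> 'r) \<Rightarrow> bool"
  where "k_derivation K R \<delta> \<longleftrightarrow>
    k_linear K R R \<delta> \<and>
    (\<forall>x\<in>carrier R. \<forall>y\<in>carrier R. \<delta> (x \<otimes>\<^bsub>R\<^esub> y) = \<delta> x \<otimes>\<^bsub>R\<^esub> y \<oplus>\<^bsub>R\<^esub> x \<otimes>\<^bsub>R\<^esub> \<delta> y)"

definition delta_ideal :: "('r, 'n) ring_scheme \<Rightarrow> ('r \<Rightarrow> 'r) \<Rightarrow> 'r set \<Rightarrow> bool"
  where "delta_ideal R \<delta> I \<longleftrightarrow> ideal I R \<and> \<delta> ` I \<subseteq> I"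

definition prime_delta_ideal :: "('r, 'n) ring_scheme \<Rightarrow> ('r \<Rightarrow> 'r) \<Rightarrow> 'r set \<Rightarrow> bool"
  where "prime_delta_ideal R \<delta> P \<longleftrightarrow> primeideal P R \<and> delta_ideal R \<delta> P"

definition delta_primitive :: "('r, 'n) ring_scheme \<Rightarrow> ('r \<Rightarrow> 'r) \<Rightarrow> 'r set \<Rightarrow> bool"
  where "delta_primitive R \<delta> P \<longleftrightarrow>
    (\<exists>\<mm>. maximalideal \<mm> R \<and> prime_delta_ideal R \<delta> P \<and> P \<subseteq> \<mm> \<and>
         (\<forall>Q. prime_delta_ideal R \<delta> Q \<and> P \<subseteq> Q \<and> Q \<subseteq> \<mm> \<longrightarrow> Q = P))"

text \<open>Intersecting with \<open>carrier R\<close> only matters when no prime \<open>\<delta>\<close>-ideal properly contains \<open>P\<close>; it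
  makes the empty intersection equal to \<open>R\<close>.\<close>

definition delta_locally_closed :: "('r, 'n) ring_scheme \<Rightarrow> ('r \<Rightarrow> 'r) \<Rightarrow> 'r set \<Rightarrow> bool"
  where "delta_locally_closed R \<delta> P \<longleftrightarrow>
    P \<subset> carrier R \<inter> \<Inter>{Q. prime_delta_ideal R \<delta> Q \<and> P \<subset> Q}"


section \<open>Fraction fields and constants\<close>

definition frac_rel :: "('d, 'n) ring_scheme \<Rightarrow> (('d \<times> 'd) \<times> ('d \<times> 'd)) set"
  where "frac_rel D =
    {((a, b), (c, d)). a \<in> carrier D \<and> b \<in> carrier D - {\<zero>\<^bsub>D\<^esub>} \<and>
                       c \<in> carrier D \<and> d \<in> carrier D - {\<zero>\<^bsub>D\<^esub>} \<and> a \<otimes>\<^bsub>D\<^esub> d = c \<otimes>\<^bsub>D\<^esub> b}"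

definition fraction :: "('d, 'n) ring_scheme \<Rightarrow> 'd \<Rightarrow> 'd \<Rightarrow> ('d \<times> 'd) set"
  where "fraction D a b = frac_rel D `` {(a, b)}"

text \<open>Operations on equivalence classes and cosets are written as unions over representatives, as in
  \<open>rcoset_mult\<close>. For a domain \<open>D\<close>, a derivation \<open>\<delta>\<close> and a \<open>\<delta>\<close>-ideal \<open>I\<close> all members of such a
  union are the same class.\<close>

definition fraction_field :: "('d, 'n) ring_scheme \<Rightarrow> ('d \<times> 'd) set ring"
  where "fraction_field D =
    \<lparr> carrier = (carrier D \<times> (carrier D - {\<zero>\<^bsub>D\<^esub>})) // frac_rel D,
      monoid.mult = (\<lambda>U V. \<Union>(a, b)\<in>U. \<Union>(c, d)\<in>V. fraction D (a \<otimes>\<^bsub>D\<^esub> c) (b \<otimes>\<^bsub>D\<^esub> d)),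
      one = fraction D \<one>\<^bsub>D\<^esub> \<one>\<^bsub>D\<^esub>,
      ring.zero = fraction D \<zero>\<^bsub>D\<^esub> \<one>\<^bsub>D\<^esub>,
      add = (\<lambda>U V. \<Union>(a, b)\<in>U. \<Union>(c, d)\<in>V.
               fraction D (a \<otimes>\<^bsub>D\<^esub> d \<oplus>\<^bsub>D\<^esub> c \<otimes>\<^bsub>D\<^esub> b) (b \<otimes>\<^bsub>D\<^esub> d)) \<rparr>"

definition frac_derivation :: "('d, 'n) ring_scheme \<Rightarrow> ('d \<Rightarrow> 'd) \<Rightarrow> ('d \<times> 'd) set \<Rightarrow> ('d \<times> 'd) set"
  where "frac_derivation D \<delta> U =
    (\<Union>(a, b)\<in>U. fraction D (\<delta> a \<otimes>\<^bsub>D\<^esub> b \<ominus>\<^bsub>D\<^esub> a \<otimes>\<^bsub>D\<^esub> \<delta> b) (b \<otimes>\<^bsub>D\<^esub> b))"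

definition quot_derivation :: "('r, 'n) ring_scheme \<Rightarrow> 'r set \<Rightarrow> ('r \<Rightarrow> 'r) \<Rightarrow> 'r set \<Rightarrow> 'r set"
  where "quot_derivation R I \<delta> U = (\<Union>x\<in>U. I +>\<^bsub>R\<^esub> \<delta> x)"

definition constants :: "('f, 'n) ring_scheme \<Rightarrow> ('f \<Rightarrow> 'f) \<Rightarrow> 'f set"
  where "constants F \<delta> = {x \<in> carrier F. \<delta> x = \<zero>\<^bsub>F\<^esub>}"

text \<open>\<open>K\<close> is viewed inside \<open>Frac (R/P)\<close> through the structure map \<open>K \<rightarrow> R \<rightarrow> R/P \<rightarrow> Frac (R/P)\<close>.\<close>

definition delta_rational ::
    "('k, 'm) ring_scheme \<Rightarrow> ('k, 'r, 'n) module_scheme \<Rightarrow> ('r \<Rightarrow> 'r) \<Rightarrow> 'r set \<Rightarrow> bool"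
  where "delta_rational K R \<delta> P \<longleftrightarrow>
    (\<forall>x \<in> constants (fraction_field (R Quot P)) (frac_derivation (R Quot P) (quot_derivation R P \<delta>)).
      (ring.algebraic (fraction_field (R Quot P)) over
        ((\<lambda>s. fraction (R Quot P) (P +>\<^bsub>R\<^esub> s) \<one>\<^bsub>R Quot P\<^esub>) ` scalars K R)) x)"


section \<open>The differential Dixmier-Moeglin equivalence\<close>

definition delta_DME ::
    "('k, 'm) ring_scheme \<Rightarrow> ('k, 'r, 'n) module_scheme \<Rightarrow> ('r \<Rightarrow> 'r) \<Rightarrow> bool"
  where "delta_DME K R \<delta> \<longleftrightarrow>
    (\<forall>P. prime_delta_ideal R \<delta> P \<longrightarrow>
      (delta_primitive R \<delta> P \<longleftrightarrow> delta_locally_closed R \<delta> P) \<and>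
      (delta_locally_closed R \<delta> P \<longleftrightarrow> delta_rational K R \<delta> P))"

end

theory Submission
  imports Defs
begin

text \<open>Let \<open>P\<close> be a prime \<open>\<delta>\<close>-ideal of \<open>R\<close>, let \<open>F\<close> be the fraction field of \<open>R/P\<close> with the induced
  derivation, and let \<open>C\<close> be its field of constants. The three conditions are linked in a cycle.

  Primitive implies rational (\<open>primitive_rational\<close>). The elements all of whose derivatives lie in a
  maximal ideal \<open>m\<close> form the largest \<open>\<delta>\<close>-ideal inside \<open>m\<close>. In characteristic zero it is prime
  (\<open>core_prime\<close>), so \<open>P\<close> is this ideal for a suitable \<open>m\<close>. The denominators of a constant \<open>c\<close> of \<open>F\<close>
  form a \<open>\<delta>\<close>-stable ideal larger than \<open>P\<close>, so \<open>c = r/s\<close> with \<open>s\<close> outside \<open>m\<close>. As \<open>R/m\<close> is algebraic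
  over \<open>k\<close>, some \<open>t\<close> in \<open>m\<close> has image \<open>p(c) s^n\<close> in \<open>F\<close> for a nonzero polynomial \<open>p\<close> over \<open>k\<close>. Since
  \<open>p(c)\<close> is constant, all derivatives of \<open>t\<close> lie in \<open>m\<close> as well. Hence \<open>t\<close> is in \<open>P\<close> and \<open>p(c) = 0\<close>.

  Locally closed implies primitive (\<open>locally_closed_primitive\<close>). Let \<open>f\<close> be an element outside \<open>P\<close> of
  all larger prime \<open>\<delta>\<close>-ideals. An ideal that contains \<open>P\<close> and is maximal among those without powers of
  \<open>f\<close> is prime, and Kaplansky's form of Zariski's lemma (\<open>power_domain_finite_extension_algebraic\<close>)
  shows that it is a maximal ideal.

  Rational implies locally closed (\<open>rational_locally_closed\<close>) is where the Hopf structure enters. Every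
  element of \<open>R\<close> is a combination of entries of a comatrix \<open>g\<close>, that is, of a matrix with
  \<open>\<Delta> g\<^sub>i\<^sub>j = \<Sum> g\<^sub>i\<^sub>k \<otimes> g\<^sub>k\<^sub>j\<close> (\<open>comatrix_expansion\<close>). With \<open>D r = \<Sum> \<delta>(r\<^sub>1) S(r\<^sub>2)\<close> this gives a linear
  differential system \<open>\<delta> g = D(g) g\<close> whose fundamental matrix \<open>g\<close> has the inverse \<open>S(g)\<close> over \<open>R\<close>. The
  map \<open>D\<close> is a derivation relative to the counit (\<open>D_mult\<close>), so \<open>D(R)\<close> is spanned by the values of \<open>D\<close>
  at finitely many generators. The coderivation identity gives \<open>\<delta>(D x) = D(\<delta> x) + D(a) D(x)\<close> (\<open>d_D\<close>), so
  that for \<open>b = S a\<close>, the inverse of \<open>a\<close>, the span \<open>W\<close> of \<open>1\<close>, \<open>b\<close> and \<open>b D(R)\<close> is a finite-dimensional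
  space stable under \<open>\<delta>\<close>. This is a Picard-Vessiot situation: solutions of linear systems with
  fundamental matrices over \<open>R/P\<close>, above the field \<open>L\<close> generated by \<open>C\<close> and \<open>W\<close>. The key lemma
  \<open>relation_zero\<close> says that a relation with constant coefficients between solutions that holds modulo a
  differential ideal holds exactly. It is applied twice. On the tensor powers of the space \<open>W\<close>, where an
  inverse Wronskian matrix has a denominator \<open>f\<close>, it shows that a prime \<open>\<delta>\<close>-ideal of \<open>R/P\<close> without \<open>f\<close>
  is disjoint from the nonzero elements of \<open>C[W]\<close>. Then, over \<open>L\<close>, it shows that such an ideal is zero
  (\<open>generic_point_locally_closed\<close>). Rationality is what makes \<open>C\<close> algebraic over \<open>k\<close>, so that ideals of
  \<open>R/P\<close> survive the passage to coefficients in \<open>C\<close> (\<open>extension_contracts\<close>).\<close>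


text \<open>Structures named by a single letter are written as plain subscripts.\<close>

abbreviation (input) mult_in ("_ \<otimes>\<^sub>_ _" [70, 1000, 71] 70) where "x \<otimes>\<^sub>G y \<equiv> x \<otimes>\<^bsub>G\<^esub> y"
abbreviation (input) add_in ("_ \<oplus>\<^sub>_ _" [65, 1000, 66] 65) where "x \<oplus>\<^sub>G y \<equiv> x \<oplus>\<^bsub>G\<^esub> y"
abbreviation (input) minus_in ("_ \<ominus>\<^sub>_ _" [65, 1000, 66] 65) where "x \<ominus>\<^sub>G y \<equiv> x \<ominus>\<^bsub>G\<^esub> y"
abbreviation (input) uminus_in ("\<ominus>\<^sub>_ _" [1000, 81] 80) where "\<ominus>\<^sub>G x \<equiv> \<ominus>\<^bsub>G\<^esub> x"
abbreviation (input) smult_in ("_ \<odot>\<^sub>_ _" [70, 1000, 71] 70) where "c \<odot>\<^sub>G x \<equiv> c \<odot>\<^bsub>G\<^esub> x"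
abbreviation (input) zero_in ("\<zero>\<^sub>_" [1000] 1000) where "\<zero>\<^sub>G \<equiv> \<zero>\<^bsub>G\<^esub>"
abbreviation (input) one_in ("\<one>\<^sub>_" [1000] 1000) where "\<one>\<^sub>G \<equiv> \<one>\<^bsub>G\<^esub>"

section \<open>Finite sums and matrices over a commutative ring\<close>

lemma (in abelian_monoid) finsum_swap:
 assumes "finite A" "finite B" "!!i j. i : A ==> j : B ==> f i j : carrier G"
 shows "(\<Oplus>i\<in>A. \<Oplus>j\<in>B. f i j) = (\<Oplus>j\<in>B. \<Oplus>i\<in>A. f i j)"
 using assms
proof (induction A)
 case empty
 thus ?case by simp
next
 case (insert a A)
 have "(\<Oplus>i\<in>insert a A. \<Oplus>j\<in>B. f i j) = (\<Oplus>j\<in>B. f a j) \<oplus> (\<Oplus>j\<in>B. \<Oplus>i\<in>A. f i j)"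
  using insert by(subst finsum_insert) (auto intro!: finsum_closed)
 also have "... = (\<Oplus>j\<in>B. f a j \<oplus> (\<Oplus>i\<in>A. f i j))"
  using insert by(subst finsum_addf) (auto intro!: finsum_closed)
 also have "... = (\<Oplus>j\<in>B. \<Oplus>i\<in>insert a A. f i j)"
  using insert by(intro finsum_cong') (auto intro!: finsum_closed simp: finsum_insert)
 finally show ?case .
qed

lemma (in abelian_monoid) finsum_single:
 assumes "finite A" "i : A" "f i : carrier G" "!!j. j : A ==> j ~= i ==> f j = \<zero>"
 shows "finsum G f A = f i"
proof -
 have A: "A = insert i (A - {i})" using assms by auto
 have "finsum G f (A - {i}) = \<zero>"
  using assms by(subst finsum_cong'[where g = "%_. \<zero>" and B = "A - {i}"]) auto
 hence "finsum G f (insert i (A - {i})) = f i"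
  using assms by(subst finsum_insert) auto
 thus ?thesis using A by simp
qed

context cring
begin

definition dot :: "'i set => ('i => 'a) => ('i => 'a) => 'a"
 where "dot I x y = (\<Oplus>i\<in>I. x i \<otimes> y i)"

lemma dot_closed [simp, intro]:
 assumes "!!i. i : I ==> x i : carrier R" "!!i. i : I ==> y i : carrier R"
 shows "dot I x y : carrier R"
 unfolding dot_def by(intro finsum_closed)(use assms in auto)

lemma dot_cong:
 assumes "!!i. i : I ==> x i = x' i" "!!i. i : I ==> y i = y' i"
  "!!i. i : I ==> x' i : carrier R" "!!i. i : I ==> y' i : carrier R"
 shows "dot I x y = dot I x' y'"
 unfolding dot_def by(intro finsum_cong')(use assms in auto)

lemma dot_comm:
 assumes "!!i. i : I ==> x i : carrier R" "!!i. i : I ==> y i : carrier R"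
 shows "dot I x y = dot I y x"
 unfolding dot_def by(intro finsum_cong')(use assms m_comm in auto)

lemma dot_add_left:
 assumes "!!i. i : I ==> x i : carrier R" "!!i. i : I ==> x' i : carrier R"
  "!!i. i : I ==> y i : carrier R"
 shows "dot I (%i. x i \<oplus> x' i) y = dot I x y \<oplus> dot I x' y"
proof -
 have "dot I (%i. x i \<oplus> x' i) y = (\<Oplus>i\<in>I. x i \<otimes> y i \<oplus> x' i \<otimes> y i)"
  unfolding dot_def by(intro finsum_cong')(use assms l_distr in auto)
 also have "... = dot I x y \<oplus> dot I x' y"
  unfolding dot_def by(intro finsum_addf)(use assms in auto)
 finally show ?thesis .
qed

lemma dot_smult_left:
 assumes "finite I" "c : carrier R"
  "!!i. i : I ==> x i : carrier R" "!!i. i : I ==> y i : carrier R"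
 shows "dot I (%i. c \<otimes> x i) y = c \<otimes> dot I x y"
proof -
 have "c \<otimes> dot I x y = (\<Oplus>i\<in>I. c \<otimes> (x i \<otimes> y i))"
  unfolding dot_def by(rule finsum_rdistr)(use assms in auto)
 also have "... = dot I (%i. c \<otimes> x i) y"
  unfolding dot_def by(intro finsum_cong')(use assms m_assoc in auto)
 finally show ?thesis by simp
qed

lemma dot_smult_right:
 assumes "finite I" "c : carrier R"
  "!!i. i : I ==> x i : carrier R" "!!i. i : I ==> y i : carrier R"
 shows "dot I x (%i. c \<otimes> y i) = c \<otimes> dot I x y"
proof -
 have "dot I x (%i. c \<otimes> y i) = dot I (%i. c \<otimes> y i) x"
  by(rule dot_comm)(use assms in auto)
 thus ?thesis
  using dot_smult_left[OF assms(1,2), of y x] dot_comm[of I x y] assms by simp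
qed

lemma dot_add_right:
 assumes "!!i. i : I ==> x i : carrier R" "!!i. i : I ==> y i : carrier R"
  "!!i. i : I ==> y' i : carrier R"
 shows "dot I x (%i. y i \<oplus> y' i) = dot I x y \<oplus> dot I x y'"
proof -
 have "dot I x (%i. y i \<oplus> y' i) = (\<Oplus>i\<in>I. x i \<otimes> y i \<oplus> x i \<otimes> y' i)"
  unfolding dot_def by(intro finsum_cong')(use assms r_distr in auto)
 also have "... = dot I x y \<oplus> dot I x y'"
  unfolding dot_def by(intro finsum_addf)(use assms in auto)
 finally show ?thesis .
qed

lemma dot_zero_left:
 assumes "!!i. i : I ==> x i = \<zero>" "!!i. i : I ==> y i : carrier R"
 shows "dot I x y = \<zero>"
proof -
 have "dot I x y = (\<Oplus>i\<in>I. \<zero>)"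
  unfolding dot_def by(intro finsum_cong')(use assms in auto)
 thus ?thesis by simp
qed

lemma dot_single_left:
 assumes "finite I" "p : I" "c : carrier R" "!!i. i : I ==> y i : carrier R"
 shows "dot I (%i. if i = p then c else \<zero>) y = c \<otimes> y p"
proof -
 have "dot I (%i. if i = p then c else \<zero>) y = (%i. (if i = p then c else \<zero>) \<otimes> y i) p"
  unfolding dot_def by(rule finsum_single)(use assms in auto)
 thus ?thesis by simp
qed

lemma dot_single_right:
 assumes "finite I" "p : I" "c : carrier R" "!!i. i : I ==> y i : carrier R"
 shows "dot I y (%i. if i = p then c else \<zero>) = y p \<otimes> c"
proof -
 have "dot I y (%i. if i = p then c else \<zero>) = (%i. y i \<otimes> (if i = p then c else \<zero>)) p"
  unfolding dot_def by(rule finsum_single)(use assms in auto)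
 thus ?thesis by simp
qed

lemma dot_assoc:
 assumes "finite I" "finite J"
  "!!j. j : J ==> x j : carrier R" "!!i. i : I ==> y i : carrier R"
  "!!i j. j : J ==> i : I ==> A j i : carrier R"
 shows "dot I (%i. dot J x (%j. A j i)) y = dot J x (%j. dot I (A j) y)"
proof -
 have "dot I (%i. dot J x (%j. A j i)) y = (\<Oplus>i\<in>I. \<Oplus>j\<in>J. x j \<otimes> A j i \<otimes> y i)"
  unfolding dot_def
  by(intro finsum_cong' finsum_ldistr)(use assms in "auto intro!: finsum_closed")
 also have "... = (\<Oplus>j\<in>J. \<Oplus>i\<in>I. x j \<otimes> A j i \<otimes> y i)"
  by(rule finsum_swap)(use assms in auto)
 also have "... = (\<Oplus>j\<in>J. \<Oplus>i\<in>I. x j \<otimes> (A j i \<otimes> y i))"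
  by(intro finsum_cong')(use assms in "auto intro!: finsum_closed simp: m_assoc")
 also have "... = dot J x (%j. dot I (A j) y)"
  unfolding dot_def
  by(intro finsum_cong' finsum_rdistr[symmetric])(use assms in "auto intro!: finsum_closed")
 finally show ?thesis .
qed

end

section \<open>Differential fields\<close>

locale diff_field = field F for F (structure) +
 fixes der :: "'a => 'a" (\<open>\<partial>\<close>)
 assumes der_closed [simp, intro]: "x : carrier F ==> der x : carrier F"
  and der_add: "[|x : carrier F; y : carrier F|] ==> der (x \<oplus> y) = der x \<oplus> der y"
  and der_mult: "[|x : carrier F; y : carrier F|] ==> der (x \<otimes> y) = der x \<otimes> y \<oplus> x \<otimes> der y"
begin

abbreviation Cst where "Cst == constants F der"

lemma add_left_eq_zero: "[|x : carrier F; y : carrier F; x \<oplus> y = x|] ==> y = \<zero>"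
 by(metis add.l_cancel_one)

lemma der_zero [simp]: "der \<zero> = \<zero>"
 by(metis add_left_eq_zero der_add der_closed l_zero zero_closed)

lemma der_one [simp]: "der \<one> = \<zero>"
 by(metis add_left_eq_zero der_closed der_mult l_one r_one one_closed)

lemma der_minus: "x : carrier F ==> der (\<ominus> x) = \<ominus> der x"
 using der_add[of x "\<ominus> x"] minus_equality[of "der (\<ominus> x)" "der x"]
 by(simp add: r_neg a_comm)

lemma inv_closed [simp]: "x : carrier F ==> x ~= \<zero> ==> inv x : carrier F"
 using field_Units Units_inv_closed by auto

lemma inv_l [simp]: "x : carrier F ==> x ~= \<zero> ==> inv x \<otimes> x = \<one>"
 using field_Units Units_l_inv by auto

lemma inv_r [simp]: "x : carrier F ==> x ~= \<zero> ==> x \<otimes> inv x = \<one>"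
 using field_Units Units_r_inv by auto

lemma inv_nonzero: "x : carrier F ==> x ~= \<zero> ==> inv x ~= \<zero>"
 using inv_r[of x] by fastforce

lemma der_finsum:
 assumes "finite A" "!!i. i : A ==> f i : carrier F"
 shows "der (\<Oplus>i\<in>A. f i) = (\<Oplus>i\<in>A. der (f i))"
 using assms by(induction A) (auto simp: finsum_insert der_add)

lemma der_dot:
 assumes "finite I" "!!i. i : I ==> x i : carrier F" "!!i. i : I ==> y i : carrier F"
 shows "der (dot I x y) = dot I (%i. der (x i)) y \<oplus> dot I x (%i. der (y i))"
proof -
 have "der (dot I x y) = (\<Oplus>i\<in>I. der (x i) \<otimes> y i \<oplus> x i \<otimes> der (y i))"
  unfolding dot_def using assms by(simp add: der_finsum der_mult cong: finsum_cong)
 also have "... = dot I (%i. der (x i)) y \<oplus> dot I x (%i. der (y i))"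
  unfolding dot_def by(intro finsum_addf)(use assms in auto)
 finally show ?thesis .
qed

lemma CstD: "c : Cst ==> c : carrier F" "c : Cst ==> der c = \<zero>"
 by(auto simp: constants_def)

lemma CstI: "c : carrier F ==> der c = \<zero> ==> c : Cst"
 by(auto simp: constants_def)

lemma Cst_mult: "c : Cst ==> d : Cst ==> c \<otimes> d : Cst"
 by(auto simp: constants_def der_mult)

lemma Cst_add: "c : Cst ==> d : Cst ==> c \<oplus> d : Cst"
 by(auto simp: constants_def der_add)

lemma Cst_minus: "c : Cst ==> \<ominus> c : Cst"
 by(auto simp: constants_def der_minus)

lemma Cst_inv:
 assumes "c : Cst" "c ~= \<zero>"
 shows "inv c : Cst"
proof -
 have c: "c : carrier F" "der c = \<zero>" "inv c : carrier F"
  using assms by(auto simp: CstD)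
 have "der (c \<otimes> inv c) = c \<otimes> der (inv c)"
  using c by(subst der_mult) auto
 hence "c \<otimes> der (inv c) = \<zero>" using c assms(2) by simp
 hence "der (inv c) = \<zero>" using c assms(2) integral by blast
 thus ?thesis using c by(auto simp: constants_def)
qed

lemma Cst_0 [simp]: "\<zero> : Cst" and Cst_1 [simp]: "\<one> : Cst"
 by(auto simp: constants_def)

lemma Cst_finsum:
 assumes "finite A" "!!i. i : A ==> f i : Cst"
 shows "(\<Oplus>i\<in>A. f i) : Cst"
 using assms by(induction A) (auto simp: finsum_insert CstD Cst_add)

lemma Cst_dot:
 assumes "finite I" "!!i. i : I ==> x i : Cst" "!!i. i : I ==> y i : Cst"
 shows "dot I x y : Cst"
 unfolding dot_def using assms by(intro Cst_finsum Cst_mult) auto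

lemma Cst_subfield: "subfield Cst F"
 by(intro field.subfieldI'[OF field_axioms] subringI)
   (auto simp: CstD Cst_mult Cst_add Cst_minus Cst_inv)

text \<open>Dividing a nonzero vector by one of its entries and differentiating removes that entry from the
  support. A linear subspace of \<open>F\<^sup>I\<close> stable under differentiation is therefore built from its
  constant vectors, and a functional with constant coefficients is determined on it by them.\<close>

lemma stable_space_constant_vectors:
 assumes I: "finite I"
  and carr: "!!r i. r : N ==> r i : carrier F"
  and supp: "!!r i. r : N ==> i ~: I ==> r i = \<zero>"
  and add: "!!r r'. r : N ==> r' : N ==> (%i. r i \<oplus> r' i) : N"
  and scale: "!!c r. c : carrier F ==> r : N ==> (%i. c \<otimes> r i) : N"
  and der: "!!r. r : N ==> (%i. der (r i)) : N"
  and h: "!!i. i : I ==> h i : Cst"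
  and const: "!!c. c : N ==> (!!i. c i : Cst) ==> dot I c h = \<zero>"
 shows "r : N ==> dot I r h = \<zero>"
proof (induction "card {i : I. r i ~= \<zero>}" arbitrary: r rule: less_induct)
 case less
 note rN = \<open>r : N\<close>
 have hc: "!!i. i : I ==> h i : carrier F" using h CstD by auto
 show ?case
 proof (cases "EX p:I. r p ~= \<zero>")
  case False
  thus ?thesis by(intro dot_zero_left)(use hc in auto)
 next
  case True
  then obtain p where p: "p : I" "r p ~= \<zero>" by blast
  define c where "c = inv (r p)"
  have cc: "c : carrier F" "c ~= \<zero>"
   unfolding c_def using p carr[OF rN] by(auto simp: inv_nonzero)
  define r1 where "r1 = (%i. c \<otimes> r i)"
  have r1N: "r1 : N" unfolding r1_def using scale cc rN by auto
  have r1p: "r1 p = \<one>" unfolding r1_def c_def using p carr[OF rN] by simp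
  have r1s: "{i : I. r1 i ~= \<zero>} = {i : I. r i ~= \<zero>}"
   unfolding r1_def using cc carr[OF rN] integral by fastforce
  have r1dot: "dot I r1 h = c \<otimes> dot I r h"
   unfolding r1_def by(rule dot_smult_left)(use I cc carr[OF rN] hc in auto)
  define d where "d = (%i. der (r1 i))"
  have dN: "d : N" unfolding d_def using der r1N by auto
  have "dot I r1 h = \<zero>"
  proof (cases "EX q:I. d q ~= \<zero>")
   case False
   have "r1 i : Cst" for i
    using False supp[OF r1N, of i] carr[OF r1N, of i] unfolding d_def
    by(cases "i : I") (auto intro: CstI)
   thus ?thesis using const[OF r1N] by auto
  next
   case True
   then obtain q where q: "q : I" "d q ~= \<zero>" by blast
   have dp: "d p = \<zero>" unfolding d_def r1p by simp
   have ds: "{i : I. d i ~= \<zero>} \<subset> {i : I. r i ~= \<zero>}"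
   proof -
    have "{i : I. d i ~= \<zero>} <= {i : I. r1 i ~= \<zero>}" by(auto simp: d_def)
    moreover have "p : {i : I. r1 i ~= \<zero>}" "p ~: {i : I. d i ~= \<zero>}"
     using p dp r1p by auto
    ultimately show ?thesis unfolding r1s[symmetric] by blast
   qed
   have d0: "dot I d h = \<zero>"
    by(rule less.hyps[OF _ dN])(use ds I in "auto intro!: psubset_card_mono")
   define m where "m = r1 q \<otimes> inv (d q)"
   have mc: "m : carrier F" unfolding m_def using q carr[OF dN] carr[OF r1N] by auto
   define e where "e = (%i. r1 i \<oplus> (\<ominus> m) \<otimes> d i)"
   have eN: "e : N" unfolding e_def using add[OF r1N scale[OF _ dN]] mc by auto
   have eq: "e q = \<zero>"
    unfolding e_def m_def using q carr[OF dN, of q] carr[OF r1N, of q]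
    by(simp add: l_minus m_assoc r_neg)
   have r1q: "r1 q ~= \<zero>" using q unfolding d_def by auto
   have "e i = \<zero>" if "i : I" "r1 i = \<zero>" for i
    unfolding e_def d_def that using mc by simp
   hence es: "{i : I. e i ~= \<zero>} \<subset> {i : I. r i ~= \<zero>}"
    unfolding r1s[symmetric] using q r1q eq by auto
   have e0: "dot I e h = \<zero>"
    by(rule less.hyps[OF _ eN])(use es I in "auto intro!: psubset_card_mono")
   have "dot I e h = dot I r1 h \<oplus> dot I (%i. (\<ominus> m) \<otimes> d i) h"
    unfolding e_def by(rule dot_add_left)(use carr[OF r1N] carr[OF dN] mc hc in auto)
   also have "dot I (%i. (\<ominus> m) \<otimes> d i) h = (\<ominus> m) \<otimes> dot I d h"
    by(rule dot_smult_left)(use I mc carr[OF dN] hc in auto)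
   finally show ?thesis
    using e0 d0 mc carr[OF r1N] hc by(simp add: dot_closed)
  qed
  hence "c \<otimes> dot I r h = \<zero>" using r1dot by simp
  thus ?thesis
   using cc integral[of c "dot I r h"] carr[OF rN] hc by(auto simp: dot_closed)
 qed
qed

end

section \<open>A linear system with a fundamental matrix has no proper invariant relations\<close>

text \<open>The fundamental matrix \<open>g\<close> is inverted up to the scalar \<open>f\<close> by \<open>s\<close>. In the applications \<open>J\<close> is a
  differential ideal of a ring that contains \<open>L\<close> and the entries of \<open>s\<close>.\<close>

locale fundamental_system = diff_field F der for F (structure) and der (\<open>\<partial>\<close>) +
 fixes I :: "'i set" and L J :: "'a set" and f :: 'a
  and v :: "'i => 'a" and g s u :: "'i => 'i => 'a"
 assumes finI: "finite I"
  and L_subfield: "subfield L F"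
  and Cst_L: "Cst <= L"
  and der_L: "x : L ==> der x : L"
  and J_carrier: "J <= carrier F"
  and zero_J: "\<zero> : J"
  and add_J: "[|x : J; y : J|] ==> x \<oplus> y : J"
  and L_J: "[|c : L; y : J|] ==> c \<otimes> y : J"
  and der_J: "y : J ==> der y : J"
  and s_J: "[|i : I; j : I; y : J|] ==> s i j \<otimes> y : J"
  and f_closed: "f : carrier F" and f_J: "f ~: J"
  and v_closed: "i : I ==> v i : carrier F"
  and g_closed: "[|i : I; j : I|] ==> g i j : carrier F"
  and s_closed: "[|i : I; j : I|] ==> s i j : carrier F"
  and u_L: "[|i : I; j : I|] ==> u i j : L"
  and der_v: "i : I ==> der (v i) = dot I (u i) v"
  and der_g: "[|i : I; j : I|] ==> der (g i j) = dot I (u i) (%k. g k j)"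
  and s_g: "[|i : I; j : I|] ==> dot I (s i) (%k. g k j) = (if i = j then f else \<zero>)"
  and g_s: "[|i : I; j : I|] ==> dot I (g i) (%k. s k j) = (if i = j then f else \<zero>)"
begin

lemma L_closed: "x : L ==> x : carrier F"
 using subfieldE(3)[OF L_subfield] by auto

lemmas L_ring = subringE[OF subfieldE(1)[OF L_subfield]]

lemma u_closed: "[|i : I; j : I|] ==> u i j : carrier F"
 using u_L L_closed by auto

lemma f_nonzero: "f ~= \<zero>" using f_J zero_J by auto

lemma L_inv: "x : L ==> x ~= \<zero> ==> inv x : L"
 using subfield_m_inv(1)[OF L_subfield, of x] by auto

lemma minus_J: "y : J ==> \<ominus> y : J"
proof -
 assume y: "y : J"
 hence "(\<ominus> \<one>) \<otimes> y : J" using L_J L_ring by auto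
 thus ?thesis using y J_carrier by(auto simp: l_minus)
qed

lemma finsum_J:
 assumes "finite A" "!!i. i : A ==> h i : J"
 shows "(\<Oplus>i\<in>A. h i) : J"
 using assms
proof (induction A)
 case (insert a A)
 thus ?case
  using J_carrier by(subst finsum_insert) (auto intro!: add_J)
qed (simp add: zero_J)

definition G :: "'i => 'i => 'a" where "G i j = inv f \<otimes> s i j"

lemma G_closed: "[|i : I; j : I|] ==> G i j : carrier F"
 unfolding G_def using f_closed f_nonzero s_closed by auto

lemma G_g: "[|i : I; j : I|] ==> dot I (G i) (%k. g k j) = (if i = j then \<one> else \<zero>)"
 unfolding G_def using f_closed f_nonzero s_closed g_closed finI s_g
 by(subst dot_smult_left) auto

lemma g_G: "[|i : I; j : I|] ==> dot I (g i) (%k. G k j) = (if i = j then \<one> else \<zero>)"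
 unfolding G_def using f_closed f_nonzero s_closed g_closed finI g_s
 by(subst dot_smult_right) auto

text \<open>Multiplying a row vector on the right by \<open>g\<close> is injective.\<close>

lemma row_eq_zero:
 assumes x: "!!k. k : I ==> x k : carrier F"
  and 0: "!!j. j : I ==> dot I x (%k. g k j) = \<zero>"
  and i: "i : I"
 shows "x i = \<zero>"
proof -
 have "x i = dot I x (%k. if k = i then \<one> else \<zero>)"
  using dot_single_right[of I i \<one> x] finI i x by auto
 also have "... = dot I x (%k. dot I (g k) (%l. G l i))"
  by(rule dot_cong)(use x i g_G in auto)
 also have "... = dot I (%l. dot I x (%k. g k l)) (%l. G l i)"
  by(rule dot_assoc[symmetric])(use finI x g_closed G_closed i in auto)
 also have "... = \<zero>"
  by(rule dot_zero_left)(use 0 i G_closed in auto)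
 finally show ?thesis .
qed

lemma der_G:
 assumes i: "i : I" and j: "j : I"
 shows "der (G i j) = \<ominus> dot I (G i) (%k. u k j)"
proof -
 define E where "E = (%j. der (G i j) \<oplus> dot I (G i) (%m. u m j))"
 have Ec: "!!k. k : I ==> E k : carrier F"
  unfolding E_def using i G_closed u_closed by auto
 have "dot I E (%k. g k l) = \<zero>" if l: "l : I" for l
 proof -
  have "dot I E (%k. g k l) = dot I (%k. der (G i k)) (%k. g k l)
    \<oplus> dot I (%k. dot I (G i) (%m. u m k)) (%k. g k l)"
   unfolding E_def by(rule dot_add_left)(use i l G_closed u_closed g_closed in auto)
  also have "dot I (%k. dot I (G i) (%m. u m k)) (%k. g k l)
    = dot I (G i) (%m. dot I (u m) (%k. g k l))"
   by(rule dot_assoc)(use finI i l G_closed u_closed g_closed in auto)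
  also have "... = dot I (G i) (%m. der (g m l))"
   by(rule dot_cong)(use der_g i l G_closed g_closed u_closed in auto)
  also have "dot I (%k. der (G i k)) (%k. g k l) \<oplus> ... = der (dot I (G i) (%k. g k l))"
   by(rule der_dot[symmetric])(use finI i l G_closed g_closed in auto)
  also have "... = \<zero>" using G_g[OF i l] by simp
  finally show ?thesis .
 qed
 hence "E j = \<zero>" using row_eq_zero[of E j] Ec j by auto
 thus ?thesis
  unfolding E_def using i j G_closed u_closed
  by(metis (no_types, lifting) der_closed dot_closed minus_equality)
qed

definition h :: "'i => 'a" where "h i = dot I (G i) v"

lemma h_closed: "i : I ==> h i : carrier F"
 unfolding h_def using G_closed v_closed by auto

lemma h_Cst:
 assumes i: "i : I"
 shows "h i : Cst"
proof -
 let ?a = "dot I (%k. dot I (G i) (%m. u m k)) v"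
 have ac: "?a : carrier F" using i G_closed u_closed v_closed by auto
 have "der (h i) = dot I (%k. der (G i k)) v \<oplus> dot I (G i) (%k. der (v k))"
  unfolding h_def by(rule der_dot)(use finI i G_closed v_closed in auto)
 also have "dot I (G i) (%k. der (v k)) = dot I (G i) (%k. dot I (u k) v)"
  by(rule dot_cong)(use i der_v G_closed u_closed v_closed in auto)
 also have "... = ?a"
  by(rule dot_assoc[symmetric])(use finI i G_closed u_closed v_closed in auto)
 also have "dot I (%k. der (G i k)) v = dot I (%k. (\<ominus> \<one>) \<otimes> dot I (G i) (%m. u m k)) v"
  by(rule dot_cong)(use i der_G G_closed u_closed v_closed in "auto simp: l_minus")
 also have "... = (\<ominus> \<one>) \<otimes> ?a"
  by(rule dot_smult_left)(use finI i G_closed u_closed v_closed in auto)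
 finally have "der (h i) = \<zero>" using ac by(simp add: l_minus l_neg)
 thus ?thesis using h_closed[OF i] CstI by auto
qed

text \<open>The vectors of \<open>Z U\<close> are the \<open>L\<close>-linear relations modulo \<open>J\<close> among the \<open>v\<close> that are
  supported on \<open>U\<close>.\<close>

definition Z :: "'i set => ('i => 'a) set"
 where "Z U = {t. (ALL i. t i : L) & (ALL i. i ~: U --> t i = \<zero>) & dot I t v : J}"

inductive_set spn :: "('i => 'a) set => ('i => 'a) set" for T where
 zero: "(%_. \<zero>) : spn T"
| step: "[|c : carrier F; t : T; x : spn T|] ==> (%i. c \<otimes> t i \<oplus> x i) : spn T"

lemma Z_closed: "t : Z U ==> t i : carrier F"
 unfolding Z_def using L_closed by auto

lemma spn_closed: "x : spn (Z U) ==> x i : carrier F"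
 by(induction rule: spn.induct) (auto simp: Z_closed)

lemma spn_supp: "x : spn (Z U) ==> i ~: U ==> x i = \<zero>"
 by(induction rule: spn.induct) (auto simp: Z_def)

lemma spn_add:
 assumes "x : spn (Z U)" "y : spn (Z U)"
 shows "(%i. x i \<oplus> y i) : spn (Z U)"
 using assms(1)
proof (induction rule: spn.induct)
 case zero
 thus ?case using assms(2) spn_closed by simp
next
 case (step c t x)
 have "(%i. c \<otimes> t i \<oplus> (x i \<oplus> y i)) : spn (Z U)"
  using step by(intro spn.step)
 also have "(%i. c \<otimes> t i \<oplus> (x i \<oplus> y i)) = (%i. c \<otimes> t i \<oplus> x i \<oplus> y i)"
  using step(1,2) Z_closed spn_closed[OF step(3)] spn_closed[OF assms(2)]
  by(auto simp: a_assoc)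
 finally show ?case .
qed

lemma spn_smult:
 assumes "x : spn (Z U)" "d : carrier F"
 shows "(%i. d \<otimes> x i) : spn (Z U)"
 using assms(1)
proof (induction rule: spn.induct)
 case zero
 thus ?case using assms(2) by(simp add: spn.zero)
next
 case (step c t x)
 have "(%i. (d \<otimes> c) \<otimes> t i \<oplus> d \<otimes> x i) : spn (Z U)"
  using step assms(2) by(intro spn.step) auto
 also have "(%i. (d \<otimes> c) \<otimes> t i \<oplus> d \<otimes> x i) = (%i. d \<otimes> (c \<otimes> t i \<oplus> x i))"
  using step(1,2) Z_closed spn_closed[OF step(3)] assms(2)
  by(auto simp: m_assoc r_distr)
 finally show ?case .
qed

lemma spn_incl: "t : Z U ==> t : spn (Z U)"
proof -
 assume t: "t : Z U"
 have "(%i. \<one> \<otimes> t i \<oplus> \<zero>) : spn (Z U)" by(rule spn.step[OF _ t spn.zero]) auto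
 thus ?thesis using t Z_closed by simp
qed

text \<open>A vector of the \<open>F\<close>-span whose entries multiply \<open>J\<close> into itself is a combination of relations
  whose coefficients are such multipliers, because eliminating one coordinate at a time with a
  normalised relation takes the coefficients from the entries of the vector itself.\<close>

lemma multiplier_relation:
 assumes "finite U" "U <= I" "y : spn (Z U)" "!!i z. i : I ==> z : J ==> y i \<otimes> z : J"
 shows "dot I y v : J"
 using assms
proof (induction U arbitrary: y)
 case empty
 have "y i = \<zero>" for i using spn_supp[OF empty.prems(2)] by auto
 hence "dot I y v = \<zero>" by(intro dot_zero_left) (auto simp: v_closed)
 thus ?case using zero_J by simp
next
 case (insert p U)
 have pI: "p : I" using insert.prems by auto
 show ?case
 proof (cases "EX t:Z (insert p U). t p ~= \<zero>")
  case False
  hence "!!t. t : Z (insert p U) ==> t p = \<zero>" by blast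
  hence "Z (insert p U) = Z U" unfolding Z_def by fastforce
  thus ?thesis using insert by auto
 next
  case True
  then obtain t where t: "t : Z (insert p U)" "t p ~= \<zero>" by blast
  have tL: "!!i. t i : L" using t unfolding Z_def by auto
  define t0 where "t0 = (%i. inv (t p) \<otimes> t i)"
  have t0p: "t0 p = \<one>" unfolding t0_def using t(2) tL L_closed by auto
  have t0L: "!!i. t0 i : L" unfolding t0_def using L_ring(6) L_inv tL t(2) by auto
  have t0c: "!!i. t0 i : carrier F" using t0L L_closed by auto
  have "dot I t0 v = inv (t p) \<otimes> dot I t v"
   unfolding t0_def by(rule dot_smult_left)(use finI tL L_closed v_closed t(2) in auto)
  hence t0J: "dot I t0 v : J"
   using t L_J L_inv tL unfolding Z_def by auto
  have t0s: "!!i. i ~: insert p U ==> t0 i = \<zero>"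
   using t(1,2) tL L_closed unfolding t0_def Z_def by auto
  have red: "(%i. x i \<oplus> (\<ominus> x p) \<otimes> t0 i) : spn (Z U)" if "x : spn (Z (insert p U))" for x
   using that
  proof (induction rule: spn.induct)
   case zero
   have "(%i. \<zero> \<oplus> (\<ominus> \<zero>) \<otimes> t0 i) = (%i. \<zero>)" using t0c by auto
   thus ?case using spn.zero by simp
  next
   case (step c w x)
   define w' where "w' = (%i. w i \<oplus> (\<ominus> w p) \<otimes> t0 i)"
   have wL: "!!i. w i : L" using step(2) unfolding Z_def by auto
   have wc: "!!i. w i : carrier F" using wL L_closed by auto
   have xc: "!!i. x i : carrier F" using spn_closed[OF step(3)] by auto
   have "dot I w' v = dot I w v \<oplus> dot I (%i. (\<ominus> w p) \<otimes> t0 i) v"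
    unfolding w'_def by(rule dot_add_left)(use wc t0c v_closed in auto)
   also have "dot I (%i. (\<ominus> w p) \<otimes> t0 i) v = (\<ominus> w p) \<otimes> dot I t0 v"
    by(rule dot_smult_left)(use wc t0c v_closed finI in auto)
   finally have "dot I w' v : J"
    using add_J L_J L_ring(5) wL t0J step(2) unfolding Z_def by auto
   moreover have "w' i : L" for i
    unfolding w'_def using L_ring(5,6,7) wL t0L by auto
   moreover have "w' i = \<zero>" if "i ~: U" for i
   proof (cases "i = p")
    case True
    thus ?thesis unfolding w'_def using t0p wc by(auto simp: r_neg)
   next
    case False
    thus ?thesis unfolding w'_def using t0s step(2) that wc unfolding Z_def by auto
   qed
   ultimately have "w' : Z U" unfolding Z_def by auto
   hence "(%i. c \<otimes> w' i \<oplus> (x i \<oplus> (\<ominus> x p) \<otimes> t0 i)) : spn (Z U)"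
    using step by(intro spn.step) auto
   also have "(%i. c \<otimes> w' i \<oplus> (x i \<oplus> (\<ominus> x p) \<otimes> t0 i))
     = (%i. c \<otimes> w i \<oplus> x i \<oplus> \<ominus> (c \<otimes> w p \<oplus> x p) \<otimes> t0 i)"
   proof
    fix i
    show "c \<otimes> w' i \<oplus> (x i \<oplus> (\<ominus> x p) \<otimes> t0 i) = c \<otimes> w i \<oplus> x i \<oplus> \<ominus> (c \<otimes> w p \<oplus> x p) \<otimes> t0 i"
     unfolding w'_def using wc[of i] wc[of p] xc[of i] xc[of p] t0c[of i] step(1) by algebra
   qed
   finally show ?case .
  qed
  define y' where "y' = (%i. y i \<oplus> (\<ominus> y p) \<otimes> t0 i)"
  have yc: "!!i. y i : carrier F" using spn_closed[OF insert.prems(2)] by auto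
  have "dot I y' v : J"
  proof (rule insert.IH)
   show "U <= I" using insert.prems by auto
   show "y' : spn (Z U)" unfolding y'_def using red insert.prems by auto
   show "y' i \<otimes> z : J" if i: "i : I" and z: "z : J" for i z
   proof -
    have zc: "z : carrier F" using z J_carrier by auto
    have "y i \<otimes> z \<oplus> (\<ominus> (y p \<otimes> (t0 i \<otimes> z))) : J"
     using add_J minus_J insert.prems(3) L_J t0L i pI z by auto
    also have "y i \<otimes> z \<oplus> (\<ominus> (y p \<otimes> (t0 i \<otimes> z))) = y' i \<otimes> z"
     unfolding y'_def using yc[of i] yc[of p] t0c[of i] zc by algebra
    finally show ?thesis .
   qed
  qed
  moreover have "y p \<otimes> dot I t0 v : J" using insert.prems(3) pI t0J by auto
  moreover have "dot I y v = dot I y' v \<oplus> y p \<otimes> dot I t0 v"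
  proof -
   have "dot I y' v = dot I y v \<oplus> dot I (%i. (\<ominus> y p) \<otimes> t0 i) v"
    unfolding y'_def by(rule dot_add_left)(use yc t0c v_closed in auto)
   also have "dot I (%i. (\<ominus> y p) \<otimes> t0 i) v = (\<ominus> y p) \<otimes> dot I t0 v"
    by(rule dot_smult_left)(use yc t0c v_closed finI in auto)
   finally show ?thesis
    using yc[of p] dot_closed[of I y v] dot_closed[of I t0 v] yc t0c v_closed by algebra
  qed
  ultimately show ?thesis using add_J by simp
 qed
qed

text \<open>If \<open>r\<close> is a row vector then \<open>r G\<close> is written as below; outside \<open>I\<close> it is zero.\<close>

definition rowG :: "('i => 'a) => 'i => 'a"
 where "rowG r = (%j. if j : I then dot I r (%i. G i j) else \<zero>)"

lemma spn_der:
 assumes "x : spn (Z I)"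
 shows "(%j. if j : I then der (x j) \<oplus> dot I x (%i. u i j) else \<zero>) : spn (Z I)"
 using assms
proof (induction rule: spn.induct)
 case zero
 have "(%j. if j : I then der \<zero> \<oplus> dot I (%_. \<zero>) (%i. u i j) else \<zero>) = (%_. \<zero>)"
  by(auto simp: dot_zero_left u_closed)
 thus ?case using spn.zero by simp
next
 case (step c t x)
 define t' where "t' = (%j. if j : I then der (t j) \<oplus> dot I t (%i. u i j) else \<zero>)"
 define x' where "x' = (%j. if j : I then der (x j) \<oplus> dot I x (%i. u i j) else \<zero>)"
 have tL: "!!i. t i : L" using step(2) unfolding Z_def by auto
 have tc: "!!i. t i : carrier F" using tL L_closed by auto
 have xc: "!!i. x i : carrier F" using spn_closed[OF step(3)] by auto
 have dL: "dot I t (%i. u i j) : L" if "j : I" for j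
  unfolding dot_def
 proof -
  have *: "(\<Oplus>i\<in>A. t i \<otimes> u i j) : L" if "finite A" "A <= I" for A
   using that
  proof (induction A)
   case (insert a A)
   thus ?case using tc u_closed \<open>j : I\<close>
    by(subst finsum_insert) (auto intro!: L_ring(6,7) tL u_L)
  qed (auto simp: L_ring(2))
  show "(\<Oplus>i\<in>I. t i \<otimes> u i j) : L" using *[OF finI] by auto
 qed
 have t'L: "t' i : L" for i
  unfolding t'_def using L_ring(2,7) der_L dL tL by auto
 have "dot I t' v = dot I (%j. der (t j) \<oplus> dot I t (%i. u i j)) v"
  by(rule dot_cong)(use tc u_closed v_closed in "auto simp: t'_def")
 also have "... = dot I (%j. der (t j)) v \<oplus> dot I (%j. dot I t (%i. u i j)) v"
  by(rule dot_add_left)(use tc u_closed v_closed in auto)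
 also have "dot I (%j. dot I t (%i. u i j)) v = dot I t (%i. dot I (u i) v)"
  by(rule dot_assoc)(use finI tc u_closed v_closed in auto)
 also have "... = dot I t (%i. der (v i))"
  by(rule dot_cong)(use der_v tc v_closed u_closed in auto)
 also have "dot I (%j. der (t j)) v \<oplus> ... = der (dot I t v)"
  by(rule der_dot[symmetric])(use finI tc v_closed in auto)
 finally have "dot I t' v : J" using der_J step(2) unfolding Z_def by auto
 hence t'Z: "t' : Z I" using t'L unfolding Z_def t'_def by auto
 have "(%i. der c \<otimes> t i \<oplus> (c \<otimes> t' i \<oplus> x' i)) : spn (Z I)"
  using step t'Z x'_def by(intro spn.step) auto
 also have "(%i. der c \<otimes> t i \<oplus> (c \<otimes> t' i \<oplus> x' i)) =
  (%j. if j : I then der (c \<otimes> t j \<oplus> x j) \<oplus> dot I (%i. c \<otimes> t i \<oplus> x i) (%i. u i j) else \<zero>)"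
  (is "?l = ?r")
 proof
  fix j
  show "?l j = ?r j"
  proof (cases "j : I")
   case False
   thus ?thesis using step(1,2) unfolding t'_def x'_def Z_def by auto
  next
   case True
   have "dot I (%i. c \<otimes> t i \<oplus> x i) (%i. u i j)
     = dot I (%i. c \<otimes> t i) (%i. u i j) \<oplus> dot I x (%i. u i j)"
    by(rule dot_add_left)(use step(1) tc xc u_closed True in auto)
   also have "dot I (%i. c \<otimes> t i) (%i. u i j) = c \<otimes> dot I t (%i. u i j)"
    by(rule dot_smult_left)(use step(1) tc u_closed True finI in auto)
   moreover have "der (c \<otimes> t j \<oplus> x j) = der c \<otimes> t j \<oplus> c \<otimes> der (t j) \<oplus> der (x j)"
    using step(1) tc xc by(simp add: der_add der_mult)
   moreover have "dot I t (%i. u i j) : carrier F" "dot I x (%i. u i j) : carrier F"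
    using tc xc u_closed True by auto
   ultimately show ?thesis
    using True step(1) tc[of j] xc[of j] unfolding t'_def x'_def
    by(simp add: r_distr m_assoc a_assoc)
      (smt (verit, best) a_lcomm add.m_closed der_closed m_closed)
  qed
 qed
 finally show ?case .
qed

text \<open>The rows \<open>r\<close> for which \<open>r G\<close> lies in the \<open>F\<close>-span of the relations form a differential space. A
  constant row \<open>c\<close> in it satisfies \<open>c h = 0\<close>: otherwise \<open>multiplier_relation\<close>, used for \<open>f c G\<close>, would put
  \<open>f\<close> into \<open>J\<close>. Constant rows determine the whole space, and \<open>l g\<close> belongs to it.\<close>

theorem relation_zero:
 assumes l: "!!i. i : I ==> l i : Cst" and lv: "dot I l v : J"
 shows "dot I l v = \<zero>"
proof -
 define N where "N = {r. (ALL i. r i : carrier F) & (ALL i. i ~: I --> r i = \<zero>) & rowG r : spn (Z I)}"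
 have lc: "!!i. i : I ==> l i : carrier F" using l CstD by auto
 have main: "dot I r h = \<zero>" if "r : N" for r
 proof (rule stable_space_constant_vectors[where N = N and I = I])
  show "finite I" by(rule finI)
  show "r : N" by fact
  show "!!i. i : I ==> h i : Cst" by(rule h_Cst)
  show "!!r i. r : N ==> r i : carrier F" "!!r i. r : N ==> i ~: I ==> r i = \<zero>"
   by(auto simp: N_def)
  show "(%i. r i \<oplus> r' i) : N" if "r : N" "r' : N" for r r'
  proof -
   have "rowG (%i. r i \<oplus> r' i) = (%j. rowG r j \<oplus> rowG r' j)"
    using that unfolding rowG_def N_def by(auto simp: dot_add_left G_closed)
   thus ?thesis using that spn_add unfolding N_def by auto
  qed
  show "(%i. c \<otimes> r i) : N" if "c : carrier F" "r : N" for c r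
  proof -
   have "rowG (%i. c \<otimes> r i) = (%j. c \<otimes> rowG r j)"
    using that finI unfolding rowG_def N_def by(auto simp: dot_smult_left G_closed)
   thus ?thesis using that spn_smult unfolding N_def by auto
  qed
  show "(%i. der (r i)) : N" if "r : N" for r
  proof -
   have rc: "!!i. r i : carrier F" using that unfolding N_def by auto
   define x where "x = rowG r"
   have xs: "x : spn (Z I)" using that unfolding N_def x_def by auto
   have "rowG (%i. der (r i)) j
     = (if j : I then der (x j) \<oplus> dot I x (%i. u i j) else \<zero>)" for j
   proof (cases "j : I")
    case True
    let ?p = "dot I (%i. der (r i)) (%i. G i j)"
    have pc: "?p : carrier F" using rc True G_closed by auto
    have "der (x j) = ?p \<oplus> dot I r (%i. der (G i j))"
     unfolding x_def rowG_def using True rc G_closed finI by(simp add: der_dot)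
    also have "dot I r (%i. der (G i j)) = dot I r (%i. (\<ominus> \<one>) \<otimes> dot I (G i) (%k. u k j))"
     by(rule dot_cong)(use rc True der_G G_closed u_closed in "auto simp: l_minus")
    also have "... = (\<ominus> \<one>) \<otimes> dot I r (%i. dot I (G i) (%k. u k j))"
     by(rule dot_smult_right)(use rc True finI G_closed u_closed in auto)
    also have "dot I r (%i. dot I (G i) (%k. u k j))
      = dot I (%k. dot I r (%i. G i k)) (%k. u k j)"
     by(rule dot_assoc[symmetric])(use rc True finI G_closed u_closed in auto)
    also have "... = dot I x (%k. u k j)"
     by(rule dot_cong)(use rc True G_closed u_closed in "auto simp: x_def rowG_def")
    finally have "der (x j) = ?p \<oplus> (\<ominus> \<one>) \<otimes> dot I x (%k. u k j)" .
    moreover have "dot I x (%k. u k j) : carrier F"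
     using spn_closed[OF xs] u_closed True by auto
    ultimately show ?thesis
     using pc True unfolding rowG_def by(simp add: l_minus a_assoc l_neg)
   qed (auto simp: rowG_def)
   hence "rowG (%i. der (r i)) : spn (Z I)"
    using spn_der[OF xs] by presburger
   thus ?thesis using that unfolding N_def by auto
  qed
  show "dot I c h = \<zero>" if cN: "c : N" and cC: "!!i. c i : Cst" for c
  proof (rule ccontr)
   assume nz: "dot I c h ~= \<zero>"
   have cc: "!!i. c i : carrier F" using cC CstD by auto
   define y where "y = (%i. f \<otimes> rowG c i)"
   have ys: "y : spn (Z I)"
    unfolding y_def using cN f_closed spn_smult unfolding N_def by auto
   have yv: "y j = dot I c (%i. s i j)" if "j : I" for j
   proof -
    have "y j = f \<otimes> (inv f \<otimes> dot I c (%i. s i j))"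
     unfolding y_def rowG_def G_def using that cc s_closed f_closed f_nonzero finI
     by(simp add: dot_smult_right)
    thus ?thesis
     using f_closed f_nonzero that cc s_closed by(simp add: m_assoc[symmetric])
   qed
   have "dot I y v : J"
   proof (rule multiplier_relation[OF finI _ ys])
    show "y j \<otimes> z : J" if "j : I" "z : J" for j z
    proof -
     have zc: "z : carrier F" using that J_carrier by auto
     have "y j \<otimes> z = (\<Oplus>i\<in>I. c i \<otimes> s i j \<otimes> z)"
      unfolding yv[OF that(1)] dot_def
      by(rule finsum_ldistr)(use zc that cc s_closed finI in auto)
     also have "... : J"
     proof (rule finsum_J[OF finI])
      fix i assume "i : I"
      hence "c i \<otimes> (s i j \<otimes> z) : J" using L_J s_J that cC[of i] Cst_L by blast
      thus "c i \<otimes> s i j \<otimes> z : J"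
       using cc s_closed zc that \<open>i : I\<close> by(simp add: m_assoc)
     qed
     finally show ?thesis .
    qed
   qed auto
   moreover have "dot I y v = f \<otimes> dot I c h"
   proof -
    have "dot I y v = f \<otimes> dot I (rowG c) v"
     unfolding y_def
     by(rule dot_smult_left)(use finI f_closed cc G_closed v_closed in "auto simp: rowG_def")
    also have "dot I (rowG c) v = dot I (%j. dot I c (%i. G i j)) v"
     by(rule dot_cong)(use cc G_closed v_closed in "auto simp: rowG_def")
    also have "... = dot I c (%i. dot I (G i) v)"
     by(rule dot_assoc)(use finI cc G_closed v_closed in auto)
    finally show ?thesis unfolding h_def .
   qed
   ultimately have "f \<otimes> dot I c h : J" by simp
   moreover have dC: "dot I c h : Cst" by(rule Cst_dot)(use finI cC h_Cst in auto)
   ultimately have "inv (dot I c h) \<otimes> (f \<otimes> dot I c h) : J"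
    using L_J Cst_L Cst_inv nz by blast
   also have "inv (dot I c h) \<otimes> (f \<otimes> dot I c h) = f"
    using dC nz f_closed CstD(1)[OF dC] by(simp add: m_lcomm)
   finally show False using f_J by simp
  qed
 qed
 define r where "r = (%j. if j : I then dot I l (%i. g i j) else \<zero>)"
 have rc: "!!i. r i : carrier F" unfolding r_def using lc g_closed by auto
 have rG: "rowG r = (%j. if j : I then l j else \<zero>)"
 proof
  fix j
  show "rowG r j = (if j : I then l j else \<zero>)"
  proof (cases "j : I")
   case True
   have "dot I r (%i. G i j) = dot I (%k. dot I l (%i. g i k)) (%k. G k j)"
    by(rule dot_cong)(use lc True g_closed G_closed in "auto simp: r_def")
   also have "... = dot I l (%i. dot I (g i) (%k. G k j))"
    by(rule dot_assoc)(use finI lc True g_closed G_closed in auto)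
   also have "... = dot I l (%i. if i = j then \<one> else \<zero>)"
    by(rule dot_cong)(use lc True g_G in auto)
   also have "... = l j" using dot_single_right[of I j \<one> l] finI True lc by auto
   finally show ?thesis using True by(simp add: rowG_def)
  qed (simp add: rowG_def)
 qed
 have l0: "dot I (%j. if j : I then l j else \<zero>) v = dot I l v"
  by(rule dot_cong)(use lc v_closed in auto)
 have "(%j. if j : I then l j else \<zero>) : Z I"
  unfolding Z_def using l Cst_L L_ring(2) l0 lv by auto
 hence "r : N" unfolding N_def using rc rG spn_incl by(auto simp: r_def)
 hence "dot I r h = \<zero>" by(rule main)
 also have "dot I r h = dot I (rowG r) v"
 proof -
  have "dot I (rowG r) v = dot I (%j. dot I r (%i. G i j)) v"
   by(rule dot_cong)(use rc G_closed v_closed in "auto simp: rowG_def")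
  also have "... = dot I r (%i. dot I (G i) v)"
   by(rule dot_assoc)(use finI rc G_closed v_closed in auto)
  finally show ?thesis unfolding h_def by simp
 qed
 finally show ?thesis unfolding rG l0 .
qed

end

section \<open>Elimination over a prime ideal\<close>

context cring
begin

lemma dot_insert:
 assumes "finite J" "p ~: J" "!!i. i : insert p J ==> x i : carrier R"
  "!!i. i : insert p J ==> y i : carrier R"
 shows "dot (insert p J) x y = x p \<otimes> y p \<oplus> dot J x y"
 unfolding dot_def by(rule finsum_insert)(use assms in auto)

lemma dot_mono_neutral:
 assumes "finite I" "J <= I" "!!i. i : I - J ==> x i = \<zero>"
  "!!i. i : I ==> x i : carrier R" "!!i. i : I ==> y i : carrier R"
 shows "dot I x y = dot J x y"
 unfolding dot_def
 by(rule add.finprod_mono_neutral_cong_right)(use assms in auto)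

lemma dot_in_ideal:
 assumes "finite I" "!!i. i : I ==> x i \<otimes> y i : Q" "\<zero> : Q" "Q <= carrier R"
  "!!a b. a : Q ==> b : Q ==> a \<oplus> b : Q"
 shows "dot I x y : Q"
 unfolding dot_def using assms(1,2)
proof (induction I)
 case (insert a I)
 thus ?case using assms(3,4) by(subst finsum_insert) (auto intro!: assms(5))
qed (use assms in simp)

end

locale subring_prime = domain F for F (structure) +
 fixes A Q :: "'a set"
 assumes A_subring: "subring A F"
  and Q_A: "Q <= A" and zero_Q: "\<zero> : Q"
  and add_Q: "[|x : Q; y : Q|] ==> x \<oplus> y : Q"
  and mult_Q: "[|x : A; y : Q|] ==> x \<otimes> y : Q"
  and one_Q: "\<one> ~: Q"
  and prime_Q: "[|x : A; y : A; x \<otimes> y : Q|] ==> x : Q \<or> y : Q"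
begin

lemma A_closed: "x : A ==> x : carrier F"
 using subringE(1)[OF A_subring] by auto

lemma Q_closed: "x : Q ==> x : carrier F"
 using Q_A A_closed by auto

lemmas A_ring = subringE[OF A_subring]

text \<open>A square system \<open>b e = M e\<close> whose matrix vanishes modulo a prime ideal that avoids the diagonal
  entries \<open>b\<close> only has the zero solution: elimination keeps both properties.\<close>

lemma elimination:
 assumes "finite I"
  "!!j. j : I ==> b j : A" "!!j. j : I ==> b j ~: Q"
  "!!j l. [|j : I; l : I|] ==> M j l : Q"
  "!!j. j : I ==> e j : carrier F"
  "!!j. j : I ==> b j \<otimes> e j = dot I (M j) e"
  "i : I"
 shows "e i = \<zero>"
 using assms
proof (induction I arbitrary: b M i)
 case (insert p I)
 note ec = insert.prems(4)
 have Mc: "!!j l. [|j : insert p I; l : insert p I|] ==> M j l : carrier F"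
  using insert.prems(3) Q_closed by auto
 have bc: "!!j. j : insert p I ==> b j : carrier F" using insert.prems(1) A_closed by auto
 define d where "d = b p \<oplus> (\<ominus> M p p)"
 have dA: "d : A" unfolding d_def using insert.prems(1,3) A_ring(5,7) Q_A by(meson insertI1 subsetD)
 have dc: "d : carrier F" using dA A_closed by auto
 have dQ: "d ~: Q"
 proof
  assume "d : Q"
  hence "d \<oplus> M p p : Q" using add_Q insert.prems(3) by auto
  moreover have "d \<oplus> M p p = b p" unfolding d_def using bc[of p] Mc[of p p] by(simp add: a_assoc l_neg)
  ultimately show False using insert.prems(2) by auto
 qed
 have row: "dot (insert p I) (M j) e = M j p \<otimes> e p \<oplus> dot I (M j) e" if "j : insert p I" for j
  by(rule dot_insert)(use insert.hyps that Mc ec in auto)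
 have dp: "d \<otimes> e p = dot I (M p) e"
 proof -
  have "b p \<otimes> e p = M p p \<otimes> e p \<oplus> dot I (M p) e" using insert.prems(5) row by auto
  moreover have "dot I (M p) e : carrier F" using Mc ec by auto
  moreover have "(b p \<oplus> (\<ominus> M p p)) \<otimes> e p = b p \<otimes> e p \<oplus> (\<ominus> (M p p \<otimes> e p))"
   using bc[of p] Mc[of p p] ec[of p] by(simp add: l_distr l_minus)
  moreover have "x = m \<oplus> y ==> x \<oplus> \<ominus> m = y"
   if "x : carrier F" "m : carrier F" "y : carrier F" for x m y
   using that by(simp add: a_comm[of m y] a_assoc r_neg)
  ultimately show ?thesis
   unfolding d_def using bc[of p] Mc[of p p] ec[of p] by simp
 qed
 define M' where "M' = (%j l. d \<otimes> M j l \<oplus> M j p \<otimes> M p l)"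
 have IH: "e j = \<zero>" if jI: "j : I" for j
 proof (rule insert.IH[of "%j. d \<otimes> b j" M'])
  show "d \<otimes> b j : A" if "j : I" for j using that dA insert.prems(1) A_ring(6) by auto
  show "d \<otimes> b j ~: Q" if "j : I" for j
   using that dA dQ insert.prems(1,2)[of j] prime_Q by blast
  show "M' j l : Q" if "j : I" "l : I" for j l
   unfolding M'_def using that dA insert.prems(3) mult_Q add_Q Q_A by(meson insertCI subsetD)
  show "e j : carrier F" if "j : I" for j using that ec by auto
  show "d \<otimes> b j \<otimes> e j = dot I (M' j) e" if "j : I" for j
  proof -
   have c: "dot I (M j) e : carrier F" "dot I (M p) e : carrier F" using that Mc ec by auto
   have "dot I (M' j) e = dot I (%l. d \<otimes> M j l) e \<oplus> dot I (%l. M j p \<otimes> M p l) e"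
    unfolding M'_def by(rule dot_add_left)(use that dc Mc ec in auto)
   also have "dot I (%l. d \<otimes> M j l) e = d \<otimes> dot I (M j) e"
    by(rule dot_smult_left)(use that dc Mc ec insert.hyps in auto)
   also have "dot I (%l. M j p \<otimes> M p l) e = M j p \<otimes> dot I (M p) e"
    by(rule dot_smult_left)(use that dc Mc ec insert.hyps in auto)
   also have "... = d \<otimes> (M j p \<otimes> e p)"
    unfolding dp[symmetric] using that dc Mc[of j p] ec[of p] by(simp add: m_lcomm)
   also have "d \<otimes> dot I (M j) e \<oplus> d \<otimes> (M j p \<otimes> e p) = d \<otimes> (b j \<otimes> e j)"
    using insert.prems(5)[of j] row[of j] that dc c Mc[of j p] ec[of p]
    by(simp add: r_distr a_comm)
   finally show ?thesis using that dc bc ec by(simp add: m_assoc)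
  qed
 qed (fact jI)
 have "dot I (M p) e = \<zero>"
 proof -
  have "dot I (M p) e = dot I e (M p)" by(rule dot_comm)(use Mc ec in auto)
  also have "... = \<zero>" by(rule dot_zero_left)(use IH Mc in auto)
  finally show ?thesis .
 qed
 hence "d \<otimes> e p = \<zero>" using dp by simp
 moreover have "d ~= \<zero>" using dQ zero_Q by auto
 ultimately have "e p = \<zero>" using integral[of d "e p"] dc ec by auto
 thus ?case using IH insert.prems(6) by auto
qed simp

text \<open>Linear combinations of elements of \<open>Q\<close> with coefficients in \<open>S\<close>.\<close>

inductive_set extension :: "'a set => 'a set" for S where
 zero: "\<zero> : extension S"
| step: "[|q : Q; c : S; x : extension S|] ==> q \<otimes> c \<oplus> x : extension S"

lemma extension_closed: "S <= carrier F ==> x : extension S ==> x : carrier F"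
 by(rotate_tac, induction rule: extension.induct) (auto simp: Q_closed)

lemma extension_add:
 assumes S: "S <= carrier F" and y: "y : extension S" and x: "x : extension S"
 shows "x \<oplus> y : extension S"
 using x
proof (induction rule: extension.induct)
 case (step q c x)
 hence "q \<otimes> c \<oplus> (x \<oplus> y) : extension S" by(intro extension.step)
 thus ?case
  using step extension_closed[OF S] y S Q_closed by(simp add: a_assoc subset_eq)
qed (use extension_closed[OF S] y in simp)

lemma extension_mult_A:
 assumes S: "S <= carrier F" and a: "a : A" and x: "x : extension S"
 shows "a \<otimes> x : extension S"
 using x
proof (induction rule: extension.induct)
 case (step q c x)
 hence "(a \<otimes> q) \<otimes> c \<oplus> a \<otimes> x : extension S" using a mult_Q by(intro extension.step) auto
 thus ?case
  using step extension_closed[OF S] S Q_closed a A_closed by(simp add: m_assoc r_distr subset_eq)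
qed (use a A_closed in "simp add: extension.zero")

lemma extension_mult_S:
 assumes S: "subring S F" and a: "a : S" and x: "x : extension S"
 shows "a \<otimes> x : extension S"
 using x
proof (induction rule: extension.induct)
 case (step q c x)
 have Sc: "S <= carrier F" using subringE(1)[OF S] .
 from step have "q \<otimes> (a \<otimes> c) \<oplus> a \<otimes> x : extension S"
  using a subringE(6)[OF S] by(intro extension.step) auto
 thus ?case
  using step extension_closed[OF Sc] Sc Q_closed a by(simp add: m_lcomm r_distr subset_eq)
qed (use a subringE(1)[OF S] in "auto simp: extension.zero")

lemma extension_incl:
 assumes "\<one> : S" "q : Q" shows "q : extension S"
 using extension.step[OF assms(2,1) extension.zero] Q_closed[OF assms(2)] by simp

lemma extension_finite_support:
 "x : extension S ==> EX xs. set xs <= S & (ALL S'. set xs <= S' --> x : extension S')"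
proof (induction rule: extension.induct)
 case zero
 show ?case by(rule exI[of _ "[]"]) (auto intro: extension.zero)
next
 case (step q c x)
 then obtain xs where xs: "set xs <= S" "!!S'. set xs <= S' ==> x : extension S'" by blast
 show ?case
  by(rule exI[of _ "c # xs"])(use step xs in "auto intro!: extension.step")
qed

lemma combine_eq_dot:
 assumes "set Ks <= carrier F" "set Us <= carrier F" "length Ks = length Us"
 shows "combine Ks Us = dot {..<length Us} (nth Ks) (nth Us)"
 using assms
proof (induction Ks Us rule: combine.induct)
 case (1 k Ks u Us)
 have "dot {..<length (u # Us)} (nth (k # Ks)) (nth (u # Us))
   = (\<Oplus>i\<in>{..length Us}. (k # Ks) ! i \<otimes> (u # Us) ! i)"
  unfolding dot_def by(simp add: lessThan_Suc_atMost)
 also have "... = (\<Oplus>i\<in>{..<length Us}. Ks ! i \<otimes> Us ! i) \<oplus> k \<otimes> u"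
 proof (cases "length Us")
  case 0
  thus ?thesis using 1 by(simp add: dot_def)
 next
  case (Suc n)
  have n: "{..<length Us} = {..n}" using Suc by auto
  have ci: "Ks ! i : carrier F" "Us ! i : carrier F" if "i <= n" for i
   using that Suc 1(2-4) nth_mem[of i Ks] nth_mem[of i Us] by auto
  have "(\<Oplus>i\<in>{..Suc n}. (k # Ks) ! i \<otimes> (u # Us) ! i)
    = (\<Oplus>i\<in>{..n}. (k # Ks) ! Suc i \<otimes> (u # Us) ! Suc i) \<oplus> (k # Ks) ! 0 \<otimes> (u # Us) ! 0"
  proof (rule finsum_Suc2)
   show "(%i. (k # Ks) ! i \<otimes> (u # Us) ! i) : {..Suc n} \<rightarrow> carrier F"
    using ci 1(2-4) by(auto simp: nth_Cons split: nat.split)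
  qed
  moreover have e: "{..length Us} = {..Suc n}" using Suc by simp
  ultimately show ?thesis unfolding n e by(simp only: nth_Cons_Suc nth_Cons_0)
 qed
 also have "... = k \<otimes> u \<oplus> dot {..<length Us} (nth Ks) (nth Us)"
 proof -
  have c: "Ks ! i : carrier F" "Us ! i : carrier F" if "i < length Us" for i
   using that 1(2-4) nth_mem[of i Ks] nth_mem[of i Us] by auto
  hence "dot {..<length Us} (nth Ks) (nth Us) : carrier F" by auto
  thus ?thesis using 1(2,3) unfolding dot_def by(intro a_comm) auto
 qed
 finally show ?case using 1(1)[OF _ _] 1(2-4) by(simp only: combine.simps list.set insert_subset length_Cons nat.inject)
qed (auto simp: dot_def)

text \<open>The coefficients that occur generate a finite-dimensional extension \<open>E\<close> of \<open>k\<close>. An element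
  \<open>b\<close> of \<open>A\<close> that is such a combination acts on a basis of \<open>E\<close> by a matrix over \<open>Q\<close>, so elimination
  puts it into \<open>Q\<close>. This replaces a prime of \<open>A[S]\<close> lying over \<open>Q\<close>.\<close>

lemma extension_contracts:
 assumes k: "subfield k F" "k <= A" and S: "S <= carrier F"
  and alg: "!!c. c : S ==> (algebraic over k) c"
  and b: "b : extension S" "b : A"
 shows "b : Q"
proof (rule ccontr)
 assume bQ: "b ~: Q"
 obtain xs where xs: "set xs <= S" "!!S'. set xs <= S' ==> b : extension S'"
  using extension_finite_support[OF b(1)] by blast
 define E where "E = finite_extension k xs"
 have xsc: "set xs <= carrier F" using xs S by auto
 have Ering: "subring E F"
  unfolding E_def using finite_extension_is_subring[OF subfieldE(1)[OF k(1)] xsc] .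
 have Ec: "E <= carrier F" using subringE(1)[OF Ering] .
 have "finite_dimension k E"
  unfolding E_def by(rule finite_extension_finite_dimension(1)[OF k(1) xsc])(use alg xs in auto)
 then obtain n where "dimension n k E" by blast
 then obtain Us where Us: "set Us <= carrier F" "Span k Us = E"
  using exists_base[OF k(1)] by blast
 have bE: "b : extension E"
  using xs(2) finite_extension_mem[OF subfieldE(1)[OF k(1)] xsc] unfolding E_def by auto
 define I where "I = {..<length Us}"
 have Uc: "!!i. i : I ==> Us ! i : carrier F" using Us nth_mem unfolding I_def by fastforce
 have UE: "!!i. i : I ==> Us ! i : E"
  using Us Span_base_incl[OF k(1) Us(1)] nth_mem unfolding I_def by fastforce
 have expand: "EX a. (ALL i. a i : k) & x = dot I a (nth Us)" if xE: "x : E" for x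
 proof -
  obtain Ks where Ks: "set Ks <= k" "length Ks = length Us" "x = combine Ks Us"
   using xE Span_mem_iff_length_version[OF k(1) Us(1), of x] Us(2) by metis
  have kc: "k <= carrier F" using subfieldE(3)[OF k(1)] .
  have "x = dot I (nth Ks) (nth Us)"
   unfolding Ks(3) I_def by(rule combine_eq_dot)(use Ks kc Us in auto)
  also have "... = dot I (%i. if i : I then Ks ! i else \<zero>) (nth Us)"
  proof (rule dot_cong)
   show "(if i : I then Ks ! i else \<zero>) : carrier F" if "i : I" for i
    using that Ks kc unfolding I_def by(simp, metis nth_mem subsetD)
  qed (use Uc in auto)
  finally have "x = dot I (%i. if i : I then Ks ! i else \<zero>) (nth Us)" .
  moreover have "ALL i. (if i : I then Ks ! i else \<zero>) : k"
   using Ks(1,2) subringE(2)[OF subfieldE(1)[OF k(1)]] nth_mem unfolding I_def by fastforce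
  ultimately show ?thesis by(intro exI[of _ "%i. if i : I then Ks ! i else \<zero>"] conjI)
 qed
 have kc: "k <= carrier F" using subfieldE(3)[OF k(1)] .
 have act: "EX m. (ALL l. m l : Q) & y \<otimes> Us ! j = dot I m (nth Us)"
  if yE: "y : extension E" and jI: "j : I" for y j
  using yE
 proof (induction rule: extension.induct)
  case zero
  show ?case
   by(rule exI[of _ "%_. \<zero>"])(use Uc jI zero_Q in "auto simp: dot_zero_left")
 next
  case (step q c x)
  then obtain m where m: "!!l. m l : Q" "x \<otimes> Us ! j = dot I m (nth Us)" by blast
  obtain a where a: "!!i. a i : k" "c \<otimes> Us ! j = dot I a (nth Us)"
   using expand[OF subringE(6)[OF Ering step(2) UE[OF jI]]] by blast
  have ac: "!!i. a i : carrier F" using a kc by auto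
  have mc: "!!i. m i : carrier F" using m Q_closed by auto
  have qc: "q : carrier F" using step Q_closed by auto
  have xc: "x : carrier F" "c : carrier F" using step extension_closed[OF Ec] Ec by auto
  have "dot I (%i. q \<otimes> a i \<oplus> m i) (nth Us) = dot I (%i. q \<otimes> a i) (nth Us) \<oplus> dot I m (nth Us)"
   by(rule dot_add_left)(use qc ac mc Uc in auto)
  also have "dot I (%i. q \<otimes> a i) (nth Us) = q \<otimes> dot I a (nth Us)"
   by(rule dot_smult_left)(use qc ac Uc in "auto simp: I_def")
  finally have "(q \<otimes> c \<oplus> x) \<otimes> Us ! j = dot I (%i. q \<otimes> a i \<oplus> m i) (nth Us)"
   using a(2) m(2) qc xc Uc[OF jI] by(simp add: l_distr m_assoc)
  moreover have "ALL i. q \<otimes> a i \<oplus> m i : Q"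
  proof
   fix i
   have "a i \<otimes> q : Q" using mult_Q a k(2) step by auto
   thus "q \<otimes> a i \<oplus> m i : Q" using add_Q m ac[of i] qc by(simp add: m_comm)
  qed
  ultimately show ?case by(intro exI[of _ "%i. q \<otimes> a i \<oplus> m i"] conjI)
 qed
 have "ALL j:I. EX m. (ALL l. m l : Q) & b \<otimes> Us ! j = dot I m (nth Us)"
  using act[OF bE] by simp
 from bchoice[OF this] obtain M
  where "ALL j:I. (ALL l. M j l : Q) & b \<otimes> Us ! j = dot I (M j) (nth Us)" ..
 hence M: "!!j l. j : I ==> M j l : Q" "!!j. j : I ==> b \<otimes> Us ! j = dot I (M j) (nth Us)"
  by simp_all
 have U0: "Us ! i = \<zero>" if "i : I" for i
  by(rule elimination[of I "%_. b" M "nth Us"])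
    (use b bQ M Uc that in "auto simp: I_def")
 obtain a where a: "!!i. a i : k" "\<one> = dot I a (nth Us)"
  using expand[of \<one>] subringE(3)[OF Ering] by blast
 have "dot I a (nth Us) = dot I (nth Us) a"
  by(rule dot_comm)(use a kc Uc in auto)
 also have "... = \<zero>" by(rule dot_zero_left)(use U0 a kc in auto)
 finally show False using a(2) by simp
qed

end

section \<open>Vectors with trivial annihilator contain an invertible matrix\<close>

context diff_field
begin

text \<open>Rows are added one at a time. Reducing row \<open>p\<close> by the rows in \<open>J\<close> gives a nonzero vector \<open>r\<close>, so some
  vector \<open>t\<close> of \<open>S\<close> is not annihilated by \<open>r\<close>. It becomes the new column.\<close>

lemma exists_invertible_columns:
 assumes I: "finite I"
  and Sc: "!!t i. t : S ==> t i : carrier F"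
  and triv: "!!r. [|!!i. r i : carrier F; !!i. i ~: I ==> r i = \<zero>; !!t. t : S ==> dot I r t = \<zero>|]
   ==> ALL i. r i = \<zero>"
  and J: "J <= I"
 shows "EX T H. (ALL j:J. T j : S) & (ALL i:J. ALL j:J. H i j : carrier F) &
  (ALL i:J. ALL j:J. dot J (H i) (T j) = (if i = j then \<one> else \<zero>)) &
  (ALL i:J. ALL j:J. dot J (%k. T k i) (%k. H k j) = (if i = j then \<one> else \<zero>))"
 using finite_subset[OF J I] J
proof (induction J)
 case (insert p J)
 hence "J <= I" by simp
 from insert.IH[OF this] obtain T H where IH: "ALL j:J. T j : S"
  "ALL i:J. ALL j:J. H i j : carrier F"
  "ALL i:J. ALL j:J. dot J (H i) (T j) = (if i = j then \<one> else \<zero>)"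
  "ALL i:J. ALL j:J. dot J (%k. T k i) (%k. H k j) = (if i = j then \<one> else \<zero>)"
  by(elim exE conjE) (rule that)
 have T: "!!j. j : J ==> T j : S"
  and Hc: "!!i j. [|i : J; j : J|] ==> H i j : carrier F"
  and HT: "!!i j. [|i : J; j : J|] ==> dot J (H i) (T j) = (if i = j then \<one> else \<zero>)"
  and TH: "!!i j. [|i : J; j : J|] ==> dot J (%k. T k i) (%k. H k j) = (if i = j then \<one> else \<zero>)"
  using IH(1) apply blast
  using IH(2) apply blast
  using IH(3) apply blast
  using IH(4) by blast
 note fJ = insert.hyps(1) and pJ = insert.hyps(2)
 have Tc: "!!j i. j : J ==> T j i : carrier F" using T Sc by auto
 define r where "r = (%l. if l = p then \<one> else if l : J then \<ominus> dot J (%j. T j p) (%j. H j l) else \<zero>)"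
 have rc: "r l : carrier F" for l unfolding r_def using Tc Hc by auto
 have rp: "r p = \<one>" unfolding r_def by simp
 have rJ: "dot J r y = \<ominus> dot J (%j. T j p) (%j. dot J (H j) y)"
  if yc: "!!i. i : J ==> y i : carrier F" for y
 proof -
  have "dot J r y = dot J (%l. (\<ominus> \<one>) \<otimes> dot J (%j. T j p) (%j. H j l)) y"
   by(rule dot_cong)(use yc Tc Hc pJ in "auto simp: r_def l_minus")
  also have "... = (\<ominus> \<one>) \<otimes> dot J (%l. dot J (%j. T j p) (%j. H j l)) y"
   by(rule dot_smult_left)(use yc fJ Tc Hc in auto)
  also have "dot J (%l. dot J (%j. T j p) (%j. H j l)) y
    = dot J (%j. T j p) (%j. dot J (H j) y)"
   by(rule dot_assoc)(use yc fJ Tc Hc in auto)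
  finally show ?thesis using yc Tc Hc by(simp add: l_minus)
 qed
 have rT: "dot (insert p J) r (T m) = \<zero>" if m: "m : J" for m
 proof -
  have "dot J (%j. T j p) (%j. dot J (H j) (T m)) = dot J (%j. T j p) (%j. if j = m then \<one> else \<zero>)"
   by(rule dot_cong)(use m HT Tc in auto)
  also have "... = T m p" using dot_single_right[of J m \<one> "%j. T j p"] m fJ Tc by simp
  finally have "dot J r (T m) = \<ominus> T m p" using rJ[of "T m"] Tc m by simp
  thus ?thesis using m fJ pJ rc Tc rp by(simp add: dot_insert r_neg)
 qed
 have "EX t:S. dot I r t ~= \<zero>"
 proof (rule ccontr)
  assume "\<not> ?thesis"
  hence "ALL i. r i = \<zero>"
   by(intro triv)(use rc insert.prems in "auto simp: r_def")
  thus False using rp by auto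
 qed
 then obtain t where t: "t : S" "dot I r t ~= \<zero>" by blast
 have tc: "!!i. t i : carrier F" using t Sc by auto
 define d where "d = dot (insert p J) r t"
 have "dot I r t = d"
  unfolding d_def by(rule dot_mono_neutral)(use I insert.prems rc tc in "auto simp: r_def")
 hence d0: "d ~= \<zero>" using t by simp
 have dc: "d : carrier F" unfolding d_def using rc tc by auto
 have d_eq: "d = t p \<oplus> dot J r t" unfolding d_def using fJ pJ rc tc rp by(simp add: dot_insert)
 define kp where "kp = (%j. dot J (H j) t)"
 have kc: "!!j. j : J ==> kp j : carrier F" unfolding kp_def using Hc tc by auto
 define T' where "T' = T(p := t)"
 define H' where "H' = (%j l. if j = p then inv d \<otimes> r l
   else (if l = p then \<zero> else H j l) \<oplus> (\<ominus> (kp j \<otimes> inv d)) \<otimes> r l)"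
 have T'c: "!!j i. j : insert p J ==> T' j i : carrier F" unfolding T'_def using tc Tc by auto
 have H'c: "!!i j. [|i : insert p J; j : insert p J|] ==> H' i j : carrier F"
  unfolding H'_def using rc Hc kc dc d0 by auto
 have T'S: "!!j. j : insert p J ==> T' j : S" unfolding T'_def using T t by auto
 have rT': "dot (insert p J) r (T' m) = (if m = p then d else \<zero>)" if "m : insert p J" for m
  using that rT pJ unfolding T'_def d_def by auto
 have left: "dot (insert p J) (H' i) (T' m) = (if i = m then \<one> else \<zero>)"
  if i: "i : insert p J" and m: "m : insert p J" for i m
 proof (cases "i = p")
  case True
  have "dot (insert p J) (H' i) (T' m) = inv d \<otimes> dot (insert p J) r (T' m)"
   unfolding H'_def True by(simp, rule dot_smult_left)(use fJ dc d0 rc T'c m in auto)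
  thus ?thesis using rT'[OF m] dc d0 True by auto
 next
  case False
  hence iJ: "i : J" using i by auto
  let ?H = "%l. if l = p then \<zero> else H i l"
  have Hc': "!!l. l : insert p J ==> ?H l : carrier F" using Hc iJ by auto
  have "dot (insert p J) (H' i) (T' m) = dot (insert p J) ?H (T' m)
    \<oplus> dot (insert p J) (%l. (\<ominus> (kp i \<otimes> inv d)) \<otimes> r l) (T' m)"
   unfolding H'_def using False
   by(simp, intro dot_add_left)(use Hc' kc iJ dc d0 rc T'c m in auto)
  also have "dot (insert p J) (%l. (\<ominus> (kp i \<otimes> inv d)) \<otimes> r l) (T' m)
    = (\<ominus> (kp i \<otimes> inv d)) \<otimes> (if m = p then d else \<zero>)"
   unfolding rT'[OF m, symmetric]
   by(rule dot_smult_left)(use fJ kc iJ dc d0 rc T'c m in auto)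
  also have "dot (insert p J) ?H (T' m) = dot J (H i) (T' m)"
  proof -
   have "dot (insert p J) ?H (T' m) = ?H p \<otimes> T' m p \<oplus> dot J ?H (T' m)"
    by(rule dot_insert)(use fJ pJ Hc' T'c m in auto)
   also have "dot J ?H (T' m) = dot J (H i) (T' m)"
    by(rule dot_cong)(use pJ Hc iJ T'c m in auto)
   finally show ?thesis using T'c[OF m] Hc iJ by simp
  qed
  also have "dot J (H i) (T' m) = (if m = p then kp i else if i = m then \<one> else \<zero>)"
   unfolding T'_def kp_def using HT iJ m by auto
  finally show ?thesis
   using False kc[OF iJ] dc d0 pJ m by(auto simp: l_minus m_assoc r_neg)
 qed
 have right: "dot (insert p J) (%k. T' k i) (%k. H' k l) = (if i = l then \<one> else \<zero>)"
  if i: "i : insert p J" and l: "l : insert p J" for i l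
 proof -
  define b where "b = dot J (%k. T k i) kp"
  define c where "c = dot J (%k. T k i) (%k. if l = p then \<zero> else H k l)"
  have cc: "c : carrier F" unfolding c_def using Tc Hc l by auto
  have bc: "b : carrier F" unfolding b_def using Tc kc by auto
  have m: "inv d \<otimes> r l : carrier F" using dc d0 rc by auto
  have "dot (insert p J) (%k. T' k i) (%k. H' k l)
    = T' p i \<otimes> H' p l \<oplus> dot J (%k. T' k i) (%k. H' k l)"
   by(rule dot_insert)(use fJ pJ T'c H'c l in auto)
  also have "T' p i \<otimes> H' p l = t i \<otimes> (inv d \<otimes> r l)" unfolding T'_def H'_def by simp
  also have "dot J (%k. T' k i) (%k. H' k l) = dot J (%k. T k i)
    (%k. (if l = p then \<zero> else H k l) \<oplus> (\<ominus> (inv d \<otimes> r l)) \<otimes> kp k)"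
  proof (rule dot_cong)
   fix k assume k: "k : J"
   have "\<ominus> (kp k \<otimes> inv d) \<otimes> r l = \<ominus> (inv d \<otimes> r l) \<otimes> kp k"
    using kc[OF k] rc[of l] inv_closed[OF dc d0] by algebra
   thus "H' k l = (if l = p then \<zero> else H k l) \<oplus> (\<ominus> (inv d \<otimes> r l)) \<otimes> kp k"
    unfolding H'_def using k pJ by auto
  qed (use pJ Tc Hc kc m l in "auto simp: T'_def")
  also have "... = c \<oplus> dot J (%k. T k i) (%k. (\<ominus> (inv d \<otimes> r l)) \<otimes> kp k)"
   unfolding c_def by(rule dot_add_right)(use Tc Hc kc m l in auto)
  also have "dot J (%k. T k i) (%k. (\<ominus> (inv d \<otimes> r l)) \<otimes> kp k) = (\<ominus> (inv d \<otimes> r l)) \<otimes> b"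
   unfolding b_def by(rule dot_smult_right)(use fJ Tc kc m in auto)
  finally have sum: "dot (insert p J) (%k. T' k i) (%k. H' k l)
    = t i \<otimes> (inv d \<otimes> r l) \<oplus> (c \<oplus> (\<ominus> (inv d \<otimes> r l)) \<otimes> b)" .
  have b_eq: "b = dot J (%k. dot J (%j. T j i) (%j. H j k)) t"
   unfolding b_def kp_def by(rule dot_assoc[symmetric])(use fJ Tc Hc tc in auto)
  have c_p: "l = p ==> c = \<zero>"
   unfolding c_def using dot_comm[of J "%k. T k i" "%k. \<zero>"] dot_zero_left[of J "%k. \<zero>" "%k. T k i"] Tc
   by simp
  show ?thesis
  proof (cases "i = p")
   case False
   hence iJ: "i : J" using i by auto
   have "b = dot J (%k. if k = i then \<one> else \<zero>) t"
    unfolding b_eq by(rule dot_cong)(use TH iJ tc in auto)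
   also have "... = t i" using dot_single_left[of J i \<one> t] fJ iJ tc by simp
   finally have "b = t i" .
   hence "t i \<otimes> (inv d \<otimes> r l) \<oplus> (c \<oplus> (\<ominus> (inv d \<otimes> r l)) \<otimes> b) = c"
    using m tc[of i] cc by algebra
   moreover have "l ~= p ==> c = (if i = l then \<one> else \<zero>)"
    unfolding c_def using TH iJ l by auto
   ultimately show ?thesis using sum c_p False by(cases "l = p") simp_all
  next
   case True
   have "dot J r t = \<ominus> b" unfolding b_def kp_def True using rJ[of t] tc by simp
   hence "d = t p \<oplus> \<ominus> b" using d_eq by simp
   moreover have "t i \<otimes> (inv d \<otimes> r l) \<oplus> (c \<oplus> (\<ominus> (inv d \<otimes> r l)) \<otimes> b)
     = c \<oplus> (t p \<oplus> \<ominus> b) \<otimes> (inv d \<otimes> r l)"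
    unfolding True using m tc[of p] cc bc by algebra
   ultimately have "t i \<otimes> (inv d \<otimes> r l) \<oplus> (c \<oplus> (\<ominus> (inv d \<otimes> r l)) \<otimes> b)
     = c \<oplus> d \<otimes> (inv d \<otimes> r l)" by simp
   also have "... = c \<oplus> r l" using dc d0 rc by(simp add: m_assoc[symmetric])
   finally have e: "dot (insert p J) (%k. T' k i) (%k. H' k l) = c \<oplus> r l" using sum by simp
   show ?thesis
   proof (cases "l = p")
    case True
    thus ?thesis using e c_p rp \<open>i = p\<close> by simp
   next
    case False
    hence lJ: "l : J" using l by auto
    have "r l = \<ominus> c" unfolding r_def c_def using False lJ \<open>i = p\<close> by simp
    thus ?thesis using e False \<open>i = p\<close> cc by(simp add: r_neg)
   qed
  qed
 qed
 show ?case
  by(rule exI[of _ T'], rule exI[of _ H'])(use T'S H'c left right in blast)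
qed simp

end

section \<open>Tensor powers of a linear differential system\<close>

definition lists_of :: "'i set => nat => 'i list set"
 where "lists_of Bs d = {xs. set xs <= Bs & length xs = d}"

lemma finite_lists_of: "finite Bs ==> finite (lists_of Bs d)"
 unfolding lists_of_def by(rule finite_lists_length_eq)

lemma lists_ofD: "xs : lists_of Bs d ==> set xs <= Bs"
 unfolding lists_of_def by auto

lemma lists_of_0: "lists_of Bs 0 = {[]}"
 unfolding lists_of_def by auto

lemma lists_of_Suc: "lists_of Bs (Suc d) = (\<Union>x\<in>Bs. Cons x ` lists_of Bs d)"
 unfolding lists_of_def by(auto simp: length_Suc_conv image_iff)

lemma lists_of_SucE:
 assumes "xs : lists_of Bs (Suc d)"
 obtains y ys where "xs = y # ys" "y : Bs" "ys : lists_of Bs d"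
 using assms unfolding lists_of_Suc by auto

context cring
begin

lemma finsum_lists_Suc:
 assumes Bs: "finite Bs" and f: "!!x xs. [|x : Bs; xs : lists_of Bs d|] ==> f (x # xs) : carrier R"
 shows "(\<Oplus>xs\<in>lists_of Bs (Suc d). f xs) = (\<Oplus>x\<in>Bs. \<Oplus>xs\<in>lists_of Bs d. f (x # xs))"
proof -
 have "(\<Oplus>xs\<in>lists_of Bs (Suc d). f xs) = (\<Oplus>x\<in>Bs. \<Oplus>xs\<in>Cons x ` lists_of Bs d. f xs)"
  unfolding lists_of_Suc
  by(rule add.finprod_UN_disjoint)
    (use Bs f finite_lists_of[OF Bs, of d] in "auto simp: pairwise_def disjnt_def")
 also have "... = (\<Oplus>x\<in>Bs. \<Oplus>xs\<in>lists_of Bs d. f (x # xs))"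
  by(intro finsum_cong' finsum_reindex)(use f in "auto intro!: finsum_closed")
 finally show ?thesis .
qed

lemma dot_lists_mult:
 assumes Bs: "finite Bs"
  and f: "!!x xs. [|x : Bs; xs : lists_of Bs d|] ==> f (x # xs) = a x \<otimes> f' xs"
  and g: "!!x xs. [|x : Bs; xs : lists_of Bs d|] ==> g (x # xs) = b x \<otimes> g' xs"
  and c: "!!x. x : Bs ==> a x : carrier R" "!!x. x : Bs ==> b x : carrier R"
   "!!xs. xs : lists_of Bs d ==> f' xs : carrier R" "!!xs. xs : lists_of Bs d ==> g' xs : carrier R"
 shows "dot (lists_of Bs (Suc d)) f g = dot Bs a b \<otimes> dot (lists_of Bs d) f' g'"
proof -
 have "dot (lists_of Bs (Suc d)) f g = (\<Oplus>x\<in>Bs. \<Oplus>xs\<in>lists_of Bs d. f (x # xs) \<otimes> g (x # xs))"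
  unfolding dot_def by(rule finsum_lists_Suc)(use Bs f g c in auto)
 also have "... = (\<Oplus>x\<in>Bs. a x \<otimes> b x \<otimes> dot (lists_of Bs d) f' g')"
 proof (intro finsum_cong' refl)
  fix x assume x: "x : Bs"
  have "(\<Oplus>xs\<in>lists_of Bs d. f (x # xs) \<otimes> g (x # xs)) = (\<Oplus>xs\<in>lists_of Bs d. (a x \<otimes> b x) \<otimes> (f' xs \<otimes> g' xs))"
  proof (intro finsum_cong' refl)
   fix xs assume "xs : lists_of Bs d"
   thus "f (x # xs) \<otimes> g (x # xs) = (a x \<otimes> b x) \<otimes> (f' xs \<otimes> g' xs)"
    using x f g c by(simp add: m_ac)
  qed (use x c in auto)
  also have "... = a x \<otimes> b x \<otimes> dot (lists_of Bs d) f' g'"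
   unfolding dot_def
   by(rule finsum_rdistr[symmetric])(use x c finite_lists_of[OF Bs] in auto)
  finally show "(\<Oplus>xs\<in>lists_of Bs d. f (x # xs) \<otimes> g (x # xs)) = a x \<otimes> b x \<otimes> dot (lists_of Bs d) f' g'" .
 qed (use c in auto)
 also have "... = dot Bs a b \<otimes> dot (lists_of Bs d) f' g'"
  unfolding dot_def[of Bs]
  by(rule finsum_ldistr[symmetric])(use Bs c in auto)
 finally show ?thesis .
qed

fun kron :: "('i => 'i => 'a) => 'i list => 'i list => 'a"
 where "kron A [] [] = \<one>"
 | "kron A (x # xs) (y # ys) = A x y \<otimes> kron A xs ys"
 | "kron A _ _ = \<zero>"

text \<open>The matrix by which a tensor power of a system with matrix \<open>N\<close> is governed, as the product rule
  gives it.\<close>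

fun kron_sum :: "('i => 'i => 'a) => 'i list => 'i list => 'a"
 where "kron_sum N (x # xs) (y # ys) =
   N x y \<otimes> (if ys = xs then \<one> else \<zero>) \<oplus> (if y = x then \<one> else \<zero>) \<otimes> kron_sum N xs ys"
 | "kron_sum N _ _ = \<zero>"

definition lprod :: "('i => 'a) => 'i list => 'a"
 where "lprod \<phi> xs = foldr (%x. (\<otimes>) (\<phi> x)) xs \<one>"

lemma lprod_simps [simp]: "lprod \<phi> [] = \<one>" "lprod \<phi> (x # xs) = \<phi> x \<otimes> lprod \<phi> xs"
 by(auto simp: lprod_def)

lemma kron_closed:
 assumes "!!x y. [|x : Bs; y : Bs|] ==> A x y : S" "subring S R" "set xs <= Bs" "set ys <= Bs"
 shows "kron A xs ys : S"
 using assms(1,3,4)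
 by(induction A xs ys rule: kron.induct)
   (simp_all add: subringE(2,3,6)[OF assms(2)])

lemma kron_sum_closed:
 assumes "!!x y. [|x : Bs; y : Bs|] ==> N x y : S" "subring S R" "set xs <= Bs" "set ys <= Bs"
 shows "kron_sum N xs ys : S"
 using assms(1,3,4)
 by(induction N xs ys rule: kron_sum.induct)
   (simp_all add: subringE(2,3,6,7)[OF assms(2)])

lemma lprod_closed:
 assumes "!!x. x : Bs ==> \<phi> x : S" "subring S R" "set xs <= Bs"
 shows "lprod \<phi> xs : S"
 using assms(1,3) by(induction xs) (simp_all add: subringE(3,6)[OF assms(2)])

lemma lprod_append:
 assumes c: "!!x. x : Bs ==> \<phi> x : carrier R" and "set xs <= Bs" "set ys <= Bs"
 shows "lprod \<phi> (xs @ ys) = lprod \<phi> xs \<otimes> lprod \<phi> ys"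
 using assms(2)
proof (induction xs)
 case Nil
 have "lprod \<phi> ys : carrier R" by(rule lprod_closed[OF c carrier_is_subring assms(3)])
 thus ?case by simp
next
 case (Cons x xs)
 have "lprod \<phi> ys : carrier R" by(rule lprod_closed[OF c carrier_is_subring assms(3)])
 moreover have "lprod \<phi> xs : carrier R"
  by(rule lprod_closed[OF c carrier_is_subring])(use Cons.prems in auto)
 ultimately show ?case using Cons c[of x] by(simp add: m_assoc)
qed

lemma kron_closed':
 assumes "!!x y. [|x : Bs; y : Bs|] ==> A x y : carrier R" "xs : lists_of Bs d" "ys : lists_of Bs e"
 shows "kron A xs ys : carrier R"
 by(rule kron_closed[OF assms(1) carrier_is_subring lists_ofD[OF assms(2)] lists_ofD[OF assms(3)]])

lemma kron_sum_closed':
 assumes "!!x y. [|x : Bs; y : Bs|] ==> A x y : carrier R" "xs : lists_of Bs d" "ys : lists_of Bs e"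
 shows "kron_sum A xs ys : carrier R"
 by(rule kron_sum_closed[OF assms(1) carrier_is_subring lists_ofD[OF assms(2)] lists_ofD[OF assms(3)]])

lemma lprod_closed':
 assumes "!!x. x : Bs ==> \<phi> x : carrier R" "xs : lists_of Bs d"
 shows "lprod \<phi> xs : carrier R"
 by(rule lprod_closed[OF assms(1) carrier_is_subring lists_ofD[OF assms(2)]])

lemma kron_mult:
 assumes Bs: "finite Bs"
  and A: "!!x y. [|x : Bs; y : Bs|] ==> A x y : carrier R"
  and B: "!!x y. [|x : Bs; y : Bs|] ==> B x y : carrier R"
 shows "xs : lists_of Bs d ==> zs : lists_of Bs d ==>
  dot (lists_of Bs d) (kron A xs) (%ys. kron B ys zs) = kron (%x z. dot Bs (A x) (%y. B y z)) xs zs"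
proof (induction d arbitrary: xs zs)
 case 0
 thus ?case by(auto simp: lists_of_0 dot_def)
next
 case (Suc d)
 obtain x xs' where x: "xs = x # xs'" "x : Bs" "xs' : lists_of Bs d"
  using Suc.prems by(auto elim: lists_of_SucE)
 obtain z zs' where z: "zs = z # zs'" "z : Bs" "zs' : lists_of Bs d"
  using Suc.prems by(auto elim: lists_of_SucE)
 have "dot (lists_of Bs (Suc d)) (kron A xs) (%ys. kron B ys zs)
   = dot Bs (A x) (%y. B y z) \<otimes> dot (lists_of Bs d) (kron A xs') (%ys. kron B ys zs')"
  by(rule dot_lists_mult)(use x z Bs A B kron_closed'[OF A] kron_closed'[OF B] in auto)
 thus ?case using Suc.IH[OF x(3) z(3)] x z by simp
qed

lemma kron_scalar:
 assumes "f : carrier R"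
 shows "xs : lists_of Bs d ==> zs : lists_of Bs d ==>
  (!!x z. [|x : Bs; z : Bs|] ==> A x z = (if x = z then f else \<zero>)) ==>
  kron A xs zs = (if xs = zs then f [^] d else \<zero>)"
proof (induction d arbitrary: xs zs)
 case 0
 thus ?case by(auto simp: lists_of_0)
next
 case (Suc d)
 obtain x xs' where x: "xs = x # xs'" "x : Bs" "xs' : lists_of Bs d"
  using Suc.prems by(auto elim: lists_of_SucE)
 obtain z zs' where z: "zs = z # zs'" "z : Bs" "zs' : lists_of Bs d"
  using Suc.prems by(auto elim: lists_of_SucE)
 show ?case using Suc.IH[OF x(3) z(3) Suc.prems(3)] Suc.prems(3)[OF x(2) z(2)] x z assms
  by(auto simp: m_comm)
qed

lemma dot_kron_sum:
 assumes Bs: "finite Bs" and x: "x : Bs" and xs: "xs : lists_of Bs d"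
  and N: "!!x y. [|x : Bs; y : Bs|] ==> N x y : carrier R"
  and g: "!!y ys. [|y : Bs; ys : lists_of Bs d|] ==> g (y # ys) = \<phi> y \<otimes> \<psi> ys"
  and c: "!!x. x : Bs ==> \<phi> x : carrier R" "!!xs. xs : lists_of Bs d ==> \<psi> xs : carrier R"
 shows "dot (lists_of Bs (Suc d)) (kron_sum N (x # xs)) g
  = dot Bs (N x) \<phi> \<otimes> \<psi> xs \<oplus> \<phi> x \<otimes> dot (lists_of Bs d) (kron_sum N xs) \<psi>"
proof -
 define f1 where "f1 = (%ys'. case ys' of [] => \<zero> | y # ys => N x y \<otimes> (if ys = xs then \<one> else \<zero>))"
 define f2 where "f2 = (%ys'. case ys' of [] => \<zero> | y # ys => (if y = x then \<one> else \<zero>) \<otimes> kron_sum N xs ys)"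
 have kc: "ys : lists_of Bs d ==> kron_sum N xs ys : carrier R" for ys
  by(rule kron_sum_closed'[OF N xs])
 have gc: "ys : lists_of Bs (Suc d) ==> g ys : carrier R" for ys
  by(erule lists_of_SucE)(use g c in auto)
 have fc: "ys : lists_of Bs (Suc d) ==> f1 ys : carrier R" "ys : lists_of Bs (Suc d) ==> f2 ys : carrier R" for ys
  by(auto elim!: lists_of_SucE simp: f1_def f2_def N x kc)
 have "dot (lists_of Bs (Suc d)) (kron_sum N (x # xs)) g = dot (lists_of Bs (Suc d)) (%ys. f1 ys \<oplus> f2 ys) g"
  by(rule dot_cong)(use gc fc in "auto elim!: lists_of_SucE simp: f1_def f2_def")
 also have "... = dot (lists_of Bs (Suc d)) f1 g \<oplus> dot (lists_of Bs (Suc d)) f2 g"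
  by(rule dot_add_left)(use gc fc in auto)
 also have "dot (lists_of Bs (Suc d)) f1 g
   = dot Bs (N x) \<phi> \<otimes> dot (lists_of Bs d) (%ys. if ys = xs then \<one> else \<zero>) \<psi>"
  by(rule dot_lists_mult)(use Bs x xs N g c in "auto simp: f1_def")
 also have "dot (lists_of Bs d) (%ys. if ys = xs then \<one> else \<zero>) \<psi> = \<psi> xs"
  using dot_single_left[of "lists_of Bs d" xs \<one> \<psi>] finite_lists_of[OF Bs] xs c by simp
 also have "dot (lists_of Bs (Suc d)) f2 g
   = dot Bs (%y. if y = x then \<one> else \<zero>) \<phi> \<otimes> dot (lists_of Bs d) (kron_sum N xs) \<psi>"
  by(rule dot_lists_mult)(use Bs x xs N g c kc in "auto simp: f2_def")
 also have "dot Bs (%y. if y = x then \<one> else \<zero>) \<phi> = \<phi> x"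
  using dot_single_left[of Bs x \<one> \<phi>] Bs x c by simp
 finally show ?thesis .
qed

end

context diff_field
begin

lemma der_lprod:
 assumes Bs: "finite Bs"
  and N: "!!x y. [|x : Bs; y : Bs|] ==> N x y : carrier F"
  and c: "!!x. x : Bs ==> \<phi> x : carrier F"
  and d: "!!x. x : Bs ==> der (\<phi> x) = dot Bs (N x) \<phi>"
 shows "xs : lists_of Bs n ==> der (lprod \<phi> xs) = dot (lists_of Bs n) (kron_sum N xs) (lprod \<phi>)"
proof (induction n arbitrary: xs)
 case 0
 thus ?case by(auto simp: lists_of_0 dot_def)
next
 case (Suc n)
 obtain x xs' where x: "xs = x # xs'" "x : Bs" "xs' : lists_of Bs n"
  using Suc.prems by(auto elim: lists_of_SucE)
 have lc: "ys : lists_of Bs n ==> lprod \<phi> ys : carrier F" for ys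
  by(rule lprod_closed'[OF c])
 have "dot (lists_of Bs (Suc n)) (kron_sum N (x # xs')) (lprod \<phi>)
  = dot Bs (N x) \<phi> \<otimes> lprod \<phi> xs' \<oplus> \<phi> x \<otimes> dot (lists_of Bs n) (kron_sum N xs') (lprod \<phi>)"
  by(rule dot_kron_sum)(use Bs x N c lc in auto)
 thus ?case using Suc.IH[OF x(3)] x c lc d by(simp add: der_mult)
qed

lemma der_kron:
 assumes Bs: "finite Bs"
  and N: "!!x y. [|x : Bs; y : Bs|] ==> N x y : carrier F"
  and c: "!!x z. [|x : Bs; z : Bs|] ==> Y x z : carrier F"
  and d: "!!x z. [|x : Bs; z : Bs|] ==> der (Y x z) = dot Bs (N x) (%y. Y y z)"
 shows "[|xs : lists_of Bs n; zs : lists_of Bs n|] ==>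
  der (kron Y xs zs) = dot (lists_of Bs n) (kron_sum N xs) (%ys. kron Y ys zs)"
proof (induction n arbitrary: xs zs)
 case 0
 thus ?case by(auto simp: lists_of_0 dot_def)
next
 case (Suc n)
 obtain x xs' where x: "xs = x # xs'" "x : Bs" "xs' : lists_of Bs n"
  using Suc.prems by(auto elim: lists_of_SucE)
 obtain z zs' where z: "zs = z # zs'" "z : Bs" "zs' : lists_of Bs n"
  using Suc.prems by(auto elim: lists_of_SucE)
 have lc: "ys : lists_of Bs n ==> kron Y ys zs' : carrier F" for ys
  by(rule kron_closed'[OF c _ z(3)])
 have "dot (lists_of Bs (Suc n)) (kron_sum N (x # xs')) (%ys. kron Y ys zs)
  = dot Bs (N x) (%y. Y y z) \<otimes> kron Y xs' zs'
   \<oplus> Y x z \<otimes> dot (lists_of Bs n) (kron_sum N xs') (%ys. kron Y ys zs')"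
  by(rule dot_kron_sum)(use Bs x z N c lc in auto)
 thus ?case using Suc.IH[OF x(3) z(3)] x z c lc d by(simp add: der_mult)
qed

end

section \<open>Rationality implies that the generic point is locally closed\<close>

context diff_field
begin

definition Cspan :: "'a set => 'a set"
 where "Cspan Bs = {dot Bs n (%x. x) | n. ALL x:Bs. n x : Cst}"

lemma Cspan_closed: "Bs <= carrier F ==> Cspan Bs <= carrier F"
 unfolding Cspan_def using CstD by(auto intro!: dot_closed)

lemma CspanI: "(!!x. x : Bs ==> n x : Cst) ==> dot Bs n (%x. x) : Cspan Bs"
 unfolding Cspan_def by auto

lemma CspanE:
 assumes "y : Cspan Bs"
 obtains n where "!!x. x : Bs ==> n x : Cst" "y = dot Bs n (%x. x)"
 using assms unfolding Cspan_def by auto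

lemma Cspan_incl:
 assumes "finite Bs" "Bs <= carrier F" "x : Bs" shows "x : Cspan Bs"
proof -
 have "dot Bs (%i. if i = x then \<one> else \<zero>) (%x. x) = \<one> \<otimes> x"
  by(rule dot_single_left)(use assms in auto)
 hence "x = dot Bs (%i. if i = x then \<one> else \<zero>) (%x. x)"
  using assms by auto
 thus ?thesis using CspanI[of Bs "%i. if i = x then \<one> else \<zero>"] by simp
qed

lemma Cspan_add:
 assumes "Bs <= carrier F" "y : Cspan Bs" "z : Cspan Bs" shows "y \<oplus> z : Cspan Bs"
proof -
 obtain n m where n: "!!x. x : Bs ==> n x : Cst" "y = dot Bs n (%x. x)"
  and m: "!!x. x : Bs ==> m x : Cst" "z = dot Bs m (%x. x)"
  using assms(2,3) by(elim CspanE) blast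
 have "y \<oplus> z = dot Bs (%x. n x \<oplus> m x) (%x. x)"
  unfolding n(2) m(2) by(rule dot_add_left[symmetric])(use assms n m CstD in auto)
 thus ?thesis using CspanI[of Bs "%x. n x \<oplus> m x"] Cst_add n m by simp
qed

lemma Cspan_smult:
 assumes "finite Bs" "Bs <= carrier F" "y : Cspan Bs" "c : Cst" shows "c \<otimes> y : Cspan Bs"
proof -
 obtain n where n: "!!x. x : Bs ==> n x : Cst" "y = dot Bs n (%x. x)"
  using assms(3) by(elim CspanE) blast
 have "c \<otimes> y = dot Bs (%x. c \<otimes> n x) (%x. x)"
  unfolding n(2) by(rule dot_smult_left[symmetric])(use assms n CstD in auto)
 thus ?thesis using CspanI[of Bs "%x. c \<otimes> n x"] Cst_mult n assms by simp
qed

lemma Cspan_zero: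
 assumes "Bs <= carrier F" shows "\<zero> : Cspan Bs"
proof -
 have "dot Bs (%_. \<zero>) (%x. x) = \<zero>" by(rule dot_zero_left)(use assms in auto)
 thus ?thesis using CspanI[of Bs "%_. \<zero>"] by simp
qed

lemma Cspan_trans:
 assumes "finite Bs" "Bs <= carrier F" "finite W" "W <= Cspan Bs" "y : Cspan W"
 shows "y : Cspan Bs"
proof -
 obtain n where n: "!!x. x : W ==> n x : Cst" "y = dot W n (%x. x)"
  using assms(5) by(elim CspanE) blast
 have c: "Cspan Bs <= carrier F" by(rule Cspan_closed) fact
 show ?thesis
  unfolding n(2)
  by(rule dot_in_ideal)
    (use assms n c Cspan_smult Cspan_add Cspan_zero in auto)
qed

lemma exists_Cst_basis:
 assumes W: "finite W" "W <= carrier F"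
 shows "EX Bs<=W. W <= Cspan Bs &
  (ALL c. (ALL x:Bs. c x : Cst) --> dot Bs c (%x. x) = \<zero> --> (ALL x:Bs. c x = \<zero>))"
proof -
 let ?P = "%Bs. Bs <= W & W <= Cspan Bs"
 have PW: "?P W" using Cspan_incl[OF W] by auto
 obtain Bs where Bs: "?P Bs" "!!Bs'. ?P Bs' ==> card Bs <= card Bs'"
  using ex_has_least_nat[of ?P W card] PW by blast
 have fX: "finite Bs" "Bs <= carrier F" using Bs W finite_subset by auto
 have "c x = \<zero>" if c: "ALL x:Bs. c x : Cst" "dot Bs c (%x. x) = \<zero>" and x: "x : Bs" for c x
 proof (rule ccontr)
  assume cx: "c x ~= \<zero>"
  define Bs' where "Bs' = Bs - {x}"
  have Bs': "finite Bs'" "Bs' <= carrier F" "x ~: Bs'" "Bs = insert x Bs'"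
   using fX x unfolding Bs'_def by auto
  have cc: "!!y. y : Bs ==> c y : carrier F" using c CstD by auto
  have xc: "x : carrier F" using x fX by auto
  have "dot Bs c (%x. x) = c x \<otimes> x \<oplus> dot Bs' c (%x. x)"
   unfolding Bs'(4) by(rule dot_insert)(use Bs' cc fX x in auto)
  hence e: "c x \<otimes> x \<oplus> dot Bs' c (%x. x) = \<zero>" using c by simp
  have dc: "dot Bs' c (%x. x) : carrier F" using Bs' cc by auto
  have ic: "inv (c x) : carrier F" using cx cc x by auto
  have "x = (\<ominus> (inv (c x))) \<otimes> dot Bs' c (%x. x)"
  proof -
   have "c x \<otimes> x = \<ominus> dot Bs' c (%x. x)"
    using e dc xc cc x minus_equality[of "c x \<otimes> x" "dot Bs' c (%x. x)"] by auto
   hence "inv (c x) \<otimes> (c x \<otimes> x) = inv (c x) \<otimes> (\<ominus> dot Bs' c (%x. x))" by simp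
   thus ?thesis
    using ic cc[OF x] xc dc cx by(simp add: m_assoc[symmetric] r_minus l_minus)
  qed
  also have "... : Cspan Bs'"
   by(rule Cspan_smult)
     (use Bs' c cx x Cst_inv Cst_minus in "auto intro!: CspanI")
  finally have "x : Cspan Bs'" .
  hence "Bs <= Cspan Bs'" using Bs' Cspan_incl[OF Bs'(1,2)] by auto
  hence "W <= Cspan Bs'" using Cspan_trans[OF Bs'(1,2) fX(1)] Bs by blast
  hence "card Bs <= card Bs'" using Bs(2)[of Bs'] Bs Bs' by auto
  thus False using Bs' by auto
 qed
 thus ?thesis using Bs by blast
qed

end

text \<open>\<open>W\<close> spans a finite-dimensional differential subspace, and every element of \<open>A\<close> is a component
  of a solution vector of a linear system over the field generated by \<open>W\<close> that has a fundamental
  matrix over \<open>A\<close>.\<close>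

locale diff_tower = diff_field F der for F (structure) and der (\<open>\<partial>\<close>) +
 fixes A k W :: "'a set"
 assumes A_subring: "subring A F"
  and der_A: "x : A ==> der x : A"
  and denominator: "x : carrier F ==> EX s:A. s ~= \<zero> & s \<otimes> x : A"
  and k_subfield: "subfield k F" and k_A: "k <= A"
  and Cst_algebraic: "c : Cst ==> (algebraic over k) c"
  and W_finite: "finite W" and W_A: "W <= A" and one_W: "\<one> : W"
  and der_W: "w : W ==> der w : Cspan W"
  and system: "q : A ==> EX (I::nat set) l v g s u. finite I &
   (ALL i:I. l i : Cst & v i : A & der (v i) = dot I (u i) v) & q = dot I l v &
   (ALL i:I. ALL j:I. g i j : A & s i j : A & u i j : carrier F &
    (EX w:Cspan W. w ~= \<zero> & w \<otimes> u i j : Cspan W) &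
    der (g i j) = dot I (u i) (%k. g k j) &
    dot I (s i) (%k. g k j) = (if i = j then \<one> else \<zero>) &
    dot I (g i) (%k. s k j) = (if i = j then \<one> else \<zero>))"
begin

lemma A_closed: "x : A ==> x : carrier F"
 using subringE(1)[OF A_subring] by auto

lemmas A_ring = subringE[OF A_subring]

lemma common_denominator:
 assumes "finite D" "D <= carrier F"
 shows "EX s:A. s ~= \<zero> & (ALL x:D. s \<otimes> x : A)"
 using assms
proof (induction D)
 case empty
 thus ?case using A_ring(3) by(intro bexI[of _ \<one>]) auto
next
 case (insert x D)
 then obtain s where s: "s : A" "s ~= \<zero>" "!!y. y : D ==> s \<otimes> y : A" by auto
 obtain t where t: "t : A" "t ~= \<zero>" "t \<otimes> x : A" using denominator[of x] insert.prems by auto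
 have "t \<otimes> s \<otimes> y : A" if "y : insert x D" for y
 proof (cases "y = x")
  case True
  hence "t \<otimes> s \<otimes> y = s \<otimes> (t \<otimes> x)"
   using s t insert.prems A_closed by(simp add: m_ac)
  thus ?thesis using A_ring(6) s t by simp
 next
  case False
  hence "t \<otimes> s \<otimes> y = t \<otimes> (s \<otimes> y)"
   using s t insert.prems A_closed that by(auto simp: m_assoc)
  thus ?thesis using A_ring(6) s t that False by simp
 qed
 thus ?case using s t A_ring(6) integral A_closed by(intro bexI[of _ "t \<otimes> s"]) blast+
qed

end

locale diff_tower_basis = diff_tower F der A k W for F (structure) and der (\<open>\<partial>\<close>) and A k W +
 fixes Bs :: "'a set" and N :: "'a => 'a => 'a"
 assumes X_W: "Bs <= W" and W_X: "W <= Cspan Bs"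
  and X_indep: "[|!!x. x : Bs ==> c x : Cst; dot Bs c (%x. x) = \<zero>; x : Bs|] ==> c x = \<zero>"
  and N_Cst: "[|x : Bs; y : Bs|] ==> N x y : Cst"
  and der_X: "x : Bs ==> der x = dot Bs (N x) (%x. x)"
begin

lemma X_finite: "finite Bs" using X_W W_finite finite_subset by blast

lemma X_A: "x : Bs ==> x : A" using X_W W_A by auto

lemma X_closed: "x : Bs ==> x : carrier F" using X_A A_closed by auto

lemma N_closed: "[|x : Bs; y : Bs|] ==> N x y : carrier F" using N_Cst CstD by auto

lemma der_iter_closed: "x : carrier F ==> (der ^^ n) x : carrier F"
 by(induction n) auto

lemma der_iter_system:
 assumes "x : Bs"
 shows "(der ^^ Suc n) x = dot Bs (N x) (%y. (der ^^ n) y)"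
proof (induction n)
 case 0
 thus ?case using der_X assms by simp
next
 case (Suc n)
 have yc: "!!y. y : Bs ==> (der ^^ n) y : carrier F" using X_closed der_iter_closed by auto
 have "(der ^^ Suc (Suc n)) x = der (dot Bs (N x) (%y. (der ^^ n) y))"
  using Suc by simp
 also have "... = dot Bs (%y. der (N x y)) (%y. (der ^^ n) y) \<oplus> dot Bs (N x) (%y. der ((der ^^ n) y))"
  by(rule der_dot)(use X_finite N_closed assms yc in auto)
 also have "dot Bs (%y. der (N x y)) (%y. (der ^^ n) y) = \<zero>"
  by(rule dot_zero_left)(use N_Cst CstD assms yc in auto)
 finally show ?case using N_closed assms yc by simp
qed

text \<open>The iterated derivatives of a basis of constants of \<open>Cspan W\<close> have no common annihilator, so a
  Wronskian matrix can be inverted.\<close>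

lemma exists_fundamental_matrix:
 "EX f Y s. f : A & f ~= \<zero> & (ALL x:Bs. ALL z:Bs. Y x z : carrier F & s x z : A &
   der (Y x z) = dot Bs (N x) (%y. Y y z) &
   dot Bs (s x) (%y. Y y z) = (if x = z then f else \<zero>) &
   dot Bs (Y x) (%y. s y z) = (if x = z then f else \<zero>))"
proof -
 define S where "S = range (%n x. if x : Bs then (der ^^ n) x else \<zero>)"
 have Sc: "!!t x. t : S ==> t x : carrier F"
  unfolding S_def using X_closed der_iter_closed by auto
 have triv: "ALL x. r x = \<zero>"
  if rc: "!!x. r x : carrier F" and rs: "!!x. x ~: Bs ==> r x = \<zero>"
   and r0: "!!t. t : S ==> dot Bs r t = \<zero>" for r
 proof
  fix z
  define M where "M = {r. (ALL x. r x : carrier F) & (ALL x. x ~: Bs --> r x = \<zero>) &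
    (ALL n. dot Bs r (%x. (der ^^ n) x) = \<zero>)}"
  have dc: "!!n x. x : Bs ==> (der ^^ n) x : carrier F" using X_closed der_iter_closed by auto
  have rM: "r : M"
  proof -
   have "dot Bs r (%x. (der ^^ n) x) = \<zero>" for n
   proof -
    have "dot Bs r (%x. (der ^^ n) x) = dot Bs r (%x. if x : Bs then (der ^^ n) x else \<zero>)"
     by(rule dot_cong)(use rc dc in auto)
    thus ?thesis using r0 unfolding S_def by auto
   qed
   thus ?thesis unfolding M_def using rc rs by auto
  qed
  show "r z = \<zero>"
  proof (cases "z : Bs")
   case True
   have "dot Bs r (%x. if x = z then \<one> else \<zero>) = \<zero>"
   proof (rule stable_space_constant_vectors[where N = M and I = Bs])
    show "(%i. r i \<oplus> r' i) : M" if "r : M" "r' : M" for r r'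
    proof -
     have rc: "!!x. r x : carrier F" "!!x. r' x : carrier F"
      and r0: "!!n. dot Bs r (%x. (der ^^ n) x) = \<zero>" "!!n. dot Bs r' (%x. (der ^^ n) x) = \<zero>"
      using that unfolding M_def by simp_all
     have "dot Bs (%i. r i \<oplus> r' i) (%x. (der ^^ n) x) = \<zero>" for n
      by(subst dot_add_left)(use rc r0 dc in simp_all)
     thus ?thesis using that unfolding M_def by simp
    qed
    show "(%i. c \<otimes> r i) : M" if "c : carrier F" "r : M" for c r
    proof -
     have rc: "!!x. r x : carrier F" and r0: "!!n. dot Bs r (%x. (der ^^ n) x) = \<zero>"
      using that unfolding M_def by simp_all
     have "dot Bs (%i. c \<otimes> r i) (%x. (der ^^ n) x) = \<zero>" for n
      by(subst dot_smult_left)(use rc r0 dc that X_finite in simp_all)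
     thus ?thesis using that unfolding M_def by simp
    qed
    show "(%i. der (r i)) : M" if r: "r : M" for r
    proof -
     have rc: "!!x. r x : carrier F" using r unfolding M_def by auto
     have "dot Bs (%x. der (r x)) (%x. (der ^^ n) x) = \<zero>" for n
     proof -
      have e: "der (dot Bs r (%x. (der ^^ n) x)) = dot Bs (%x. der (r x)) (%x. (der ^^ n) x)
        \<oplus> dot Bs r (%x. der ((der ^^ n) x))"
       by(rule der_dot)(use X_finite rc dc in auto)
      have e0: "dot Bs r (%x. (der ^^ n) x) = \<zero>" using r unfolding M_def by blast
      have "dot Bs r (%x. (der ^^ Suc n) x) = \<zero>" using r unfolding M_def by blast
      hence e1: "dot Bs r (%x. der ((der ^^ n) x)) = \<zero>"
       by(simp only: funpow.simps comp_def)
      have "dot Bs (%x. der (r x)) (%x. (der ^^ n) x) : carrier F"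
       using rc dc by(intro dot_closed) auto
      thus ?thesis using e[unfolded e0 e1] by(simp only: der_zero r_zero)
     qed
     thus ?thesis using r unfolding M_def by auto
    qed
    show "dot Bs c (%x. if x = z then \<one> else \<zero>) = \<zero>"
     if c: "c : M" "!!i. c i : Cst" for c
    proof -
     have "dot Bs c (%x. (der ^^ 0) x) = \<zero>" using c(1) unfolding M_def by blast
     hence "c x = \<zero>" if "x : Bs" for x using X_indep[of c x] c(2) that by simp
     thus ?thesis by(intro dot_zero_left) auto
    qed
   qed (use X_finite rM in "auto simp: M_def")
   thus ?thesis using dot_single_right[of Bs z \<one> r] X_finite True rc by simp
  qed (use rs in auto)
 qed
 have "EX T H. (ALL j:Bs. T j : S) & (ALL i:Bs. ALL j:Bs. H i j : carrier F) &
  (ALL i:Bs. ALL j:Bs. dot Bs (H i) (T j) = (if i = j then \<one> else \<zero>)) &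
  (ALL i:Bs. ALL j:Bs. dot Bs (%k. T k i) (%k. H k j) = (if i = j then \<one> else \<zero>))"
 proof (rule exists_invertible_columns[OF X_finite])
  show "ALL i. r i = \<zero>" if "!!i. r i : carrier F" "!!i. i ~: Bs ==> r i = \<zero>"
    "!!t. t : S ==> dot Bs r t = \<zero>" for r
   using that by(rule triv)
 qed (use Sc in auto)
 then obtain T H where T: "ALL j:Bs. T j : S" and H: "ALL i:Bs. ALL j:Bs. H i j : carrier F"
  and HT: "ALL i:Bs. ALL j:Bs. dot Bs (H i) (T j) = (if i = j then \<one> else \<zero>)"
  and TH: "ALL i:Bs. ALL j:Bs. dot Bs (%k. T k i) (%k. H k j) = (if i = j then \<one> else \<zero>)"
  by(elim exE conjE) (rule that)
 have Tc: "!!j x. j : Bs ==> T j x : carrier F" using T Sc by auto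
 have Hc: "!!i j. [|i : Bs; j : Bs|] ==> H i j : carrier F" using H by auto
 have "(%(i, j). H i j) ` (Bs \<times> Bs) <= carrier F" using Hc by auto
 then obtain f where f: "f : A" "f ~= \<zero>" "ALL h:(%(i, j). H i j) ` (Bs \<times> Bs). f \<otimes> h : A"
  using common_denominator[of "(%(i, j). H i j) ` (Bs \<times> Bs)"] X_finite by auto
 have fc: "f : carrier F" using f A_closed by auto
 have dT: "der (T j x) = dot Bs (N x) (%y. T j y)" if j: "j : Bs" and x: "x : Bs" for j x
 proof -
  obtain n where n: "T j = (%x. if x : Bs then (der ^^ n) x else \<zero>)"
   using T j unfolding S_def by auto
  have "der (T j x) = (der ^^ Suc n) x" using n x by simp
  also have "... = dot Bs (N x) (%y. (der ^^ n) y)" by(rule der_iter_system[OF x])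
  also have "... = dot Bs (N x) (%y. T j y)"
   by(rule dot_cong)(use n x N_closed X_closed der_iter_closed in auto)
  finally show ?thesis .
 qed
 show ?thesis
 proof (rule exI[of _ f], rule exI[of _ "%x z. T z x"], rule exI[of _ "%x z. f \<otimes> H x z"], intro conjI ballI)
  fix x z assume x: "x : Bs" and z: "z : Bs"
  show "dot Bs (%y. f \<otimes> H x y) (%y. T z y) = (if x = z then f else \<zero>)"
   using x z HT fc Hc Tc X_finite by(subst dot_smult_left) auto
  show "dot Bs (%y. T y x) (%y. f \<otimes> H y z) = (if x = z then f else \<zero>)"
   using x z TH fc Hc Tc X_finite by(subst dot_smult_right) auto
 qed (use f Tc dT in auto)
qed

definition V :: "nat => 'a set"
 where "V d = {dot (lists_of Bs d) l (lprod (%x. x)) | l. ALL xs:lists_of Bs d. l xs : Cst}"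

abbreviation mon where "mon == lprod (%x. x)"

lemma fin_lists: "finite (lists_of Bs d)" by(rule finite_lists_of[OF X_finite])

lemma mon_closed: "xs : lists_of Bs d ==> mon xs : carrier F"
 by(rule lprod_closed'[OF X_closed])

lemma V_closed: "y : V d ==> y : carrier F"
 unfolding V_def using mon_closed CstD by(auto intro!: dot_closed)

lemma V_add:
 assumes "y : V d" "z : V d" shows "y \<oplus> z : V d"
proof -
 obtain l m where l: "ALL xs:lists_of Bs d. l xs : Cst" "y = dot (lists_of Bs d) l mon"
  and m: "ALL xs:lists_of Bs d. m xs : Cst" "z = dot (lists_of Bs d) m mon"
  using assms unfolding V_def by auto
 have "y \<oplus> z = dot (lists_of Bs d) (%xs. l xs \<oplus> m xs) mon"
  unfolding l m by(rule dot_add_left[symmetric])(use l m CstD mon_closed in auto)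
 thus ?thesis unfolding V_def using l m Cst_add by auto
qed

lemma V_smult:
 assumes "y : V d" "c : Cst" shows "c \<otimes> y : V d"
proof -
 obtain l where l: "ALL xs:lists_of Bs d. l xs : Cst" "y = dot (lists_of Bs d) l mon"
  using assms unfolding V_def by auto
 have "c \<otimes> y = dot (lists_of Bs d) (%xs. c \<otimes> l xs) mon"
  unfolding l by(rule dot_smult_left[symmetric])(use l CstD mon_closed assms fin_lists in auto)
 thus ?thesis unfolding V_def using l assms Cst_mult by auto
qed

lemma V_zero: "\<zero> : V d"
proof -
 have "\<zero> = dot (lists_of Bs d) (%_. \<zero>) mon"
  by(rule dot_zero_left[symmetric])(use mon_closed in auto)
 thus ?thesis unfolding V_def using Cst_0 by blast
qed

lemma V_mon:
 assumes "xs : lists_of Bs d" shows "mon xs : V d"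
proof -
 have "dot (lists_of Bs d) (%ys. if ys = xs then \<one> else \<zero>) mon = \<one> \<otimes> mon xs"
  by(rule dot_single_left)(use assms mon_closed fin_lists in auto)
 hence "mon xs = dot (lists_of Bs d) (%ys. if ys = xs then \<one> else \<zero>) mon"
  using mon_closed[OF assms] by simp
 moreover have "ALL ys:lists_of Bs d. (if ys = xs then \<one> else \<zero>) : Cst" by simp
 ultimately show ?thesis unfolding V_def by blast
qed

lemma V_dot:
 assumes "finite I" "!!i. i : I ==> l i \<otimes> y i : V d"
 shows "dot I l y : V d"
 by(rule dot_in_ideal)(use assms V_zero V_add V_closed in auto)

text \<open>A statement about \<open>V d\<close> that is linear over the constants need only be checked on monomials.\<close>

lemma V_linear_induct:
 assumes y: "y : V d" and h: "!!xs. xs : lists_of Bs d ==> z \<otimes> mon xs : V e" and z: "z : carrier F"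
 shows "z \<otimes> y : V e"
proof -
 obtain l where l: "ALL xs:lists_of Bs d. l xs : Cst" "y = dot (lists_of Bs d) l mon"
  using y unfolding V_def by auto
 have "z \<otimes> y = dot (lists_of Bs d) l (%xs. z \<otimes> mon xs)"
  unfolding l
  by(rule dot_smult_right[symmetric])(use l CstD mon_closed z fin_lists in auto)
 also have "... : V e"
  by(rule V_dot)(use fin_lists l h V_smult in auto)
 finally show ?thesis .
qed

lemma V_mult:
 assumes "y : V d" "z : V e" shows "y \<otimes> z : V (d + e)"
proof (rule V_linear_induct[OF assms(2)])
 show "y \<otimes> mon zs : V (d + e)" if zs: "zs : lists_of Bs e" for zs
 proof -
  have "mon zs \<otimes> y : V (d + e)"
  proof (rule V_linear_induct[OF assms(1)])
   fix ys assume ys: "ys : lists_of Bs d"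
   have "mon zs \<otimes> mon ys = mon (ys @ zs)"
    using lprod_append[of Bs "%x. x" ys zs] ys zs X_closed mon_closed[OF ys] mon_closed[OF zs]
    unfolding lists_of_def by(simp add: m_comm)
   moreover have "ys @ zs : lists_of Bs (d + e)" using ys zs unfolding lists_of_def by auto
   ultimately show "mon zs \<otimes> mon ys : V (d + e)" using V_mon by simp
  qed (rule mon_closed[OF zs])
  thus ?thesis using mon_closed[OF zs] V_closed[OF assms(1)] by(simp add: m_comm)
 qed
qed (rule V_closed[OF assms(1)])

lemma V_0: "V 0 = Cst"
proof
 show "V 0 <= Cst" unfolding V_def lists_of_0 dot_def using CstD by(auto simp: r_one)
 show "Cst <= V 0"
 proof
  fix c assume c: "c : Cst"
  thus "c : V 0"
   using V_smult[OF V_mon[of "[]" 0] c] CstD by(simp add: lists_of_0)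
 qed
qed

lemma V_1: "Cspan Bs <= V 1"
proof
 fix y assume "y : Cspan Bs"
 then obtain n where n: "!!x. x : Bs ==> n x : Cst" "y = dot Bs n (%x. x)" by(elim CspanE) blast
 have "x : V 1" if "x : Bs" for x
  using V_mon[of "[x]" 1] that X_closed by(auto simp: lists_of_def)
 thus "y : V 1" unfolding n(2) using X_finite n(1) V_smult by(intro V_dot) auto
qed

lemma one_V: "\<one> : V d"
proof (induction d)
 case 0
 thus ?case by(simp add: V_0)
next
 case (Suc d)
 have "\<one> : V 1" using one_W W_X V_1 by auto
 thus ?case using V_mult[OF Suc, of \<one> 1] by simp
qed

lemma V_der:
 assumes "y : V d" shows "der y : V d"
proof -
 obtain l where l: "ALL xs:lists_of Bs d. l xs : Cst" "y = dot (lists_of Bs d) l mon"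
  using assms unfolding V_def by auto
 have "der y = dot (lists_of Bs d) (%xs. der (l xs)) mon \<oplus> dot (lists_of Bs d) l (%xs. der (mon xs))"
  unfolding l by(rule der_dot)(use l fin_lists CstD mon_closed in auto)
 also have "dot (lists_of Bs d) (%xs. der (l xs)) mon = \<zero>"
  by(rule dot_zero_left)(use l CstD mon_closed in auto)
 finally have e: "der y = dot (lists_of Bs d) l (%xs. der (mon xs))"
  using l CstD mon_closed by(simp add: dot_closed)
 show ?thesis
  unfolding e
 proof (rule V_dot[OF fin_lists])
  fix xs assume xs: "xs : lists_of Bs d"
  have "der (mon xs) = dot (lists_of Bs d) (kron_sum N xs) mon"
   by(rule der_lprod)(use X_finite N_closed X_closed der_X xs in auto)
  moreover have "kron_sum N xs ys : Cst" if "ys : lists_of Bs d" for ys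
   by(rule kron_sum_closed[of Bs N Cst])
     (use xs that N_Cst subfieldE(1)[OF Cst_subfield] in "auto simp: lists_of_def")
  ultimately have "der (mon xs) : V d" unfolding V_def by auto
  thus "l xs \<otimes> der (mon xs) : V d" using V_smult l xs by auto
 qed
qed

definition B :: "'a set" where "B = (\<Union>d. V d)"

lemma V_mono: "y : V d ==> y : V (d + e)"
 using V_mult[OF _ one_V, of y d e] V_closed by simp

lemma B_closed: "y : B ==> y : carrier F" unfolding B_def using V_closed by auto

lemma B_add: "y : B ==> z : B ==> y \<oplus> z : B"
proof -
 assume "y : B" "z : B"
 then obtain d e where "y : V d" "z : V e" unfolding B_def by auto
 hence "y : V (d + e)" "z : V (d + e)" using V_mono V_mono[of z e d] by(auto simp: add.commute)
 thus ?thesis unfolding B_def using V_add by auto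
qed

lemma B_mult: "y : B ==> z : B ==> y \<otimes> z : B"
 unfolding B_def using V_mult by blast

lemma B_Cst: "Cst <= B" unfolding B_def using V_0 by blast

lemma B_minus: "y : B ==> \<ominus> y : B"
 using B_mult[of "\<ominus> \<one>" y] B_Cst Cst_minus[OF Cst_1] B_closed by(auto simp: l_minus)

lemma B_der: "y : B ==> der y : B" unfolding B_def using V_der by auto

lemma B_W: "Cspan W <= B"
proof
 fix y assume "y : Cspan W"
 hence "y : Cspan Bs" using Cspan_trans[OF X_finite _ W_finite W_X] X_closed by auto
 thus "y : B" unfolding B_def using V_1 by auto
qed

definition L :: "'a set"
 where "L = {x : carrier F. EX b:B. b ~= \<zero> & b \<otimes> x : B}"

lemma L_I: "[|x : carrier F; b : B; b ~= \<zero>; b \<otimes> x : B|] ==> x : L"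
 unfolding L_def by auto

lemma B_L: "B <= L"
 using B_closed B_Cst Cst_1 by(auto intro!: L_I[of _ \<one>])

lemma L_E:
 assumes "x : L"
 obtains b where "x : carrier F" "b : B" "b ~= \<zero>" "b \<otimes> x : B" "b : carrier F"
 using assms B_closed unfolding L_def by auto

lemma L_subfield: "subfield L F"
proof (rule field.subfieldI'[OF field_axioms])
 show "subring L F"
 proof (rule subringI)
  show "L <= carrier F" unfolding L_def by auto
  show "\<one> : L" by(rule subsetD[OF B_L subsetD[OF B_Cst Cst_1]])
  show "\<ominus> x : L" if "x : L" for x
   using that by(elim L_E) (rule L_I, auto simp: r_minus B_minus)
  fix x y assume "x : L" "y : L"
  then obtain b c where b: "x : carrier F" "b : B" "b ~= \<zero>" "b \<otimes> x : B" "b : carrier F"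
   and c: "y : carrier F" "c : B" "c ~= \<zero>" "c \<otimes> y : B" "c : carrier F"
   by(elim L_E) blast
  have bc: "b \<otimes> c : B" "b \<otimes> c ~= \<zero>" using b c B_mult integral by auto
  have "(b \<otimes> c) \<otimes> (x \<otimes> y) = (b \<otimes> x) \<otimes> (c \<otimes> y)" using b c by(simp add: m_ac)
  hence "(b \<otimes> c) \<otimes> (x \<otimes> y) : B" using B_mult b c by simp
  thus "x \<otimes> y : L" using L_I bc b c by auto
  have "(b \<otimes> c) \<otimes> (x \<oplus> y) = c \<otimes> (b \<otimes> x) \<oplus> b \<otimes> (c \<otimes> y)"
   using b c by(simp add: m_ac r_distr)
  hence "(b \<otimes> c) \<otimes> (x \<oplus> y) : B" using B_mult B_add b c by simp
  thus "x \<oplus> y : L" using L_I bc b c by auto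
 qed
 fix x assume x: "x : L - {\<zero>}"
 then obtain b where b: "x : carrier F" "b : B" "b ~= \<zero>" "b \<otimes> x : B" "b : carrier F"
  by(auto elim: L_E)
 have "b \<otimes> x \<otimes> inv x = b" using b x by(simp add: m_assoc)
 moreover have "b \<otimes> x ~= \<zero>" using b x integral by auto
 ultimately show "inv x : L" using b x by(intro L_I[of _ "b \<otimes> x"]) auto
qed

lemma L_der:
 assumes "x : L" shows "der x : L"
proof -
 obtain b where b: "x : carrier F" "b : B" "b ~= \<zero>" "b \<otimes> x : B" "b : carrier F"
  using assms by(elim L_E)
 have bb: "b \<otimes> b : B" "b \<otimes> b ~= \<zero>" using b B_mult integral by auto
 have "der (b \<otimes> x) = der b \<otimes> x \<oplus> b \<otimes> der x" using b by(simp add: der_mult)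
 hence "(b \<otimes> b) \<otimes> der x = b \<otimes> der (b \<otimes> x) \<oplus> (\<ominus> (der b \<otimes> (b \<otimes> x)))"
  using b(1,5) der_closed[OF b(1)] der_closed[OF b(5)] by(simp only:) algebra
 hence "(b \<otimes> b) \<otimes> der x : B" using B_mult B_add B_minus B_der b by simp
 thus ?thesis using bb b by(intro L_I[of _ "b \<otimes> b"]) auto
qed

end

section \<open>Differential primes that avoid the denominator of the Wronskian\<close>

locale diff_tower_prime = diff_tower_basis F der A k W Bs N + subring_prime F A Q
 for F (structure) and der (\<open>\<partial>\<close>) and A k W Bs N Q +
 fixes f :: 'a and Y s :: "'a => 'a => 'a"
 assumes der_Q: "x : Q ==> der x : Q"
  and f_A: "f : A" and f_Q: "f ~: Q"
  and Y_closed: "[|x : Bs; z : Bs|] ==> Y x z : carrier F"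
  and s_A: "[|x : Bs; z : Bs|] ==> s x z : A"
  and der_Y: "[|x : Bs; z : Bs|] ==> der (Y x z) = dot Bs (N x) (%y. Y y z)"
  and s_Y: "[|x : Bs; z : Bs|] ==> dot Bs (s x) (%y. Y y z) = (if x = z then f else \<zero>)"
  and Y_s: "[|x : Bs; z : Bs|] ==> dot Bs (Y x) (%y. s y z) = (if x = z then f else \<zero>)"
begin

abbreviation E where "E == extension Cst"

lemma Cst_carrier: "Cst <= carrier F" using CstD by auto

lemma Cst_subring: "subring Cst F" using subfieldE(1)[OF Cst_subfield] .

lemma E_contracts: "b : E ==> b : A ==> b : Q"
 using extension_contracts[OF k_subfield k_A Cst_carrier Cst_algebraic] by blast

lemma E_der: "x : E ==> der x : E"
proof (induction rule: extension.induct)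
 case zero
 thus ?case by(simp add: extension.zero)
next
 case (step q c x)
 have c: "q : carrier F" "c : carrier F" "der c = \<zero>" "x : carrier F"
  using step Q_closed CstD extension_closed[OF Cst_carrier] by auto
 have "der (q \<otimes> c \<oplus> x) = der q \<otimes> c \<oplus> der x"
  using c by(simp add: der_add der_mult)
 thus ?case using step der_Q by(auto intro!: extension.step)
qed

lemma f_pow_E: "f [^] (d::nat) ~: E"
proof
 assume "f [^] d : E"
 moreover have A: "f [^] (n::nat) : A" for n
  using f_A A_ring(3,6) by(induction n) auto
 ultimately have "f [^] d : Q" using E_contracts by auto
 thus False
 proof (induction d)
  case 0
  thus ?case using one_Q by simp
 next
  case (Suc d)
  thus ?case using prime_Q[OF A[of d] f_A] f_Q by auto
 qed
qed

text \<open>Over the field of constants, \<open>kron Y\<close> is a fundamental matrix for the monomials in the basis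
  \<open>Bs\<close>.\<close>

lemma V_E: 
 assumes "q : V d" "q : E"
 shows "q = \<zero>"
proof -
 let ?I = "lists_of Bs d"
 have sc: "[|x : Bs; z : Bs|] ==> s x z : carrier F" for x z using s_A A_closed by auto
 have fc: "f : carrier F" using f_A A_closed by auto
 interpret fs: fundamental_system F der ?I Cst E "f [^] d" mon "kron Y" "kron s" "kron_sum N"
 proof (intro fundamental_system.intro fundamental_system_axioms.intro diff_field_axioms)
  show "finite ?I" by(rule fin_lists)
  show "subfield Cst F" by(rule Cst_subfield)
  show "x : Cst ==> der x : Cst" for x using CstD by simp
  show "E <= carrier F" using extension_closed[OF Cst_carrier] by auto
  show "\<zero> : E" by(rule extension.zero)
  show "[|x : E; y : E|] ==> x \<oplus> y : E" for x y using extension_add[OF Cst_carrier] by auto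
  show "[|c : Cst; y : E|] ==> c \<otimes> y : E" for c y using extension_mult_S[OF Cst_subring] by auto
  show "y : E ==> der y : E" for y by(rule E_der)
  show "kron s i j \<otimes> y : E" if "i : ?I" "j : ?I" "y : E" for i j y
  proof -
   have "kron s i j : A"
    by(rule kron_closed[of Bs s A])(use that s_A A_subring in "auto simp: lists_of_def")
   thus ?thesis using extension_mult_A[OF Cst_carrier] that by auto
  qed
  show "f [^] d : carrier F" using fc by auto
  show "f [^] d ~: E" by(rule f_pow_E)
  show "i : ?I ==> mon i : carrier F" for i by(rule mon_closed)
  show "[|i : ?I; j : ?I|] ==> kron Y i j : carrier F" for i j by(rule kron_closed'[OF Y_closed])
  show "[|i : ?I; j : ?I|] ==> kron s i j : carrier F" for i j by(rule kron_closed'[OF sc])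
  show "kron_sum N i j : Cst" if "i : ?I" "j : ?I" for i j
   by(rule kron_sum_closed[of Bs N Cst])
     (use that N_Cst Cst_subring in "auto simp: lists_of_def")
  show "i : ?I ==> der (mon i) = dot ?I (kron_sum N i) mon" for i
   by(rule der_lprod)(use X_finite N_closed X_closed der_X in auto)
  show "[|i : ?I; j : ?I|] ==> der (kron Y i j) = dot ?I (kron_sum N i) (%k. kron Y k j)" for i j
   by(rule der_kron)(use X_finite N_closed Y_closed der_Y in auto)
  show "dot ?I (kron s i) (%k. kron Y k j) = (if i = j then f [^] d else \<zero>)"
   if "i : ?I" "j : ?I" for i j
   using that kron_mult[OF X_finite sc Y_closed that] kron_scalar[OF fc that, of "%x z. dot Bs (s x) (%y. Y y z)"]
    s_Y by simp
  show "dot ?I (kron Y i) (%k. kron s k j) = (if i = j then f [^] d else \<zero>)"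
   if "i : ?I" "j : ?I" for i j
   using that kron_mult[OF X_finite Y_closed sc that] kron_scalar[OF fc that, of "%x z. dot Bs (Y x) (%y. s y z)"]
    Y_s by simp
 qed auto
 obtain l where l: "ALL xs:?I. l xs : Cst" "q = dot ?I l mon"
  using assms(1) unfolding V_def by auto
 thus ?thesis using fs.relation_zero[of l] assms(2) by auto
qed

lemma B_mult_E:
 assumes "b : B" "y : E" shows "b \<otimes> y : E"
proof -
 obtain d l where l: "ALL xs:lists_of Bs d. l xs : Cst" "b = dot (lists_of Bs d) l mon"
  using assms(1) unfolding B_def V_def by auto
 have yc: "y : carrier F" using assms extension_closed[OF Cst_carrier] by auto
 have monA: "mon xs : A" if "xs : lists_of Bs d" for xs
  by(rule lprod_closed[of Bs _ A])(use that X_A A_subring in "auto simp: lists_of_def")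
 have "y \<otimes> b = dot (lists_of Bs d) l (%xs. y \<otimes> mon xs)"
  unfolding l by(rule dot_smult_right[symmetric])(use l CstD mon_closed yc fin_lists in auto)
 also have "... : E"
 proof (rule dot_in_ideal[OF fin_lists])
  fix xs assume xs: "xs : lists_of Bs d"
  have "mon xs \<otimes> y : E" using extension_mult_A[OF Cst_carrier monA[OF xs]] assms by auto
  thus "l xs \<otimes> (y \<otimes> mon xs) : E"
   using extension_mult_S[OF Cst_subring] l xs yc mon_closed[OF xs] by(simp add: m_comm)
 qed (use extension.zero extension_closed[OF Cst_carrier] extension_add[OF Cst_carrier] in auto)
 finally show ?thesis using yc B_closed[OF assms(1)] by(simp add: m_comm)
qed

definition J :: "'a set" where "J = {x : carrier F. EX b:B. b ~= \<zero> & b \<otimes> x : E}"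

lemma J_I: "[|x : carrier F; b : B; b ~= \<zero>; b \<otimes> x : E|] ==> x : J"
 unfolding J_def by auto

lemma J_E:
 assumes "x : J"
 obtains b where "x : carrier F" "b : B" "b ~= \<zero>" "b \<otimes> x : E" "b : carrier F"
 using assms B_closed unfolding J_def by auto

lemma E_add: "[|x : E; y : E|] ==> x \<oplus> y : E" using extension_add[OF Cst_carrier] by auto

text \<open>An element of \<open>Q\<close> is a combination with constant coefficients of solutions of a linear system over \<open>L\<close>,
  so it vanishes as soon as the ideal that \<open>Q\<close> generates over \<open>L\<close> is proper, which is the content of \<open>V_E\<close>.\<close>

theorem Q_trivial:
 assumes q: "q : Q"
 shows "q = \<zero>"
proof -
 have qA: "q : A" using q Q_A by auto
 from system[OF qA] obtain I :: "nat set" and l v g t u where I: "finite I"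
  and lv: "ALL i:I. l i : Cst & v i : A & der (v i) = dot I (u i) v" and qlv: "q = dot I l v"
  and gtu: "ALL i:I. ALL j:I. g i j : A & t i j : A & u i j : carrier F &
    (EX w:Cspan W. w ~= \<zero> & w \<otimes> u i j : Cspan W) &
    der (g i j) = dot I (u i) (%k. g k j) &
    dot I (t i) (%k. g k j) = (if i = j then \<one> else \<zero>) &
    dot I (g i) (%k. t k j) = (if i = j then \<one> else \<zero>)"
  by(elim exE conjE) (rule that)
 interpret fs: fundamental_system F der I L J \<one> v g t u
 proof (intro fundamental_system.intro fundamental_system_axioms.intro diff_field_axioms)
  show "subfield L F" by(rule L_subfield)
  show "Cst <= L" using B_Cst B_L by auto
  show "x : L ==> der x : L" for x by(rule L_der)
  show "J <= carrier F" unfolding J_def by auto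
  show "\<zero> : J" using B_Cst Cst_1 by(intro J_I[of _ \<one>]) (auto simp: extension.zero)
  show "x \<oplus> y : J" if xy: "x : J" "y : J" for x y
  proof -
   obtain b c where b: "x : carrier F" "b : B" "b ~= \<zero>" "b \<otimes> x : E" "b : carrier F"
    and c: "y : carrier F" "c : B" "c ~= \<zero>" "c \<otimes> y : E" "c : carrier F"
    using xy by(elim J_E) blast
   have bc: "b \<otimes> c : B" "b \<otimes> c ~= \<zero>" using b c B_mult integral by auto
   have "(b \<otimes> c) \<otimes> (x \<oplus> y) = c \<otimes> (b \<otimes> x) \<oplus> b \<otimes> (c \<otimes> y)"
    using b c by(simp add: m_ac r_distr)
   hence "(b \<otimes> c) \<otimes> (x \<oplus> y) : E" using B_mult_E E_add b c by simp
   thus ?thesis using J_I bc b c by auto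
  qed
  show "c \<otimes> y : J" if cy: "c : L" "y : J" for c y
  proof -
   obtain b where b: "y : carrier F" "b : B" "b ~= \<zero>" "b \<otimes> y : E" "b : carrier F"
    using cy by(elim J_E)
   obtain b' where b': "c : carrier F" "b' : B" "b' ~= \<zero>" "b' \<otimes> c : B" "b' : carrier F"
    using cy by(elim L_E)
   have bc: "b' \<otimes> b : B" "b' \<otimes> b ~= \<zero>" using b b' B_mult integral by auto
   have "(b' \<otimes> b) \<otimes> (c \<otimes> y) = (b' \<otimes> c) \<otimes> (b \<otimes> y)" using b b' by(simp add: m_ac)
   hence "(b' \<otimes> b) \<otimes> (c \<otimes> y) : E" using B_mult_E b b' by simp
   thus ?thesis using J_I bc b b' by auto
  qed
  show "der y : J" if cy: "y : J" for y
  proof -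
   obtain b where b: "y : carrier F" "b : B" "b ~= \<zero>" "b \<otimes> y : E" "b : carrier F"
    using cy by(elim J_E)
   have bb: "b \<otimes> b : B" "b \<otimes> b ~= \<zero>" using b B_mult integral by auto
   have "der (b \<otimes> y) = der b \<otimes> y \<oplus> b \<otimes> der y" using b by(simp add: der_mult)
   hence "(b \<otimes> b) \<otimes> der y = b \<otimes> der (b \<otimes> y) \<oplus> ((\<ominus> der b) \<otimes> (b \<otimes> y))"
    using b(1,5) der_closed[OF b(1)] der_closed[OF b(5)] by(simp only:) algebra
   hence "(b \<otimes> b) \<otimes> der y : E" using B_mult_E E_add B_minus B_der E_der b by simp
   thus ?thesis using bb b by(intro J_I[of _ "b \<otimes> b"]) auto
  qed
  show "t i j \<otimes> y : J" if i: "i : I" "j : I" and cy: "y : J" for i j y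
  proof -
   obtain b where b: "y : carrier F" "b : B" "b ~= \<zero>" "b \<otimes> y : E" "b : carrier F"
    using cy by(elim J_E)
   have tA: "t i j : A" using gtu i by auto
   have "b \<otimes> (t i j \<otimes> y) = t i j \<otimes> (b \<otimes> y)" using b A_closed[OF tA] by(simp add: m_ac)
   hence "b \<otimes> (t i j \<otimes> y) : E" using extension_mult_A[OF Cst_carrier tA] b by simp
   thus ?thesis using b A_closed[OF tA] by(intro J_I[of _ b]) auto
  qed
  show "\<one> ~: J"
  proof
   assume "\<one> : J"
   then obtain b where "b : B" "b ~= \<zero>" "b : E" by(elim J_E) auto
   thus False unfolding B_def using V_E by auto
  qed
  show "u i j : L" if ij: "i : I" "j : I" for i j
  proof -
   obtain w where "w : Cspan W" "w ~= \<zero>" "w \<otimes> u i j : Cspan W" "u i j : carrier F"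
    using gtu ij by blast
   thus ?thesis using B_W by(intro L_I[of _ w]) auto
  qed
 qed (use I lv gtu A_closed in "simp_all")
 have "q : J"
  using extension_incl[of Cst q] q Cst_1 B_Cst Q_closed[OF q]
  by(intro J_I[of _ \<one>]) auto
 thus ?thesis using fs.relation_zero[of l] lv unfolding qlv by auto
qed

end

context diff_tower
begin

theorem generic_point_locally_closed:
 "EX f:A. f ~= \<zero> & (ALL Q. subring_prime F A Q --> (ALL x:Q. der x : Q) --> f ~: Q --> Q = {\<zero>})"
proof -
 have Wc: "W <= carrier F" using W_A A_closed by auto
 obtain Bs where Bs: "Bs <= W" "W <= Cspan Bs"
  "ALL c. (ALL x:Bs. c x : Cst) --> dot Bs c (%x. x) = \<zero> --> (ALL x:Bs. c x = \<zero>)"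
  using exists_Cst_basis[OF W_finite Wc] by blast
 have fX: "finite Bs" "Bs <= carrier F" using Bs W_finite Wc finite_subset by auto
 have "ALL x:Bs. EX n. (ALL y:Bs. n y : Cst) & der x = dot Bs n (%x. x)"
 proof
  fix x assume "x : Bs"
  hence "der x : Cspan Bs" using der_W Bs Cspan_trans[OF fX W_finite Bs(2)] by auto
  thus "EX n. (ALL y:Bs. n y : Cst) & der x = dot Bs n (%x. x)" unfolding Cspan_def by auto
 qed
 from bchoice[OF this] obtain N
  where N: "ALL x:Bs. (ALL y:Bs. N x y : Cst) & der x = dot Bs (N x) (%x. x)" ..
 interpret b: diff_tower_basis F der A k W Bs N
  by unfold_locales (use Bs N in auto)
 obtain f Y s where f: "f : A" "f ~= \<zero>"
  and Ys: "ALL x:Bs. ALL z:Bs. Y x z : carrier F & s x z : A &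
   der (Y x z) = dot Bs (N x) (%y. Y y z) &
   dot Bs (s x) (%y. Y y z) = (if x = z then f else \<zero>) &
   dot Bs (Y x) (%y. s y z) = (if x = z then f else \<zero>)"
  using b.exists_fundamental_matrix by(elim exE conjE) (rule that)
 have "Q = {\<zero>}" if "subring_prime F A Q" "ALL x:Q. der x : Q" "f ~: Q" for Q
 proof -
  interpret sp: subring_prime F A Q by fact
  interpret dp: diff_tower_prime F der A k W Bs N Q f Y s
  proof unfold_locales
   show "x : Q ==> der x : Q" for x using that(2) by blast
   show "f : A" "f ~: Q" by fact+
  qed (use Ys in blast)+
  show ?thesis using dp.Q_trivial sp.zero_Q by blast
 qed
 thus ?thesis using f by blast
qed

end

section \<open>Fraction fields\<close>

lemma UN_constant_on:
 assumes "x : A" "!!x. x : A ==> f x = S"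
 shows "(\<Union>x\<in>A. f x) = S"
 using assms by auto

context domain
begin

abbreviation nz where "nz == carrier R - {\<zero>}"

abbreviation Fr where "Fr == fraction_field R"

lemma cancel_right:
 assumes "x : carrier R" "y : carrier R" "z : nz" "x \<otimes> z = y \<otimes> z"
 shows "x = y"
 using assms m_rcancel by auto

lemma fraction_iff:
 assumes "a : carrier R" "b : nz"
 shows "(c, d) : fraction R a b \<longleftrightarrow> c : carrier R & d : nz & a \<otimes> d = c \<otimes> b"
 using assms unfolding fraction_def frac_rel_def by auto

lemma fraction_self: "[|a : carrier R; b : nz|] ==> (a, b) : fraction R a b"
 by(simp add: fraction_iff)

lemma fraction_eqI:
 assumes "a : carrier R" "b : nz" "c : carrier R" "d : nz" "a \<otimes> d = c \<otimes> b"
 shows "fraction R a b = fraction R c d"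
proof -
 have *: "fraction R a b <= fraction R c d"
  if h: "a : carrier R" "b : nz" "c : carrier R" "d : nz" "a \<otimes> d = c \<otimes> b" for a b c d
 proof
  fix p assume p: "p : fraction R a b"
  obtain x y where xy: "p = (x, y)" by(cases p)
  hence x: "x : carrier R" "y : nz" "a \<otimes> y = x \<otimes> b" using p fraction_iff[OF h(1,2)] by auto
  have cl: "a : carrier R" "b : carrier R" "c : carrier R" "d : carrier R"
   "x : carrier R" "y : carrier R" using h x by auto
  have "(c \<otimes> y) \<otimes> b = (c \<otimes> b) \<otimes> y" using cl by(simp add: m_ac)
  also have "... = (a \<otimes> y) \<otimes> d" unfolding h(5)[symmetric] using cl by(simp add: m_ac)
  also have "... = (x \<otimes> d) \<otimes> b" unfolding x(3) using cl by(simp add: m_ac)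
  finally have "c \<otimes> y = x \<otimes> d" using cancel_right[of "c \<otimes> y" "x \<otimes> d" b] h x by simp
  thus "p : fraction R c d" unfolding xy using fraction_iff[OF h(3,4)] x by auto
 qed
 show ?thesis using *[OF assms] *[OF assms(3,4,1,2) assms(5)[symmetric]] by auto
qed

lemma fraction_eq_iff:
 assumes "a : carrier R" "b : nz" "c : carrier R" "d : nz"
 shows "fraction R a b = fraction R c d \<longleftrightarrow> a \<otimes> d = c \<otimes> b"
 using fraction_eqI[OF assms] fraction_self[OF assms(3,4)] fraction_iff[OF assms(1,2), of c d] by auto

lemma carrier_Fr: "carrier Fr = {fraction R a b | a b. a : carrier R & b : nz}"
 unfolding fraction_field_def quotient_def fraction_def by auto

lemma Fr_E:
 assumes "x : carrier Fr"
 obtains a b where "a : carrier R" "b : nz" "x = fraction R a b"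
 using assms unfolding carrier_Fr by auto

lemma Fr_I: "[|a : carrier R; b : nz|] ==> fraction R a b : carrier Fr"
 unfolding carrier_Fr by auto

lemma nz_mult: "[|b : nz; d : nz|] ==> b \<otimes> d : nz"
 using integral by auto

lemma Fr_mult:
 assumes a: "a : carrier R" "b : nz" and c: "c : carrier R" "d : nz"
 shows "fraction R a b \<otimes>\<^bsub>Fr\<^esub> fraction R c d = fraction R (a \<otimes> c) (b \<otimes> d)"
proof -
 have eq: "fraction R (fst p \<otimes> fst q) (snd p \<otimes> snd q) = fraction R (a \<otimes> c) (b \<otimes> d)"
  if pq: "p : fraction R a b" "q : fraction R c d" for p q
 proof -
  obtain x y z w where [simp]: "p = (x, y)" "q = (z, w)" by(cases p, cases q)
  have x: "x : carrier R" "y : nz" "a \<otimes> y = x \<otimes> b" and z: "z : carrier R" "w : nz" "c \<otimes> w = z \<otimes> d"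
   using pq a c by(auto simp: fraction_iff)
  have cl: "a : carrier R" "b : carrier R" "c : carrier R" "d : carrier R"
   "x : carrier R" "y : carrier R" "z : carrier R" "w : carrier R" using a c x z by auto
  have "(x \<otimes> z) \<otimes> (b \<otimes> d) = (x \<otimes> b) \<otimes> (z \<otimes> d)" using cl by(simp add: m_ac)
  also have "... = (a \<otimes> c) \<otimes> (y \<otimes> w)"
   unfolding x(3)[symmetric] z(3)[symmetric] using cl by(simp add: m_ac)
  finally show ?thesis using a c x z nz_mult by(intro fraction_eqI) auto
 qed
 have "fraction R a b \<otimes>\<^bsub>Fr\<^esub> fraction R c d = (\<Union>p\<in>fraction R a b. \<Union>q\<in>fraction R c d.
   fraction R (fst p \<otimes> fst q) (snd p \<otimes> snd q))"
  unfolding fraction_field_def by(simp add: case_prod_beta)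
 also have "... = fraction R (a \<otimes> c) (b \<otimes> d)"
  by(intro UN_constant_on[OF fraction_self[OF a]] UN_constant_on[OF fraction_self[OF c]] eq)
 finally show ?thesis .
qed

lemma Fr_add:
 assumes a: "a : carrier R" "b : nz" and c: "c : carrier R" "d : nz"
 shows "fraction R a b \<oplus>\<^bsub>Fr\<^esub> fraction R c d = fraction R (a \<otimes> d \<oplus> c \<otimes> b) (b \<otimes> d)"
proof -
 have eq: "fraction R (fst p \<otimes> snd q \<oplus> fst q \<otimes> snd p) (snd p \<otimes> snd q)
   = fraction R (a \<otimes> d \<oplus> c \<otimes> b) (b \<otimes> d)"
  if pq: "p : fraction R a b" "q : fraction R c d" for p q
 proof -
  obtain x y z w where [simp]: "p = (x, y)" "q = (z, w)" by(cases p, cases q)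
  have x: "x : carrier R" "y : nz" "a \<otimes> y = x \<otimes> b" and z: "z : carrier R" "w : nz" "c \<otimes> w = z \<otimes> d"
   using pq a c by(auto simp: fraction_iff)
  have cl: "a : carrier R" "b : carrier R" "c : carrier R" "d : carrier R"
   "x : carrier R" "y : carrier R" "z : carrier R" "w : carrier R" using a c x z by auto
  have "(x \<otimes> w \<oplus> z \<otimes> y) \<otimes> (b \<otimes> d) = (x \<otimes> b) \<otimes> (w \<otimes> d) \<oplus> (z \<otimes> d) \<otimes> (y \<otimes> b)"
   using cl by algebra
  also have "... = (a \<otimes> d \<oplus> c \<otimes> b) \<otimes> (y \<otimes> w)"
   unfolding x(3)[symmetric] z(3)[symmetric] using cl by algebra
  finally show ?thesis using a c x z nz_mult by(intro fraction_eqI) auto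
 qed
 have "fraction R a b \<oplus>\<^bsub>Fr\<^esub> fraction R c d = (\<Union>p\<in>fraction R a b. \<Union>q\<in>fraction R c d.
   fraction R (fst p \<otimes> snd q \<oplus> fst q \<otimes> snd p) (snd p \<otimes> snd q))"
  unfolding fraction_field_def by(simp add: case_prod_beta)
 also have "... = fraction R (a \<otimes> d \<oplus> c \<otimes> b) (b \<otimes> d)"
  by(intro UN_constant_on[OF fraction_self[OF a]] UN_constant_on[OF fraction_self[OF c]] eq)
 finally show ?thesis .
qed

lemma Fr_one: "\<one>\<^bsub>Fr\<^esub> = fraction R \<one> \<one>" and Fr_zero: "\<zero>\<^bsub>Fr\<^esub> = fraction R \<zero> \<one>"
 unfolding fraction_field_def by auto

lemma one_nz: "\<one> : nz" by auto

lemma Fr_zero_iff: "[|a : carrier R; b : nz|] ==> fraction R a b = \<zero>\<^bsub>Fr\<^esub> \<longleftrightarrow> a = \<zero>"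
 unfolding Fr_zero using one_nz by(subst fraction_eq_iff) auto

lemma fraction_zero: "b : nz ==> fraction R \<zero> b = \<zero>\<^bsub>Fr\<^esub>"
 by(simp add: Fr_zero_iff)

lemma Fr_field: "field Fr"
proof -
 have cr: "cring Fr"
 proof (rule cringI)
  show "abelian_group Fr"
  proof (rule abelian_groupI)
   fix x y assume "x : carrier Fr" "y : carrier Fr"
   then obtain a b c d where [simp]: "x = fraction R a b" "y = fraction R c d"
    and a: "a : carrier R" "b : nz" and c: "c : carrier R" "d : nz" by(elim Fr_E) blast
   show "x \<oplus>\<^bsub>Fr\<^esub> y : carrier Fr"
    using a c nz_mult by(auto simp: Fr_add intro!: Fr_I)
   show "x \<oplus>\<^bsub>Fr\<^esub> y = y \<oplus>\<^bsub>Fr\<^esub> x"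
    using a c by(simp add: Fr_add a_comm m_comm)
   fix z assume "z : carrier Fr"
   then obtain e f where [simp]: "z = fraction R e f" and e: "e : carrier R" "f : nz" by(elim Fr_E) blast
   show "x \<oplus>\<^bsub>Fr\<^esub> y \<oplus>\<^bsub>Fr\<^esub> z = x \<oplus>\<^bsub>Fr\<^esub> (y \<oplus>\<^bsub>Fr\<^esub> z)"
   proof -
    have cl: "b : carrier R" "d : carrier R" "f : carrier R" using a c e by auto
    have "(a \<otimes> d \<oplus> c \<otimes> b) \<otimes> f \<oplus> e \<otimes> (b \<otimes> d) = a \<otimes> (d \<otimes> f) \<oplus> (c \<otimes> f \<oplus> e \<otimes> d) \<otimes> b"
     "b \<otimes> d \<otimes> f = b \<otimes> (d \<otimes> f)"
     using cl a(1) c(1) e(1) by algebra+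
    thus ?thesis
     using a c e nz_mult[OF a(2) c(2)] nz_mult[OF c(2) e(2)] by(simp add: Fr_add)
   qed
  next
   show "\<zero>\<^bsub>Fr\<^esub> : carrier Fr" unfolding Fr_zero using Fr_I one_nz by auto
   fix x assume "x : carrier Fr"
   then obtain a b where [simp]: "x = fraction R a b" and a: "a : carrier R" "b : nz" by(elim Fr_E) blast
   show "\<zero>\<^bsub>Fr\<^esub> \<oplus>\<^bsub>Fr\<^esub> x = x"
    unfolding Fr_zero using a one_nz by(simp add: Fr_add)
   show "EX y:carrier Fr. y \<oplus>\<^bsub>Fr\<^esub> x = \<zero>\<^bsub>Fr\<^esub>"
    using a nz_mult[OF a(2,2)]
    by(intro bexI[of _ "fraction R (\<ominus> a) b"] Fr_I) (auto simp: Fr_add l_minus l_neg fraction_zero)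
  qed
  show "comm_monoid Fr"
  proof (rule comm_monoidI)
   fix x y assume "x : carrier Fr" "y : carrier Fr"
   then obtain a b c d where [simp]: "x = fraction R a b" "y = fraction R c d"
    and a: "a : carrier R" "b : nz" and c: "c : carrier R" "d : nz" by(elim Fr_E) blast
   show "x \<otimes>\<^bsub>Fr\<^esub> y : carrier Fr"
    using a c nz_mult by(auto simp: Fr_mult intro!: Fr_I)
   show "x \<otimes>\<^bsub>Fr\<^esub> y = y \<otimes>\<^bsub>Fr\<^esub> x"
    using a c by(simp add: Fr_mult m_comm)
   fix z assume "z : carrier Fr"
   then obtain e f where [simp]: "z = fraction R e f" and e: "e : carrier R" "f : nz" by(elim Fr_E) blast
   show "x \<otimes>\<^bsub>Fr\<^esub> y \<otimes>\<^bsub>Fr\<^esub> z = x \<otimes>\<^bsub>Fr\<^esub> (y \<otimes>\<^bsub>Fr\<^esub> z)"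
    using a c e nz_mult[OF a(2) c(2)] nz_mult[OF c(2) e(2)] by(simp add: Fr_mult m_assoc)
  next
   show "\<one>\<^bsub>Fr\<^esub> : carrier Fr" unfolding Fr_one using Fr_I one_nz by auto
   fix x assume "x : carrier Fr"
   then obtain a b where [simp]: "x = fraction R a b" and a: "a : carrier R" "b : nz" by(elim Fr_E) blast
   show "\<one>\<^bsub>Fr\<^esub> \<otimes>\<^bsub>Fr\<^esub> x = x"
    unfolding Fr_one using a one_nz by(simp add: Fr_mult)
  qed
  fix x y z assume "x : carrier Fr" "y : carrier Fr" "z : carrier Fr"
  then obtain a b c d e f where [simp]: "x = fraction R a b" "y = fraction R c d" "z = fraction R e f"
   and a: "a : carrier R" "b : nz" and c: "c : carrier R" "d : nz"
   and e: "e : carrier R" "f : nz" by(elim Fr_E) blast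
  note n = nz_mult[OF a(2) c(2)] nz_mult[OF c(2) e(2)] nz_mult[OF a(2) e(2)]
  have "fraction R ((a \<otimes> d \<oplus> c \<otimes> b) \<otimes> e) (b \<otimes> d \<otimes> f)
    = fraction R (a \<otimes> e \<otimes> (d \<otimes> f) \<oplus> c \<otimes> e \<otimes> (b \<otimes> f)) (b \<otimes> f \<otimes> (d \<otimes> f))"
  proof (rule fraction_eqI)
   show "b \<otimes> d \<otimes> f : nz" "b \<otimes> f \<otimes> (d \<otimes> f) : nz"
    using nz_mult n e by auto
   show "(a \<otimes> d \<oplus> c \<otimes> b) \<otimes> e \<otimes> (b \<otimes> f \<otimes> (d \<otimes> f))
     = (a \<otimes> e \<otimes> (d \<otimes> f) \<oplus> c \<otimes> e \<otimes> (b \<otimes> f)) \<otimes> (b \<otimes> d \<otimes> f)"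
   proof -
    have cl: "b : carrier R" "d : carrier R" "f : carrier R" using a c e by auto
    show ?thesis using cl a(1) c(1) e(1) by algebra
   qed
  qed (use a c e in auto)
  thus "(x \<oplus>\<^bsub>Fr\<^esub> y) \<otimes>\<^bsub>Fr\<^esub> z = x \<otimes>\<^bsub>Fr\<^esub> z \<oplus>\<^bsub>Fr\<^esub> y \<otimes>\<^bsub>Fr\<^esub> z"
   using a c e n by(simp add: Fr_add Fr_mult)
 qed
 show ?thesis
 proof (rule cring.cring_fieldI2[OF cr])
  show "\<zero>\<^bsub>Fr\<^esub> ~= \<one>\<^bsub>Fr\<^esub>"
   using Fr_zero_iff[of \<one> \<one>] one_nz unfolding Fr_one by auto
  fix x assume "x : carrier Fr" and x0: "x ~= \<zero>\<^bsub>Fr\<^esub>"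
  then obtain a b where [simp]: "x = fraction R a b" and a: "a : carrier R" "b : nz" by(elim Fr_E) blast
  have a0: "a : nz" using x0 a by(auto simp: Fr_zero_iff)
  have "fraction R (a \<otimes> b) (b \<otimes> a) = fraction R \<one> \<one>"
   using a a0 nz_mult[OF a(2) a0] one_nz by(intro fraction_eqI) (auto simp: m_comm)
  thus "EX y:carrier Fr. x \<otimes>\<^bsub>Fr\<^esub> y = \<one>\<^bsub>Fr\<^esub>"
   using a a0 unfolding Fr_one by(intro bexI[of _ "fraction R b a"] Fr_I) (auto simp: Fr_mult)
 qed
qed

definition emb :: "'a => ('a \<times> 'a) set" where "emb a = fraction R a \<one>"

lemma emb_closed: "a : carrier R ==> emb a : carrier Fr"
 unfolding emb_def using Fr_I one_nz by auto

lemma emb_mult: "[|a : carrier R; b : carrier R|] ==> emb (a \<otimes> b) = emb a \<otimes>\<^bsub>Fr\<^esub> emb b"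
 unfolding emb_def using one_nz by(simp add: Fr_mult)

lemma emb_add: "[|a : carrier R; b : carrier R|] ==> emb (a \<oplus> b) = emb a \<oplus>\<^bsub>Fr\<^esub> emb b"
 unfolding emb_def using one_nz by(simp add: Fr_add)

lemma emb_one: "emb \<one> = \<one>\<^bsub>Fr\<^esub>" unfolding emb_def Fr_one by simp

lemma emb_hom: "emb : ring_hom R Fr"
 by(rule ring_hom_memI) (auto simp: emb_closed emb_mult emb_add emb_one)

lemma emb_zero_iff: "a : carrier R ==> emb a = \<zero>\<^bsub>Fr\<^esub> \<longleftrightarrow> a = \<zero>"
 unfolding emb_def using Fr_zero_iff one_nz by auto

lemma emb_denominator: "[|a : carrier R; b : nz|] ==> emb b \<otimes>\<^bsub>Fr\<^esub> fraction R a b = emb a"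
 unfolding emb_def using one_nz nz_mult
 by(simp add: Fr_mult) (rule fraction_eqI, auto simp: m_comm)

lemma Fr_denominator:
 assumes "x : carrier Fr"
 obtains a b where "a : carrier R" "b : carrier R" "b ~= \<zero>" "emb b \<otimes>\<^bsub>Fr\<^esub> x = emb a"
 using assms by(elim Fr_E) (auto simp: emb_denominator)

end

locale diff_domain = domain R for R (structure) +
 fixes \<delta> :: "'a => 'a"
 assumes d_closed: "x : carrier R ==> \<delta> x : carrier R"
  and d_add: "[|x : carrier R; y : carrier R|] ==> \<delta> (x \<oplus> y) = \<delta> x \<oplus> \<delta> y"
  and d_mult: "[|x : carrier R; y : carrier R|] ==> \<delta> (x \<otimes> y) = \<delta> x \<otimes> y \<oplus> x \<otimes> \<delta> y"
begin

abbreviation D where "D == frac_derivation R \<delta>"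

lemma quotient_rule_wd:
 assumes a: "a : carrier R" "b : nz" and c: "c : carrier R" "d : nz" and e: "a \<otimes> d = c \<otimes> b"
 shows "(\<delta> c \<otimes> d \<ominus> c \<otimes> \<delta> d) \<otimes> (b \<otimes> b) = (\<delta> a \<otimes> b \<ominus> a \<otimes> \<delta> b) \<otimes> (d \<otimes> d)"
proof -
 note cl = a(1) c(1) d_closed[OF a(1)] d_closed[OF c(1)] 
 have bd: "b : carrier R" "d : carrier R" "\<delta> b : carrier R" "\<delta> d : carrier R"
  using a c d_closed by auto
 have e': "\<delta> a \<otimes> d \<oplus> a \<otimes> \<delta> d = \<delta> c \<otimes> b \<oplus> c \<otimes> \<delta> b"
  using d_mult[of a d] d_mult[of c b] e cl bd by simp
 have "(\<delta> c \<otimes> d \<ominus> c \<otimes> \<delta> d) \<otimes> (b \<otimes> b)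
   = (\<delta> c \<otimes> b \<oplus> c \<otimes> \<delta> b) \<otimes> (b \<otimes> d) \<ominus> (c \<otimes> b) \<otimes> (\<delta> b \<otimes> d \<oplus> b \<otimes> \<delta> d)"
  using cl bd by algebra
 also have "... = (\<delta> a \<otimes> d \<oplus> a \<otimes> \<delta> d) \<otimes> (b \<otimes> d) \<ominus> (a \<otimes> d) \<otimes> (\<delta> b \<otimes> d \<oplus> b \<otimes> \<delta> d)"
  by(simp only: e' e)
 also have "... = (\<delta> a \<otimes> b \<ominus> a \<otimes> \<delta> b) \<otimes> (d \<otimes> d)"
  using cl bd by algebra
 finally show ?thesis .
qed

lemma D_fraction:
 assumes a: "a : carrier R" "b : nz"
 shows "D (fraction R a b) = fraction R (\<delta> a \<otimes> b \<ominus> a \<otimes> \<delta> b) (b \<otimes> b)"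
proof -
 have eq: "fraction R (\<delta> (fst p) \<otimes> snd p \<ominus> fst p \<otimes> \<delta> (snd p)) (snd p \<otimes> snd p)
   = fraction R (\<delta> a \<otimes> b \<ominus> a \<otimes> \<delta> b) (b \<otimes> b)"
  if p: "p : fraction R a b" for p
 proof -
  obtain x y where [simp]: "p = (x, y)" by(cases p)
  have x: "x : carrier R" "y : nz" "a \<otimes> y = x \<otimes> b" using p a by(auto simp: fraction_iff)
  thus ?thesis
   using quotient_rule_wd[OF a x] a nz_mult[OF a(2) a(2)] nz_mult[OF x(2) x(2)] d_closed
   by(intro fraction_eqI) auto
 qed
 have "D (fraction R a b) = (\<Union>p\<in>fraction R a b.
   fraction R (\<delta> (fst p) \<otimes> snd p \<ominus> fst p \<otimes> \<delta> (snd p)) (snd p \<otimes> snd p))"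
  unfolding frac_derivation_def by(simp add: case_prod_beta)
 also have "... = fraction R (\<delta> a \<otimes> b \<ominus> a \<otimes> \<delta> b) (b \<otimes> b)"
  by(intro UN_constant_on[OF fraction_self[OF a]] eq)
 finally show ?thesis .
qed

lemma d_one: "\<delta> \<one> = \<zero>"
proof -
 have "\<delta> \<one> = \<delta> \<one> \<oplus> \<delta> \<one>" using d_mult[of \<one> \<one>] d_closed[of \<one>] by simp
 thus ?thesis by(metis add.l_cancel_one d_closed one_closed)
qed

lemma D_emb: "a : carrier R ==> D (emb a) = emb (\<delta> a)"
 unfolding emb_def using one_nz d_closed by(simp add: D_fraction d_one a_minus_def)

lemma Fr_diff_field: "diff_field Fr D"
proof -
 show ?thesis
 proof (intro diff_field.intro diff_field_axioms.intro Fr_field)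
  fix x assume "x : carrier Fr"
  then obtain a b where x: "x = fraction R a b" and a: "a : carrier R" "b : nz" by(elim Fr_E) blast
  show "D x : carrier Fr"
   unfolding x D_fraction[OF a] by(rule Fr_I[OF _ nz_mult[OF a(2,2)]])(use a d_closed in auto)
  fix y assume "y : carrier Fr"
  then obtain c d where y: "y = fraction R c d" and c: "c : carrier R" "d : nz" by(elim Fr_E) blast
  have bd: "b : carrier R" "d : carrier R" "\<delta> b : carrier R" "\<delta> d : carrier R"
   "\<delta> a : carrier R" "\<delta> c : carrier R"
   using a c by(blast intro: d_closed)+
  note n = nz_mult[OF a(2) c(2)] nz_mult[OF a(2) a(2)] nz_mult[OF c(2) c(2)]
  have cx: "\<delta> a \<otimes> b \<ominus> a \<otimes> \<delta> b : carrier R" and cy: "\<delta> c \<otimes> d \<ominus> c \<otimes> \<delta> d : carrier R"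
   using a(1) c(1) bd by(auto intro!: minus_closed)
  show "D (x \<oplus>\<^bsub>Fr\<^esub> y) = D x \<oplus>\<^bsub>Fr\<^esub> D y"
  proof -
   have "D (x \<oplus>\<^bsub>Fr\<^esub> y) = fraction R (\<delta> (a \<otimes> d \<oplus> c \<otimes> b) \<otimes> (b \<otimes> d)
     \<ominus> (a \<otimes> d \<oplus> c \<otimes> b) \<otimes> \<delta> (b \<otimes> d)) (b \<otimes> d \<otimes> (b \<otimes> d))"
    unfolding x y Fr_add[OF a c] by(rule D_fraction)(use a c n bd in auto)
   also have "... = fraction R ((\<delta> a \<otimes> b \<ominus> a \<otimes> \<delta> b) \<otimes> (d \<otimes> d) \<oplus> (\<delta> c \<otimes> d \<ominus> c \<otimes> \<delta> d) \<otimes> (b \<otimes> b))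
     (b \<otimes> b \<otimes> (d \<otimes> d))"
   proof -
    have e: "\<delta> (a \<otimes> d \<oplus> c \<otimes> b) = \<delta> a \<otimes> d \<oplus> a \<otimes> \<delta> d \<oplus> (\<delta> c \<otimes> b \<oplus> c \<otimes> \<delta> b)"
     "\<delta> (b \<otimes> d) = \<delta> b \<otimes> d \<oplus> b \<otimes> \<delta> d"
     using a c bd by(auto simp: d_add d_mult)
    have "\<delta> (a \<otimes> d \<oplus> c \<otimes> b) \<otimes> (b \<otimes> d) \<ominus> (a \<otimes> d \<oplus> c \<otimes> b) \<otimes> \<delta> (b \<otimes> d)
     = (\<delta> a \<otimes> b \<ominus> a \<otimes> \<delta> b) \<otimes> (d \<otimes> d) \<oplus> (\<delta> c \<otimes> d \<ominus> c \<otimes> \<delta> d) \<otimes> (b \<otimes> b)"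
     "b \<otimes> d \<otimes> (b \<otimes> d) = b \<otimes> b \<otimes> (d \<otimes> d)"
     unfolding e using a(1) c(1) bd by algebra+
    thus ?thesis by(simp only:)
   qed
   also have "... = D x \<oplus>\<^bsub>Fr\<^esub> D y"
    unfolding x y D_fraction[OF a] D_fraction[OF c]
    by(rule Fr_add[OF cx n(2) cy n(3), symmetric])
   finally show ?thesis .
  qed
  show "D (x \<otimes>\<^bsub>Fr\<^esub> y) = D x \<otimes>\<^bsub>Fr\<^esub> y \<oplus>\<^bsub>Fr\<^esub> x \<otimes>\<^bsub>Fr\<^esub> D y"
  proof -
   have "D (x \<otimes>\<^bsub>Fr\<^esub> y) = fraction R (\<delta> (a \<otimes> c) \<otimes> (b \<otimes> d) \<ominus> (a \<otimes> c) \<otimes> \<delta> (b \<otimes> d)) (b \<otimes> d \<otimes> (b \<otimes> d))"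
    unfolding x y Fr_mult[OF a c] by(rule D_fraction)(use a c n bd in auto)
   also have "... = fraction R ((\<delta> a \<otimes> b \<ominus> a \<otimes> \<delta> b) \<otimes> c \<otimes> (b \<otimes> (d \<otimes> d))
     \<oplus> a \<otimes> (\<delta> c \<otimes> d \<ominus> c \<otimes> \<delta> d) \<otimes> (b \<otimes> b \<otimes> d)) (b \<otimes> b \<otimes> d \<otimes> (b \<otimes> (d \<otimes> d)))"
   proof (rule fraction_eqI)
    have e: "\<delta> (a \<otimes> c) = \<delta> a \<otimes> c \<oplus> a \<otimes> \<delta> c" "\<delta> (b \<otimes> d) = \<delta> b \<otimes> d \<oplus> b \<otimes> \<delta> d"
     using a c bd by(auto simp: d_mult)
    have n': "\<delta> (a \<otimes> c) \<otimes> (b \<otimes> d) \<ominus> (a \<otimes> c) \<otimes> \<delta> (b \<otimes> d)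
     = (\<delta> a \<otimes> b \<ominus> a \<otimes> \<delta> b) \<otimes> (c \<otimes> d) \<oplus> (a \<otimes> b) \<otimes> (\<delta> c \<otimes> d \<ominus> c \<otimes> \<delta> d)"
     unfolding e using a(1) c(1) bd by algebra
    have pq: "(p \<otimes> (c \<otimes> d) \<oplus> (a \<otimes> b) \<otimes> q) \<otimes> (b \<otimes> b \<otimes> d \<otimes> (b \<otimes> (d \<otimes> d)))
     = (p \<otimes> c \<otimes> (b \<otimes> (d \<otimes> d)) \<oplus> a \<otimes> q \<otimes> (b \<otimes> b \<otimes> d)) \<otimes> (b \<otimes> d \<otimes> (b \<otimes> d))"
     if "p : carrier R" "q : carrier R" for p q
     using a(1) c(1) bd(1,2) that by algebra
    show "(\<delta> (a \<otimes> c) \<otimes> (b \<otimes> d) \<ominus> (a \<otimes> c) \<otimes> \<delta> (b \<otimes> d)) \<otimes> (b \<otimes> b \<otimes> d \<otimes> (b \<otimes> (d \<otimes> d)))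
     = ((\<delta> a \<otimes> b \<ominus> a \<otimes> \<delta> b) \<otimes> c \<otimes> (b \<otimes> (d \<otimes> d)) \<oplus> a \<otimes> (\<delta> c \<otimes> d \<ominus> c \<otimes> \<delta> d) \<otimes> (b \<otimes> b \<otimes> d))
      \<otimes> (b \<otimes> d \<otimes> (b \<otimes> d))"
     unfolding n' by(rule pq)(use a(1) c(1) bd in auto)
    show "b \<otimes> d \<otimes> (b \<otimes> d) : nz" "b \<otimes> b \<otimes> d \<otimes> (b \<otimes> (d \<otimes> d)) : nz"
     by(rule nz_mult[OF n(1) n(1)], rule nz_mult[OF nz_mult[OF n(2) c(2)] nz_mult[OF a(2) n(3)]])
    have ac: "a \<otimes> c : carrier R" using a(1) c(1) by(rule m_closed)
    show "\<delta> (a \<otimes> c) \<otimes> (b \<otimes> d) \<ominus> a \<otimes> c \<otimes> \<delta> (b \<otimes> d) : carrier R"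
     using bd ac d_closed[OF ac] d_closed[OF m_closed[OF bd(1,2)]] by(simp only: minus_closed m_closed)
    show "(\<delta> a \<otimes> b \<ominus> a \<otimes> \<delta> b) \<otimes> c \<otimes> (b \<otimes> (d \<otimes> d)) \<oplus> a \<otimes> (\<delta> c \<otimes> d \<ominus> c \<otimes> \<delta> d) \<otimes> (b \<otimes> b \<otimes> d) : carrier R"
     using bd cx cy a(1) c(1) by(simp only: a_closed m_closed)
   qed
   also have "... = D x \<otimes>\<^bsub>Fr\<^esub> y \<oplus>\<^bsub>Fr\<^esub> x \<otimes>\<^bsub>Fr\<^esub> D y"
   proof -
    have m: "b \<otimes> b \<otimes> d : nz" "b \<otimes> (d \<otimes> d) : nz"
     by(rule nz_mult[OF n(2) c(2)], rule nz_mult[OF a(2) n(3)])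
    have m': "(\<delta> a \<otimes> b \<ominus> a \<otimes> \<delta> b) \<otimes> c : carrier R" "a \<otimes> (\<delta> c \<otimes> d \<ominus> c \<otimes> \<delta> d) : carrier R"
     by(rule m_closed[OF cx c(1)], rule m_closed[OF a(1) cy])
    have "D x \<otimes>\<^bsub>Fr\<^esub> y = fraction R ((\<delta> a \<otimes> b \<ominus> a \<otimes> \<delta> b) \<otimes> c) (b \<otimes> b \<otimes> d)"
     unfolding x y D_fraction[OF a] by(rule Fr_mult[OF cx n(2) c])
    moreover have "x \<otimes>\<^bsub>Fr\<^esub> D y = fraction R (a \<otimes> (\<delta> c \<otimes> d \<ominus> c \<otimes> \<delta> d)) (b \<otimes> (d \<otimes> d))"
     unfolding x y D_fraction[OF c] by(rule Fr_mult[OF a cy n(3)])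
    ultimately show ?thesis by(simp only: Fr_add[OF m'(1) m(1) m'(2) m(2)])
   qed
   finally show ?thesis .
  qed
 qed
qed

end

section \<open>Summation against a finitely supported function\<close>

lemma (in abelian_monoid) finsum_Times:
 assumes "finite A" "finite B" "!!i j. i : A ==> j : B ==> f (i, j) : carrier G"
 shows "(\<Oplus>p\<in>A \<times> B. f p) = (\<Oplus>i\<in>A. \<Oplus>j\<in>B. f (i, j))"
proof -
 have "A \<times> B = (\<Union>i\<in>A. Pair i ` B)" by auto
 hence "(\<Oplus>p\<in>A \<times> B. f p) = (\<Oplus>i\<in>A. \<Oplus>p\<in>Pair i ` B. f p)"
  by(simp only:) (rule add.finprod_UN_disjoint, use assms in "auto simp: pairwise_def disjnt_def")
 also have "... = (\<Oplus>i\<in>A. \<Oplus>j\<in>B. f (i, j))"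
  by(intro finsum_cong' finsum_reindex)(use assms in "auto intro!: finsum_closed simp: inj_on_def")
 finally show ?thesis .
qed

text \<open>\<open>lin K C f \<phi>\<close> integrates \<open>\<phi>\<close> against \<open>f\<close>. In terms of it the convolution product of a monoid
  algebra is characterised by Fubini's formula (\<open>lin_mult\<close> below), from which the ring axioms and the
  universal property of tensor products follow.\<close>

definition lin :: "('k, 'm) ring_scheme => ('k, 'c, 'q) module_scheme => ('x => 'k) => ('x => 'c) => 'c"
 where "lin K C f \<phi> = (\<Oplus>\<^bsub>C\<^esub>x\<in>{x. f x ~= \<zero>\<^sub>K}. f x \<odot>\<^sub>C \<phi> x)"

lemma monoid_algebra_simps:
 "f : carrier (monoid_algebra K M) \<longleftrightarrow> (ALL x. f x : carrier K) &
   (ALL x. x ~: carrier M --> f x = \<zero>\<^sub>K) & finite {x. f x ~= \<zero>\<^sub>K}"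
 "f \<oplus>\<^bsub>monoid_algebra K M\<^esub> g = (%x. f x \<oplus>\<^sub>K g x)"
 "\<zero>\<^bsub>monoid_algebra K M\<^esub> = (%x. \<zero>\<^sub>K)"
 "\<one>\<^bsub>monoid_algebra K M\<^esub> = (%x. if x = \<one>\<^sub>M then \<one>\<^sub>K else \<zero>\<^sub>K)"
 "c \<odot>\<^bsub>monoid_algebra K M\<^esub> f = (%x. c \<otimes>\<^sub>K f x)"
 unfolding monoid_algebra_def by auto

definition self_module :: "('k, 'm) ring_scheme => ('k, 'k) module"
 where "self_module K = \<lparr> carrier = carrier K, monoid.mult = monoid.mult K, one = one K,
  ring.zero = ring.zero K, add = add K, smult = monoid.mult K \<rparr>"

lemma self_module_simps [simp]:
 "carrier (self_module K) = carrier K" "monoid.mult (self_module K) = monoid.mult K"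
 "one (self_module K) = one K" "ring.zero (self_module K) = ring.zero K"
 "add (self_module K) = add K" "smult (self_module K) = monoid.mult K"
 unfolding self_module_def by auto

lemma self_module_module:
 assumes "cring K" shows "module K (self_module K)"
proof -
 interpret cring K by fact
 show ?thesis
 proof (rule moduleI)
  show "abelian_group (self_module K)"
   by(rule abelian_groupI)(use add.m_assoc a_comm l_neg in auto)
 qed (auto simp: l_distr r_distr m_assoc is_cring)
qed

locale monoid_alg = K?: cring K + M?: comm_monoid M
 for K :: "('k, 'm) ring_scheme" and M :: "('x, 'n) monoid_scheme"
begin

abbreviation "P == monoid_algebra K M"
abbreviation "supp f == {x. f x ~= \<zero>\<^sub>K}"

lemmas P_simps = monoid_algebra_simps[where K = K and M = M]

lemma P_abelian: "abelian_group P"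
proof (rule abelian_groupI)
 fix f g assume fg: "f : carrier P" "g : carrier P"
 have "finite ((supp f) \<union> (supp g))" using fg by(auto simp: P_simps)
 moreover have "{x. f x \<oplus>\<^sub>K g x ~= \<zero>\<^sub>K} <= (supp f) \<union> (supp g)" by auto
 ultimately have "finite {x. f x \<oplus>\<^sub>K g x ~= \<zero>\<^sub>K}" by(rule rev_finite_subset)
 thus "f \<oplus>\<^sub>P g : carrier P" using fg by(auto simp: P_simps)
 show "f \<oplus>\<^sub>P g = g \<oplus>\<^sub>P f" using fg by(auto simp: P_simps K.a_comm)
 fix h assume "h : carrier P"
 thus "f \<oplus>\<^sub>P g \<oplus>\<^sub>P h = f \<oplus>\<^sub>P (g \<oplus>\<^sub>P h)" using fg by(auto simp: P_simps K.a_assoc)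
next
 show "\<zero>\<^sub>P : carrier P" by(auto simp: P_simps)
 fix f assume f: "f : carrier P"
 show "\<zero>\<^sub>P \<oplus>\<^sub>P f = f" using f by(auto simp: P_simps)
 have "{x. \<ominus>\<^sub>K f x ~= \<zero>\<^sub>K} <= (supp f)" using K.minus_zero by auto
 hence "finite {x. \<ominus>\<^sub>K f x ~= \<zero>\<^sub>K}" using f rev_finite_subset by(auto simp: P_simps)
 hence "(%x. \<ominus>\<^sub>K f x) : carrier P" using f K.minus_zero by(auto simp: P_simps)
 thus "EX g:carrier P. g \<oplus>\<^sub>P f = \<zero>\<^sub>P"
  by(rule bexI[rotated])(use f in "auto simp: P_simps K.l_neg")
qed

sublocale P: abelian_group P by(rule P_abelian)

lemma P_smult: "c : carrier K ==> f : carrier P ==> c \<odot>\<^sub>P f : carrier P"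
proof -
 assume a: "c : carrier K" "f : carrier P"
 have "{x. c \<otimes>\<^sub>K f x ~= \<zero>\<^sub>K} <= (supp f)" using a by auto
 hence "finite {x. c \<otimes>\<^sub>K f x ~= \<zero>\<^sub>K}" using a rev_finite_subset by(auto simp: P_simps)
 thus ?thesis using a by(auto simp: P_simps)
qed

lemma basis_in_P: "m : carrier M ==> (%x. if x = m then \<one>\<^sub>K else \<zero>\<^sub>K) : carrier P"
 by(auto simp: P_simps)

end

locale monoid_alg_module = monoid_alg K M + C: module K C
 for K :: "('k, 'm) ring_scheme" and M :: "('x, 'n) monoid_scheme"
  and C :: "('k, 'c, 'q) module_scheme"
begin

lemma lin_superset:
 assumes "f : carrier P" "finite T" "(supp f) <= T" "!!x. x : T ==> \<phi> x : carrier C"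
 shows "lin K C f \<phi> = (\<Oplus>\<^bsub>C\<^esub>x\<in>T. f x \<odot>\<^sub>C \<phi> x)"
 unfolding lin_def
 by(rule C.M.add.finprod_mono_neutral_cong_left)(use assms in "auto simp: P_simps")

lemma supp_M: "f : carrier P ==> (supp f) <= carrier M"
 by(auto simp: P_simps)

lemma supp_mem: "f : carrier P ==> f x ~= \<zero>\<^sub>K ==> x : carrier M"
 by(auto simp: P_simps)

lemma supp_finite: "f : carrier P ==> finite (supp f)"
 by(auto simp: P_simps)

lemma P_val: "f : carrier P ==> f x : carrier K"
 by(auto simp: P_simps)

lemma lin_closed:
 assumes "f : carrier P" "!!x. x : carrier M ==> \<phi> x : carrier C"
 shows "lin K C f \<phi> : carrier C"
 unfolding lin_def
 by(rule C.M.finsum_closed)(use assms supp_mem[OF assms(1)] P_val[OF assms(1)] in auto)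

lemma lin_cong:
 assumes "f : carrier P" "!!x. x : carrier M ==> \<phi> x = \<psi> x" "!!x. x : carrier M ==> \<psi> x : carrier C"
 shows "lin K C f \<phi> = lin K C f \<psi>"
proof -
 have "!!x. f x ~= \<zero>\<^sub>K ==> x : carrier M" using supp_M[OF assms(1)] by auto
 thus ?thesis
  unfolding lin_def by(intro C.M.finsum_cong')(use assms P_val in auto)
qed

lemma lin_add:
 assumes "f : carrier P" "g : carrier P" "!!x. x : carrier M ==> \<phi> x : carrier C"
 shows "lin K C (f \<oplus>\<^sub>P g) \<phi> = lin K C f \<phi> \<oplus>\<^sub>C lin K C g \<phi>"
proof -
 let ?T = "(supp f) \<union> (supp g)"
 have T: "finite ?T" "?T <= carrier M" using assms supp_finite supp_M by auto
 have c: "!!x. x : ?T ==> \<phi> x : carrier C" using T assms(3) by auto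
 have "lin K C (f \<oplus>\<^sub>P g) \<phi> = (\<Oplus>\<^bsub>C\<^esub>x\<in>?T. (f \<oplus>\<^sub>P g) x \<odot>\<^sub>C \<phi> x)"
  by(rule lin_superset[OF P.a_closed[OF assms(1,2)] T(1)])
    (use c in "auto simp: monoid_algebra_simps(2)")
 also have "... = (\<Oplus>\<^bsub>C\<^esub>x\<in>?T. f x \<odot>\<^sub>C \<phi> x \<oplus>\<^sub>C g x \<odot>\<^sub>C \<phi> x)"
  by(intro C.M.finsum_cong')(use c P_val[OF assms(1)] P_val[OF assms(2)] in "auto simp: monoid_algebra_simps(2) C.smult_l_distr")
 also have "... = (\<Oplus>\<^bsub>C\<^esub>x\<in>?T. f x \<odot>\<^sub>C \<phi> x) \<oplus>\<^sub>C (\<Oplus>\<^bsub>C\<^esub>x\<in>?T. g x \<odot>\<^sub>C \<phi> x)"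
  by(intro C.M.finsum_addf)(use c P_val[OF assms(1)] P_val[OF assms(2)] in auto)
 also have "(\<Oplus>\<^bsub>C\<^esub>x\<in>?T. f x \<odot>\<^sub>C \<phi> x) = lin K C f \<phi>"
  by(rule lin_superset[symmetric])(use assms T c in auto)
 also have "(\<Oplus>\<^bsub>C\<^esub>x\<in>?T. g x \<odot>\<^sub>C \<phi> x) = lin K C g \<phi>"
  by(rule lin_superset[symmetric])(use assms T c in auto)
 finally show ?thesis .
qed

lemma lin_smult:
 assumes "c : carrier K" "f : carrier P" "!!x. x : carrier M ==> \<phi> x : carrier C"
 shows "lin K C (c \<odot>\<^sub>P f) \<phi> = c \<odot>\<^sub>C lin K C f \<phi>"
proof -
 let ?T = "(supp f)"
 have T: "finite ?T" "?T <= carrier M" using assms supp_finite supp_M by auto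
 have ph: "!!x. x : ?T ==> \<phi> x : carrier C" using T assms(3) by auto
 have "lin K C (c \<odot>\<^sub>P f) \<phi> = (\<Oplus>\<^bsub>C\<^esub>x\<in>?T. (c \<odot>\<^sub>P f) x \<odot>\<^sub>C \<phi> x)"
  by(rule lin_superset)(use assms T ph P_smult in "auto simp: monoid_algebra_simps(5)")
 also have "... = (\<Oplus>\<^bsub>C\<^esub>x\<in>?T. c \<odot>\<^sub>C (f x \<odot>\<^sub>C \<phi> x))"
  by(intro C.M.finsum_cong')(use ph assms(1) P_val[OF assms(2)] in "auto simp: monoid_algebra_simps(5) C.smult_assoc1")
 also have "... = c \<odot>\<^sub>C (\<Oplus>\<^bsub>C\<^esub>x\<in>?T. f x \<odot>\<^sub>C \<phi> x)"
  by(rule C.finsum_smult_ldistr[symmetric])(use T ph assms(1) P_val[OF assms(2)] in auto)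
 finally show ?thesis unfolding lin_def .
qed

lemma lin_basis:
 assumes "m : carrier M" "\<phi> m : carrier C"
 shows "lin K C (%x. if x = m then \<one>\<^sub>K else \<zero>\<^sub>K) \<phi> = \<phi> m"
proof -
 have "lin K C (%x. if x = m then \<one>\<^sub>K else \<zero>\<^sub>K) \<phi>
   = (\<Oplus>\<^bsub>C\<^esub>x\<in>{m}. (if x = m then \<one>\<^sub>K else \<zero>\<^sub>K) \<odot>\<^sub>C \<phi> x)"
  by(rule lin_superset)(use assms basis_in_P in auto)
 thus ?thesis using assms by simp
qed

lemma lin_zero: "(!!x. x : carrier M ==> \<phi> x : carrier C) ==> lin K C \<zero>\<^sub>P \<phi> = \<zero>\<^sub>C"
 unfolding lin_def by(simp add: monoid_algebra_simps(3))

lemma lin_minus: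
 assumes "f : carrier P" "g : carrier P" "!!x. x : carrier M ==> \<phi> x : carrier C"
 shows "lin K C (f \<ominus>\<^sub>P g) \<phi> = lin K C f \<phi> \<ominus>\<^sub>C lin K C g \<phi>"
proof -
 have c: "f \<ominus>\<^sub>P g : carrier P" "lin K C (f \<ominus>\<^sub>P g) \<phi> : carrier C" "lin K C g \<phi> : carrier C"
  using assms lin_closed by(auto simp: P.minus_closed)
 have "(f \<ominus>\<^sub>P g) \<oplus>\<^sub>P g = f"
  unfolding a_minus_def using assms P.a_assoc P.l_neg by auto
 hence "lin K C f \<phi> = lin K C (f \<ominus>\<^sub>P g) \<phi> \<oplus>\<^sub>C lin K C g \<phi>"
  using lin_add[OF c(1) assms(2), of \<phi>] assms(3) by simp
 moreover have "x = d \<oplus>\<^sub>C y ==> d = x \<ominus>\<^sub>C y"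
  if "d : carrier C" "y : carrier C" for x d y
  unfolding a_minus_def using that by(simp add: C.M.a_assoc C.M.r_neg)
 ultimately show ?thesis using c by blast
qed

lemma lin_finsum:
 assumes "finite S" "!!i. i : S ==> g i : carrier P" "!!x. x : carrier M ==> \<phi> x : carrier C"
 shows "lin K C (\<Oplus>\<^bsub>P\<^esub>i\<in>S. g i) \<phi> = (\<Oplus>\<^bsub>C\<^esub>i\<in>S. lin K C (g i) \<phi>)"
 using assms(1,2)
proof (induction S)
 case empty
 thus ?case using lin_zero assms(3) by simp
next
 case (insert a S)
 have "lin K C (\<Oplus>\<^bsub>P\<^esub>i\<in>insert a S. g i) \<phi> = lin K C (g a \<oplus>\<^sub>P (\<Oplus>\<^bsub>P\<^esub>i\<in>S. g i)) \<phi>"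
  using insert by(subst P.finsum_insert) auto
 also have "... = lin K C (g a) \<phi> \<oplus>\<^sub>C lin K C (\<Oplus>\<^bsub>P\<^esub>i\<in>S. g i) \<phi>"
  by(rule lin_add)(use insert assms(3) in "auto intro!: P.finsum_closed")
 also have "... = (\<Oplus>\<^bsub>C\<^esub>i\<in>insert a S. lin K C (g i) \<phi>)"
  using insert lin_closed assms(3) by(subst C.M.finsum_insert) auto
 finally show ?case .
qed

lemma lin_swap:
 assumes "f : carrier P" "g : carrier P"
  "!!x y. [|x : carrier M; y : carrier M|] ==> \<psi> x y : carrier C"
 shows "lin K C f (%x. lin K C g (%y. \<psi> x y)) = lin K C g (%y. lin K C f (%x. \<psi> x y))"
proof -
 let ?S = "(supp f)" and ?T = "(supp g)"
 have S: "finite ?S" "?S <= carrier M" "finite ?T" "?T <= carrier M" using assms supp_finite supp_M by auto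
 have c: "!!x y. [|x : ?S; y : ?T|] ==> \<psi> x y : carrier C" using S assms(3) by blast
 have "lin K C f (%x. lin K C g (%y. \<psi> x y)) = (\<Oplus>\<^bsub>C\<^esub>x\<in>?S. \<Oplus>\<^bsub>C\<^esub>y\<in>?T. f x \<odot>\<^sub>C (g y \<odot>\<^sub>C \<psi> x y))"
  unfolding lin_def
  by(intro C.M.finsum_cong' C.finsum_smult_ldistr)
    (use S c P_val[OF assms(1)] P_val[OF assms(2)] in "auto intro!: C.M.finsum_closed")
 also have "... = (\<Oplus>\<^bsub>C\<^esub>y\<in>?T. \<Oplus>\<^bsub>C\<^esub>x\<in>?S. f x \<odot>\<^sub>C (g y \<odot>\<^sub>C \<psi> x y))"
  by(rule C.M.finsum_swap)(use S c P_val[OF assms(1)] P_val[OF assms(2)] in auto)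
 also have "... = (\<Oplus>\<^bsub>C\<^esub>y\<in>?T. \<Oplus>\<^bsub>C\<^esub>x\<in>?S. g y \<odot>\<^sub>C (f x \<odot>\<^sub>C \<psi> x y))"
  by(intro C.M.finsum_cong')
    (use S c P_val[OF assms(1)] P_val[OF assms(2)] in
     \<open>auto intro!: C.M.finsum_closed simp: C.smult_assoc1[symmetric] K.m_comm\<close>)
 also have "... = lin K C g (%y. lin K C f (%x. \<psi> x y))"
  unfolding lin_def
  by(intro C.M.finsum_cong' C.finsum_smult_ldistr[symmetric])
    (use S c P_val[OF assms(1)] P_val[OF assms(2)] in "auto intro!: C.M.finsum_closed")
 finally show ?thesis .
qed

lemma P_mult_apply:
 assumes "f : carrier P" "g : carrier P"
 shows "(f \<otimes>\<^sub>P g) z = (\<Oplus>\<^bsub>K\<^esub>p\<in>{p : (supp f) \<times> (supp g). fst p \<otimes>\<^sub>M snd p = z}.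
  f (fst p) \<otimes>\<^sub>K g (snd p))"
proof -
 have "{(x, y). x : carrier M & y : carrier M & f x ~= \<zero>\<^sub>K & g y ~= \<zero>\<^sub>K & x \<otimes>\<^sub>M y = z}
   = {p : (supp f) \<times> (supp g). fst p \<otimes>\<^sub>M snd p = z}"
  using supp_M[OF assms(1)] supp_M[OF assms(2)] by auto
 thus ?thesis unfolding monoid_algebra_def by simp
qed

lemma P_mult_closed:
 assumes "f : carrier P" "g : carrier P"
 shows "f \<otimes>\<^sub>P g : carrier P"
  and "{z. (f \<otimes>\<^sub>P g) z ~= \<zero>\<^sub>K} <= (%p. fst p \<otimes>\<^sub>M snd p) ` ((supp f) \<times> (supp g))"
proof -
 let ?P = "(supp f) \<times> (supp g)"
 have fin: "finite ?P" using assms supp_finite by auto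
 have 0: "(f \<otimes>\<^sub>P g) z = \<zero>\<^sub>K" if "z ~: (%p. fst p \<otimes>\<^sub>M snd p) ` ?P" for z
 proof -
  have "{p : ?P. fst p \<otimes>\<^sub>M snd p = z} = {}" using that by blast
  thus ?thesis unfolding P_mult_apply[OF assms] by(simp only: K.finsum_empty)
 qed
 thus sub: "{z. (f \<otimes>\<^sub>P g) z ~= \<zero>\<^sub>K} <= (%p. fst p \<otimes>\<^sub>M snd p) ` ?P" by blast
 have im: "(%p. fst p \<otimes>\<^sub>M snd p) ` ?P <= carrier M"
  using supp_mem[OF assms(1)] supp_mem[OF assms(2)] by auto
 have "(f \<otimes>\<^sub>P g) z : carrier K" for z
  unfolding P_mult_apply[OF assms]
  by(rule K.finsum_closed)(use P_val[OF assms(1)] P_val[OF assms(2)] in auto)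
 moreover have "(f \<otimes>\<^sub>P g) z = \<zero>\<^sub>K" if "z ~: carrier M" for z using 0 im that by blast
 moreover have "finite {z. (f \<otimes>\<^sub>P g) z ~= \<zero>\<^sub>K}" using sub fin finite_subset by blast
 ultimately show "f \<otimes>\<^sub>P g : carrier P" unfolding monoid_algebra_simps(1) by blast
qed

lemma finsum_smult_rdistr:
 assumes "finite A" "!!i. i : A ==> h i : carrier K" "m : carrier C"
 shows "(\<Oplus>\<^bsub>K\<^esub>i\<in>A. h i) \<odot>\<^sub>C m = (\<Oplus>\<^bsub>C\<^esub>i\<in>A. h i \<odot>\<^sub>C m)"
 using assms(1,2)
proof (induction A)
 case empty
 thus ?case using assms(3) C.smult_l_null by simp
next
 case (insert a A)
 have "(\<Oplus>\<^bsub>K\<^esub>i\<in>A. h i) : carrier K" using insert by(intro K.finsum_closed) auto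
 thus ?case
  using insert assms(3) by(subst K.finsum_insert) (auto simp: C.smult_l_distr)
qed

lemma lin_mult:
 assumes "f : carrier P" "g : carrier P" "!!x. x : carrier M ==> \<phi> x : carrier C"
 shows "lin K C (f \<otimes>\<^sub>P g) \<phi> = lin K C f (%x. lin K C g (%y. \<phi> (x \<otimes>\<^sub>M y)))"
proof -
 let ?S = "(supp f)" and ?T = "(supp g)"
 let ?mul = "%p. fst p \<otimes>\<^sub>M snd p"
 let ?fib = "%z. {p : ?S \<times> ?T. ?mul p = z}"
 have S: "finite ?S" "?S <= carrier M" "finite ?T" "?T <= carrier M" using assms supp_finite supp_M by auto
 note fv = P_val[OF assms(1)] and gv = P_val[OF assms(2)]
 have fin: "finite (?mul ` (?S \<times> ?T))" using S by auto
 have mc: "?mul p : carrier M" if "p : ?S \<times> ?T" for p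
  using that supp_mem[OF assms(1)] supp_mem[OF assms(2)] by auto
 have imc: "z : carrier M" if "z : ?mul ` (?S \<times> ?T)" for z using that mc by blast
 have "lin K C (f \<otimes>\<^sub>P g) \<phi> = (\<Oplus>\<^bsub>C\<^esub>z\<in>?mul ` (?S \<times> ?T). (f \<otimes>\<^sub>P g) z \<odot>\<^sub>C \<phi> z)"
  by(rule lin_superset[OF P_mult_closed(1)[OF assms(1,2)] fin P_mult_closed(2)[OF assms(1,2)]])
    (use imc assms(3) in blast)
 also have "... = (\<Oplus>\<^bsub>C\<^esub>z\<in>?mul ` (?S \<times> ?T). \<Oplus>\<^bsub>C\<^esub>p\<in>?fib z. (f (fst p) \<otimes>\<^sub>K g (snd p)) \<odot>\<^sub>C \<phi> (?mul p))"
 proof (rule C.M.finsum_cong'[OF refl])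
  show "(%z. \<Oplus>\<^bsub>C\<^esub>p\<in>?fib z. (f (fst p) \<otimes>\<^sub>K g (snd p)) \<odot>\<^sub>C \<phi> (?mul p)) : ?mul ` (?S \<times> ?T) \<rightarrow> carrier C"
   using mc assms(3) fv gv by(auto intro!: C.M.finsum_closed C.smult_closed)
  fix z assume z: "z : ?mul ` (?S \<times> ?T)"
  have pz: "\<phi> z : carrier C" using imc[OF z] assms(3) by auto
  have "(f \<otimes>\<^sub>P g) z \<odot>\<^sub>C \<phi> z = (\<Oplus>\<^bsub>C\<^esub>p\<in>?fib z. (f (fst p) \<otimes>\<^sub>K g (snd p)) \<odot>\<^sub>C \<phi> z)"
   unfolding P_mult_apply[OF assms(1,2)]
   by(rule finsum_smult_rdistr)(use S fv gv pz in auto)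
  also have "... = (\<Oplus>\<^bsub>C\<^esub>p\<in>?fib z. (f (fst p) \<otimes>\<^sub>K g (snd p)) \<odot>\<^sub>C \<phi> (?mul p))"
   by(rule C.M.finsum_cong'[OF refl])(use fv gv pz in auto)
  finally show "(f \<otimes>\<^sub>P g) z \<odot>\<^sub>C \<phi> z
    = (\<Oplus>\<^bsub>C\<^esub>p\<in>?fib z. (f (fst p) \<otimes>\<^sub>K g (snd p)) \<odot>\<^sub>C \<phi> (?mul p))" .
 qed
 also have "... = (\<Oplus>\<^bsub>C\<^esub>p\<in>(\<Union>z\<in>?mul ` (?S \<times> ?T). ?fib z). (f (fst p) \<otimes>\<^sub>K g (snd p)) \<odot>\<^sub>C \<phi> (?mul p))"
 proof (rule C.M.add.finprod_UN_disjoint[symmetric])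
  show "finite (?mul ` (?S \<times> ?T))" by fact
  show "finite (?fib z)" for z using S by auto
  show "pairwise (%i j. disjnt (?fib i) (?fib j)) (?mul ` (?S \<times> ?T))"
   unfolding pairwise_def disjnt_def by blast
  show "(f (fst x) \<otimes>\<^sub>K g (snd x)) \<odot>\<^sub>C \<phi> (?mul x) : carrier C" if "x : ?fib i" for i x
   using that mc[of x] assms(3) fv gv by blast
 qed
 also have "(\<Union>z\<in>?mul ` (?S \<times> ?T). ?fib z) = ?S \<times> ?T" by blast
 also have "(\<Oplus>\<^bsub>C\<^esub>p\<in>?S \<times> ?T. (f (fst p) \<otimes>\<^sub>K g (snd p)) \<odot>\<^sub>C \<phi> (?mul p))
   = (\<Oplus>\<^bsub>C\<^esub>x\<in>?S. \<Oplus>\<^bsub>C\<^esub>y\<in>?T. (f x \<otimes>\<^sub>K g y) \<odot>\<^sub>C \<phi> (x \<otimes>\<^sub>M y))"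
  by(subst C.M.finsum_Times)(use S mc assms(3) fv gv in auto)
 also have "... = lin K C f (%x. lin K C g (%y. \<phi> (x \<otimes>\<^sub>M y)))"
  unfolding lin_def
 proof (rule C.M.finsum_cong'[OF refl])
  have pc: "\<phi> (x \<otimes>\<^sub>M y) : carrier C" if "x : ?S" "y : ?T" for x y
   using mc[of "(x, y)"] that assms(3) by auto
  show "(%x. f x \<odot>\<^sub>C (\<Oplus>\<^bsub>C\<^esub>y\<in>?T. g y \<odot>\<^sub>C \<phi> (x \<otimes>\<^sub>M y))) : ?S \<rightarrow> carrier C"
   using pc fv gv by(auto intro!: C.M.finsum_closed C.smult_closed)
  fix x assume x: "x : ?S"
  have "f x \<odot>\<^sub>C (\<Oplus>\<^bsub>C\<^esub>y\<in>?T. g y \<odot>\<^sub>C \<phi> (x \<otimes>\<^sub>M y)) = (\<Oplus>\<^bsub>C\<^esub>y\<in>?T. f x \<odot>\<^sub>C (g y \<odot>\<^sub>C \<phi> (x \<otimes>\<^sub>M y)))"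
   by(rule C.finsum_smult_ldistr)(use S fv gv pc[OF x] in auto)
  also have "... = (\<Oplus>\<^bsub>C\<^esub>y\<in>?T. (f x \<otimes>\<^sub>K g y) \<odot>\<^sub>C \<phi> (x \<otimes>\<^sub>M y))"
   by(rule C.M.finsum_cong'[OF refl])(use fv gv pc[OF x] in "auto simp: C.smult_assoc1")
  finally show "(\<Oplus>\<^bsub>C\<^esub>y\<in>?T. (f x \<otimes>\<^sub>K g y) \<odot>\<^sub>C \<phi> (x \<otimes>\<^sub>M y))
    = f x \<odot>\<^sub>C (\<Oplus>\<^bsub>C\<^esub>y\<in>?T. g y \<odot>\<^sub>C \<phi> (x \<otimes>\<^sub>M y))" by simp
 qed
 finally show ?thesis .
qed

end

section \<open>Monoid algebras\<close>

context monoid_alg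
begin

lemma scalar_module: "monoid_alg_module K M (self_module K)"
 by(intro monoid_alg_module.intro monoid_alg_axioms self_module_module K.is_cring)

interpretation S: monoid_alg_module K M "self_module K" by(rule scalar_module)

lemma P_ext:
 assumes "f : carrier P" "g : carrier P"
  "!!\<phi>. (!!x. \<phi> x : carrier K) ==> lin K (self_module K) f \<phi> = lin K (self_module K) g \<phi>"
 shows "f = g"
proof
 fix z
 have e: "lin K (self_module K) h (%x. if x = z then \<one>\<^sub>K else \<zero>\<^sub>K) = h z" if h: "h : carrier P" for h
 proof -
  have "lin K (self_module K) h (%x. if x = z then \<one>\<^sub>K else \<zero>\<^sub>K)
   = (\<Oplus>\<^bsub>self_module K\<^esub>x\<in>insert z (supp h). h x \<odot>\<^bsub>self_module K\<^esub> (if x = z then \<one>\<^sub>K else \<zero>\<^sub>K))"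
   by(rule S.lin_superset)(use h S.supp_finite in auto)
  also have "... = h z \<odot>\<^bsub>self_module K\<^esub> (if z = z then \<one>\<^sub>K else \<zero>\<^sub>K)"
   by(rule S.C.M.finsum_single)(use h S.supp_finite S.P_val in auto)
  finally show ?thesis using S.P_val[OF h] by simp
 qed
 show "f z = g z"
  using e[OF assms(1)] e[OF assms(2)] assms(3)[of "%x. if x = z then \<one>\<^sub>K else \<zero>\<^sub>K"] by simp
qed

lemma P_mult_cl: "[|f : carrier P; g : carrier P|] ==> f \<otimes>\<^sub>P g : carrier P"
 by(rule S.P_mult_closed)

lemma P_one_cl: "\<one>\<^sub>P : carrier P"
 unfolding monoid_algebra_simps(4) by(rule basis_in_P) simp

lemma P_cring: "cring P"
proof (rule cringI[OF P_abelian])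
 let ?l = "lin K (self_module K)"
 show "comm_monoid P"
 proof (rule comm_monoidI)
  fix f g assume fg: "f : carrier P" "g : carrier P"
  show "f \<otimes>\<^sub>P g : carrier P" using fg by(rule P_mult_cl)
  show "f \<otimes>\<^sub>P g = g \<otimes>\<^sub>P f"
  proof (rule P_ext)
   fix \<phi> :: "'x => 'k" assume c: "!!x. \<phi> x : carrier K"
   have "?l (f \<otimes>\<^sub>P g) \<phi> = ?l f (%x. ?l g (%y. \<phi> (x \<otimes>\<^sub>M y)))"
    by(rule S.lin_mult)(use fg c in auto)
   also have "... = ?l g (%y. ?l f (%x. \<phi> (x \<otimes>\<^sub>M y)))"
    by(rule S.lin_swap)(use fg c in auto)
   also have "... = ?l g (%y. ?l f (%x. \<phi> (y \<otimes>\<^sub>M x)))"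
    by(intro S.lin_cong S.lin_closed)(use fg c M.m_comm in auto)
   also have "... = ?l (g \<otimes>\<^sub>P f) \<phi>"
    by(rule S.lin_mult[symmetric])(use fg c in auto)
   finally show "?l (f \<otimes>\<^sub>P g) \<phi> = ?l (g \<otimes>\<^sub>P f) \<phi>" .
  qed (use fg P_mult_cl in auto)
  fix h assume h: "h : carrier P"
  show "f \<otimes>\<^sub>P g \<otimes>\<^sub>P h = f \<otimes>\<^sub>P (g \<otimes>\<^sub>P h)"
  proof (rule P_ext)
   fix \<phi> :: "'x => 'k" assume c: "!!x. \<phi> x : carrier K"
   have c2: "(%t. \<phi> (w \<otimes>\<^sub>M t)) x : carrier (self_module K)" for w x using c by simp
   have c3: "?l h (%t. \<phi> (w \<otimes>\<^sub>M t)) : carrier (self_module K)" for w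
    by(rule S.lin_closed[OF h c2])
   have "?l (f \<otimes>\<^sub>P g \<otimes>\<^sub>P h) \<phi> = ?l (f \<otimes>\<^sub>P g) (%w. ?l h (%t. \<phi> (w \<otimes>\<^sub>M t)))"
    by(rule S.lin_mult)(use fg h c P_mult_cl in auto)
   also have "... = ?l f (%x. ?l g (%y. ?l h (%t. \<phi> (x \<otimes>\<^sub>M y \<otimes>\<^sub>M t))))"
    by(rule S.lin_mult)(use fg c3 in auto)
   also have "... = ?l f (%x. ?l g (%y. ?l h (%t. \<phi> (x \<otimes>\<^sub>M (y \<otimes>\<^sub>M t)))))"
    by(intro S.lin_cong S.lin_closed)(use fg h c M.m_assoc in auto)
   also have "... = ?l f (%x. ?l (g \<otimes>\<^sub>P h) (%w. \<phi> (x \<otimes>\<^sub>M w)))"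
    by(intro S.lin_cong S.lin_mult[symmetric] S.lin_closed)(use fg h c P_mult_cl in auto)
   also have "... = ?l (f \<otimes>\<^sub>P (g \<otimes>\<^sub>P h)) \<phi>"
    by(rule S.lin_mult[symmetric])(use fg h c P_mult_cl in auto)
   finally show "?l (f \<otimes>\<^sub>P g \<otimes>\<^sub>P h) \<phi> = ?l (f \<otimes>\<^sub>P (g \<otimes>\<^sub>P h)) \<phi>" .
  qed (use fg h P_mult_cl in auto)
 next
  show "\<one>\<^sub>P : carrier P" by(rule P_one_cl)
  fix f assume f: "f : carrier P"
  show "\<one>\<^sub>P \<otimes>\<^sub>P f = f"
  proof (rule P_ext)
   fix \<phi> :: "'x => 'k" assume c: "!!x. \<phi> x : carrier K"
   have c1: "?l f (%y. \<phi> (\<one>\<^sub>M \<otimes>\<^sub>M y)) : carrier (self_module K)"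
    by(rule S.lin_closed)(use f c in auto)
   have "?l (\<one>\<^sub>P \<otimes>\<^sub>P f) \<phi> = ?l \<one>\<^sub>P (%x. ?l f (%y. \<phi> (x \<otimes>\<^sub>M y)))"
    by(rule S.lin_mult)(use f c P_one_cl in auto)
   also have "... = ?l f (%y. \<phi> (\<one>\<^sub>M \<otimes>\<^sub>M y))"
    unfolding monoid_algebra_simps(4)
    by(rule S.lin_basis)(use c1 in auto)
   also have "... = ?l f \<phi>" by(intro S.lin_cong)(use f c in auto)
   finally show "?l (\<one>\<^sub>P \<otimes>\<^sub>P f) \<phi> = ?l f \<phi>" .
  qed (use f P_mult_cl P_one_cl in auto)
 qed
 fix f g h assume fgh: "f : carrier P" "g : carrier P" "h : carrier P"
 have fg: "f \<oplus>\<^sub>P g : carrier P" using fgh by simp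
 show "(f \<oplus>\<^sub>P g) \<otimes>\<^sub>P h = f \<otimes>\<^sub>P h \<oplus>\<^sub>P g \<otimes>\<^sub>P h"
 proof (rule P_ext)
  fix \<phi> :: "'x => 'k" assume c: "!!x. \<phi> x : carrier K"
  have c3: "?l h (%t. \<phi> (w \<otimes>\<^sub>M t)) : carrier (self_module K)" for w
   by(rule S.lin_closed)(use fgh c in auto)
  have m: "?l (u \<otimes>\<^sub>P h) \<phi> = ?l u (%w. ?l h (%t. \<phi> (w \<otimes>\<^sub>M t)))" if "u : carrier P" for u
   by(rule S.lin_mult)(use that fgh c in auto)
  have "?l (f \<otimes>\<^sub>P h \<oplus>\<^sub>P g \<otimes>\<^sub>P h) \<phi> = ?l (f \<otimes>\<^sub>P h) \<phi> \<oplus>\<^bsub>self_module K\<^esub> ?l (g \<otimes>\<^sub>P h) \<phi>"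
   by(rule S.lin_add)(use fgh c P_mult_cl in auto)
  thus "?l ((f \<oplus>\<^sub>P g) \<otimes>\<^sub>P h) \<phi> = ?l (f \<otimes>\<^sub>P h \<oplus>\<^sub>P g \<otimes>\<^sub>P h) \<phi>"
   using m[OF fg] m[OF fgh(1)] m[OF fgh(2)] S.lin_add[OF fgh(1,2) c3] by simp
 qed (use fgh fg P_mult_cl in auto)
qed

lemma P_smult_one:
 assumes "c : carrier K" "f : carrier P"
 shows "c \<odot>\<^sub>P f = (c \<odot>\<^sub>P \<one>\<^sub>P) \<otimes>\<^sub>P f"
proof (rule P_ext)
 let ?l = "lin K (self_module K)"
 fix \<phi> :: "'x => 'k" assume c: "!!x. \<phi> x : carrier K"
 interpret Q: cring P by(rule P_cring)
 have c3: "?l f (%t. \<phi> (w \<otimes>\<^sub>M t)) : carrier (self_module K)" for w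
  by(rule S.lin_closed)(use assms c in auto)
 have one: "c \<odot>\<^sub>P \<one>\<^sub>P : carrier P" using assms P_one_cl P_smult by auto
 have "?l ((c \<odot>\<^sub>P \<one>\<^sub>P) \<otimes>\<^sub>P f) \<phi> = ?l (c \<odot>\<^sub>P \<one>\<^sub>P) (%w. ?l f (%t. \<phi> (w \<otimes>\<^sub>M t)))"
  by(rule S.lin_mult)(use assms one c in auto)
 also have "... = c \<odot>\<^bsub>self_module K\<^esub> ?l \<one>\<^sub>P (%w. ?l f (%t. \<phi> (w \<otimes>\<^sub>M t)))"
  by(rule S.lin_smult)(use assms P_one_cl c3 in auto)
 also have "?l \<one>\<^sub>P (%w. ?l f (%t. \<phi> (w \<otimes>\<^sub>M t))) = ?l (\<one>\<^sub>P \<otimes>\<^sub>P f) \<phi>"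
  by(rule S.lin_mult[symmetric])(use assms P_one_cl c in auto)
 also have "\<one>\<^sub>P \<otimes>\<^sub>P f = f" using assms by simp
 also have "c \<odot>\<^bsub>self_module K\<^esub> ?l f \<phi> = ?l (c \<odot>\<^sub>P f) \<phi>"
  by(rule S.lin_smult[symmetric])(use assms c in auto)
 finally show "?l (c \<odot>\<^sub>P f) \<phi> = ?l ((c \<odot>\<^sub>P \<one>\<^sub>P) \<otimes>\<^sub>P f) \<phi>" by simp
qed (use assms P_one_cl P_smult P_mult_cl in auto)

lemma P_decompose:
 assumes f: "f : carrier P"
 shows "f = (\<Oplus>\<^bsub>P\<^esub>m\<in>(supp f). f m \<odot>\<^sub>P (%x. if x = m then \<one>\<^sub>K else \<zero>\<^sub>K))"
  (is "f = ?r")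
proof (rule P_ext)
 let ?l = "lin K (self_module K)"
 have S: "finite (supp f)" "(supp f) <= carrier M" using f S.supp_finite S.supp_M by auto
 have b: "f m \<odot>\<^sub>P (%x. if x = m then \<one>\<^sub>K else \<zero>\<^sub>K) : carrier P" if "m : (supp f)" for m
  using that S f S.P_val by(intro P_smult basis_in_P) auto
 show "?r : carrier P" using b by(intro P.finsum_closed) auto
 fix \<phi> :: "'x => 'k" assume c: "!!x. \<phi> x : carrier K"
 have "?l ?r \<phi> = (\<Oplus>\<^bsub>self_module K\<^esub>m\<in>(supp f). ?l (f m \<odot>\<^sub>P (%x. if x = m then \<one>\<^sub>K else \<zero>\<^sub>K)) \<phi>)"
  by(rule S.lin_finsum)(use S b c in auto)
 also have "... = (\<Oplus>\<^bsub>self_module K\<^esub>m\<in>(supp f). f m \<odot>\<^bsub>self_module K\<^esub> \<phi> m)"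
 proof (rule S.C.M.finsum_cong'[OF refl])
  fix m assume m: "m : (supp f)"
  have "?l (f m \<odot>\<^sub>P (%x. if x = m then \<one>\<^sub>K else \<zero>\<^sub>K)) \<phi>
    = f m \<odot>\<^bsub>self_module K\<^esub> ?l (%x. if x = m then \<one>\<^sub>K else \<zero>\<^sub>K) \<phi>"
   by(rule S.lin_smult)(use S m f S.P_val basis_in_P c in auto)
  also have "?l (%x. if x = m then \<one>\<^sub>K else \<zero>\<^sub>K) \<phi> = \<phi> m"
   by(rule S.lin_basis)(use S m c in auto)
  finally show "?l (f m \<odot>\<^sub>P (%x. if x = m then \<one>\<^sub>K else \<zero>\<^sub>K)) \<phi> = f m \<odot>\<^bsub>self_module K\<^esub> \<phi> m" .
 qed (use f c S.P_val in auto)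
 finally show "?l f \<phi> = ?l ?r \<phi>" unfolding lin_def by simp
qed (rule f)

end

section \<open>Tensor products\<close>

lemma DirProd_comm_monoid:
 assumes "comm_monoid G" "comm_monoid H" shows "comm_monoid (G \<times>\<times> H)"
proof -
 interpret G: comm_monoid G by fact
 interpret H: comm_monoid H by fact
 show ?thesis
  by(rule comm_monoidI) (auto simp: G.m_assoc H.m_assoc intro: G.m_comm H.m_comm)
qed

definition bilinear_map ::
  "('k, 'm) ring_scheme => ('k, 'a, 'n) module_scheme => ('k, 'b, 'p) module_scheme
   => ('k, 'c, 'q) module_scheme => ('a => 'b => 'c) => bool"
 where "bilinear_map K A B C \<phi> \<longleftrightarrow>
  (ALL a:carrier A. ALL b:carrier B. \<phi> a b : carrier C) &
  (ALL a:carrier A. ALL a':carrier A. ALL b:carrier B. \<phi> (a \<oplus>\<^sub>A a') b = \<phi> a b \<oplus>\<^sub>C \<phi> a' b) &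
  (ALL a:carrier A. ALL b:carrier B. ALL b':carrier B. \<phi> a (b \<oplus>\<^sub>B b') = \<phi> a b \<oplus>\<^sub>C \<phi> a b') &
  (ALL c:carrier K. ALL a:carrier A. ALL b:carrier B. \<phi> (c \<odot>\<^sub>A a) b = c \<odot>\<^sub>C \<phi> a b) &
  (ALL c:carrier K. ALL a:carrier A. ALL b:carrier B. \<phi> a (c \<odot>\<^sub>B b) = c \<odot>\<^sub>C \<phi> a b)"

lemma bilinear_mapI:
 assumes "!!a b. [|a : carrier A; b : carrier B|] ==> \<phi> a b : carrier C"
  "!!a a' b. [|a : carrier A; a' : carrier A; b : carrier B|] ==> \<phi> (a \<oplus>\<^sub>A a') b = \<phi> a b \<oplus>\<^sub>C \<phi> a' b"
  "!!a b b'. [|a : carrier A; b : carrier B; b' : carrier B|] ==> \<phi> a (b \<oplus>\<^sub>B b') = \<phi> a b \<oplus>\<^sub>C \<phi> a b'"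
  "!!c a b. [|c : carrier K; a : carrier A; b : carrier B|] ==> \<phi> (c \<odot>\<^sub>A a) b = c \<odot>\<^sub>C \<phi> a b"
  "!!c a b. [|c : carrier K; a : carrier A; b : carrier B|] ==> \<phi> a (c \<odot>\<^sub>B b) = c \<odot>\<^sub>C \<phi> a b"
 shows "bilinear_map K A B C \<phi>"
 unfolding bilinear_map_def using assms by blast

lemma bilinear_mapD:
 assumes "bilinear_map K A B C \<phi>"
 shows "[|a : carrier A; b : carrier B|] ==> \<phi> a b : carrier C"
  "[|a : carrier A; a' : carrier A; b : carrier B|] ==> \<phi> (a \<oplus>\<^sub>A a') b = \<phi> a b \<oplus>\<^sub>C \<phi> a' b"
  "[|a : carrier A; b : carrier B; b' : carrier B|] ==> \<phi> a (b \<oplus>\<^sub>B b') = \<phi> a b \<oplus>\<^sub>C \<phi> a b'"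
  "[|c : carrier K; a : carrier A; b : carrier B|] ==> \<phi> (c \<odot>\<^sub>A a) b = c \<odot>\<^sub>C \<phi> a b"
  "[|c : carrier K; a : carrier A; b : carrier B|] ==> \<phi> a (c \<odot>\<^sub>B b) = c \<odot>\<^sub>C \<phi> a b"
 using assms unfolding bilinear_map_def by blast+

lemma ring_extend_simps:
 "carrier (ring.extend Q m) = carrier Q" "monoid.mult (ring.extend Q m) = monoid.mult Q"
 "one (ring.extend Q m) = one Q" "ring.zero (ring.extend Q m) = ring.zero Q"
 "add (ring.extend Q m) = add Q"
 unfolding ring.extend_def by auto

lemma cring_extend:
 assumes "cring Q" shows "cring (ring.extend Q m)"
proof -
 interpret q: cring Q by fact
 show ?thesis
 proof (rule cringI)
  show "abelian_group (ring.extend Q m)"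
   by(rule abelian_groupI)(use q.a_assoc q.a_comm q.l_neg in "auto simp: ring_extend_simps")
  show "comm_monoid (ring.extend Q m)"
   by(rule comm_monoidI) (auto simp: ring_extend_simps q.m_assoc intro: q.m_comm)
 qed (auto simp: ring_extend_simps q.l_distr)
qed

locale algebra_pair = A: algebra K A + B: algebra K B
 for K :: "('k, 'm) ring_scheme" and A :: "('k, 'a, 'n) module_scheme"
  and B :: "('k, 'b, 'p) module_scheme"
begin

abbreviation "FP == monoid_algebra K (A \<times>\<times> B)"
abbreviation "TI == tensor_ideal K A B"
abbreviation "T == tensor K A B"
abbreviation "bas == basis_pair K"

lemma pairs_comm_monoid: "comm_monoid (A \<times>\<times> B)"
 by(intro DirProd_comm_monoid A.comm_monoid_axioms B.comm_monoid_axioms)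

lemma FP_eq: "free_pairs K A B = FP" by(simp add: free_pairs_def)

sublocale F: monoid_alg K "A \<times>\<times> B"
 by(intro monoid_alg.intro A.R.is_cring pairs_comm_monoid)

lemma FP_cring: "cring FP" by(rule F.P_cring)

sublocale FPr: cring FP by(rule FP_cring)

lemma bas_eq: "bas a b = (%x. if x = (a, b) then \<one>\<^sub>K else \<zero>\<^sub>K)"
 unfolding basis_pair_def by simp

lemma bas_closed: "[|a : carrier A; b : carrier B|] ==> bas a b : carrier FP"
 unfolding bas_eq using F.basis_in_P[of "(a, b)"] by simp

lemma FP_smult: "[|c : carrier K; f : carrier FP|] ==> c \<odot>\<^bsub>FP\<^esub> f : carrier FP"
 using F.P_smult by simp

lemma relations_closed: "bilinear_relations K A B <= carrier FP"
 unfolding bilinear_relations_def FP_eq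
 by(auto intro!: F.P.minus_closed F.P.a_closed bas_closed FP_smult)

lemma TI_ideal: "ideal TI FP"
 unfolding tensor_ideal_def FP_eq by(rule FPr.genideal_ideal[OF relations_closed])

lemmas TI_additive = ideal.axioms(1)[OF TI_ideal]
lemmas TI_Hcarr = additive_subgroup.a_Hcarr[OF TI_additive]

lemma TI_self: "f : carrier FP ==> f : TI +>\<^bsub>FP\<^esub> f"
 using additive_subgroup.zero_closed[OF TI_additive]
 by(auto simp: a_r_coset_def r_coset_def intro!: bexI[of _ "\<zero>\<^bsub>FP\<^esub>"])

end

locale algebra_pair_module = algebra_pair K A B + C: module K C
 for K :: "('k, 'm) ring_scheme" and A :: "('k, 'a, 'n) module_scheme"
  and B :: "('k, 'b, 'p) module_scheme" and C :: "('k, 'c, 'q) module_scheme"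
begin

lemma lin_module: "monoid_alg_module K (A \<times>\<times> B) C"
 by(intro monoid_alg_module.intro F.monoid_alg_axioms C.module_axioms)

sublocale L: monoid_alg_module K "A \<times>\<times> B" C
 by(rule lin_module)

lemma lin_bas: "[|a : carrier A; b : carrier B; \<psi> (a, b) : carrier C|] ==> lin K C (bas a b) \<psi> = \<psi> (a, b)"
 unfolding bas_eq by(rule L.lin_basis) auto

lemma lin_zero_fun:
 assumes "g : carrier FP" shows "lin K C g (%_. \<zero>\<^sub>C) = \<zero>\<^sub>C"
proof -
 have "lin K C g (%_. \<zero>\<^sub>C) = (\<Oplus>\<^bsub>C\<^esub>x\<in>{x. g x ~= \<zero>\<^sub>K}. \<zero>\<^sub>C)"
  unfolding lin_def
  by(rule C.M.finsum_cong'[OF refl])(use L.P_val[OF assms] C.smult_r_null in auto)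
 thus ?thesis by simp
qed

text \<open>Multiplying by a basis pair carries a bilinear function to a bilinear function, so Fubini's formula
  shows that the relations stay in the kernel after multiplication by any element.\<close>

lemma lin_relation:
 assumes bil: "bilinear_map K A B C \<phi>" and r: "r : bilinear_relations K A B"
 shows "lin K C r (%p. \<phi> (fst p) (snd p)) = \<zero>\<^sub>C"
proof -
 let ?\<phi> = "%p. \<phi> (fst p) (snd p)"
 note b = bilinear_mapD[OF bil]
 have c: "!!x. x : carrier (A \<times>\<times> B) ==> ?\<phi> x : carrier C" using b(1) by auto
 have m: "lin K C (f \<ominus>\<^bsub>FP\<^esub> g) ?\<phi> = lin K C f ?\<phi> \<ominus>\<^sub>C lin K C g ?\<phi>"
  if "f : carrier FP" "g : carrier FP" for f g
  by(rule L.lin_minus[OF that c])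
 have p: "lin K C (f \<oplus>\<^bsub>FP\<^esub> g) ?\<phi> = lin K C f ?\<phi> \<oplus>\<^sub>C lin K C g ?\<phi>"
  if "f : carrier FP" "g : carrier FP" for f g
  by(rule L.lin_add[OF that c])
 have s: "lin K C (k \<odot>\<^bsub>FP\<^esub> f) ?\<phi> = k \<odot>\<^sub>C lin K C f ?\<phi>"
  if "k : carrier K" "f : carrier FP" for f k
  by(rule L.lin_smult[OF that c])
 have l: "lin K C (bas x y) ?\<phi> = \<phi> x y" if "x : carrier A" "y : carrier B" for x y
  using lin_bas[of x y ?\<phi>] that b(1) by simp
 have z: "u \<ominus>\<^sub>C u = \<zero>\<^sub>C" if "u : carrier C" for u
  using that by(simp add: a_minus_def C.M.r_neg)
 consider
  (1) x x' y where "r = bas (x \<oplus>\<^sub>A x') y \<ominus>\<^bsub>FP\<^esub> (bas x y \<oplus>\<^bsub>FP\<^esub> bas x' y)" "x : carrier A" "x' : carrier A" "y : carrier B"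
 | (2) x y y' where "r = bas x (y \<oplus>\<^sub>B y') \<ominus>\<^bsub>FP\<^esub> (bas x y \<oplus>\<^bsub>FP\<^esub> bas x y')" "x : carrier A" "y : carrier B" "y' : carrier B"
 | (3) k x y where "r = bas (k \<odot>\<^sub>A x) y \<ominus>\<^bsub>FP\<^esub> (k \<odot>\<^bsub>FP\<^esub> bas x y)" "k : carrier K" "x : carrier A" "y : carrier B"
 | (4) k x y where "r = bas x (k \<odot>\<^sub>B y) \<ominus>\<^bsub>FP\<^esub> (k \<odot>\<^bsub>FP\<^esub> bas x y)" "k : carrier K" "x : carrier A" "y : carrier B"
  using r unfolding bilinear_relations_def FP_eq by blast
 thus ?thesis
 proof cases
  case 1
  thus ?thesis using b by(simp add: m p l z bas_closed)
 next
  case 2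
  thus ?thesis using b by(simp add: m p l z bas_closed)
 next
  case 3
  thus ?thesis using b by(simp add: m s l z bas_closed FP_smult)
 next
  case 4
  thus ?thesis using b by(simp add: m s l z bas_closed FP_smult)
 qed
qed

lemma bilinear_shift:
 assumes bil: "bilinear_map K A B C \<phi>" and x: "x : carrier A" "y : carrier B"
 shows "bilinear_map K A B C (%a b. \<phi> (x \<otimes>\<^sub>A a) (y \<otimes>\<^sub>B b))"
proof (rule bilinear_mapI)
 note b = bilinear_mapD[OF bil]
 show "\<phi> (x \<otimes>\<^sub>A (k \<odot>\<^sub>A a)) (y \<otimes>\<^sub>B b') = k \<odot>\<^sub>C \<phi> (x \<otimes>\<^sub>A a) (y \<otimes>\<^sub>B b')"
  if "k : carrier K" "a : carrier A" "b' : carrier B" for k a b'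
 proof -
  have "x \<otimes>\<^sub>A (k \<odot>\<^sub>A a) = k \<odot>\<^sub>A (x \<otimes>\<^sub>A a)"
   using that x A.smult_assoc2[of k a x] by(simp add: A.m_comm)
  thus ?thesis using that x b by simp
 qed
 show "\<phi> (x \<otimes>\<^sub>A a) (y \<otimes>\<^sub>B (k \<odot>\<^sub>B b')) = k \<odot>\<^sub>C \<phi> (x \<otimes>\<^sub>A a) (y \<otimes>\<^sub>B b')"
  if "k : carrier K" "a : carrier A" "b' : carrier B" for k a b'
 proof -
  have "y \<otimes>\<^sub>B (k \<odot>\<^sub>B b') = k \<odot>\<^sub>B (y \<otimes>\<^sub>B b')"
   using that x B.smult_assoc2[of k b' y] by(simp add: B.m_comm)
  thus ?thesis using that x b by simp
 qed
qed (use x bilinear_mapD[OF bil] in "simp_all add: A.r_distr B.r_distr")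

text \<open>The tensor ideal is generated as an ideal, so the vanishing has to be shown for all multiples of the
  relations.\<close>

lemma lin_vanishes:
 assumes bil: "bilinear_map K A B C \<phi>" and f: "f : TI"
 shows "lin K C f (%p. \<phi> (fst p) (snd p)) = \<zero>\<^sub>C"
proof -
 let ?\<phi> = "%p. \<phi> (fst p) (snd p)"
 have c: "!!x. x : carrier (A \<times>\<times> B) ==> ?\<phi> x : carrier C" using bilinear_mapD(1)[OF bil] by auto
 define N where "N = {f : carrier FP. ALL g:carrier FP. lin K C (g \<otimes>\<^bsub>FP\<^esub> f) ?\<phi> = \<zero>\<^sub>C}"
 have "ideal N FP"
 proof (rule idealI[OF FPr.ring_axioms])
  show "subgroup N (add_monoid FP)"
  proof (rule F.P.add.subgroupI)
   show "N <= carrier FP" unfolding N_def by auto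
   have "\<zero>\<^bsub>FP\<^esub> : N" unfolding N_def using L.lin_zero[OF c] by auto
   thus "N ~= {}" by auto
   show "\<ominus>\<^bsub>FP\<^esub> f : N" if "f : N" for f
   proof -
    have fc: "f : carrier FP" and f0: "!!g. g : carrier FP ==> lin K C (g \<otimes>\<^bsub>FP\<^esub> f) ?\<phi> = \<zero>\<^sub>C"
     using that unfolding N_def by auto
    have "lin K C (g \<otimes>\<^bsub>FP\<^esub> (\<ominus>\<^bsub>FP\<^esub> f)) ?\<phi> = \<zero>\<^sub>C" if g: "g : carrier FP" for g
    proof -
     have "g \<otimes>\<^bsub>FP\<^esub> (\<ominus>\<^bsub>FP\<^esub> f) = (\<ominus>\<^bsub>FP\<^esub> g) \<otimes>\<^bsub>FP\<^esub> f"
      using fc g by(simp add: FPr.l_minus FPr.r_minus)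
     thus ?thesis using f0[of "\<ominus>\<^bsub>FP\<^esub> g"] g by simp
    qed
    thus ?thesis unfolding N_def using fc by auto
   qed
   show "f \<oplus>\<^bsub>FP\<^esub> f' : N" if "f : N" "f' : N" for f f'
   proof -
    have fc: "f : carrier FP" "f' : carrier FP"
     and f0: "!!g. g : carrier FP ==> lin K C (g \<otimes>\<^bsub>FP\<^esub> f) ?\<phi> = \<zero>\<^sub>C"
      "!!g. g : carrier FP ==> lin K C (g \<otimes>\<^bsub>FP\<^esub> f') ?\<phi> = \<zero>\<^sub>C"
     using that unfolding N_def by auto
    have "lin K C (g \<otimes>\<^bsub>FP\<^esub> (f \<oplus>\<^bsub>FP\<^esub> f')) ?\<phi> = \<zero>\<^sub>C" if g: "g : carrier FP" for g
     using fc g f0[OF g] L.lin_add[of "g \<otimes>\<^bsub>FP\<^esub> f" "g \<otimes>\<^bsub>FP\<^esub> f'" ?\<phi>] c by(simp add: FPr.r_distr)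
    thus ?thesis unfolding N_def using fc by auto
   qed
  qed
  fix f x assume f: "f : N" and x: "x : carrier FP"
  have fc: "f : carrier FP" and f0: "!!g. g : carrier FP ==> lin K C (g \<otimes>\<^bsub>FP\<^esub> f) ?\<phi> = \<zero>\<^sub>C"
   using f unfolding N_def by auto
  have "lin K C (g \<otimes>\<^bsub>FP\<^esub> (x \<otimes>\<^bsub>FP\<^esub> f)) ?\<phi> = \<zero>\<^sub>C" if g: "g : carrier FP" for g
   using f0[of "g \<otimes>\<^bsub>FP\<^esub> x"] g x fc by(simp add: FPr.m_assoc)
  thus "x \<otimes>\<^bsub>FP\<^esub> f : N" unfolding N_def using fc x by auto
  thus "f \<otimes>\<^bsub>FP\<^esub> x : N" using fc x by(simp add: FPr.m_comm)
 qed
 moreover have "bilinear_relations K A B <= N"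
 proof
  fix r assume r: "r : bilinear_relations K A B"
  have rc: "r : carrier FP" using r relations_closed by auto
  have "lin K C (g \<otimes>\<^bsub>FP\<^esub> r) ?\<phi> = \<zero>\<^sub>C" if g: "g : carrier FP" for g
  proof -
   have "lin K C (g \<otimes>\<^bsub>FP\<^esub> r) ?\<phi> = lin K C g (%x. lin K C r (%y. ?\<phi> (x \<otimes>\<^bsub>A \<times>\<times> B\<^esub> y)))"
    by(rule L.lin_mult[OF g rc c])
   also have "... = lin K C g (%_. \<zero>\<^sub>C)"
   proof (rule L.lin_cong[OF g])
    fix x assume "x : carrier (A \<times>\<times> B)"
    then obtain x1 x2 where x: "x = (x1, x2)" "x1 : carrier A" "x2 : carrier B" by auto
    have "(%y. ?\<phi> (x \<otimes>\<^bsub>A \<times>\<times> B\<^esub> y)) = (%p. \<phi> (x1 \<otimes>\<^sub>A fst p) (x2 \<otimes>\<^sub>B snd p))"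
     unfolding x(1) by(auto simp: DirProd_def)
    thus "lin K C r (%y. ?\<phi> (x \<otimes>\<^bsub>A \<times>\<times> B\<^esub> y)) = \<zero>\<^sub>C"
     using lin_relation[OF bilinear_shift[OF bil x(2,3)] r] by simp
   qed auto
   also have "... = \<zero>\<^sub>C" by(rule lin_zero_fun[OF g])
   finally show ?thesis .
  qed
  thus "r : N" unfolding N_def using rc by auto
 qed
 ultimately have "TI <= N" unfolding tensor_ideal_def FP_eq by(rule FPr.genideal_minimal)
 hence fN: "f : N" using f by blast
 have all: "ALL g:carrier FP. lin K C (g \<otimes>\<^bsub>FP\<^esub> f) ?\<phi> = \<zero>\<^sub>C"
  using fN unfolding N_def mem_Collect_eq by(rule conjunct2)
 have "lin K C (\<one>\<^bsub>FP\<^esub> \<otimes>\<^bsub>FP\<^esub> f) ?\<phi> = \<zero>\<^sub>C"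
  by(rule all[rule_format, OF F.P_one_cl])
 thus ?thesis by(simp only: FPr.l_one[OF TI_Hcarr[OF f]])
qed

lemma lift_coset:
 assumes bil: "bilinear_map K A B C \<phi>" and f: "f : carrier FP"
 shows "tensor_lift K A B C \<phi> (TI +>\<^bsub>FP\<^esub> f) = lin K C f (%p. \<phi> (fst p) (snd p))"
proof -
 let ?\<phi> = "%p. \<phi> (fst p) (snd p)"
 have c: "!!x. x : carrier (A \<times>\<times> B) ==> ?\<phi> x : carrier C" using bilinear_mapD(1)[OF bil] by auto
 have e: "lin K C g ?\<phi> = lin K C f ?\<phi>" if g: "g : TI +>\<^bsub>FP\<^esub> f" for g
 proof -
  obtain i where i: "i : TI" "g = i \<oplus>\<^bsub>FP\<^esub> f" using g by(auto simp: a_r_coset_def r_coset_def)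
  have "lin K C g ?\<phi> = lin K C i ?\<phi> \<oplus>\<^sub>C lin K C f ?\<phi>"
   unfolding i(2) by(rule L.lin_add[OF TI_Hcarr[OF i(1)] f c])
  thus ?thesis using lin_vanishes[OF bil i(1)] L.lin_closed[OF f c] by simp
 qed
 have "f : TI +>\<^bsub>FP\<^esub> f" using TI_self[OF f] .
 hence "(%g. lin K C g ?\<phi>) ` (TI +>\<^bsub>FP\<^esub> f) = {lin K C f ?\<phi>}" using e by blast
 hence "the_elem ((%g. lin K C g ?\<phi>) ` (TI +>\<^bsub>FP\<^esub> f)) = lin K C f ?\<phi>" by simp
 thus ?thesis unfolding tensor_lift_def lin_def .
qed

end

context algebra_pair
begin

abbreviation proj where "proj f == TI +>\<^bsub>FP\<^esub> f"

lemma tensor_simps: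
 "carrier T = carrier (FP Quot TI)" "monoid.mult T = monoid.mult (FP Quot TI)"
 "one T = one (FP Quot TI)" "ring.zero T = ring.zero (FP Quot TI)" "add T = add (FP Quot TI)"
 unfolding tensor_def FP_eq by(rule ring_extend_simps)+

lemma tensor_cring: "cring T"
 unfolding tensor_def FP_eq by(rule cring_extend[OF ideal.quotient_is_cring[OF TI_ideal FP_cring]])

sublocale T: cring T by(rule tensor_cring)

lemma proj_hom: "proj : ring_hom FP T"
 using ideal.rcos_ring_hom[OF TI_ideal] unfolding ring_hom_def by(simp add: tensor_simps)

lemma proj_ring_hom: "ring_hom_cring FP T proj"
 by(rule ring_hom_cring.intro[OF FP_cring tensor_cring]) (rule ring_hom_cring_axioms.intro[OF proj_hom])

sublocale proj: ring_hom_cring FP T proj by(rule proj_ring_hom)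

lemma tensor_coset:
 assumes "t : carrier T" obtains f where "f : carrier FP" "t = proj f"
 using assms unfolding tensor_simps FactRing_def by(auto simp: A_RCOSETS_def' )

lemma tensor_smult_coset:
 assumes c: "c : carrier K" and f: "f : carrier FP"
 shows "c \<odot>\<^sub>T proj f = proj (c \<odot>\<^bsub>FP\<^esub> f)"
proof -
 have s: "proj (c \<odot>\<^bsub>FP\<^esub> g) = proj (c \<odot>\<^bsub>FP\<^esub> \<one>\<^bsub>FP\<^esub>) \<otimes>\<^sub>T proj g" if "g : carrier FP" for g
  unfolding F.P_smult_one[OF c that] by(rule proj.hom_mult[OF FP_smult[OF c F.P_one_cl] that])
 have "c \<odot>\<^sub>T proj f = (\<Union>g\<in>proj f. proj (c \<odot>\<^bsub>FP\<^esub> g))"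
  unfolding tensor_def FP_eq ring.extend_def module.fields_def by simp
 also have "... = proj (c \<odot>\<^bsub>FP\<^esub> f)"
 proof -
  have "proj (c \<odot>\<^bsub>FP\<^esub> g) = proj (c \<odot>\<^bsub>FP\<^esub> f)" if g: "g : proj f" for g
  proof -
   have gc: "g : carrier FP"
    using g f TI_Hcarr by(auto simp: a_r_coset_def r_coset_def)
   have e: "proj g = proj f" using F.P.a_repr_independence[OF g f additive_subgroup.a_subgroup[OF TI_additive]] by(rule sym)
   show ?thesis unfolding s[OF gc] s[OF f] e ..
  qed
  hence "(\<Union>g\<in>proj f. proj (c \<odot>\<^bsub>FP\<^esub> g)) = (\<Union>g\<in>proj f. proj (c \<odot>\<^bsub>FP\<^esub> f))" by(rule SUP_cong[OF refl])
  also have "... = proj (c \<odot>\<^bsub>FP\<^esub> f)" by(rule UN_constant[THEN trans])(use TI_self[OF f] in auto)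
  finally show ?thesis .
 qed
 finally show ?thesis .
qed

lemma tensor_module: "module K T"
proof (rule moduleI[OF A.R.is_cring T.abelian_group_axioms])
 note ts = tensor_smult_coset
 fix c t assume c: "c : carrier K" and t: "t : carrier T"
 obtain f where f: "f : carrier FP" "t = proj f" using t by(elim tensor_coset)
 have fv: "!!x. f x : carrier K" using f(1) unfolding monoid_algebra_simps(1) by blast
 have cf: "c \<odot>\<^bsub>FP\<^esub> f : carrier FP" by(rule FP_smult[OF c f(1)])
 show "c \<odot>\<^sub>T t : carrier T"
  unfolding f(2) ts[OF c f(1)] by(rule proj.hom_closed[OF cf])
 show "(c \<oplus>\<^sub>K d) \<odot>\<^sub>T t = c \<odot>\<^sub>T t \<oplus>\<^sub>T d \<odot>\<^sub>T t" if d: "d : carrier K" for d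
 proof -
  have "(c \<oplus>\<^sub>K d) \<odot>\<^bsub>FP\<^esub> f = c \<odot>\<^bsub>FP\<^esub> f \<oplus>\<^bsub>FP\<^esub> d \<odot>\<^bsub>FP\<^esub> f"
   unfolding monoid_algebra_simps(2,5) using fv c d by(simp add: A.R.l_distr)
  thus ?thesis
   unfolding f(2) ts[OF c f(1)] ts[OF d f(1)] ts[OF A.R.a_closed[OF c d] f(1)]
   by(simp only: proj.hom_add[OF cf FP_smult[OF d f(1)]])
 qed
 show "(c \<otimes>\<^sub>K d) \<odot>\<^sub>T t = c \<odot>\<^sub>T (d \<odot>\<^sub>T t)" if d: "d : carrier K" for d
 proof -
  have "(c \<otimes>\<^sub>K d) \<odot>\<^bsub>FP\<^esub> f = c \<odot>\<^bsub>FP\<^esub> (d \<odot>\<^bsub>FP\<^esub> f)"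
   unfolding monoid_algebra_simps(5) using fv c d by(simp add: A.R.m_assoc)
  thus ?thesis
   unfolding f(2) ts[OF d f(1)] ts[OF A.R.m_closed[OF c d] f(1)] ts[OF c FP_smult[OF d f(1)]]
   by(simp only:)
 qed
 show "c \<odot>\<^sub>T (t \<oplus>\<^sub>T t') = c \<odot>\<^sub>T t \<oplus>\<^sub>T c \<odot>\<^sub>T t'" if t': "t' : carrier T" for t'
 proof -
  obtain f' where f': "f' : carrier FP" "t' = proj f'" using t' by(elim tensor_coset)
  have fv': "!!x. f' x : carrier K" using f'(1) unfolding monoid_algebra_simps(1) by blast
  have "c \<odot>\<^bsub>FP\<^esub> (f \<oplus>\<^bsub>FP\<^esub> f') = c \<odot>\<^bsub>FP\<^esub> f \<oplus>\<^bsub>FP\<^esub> c \<odot>\<^bsub>FP\<^esub> f'"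
   unfolding monoid_algebra_simps(2,5) using fv fv' c by(simp add: A.R.r_distr)
  thus ?thesis
   unfolding f(2) f'(2) proj.hom_add[OF f(1) f'(1), symmetric] ts[OF c f(1)] ts[OF c f'(1)]
    ts[OF c F.P.a_closed[OF f(1) f'(1)]]
   by(simp only: proj.hom_add[OF cf FP_smult[OF c f'(1)]])
 qed
next
 fix t assume "t : carrier T"
 then obtain f where f: "f : carrier FP" "t = proj f" by(elim tensor_coset)
 have fv: "!!x. f x : carrier K" using f(1) unfolding monoid_algebra_simps(1) by blast
 have "\<one>\<^sub>K \<odot>\<^bsub>FP\<^esub> f = f" unfolding monoid_algebra_simps(5) using fv by simp
 thus "\<one>\<^sub>K \<odot>\<^sub>T t = t"
  unfolding f(2) tensor_smult_coset[OF A.R.one_closed f(1)] by(simp only:)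
qed

lemma tensor_algebra: "algebra K T"
proof (rule algebra.intro[OF tensor_module tensor_cring])
 show "algebra_axioms K T"
 proof (rule algebra_axioms.intro)
  fix c t t' assume c: "c : carrier K" and t: "t : carrier T" and t': "t' : carrier T"
  obtain f where f: "f : carrier FP" "t = proj f" using t by(elim tensor_coset)
  obtain f' where f': "f' : carrier FP" "t' = proj f'" using t' by(elim tensor_coset)
  have one: "c \<odot>\<^bsub>FP\<^esub> \<one>\<^bsub>FP\<^esub> : carrier FP" by(rule FP_smult[OF c F.P_one_cl])
  have e: "(c \<odot>\<^bsub>FP\<^esub> f) \<otimes>\<^bsub>FP\<^esub> f' = c \<odot>\<^bsub>FP\<^esub> (f \<otimes>\<^bsub>FP\<^esub> f')"
   unfolding F.P_smult_one[OF c f(1)] F.P_smult_one[OF c F.P_mult_cl[OF f(1) f'(1)]]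
   by(rule FPr.m_assoc[OF one f(1) f'(1)])
  show "(c \<odot>\<^sub>T t) \<otimes>\<^sub>T t' = c \<odot>\<^sub>T (t \<otimes>\<^sub>T t')"
   unfolding f(2) f'(2) proj.hom_mult[OF f(1) f'(1), symmetric] tensor_smult_coset[OF c f(1)]
    tensor_smult_coset[OF c F.P_mult_cl[OF f(1) f'(1)]] e[symmetric]
   by(rule proj.hom_mult[OF FP_smult[OF c f(1)] f'(1), symmetric])
 qed
qed

abbreviation "pure == pure_tensor K A B"

lemma pure_proj: "pure x y = proj (bas x y)"
 unfolding pure_tensor_def FP_eq ..

lemma pure_closed [simp]: "[|x : carrier A; y : carrier B|] ==> pure x y : carrier T"
 unfolding pure_proj using bas_closed by simp

lemma proj_eqI:
 assumes "f \<ominus>\<^bsub>FP\<^esub> g : bilinear_relations K A B" "f : carrier FP" "g : carrier FP"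
 shows "proj f = proj g"
proof -
 have "f \<ominus>\<^bsub>FP\<^esub> g : TI"
  unfolding tensor_ideal_def FP_eq using FPr.genideal_self[OF relations_closed] assms(1) by auto
 thus ?thesis
  using FPr.quotient_eq_iff_same_a_r_cos[OF TI_ideal assms(2,3)] by blast
qed

lemma pure_bilinear: "bilinear_map K A B T pure"
proof (rule bilinear_mapI)
 fix x x' y assume h: "x : carrier A" "x' : carrier A" "y : carrier B"
 note b = bas_closed[OF h(1,3)] bas_closed[OF h(2,3)] bas_closed[OF A.M.a_closed[OF h(1,2)] h(3)]
 have "bas (x \<oplus>\<^sub>A x') y \<ominus>\<^bsub>FP\<^esub> (bas x y \<oplus>\<^bsub>FP\<^esub> bas x' y) : bilinear_relations K A B"
  unfolding bilinear_relations_def FP_eq using h by blast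
 from proj_eqI[OF this b(3) F.P.a_closed[OF b(1,2)]]
 show "pure (x \<oplus>\<^sub>A x') y = pure x y \<oplus>\<^sub>T pure x' y"
  unfolding pure_proj proj.hom_add[OF b(1,2), symmetric] .
next
 fix x y y' assume h: "x : carrier A" "y : carrier B" "y' : carrier B"
 note b = bas_closed[OF h(1,2)] bas_closed[OF h(1,3)] bas_closed[OF h(1) B.M.a_closed[OF h(2,3)]]
 have "bas x (y \<oplus>\<^sub>B y') \<ominus>\<^bsub>FP\<^esub> (bas x y \<oplus>\<^bsub>FP\<^esub> bas x y') : bilinear_relations K A B"
  unfolding bilinear_relations_def FP_eq using h by blast
 from proj_eqI[OF this b(3) F.P.a_closed[OF b(1,2)]]
 show "pure x (y \<oplus>\<^sub>B y') = pure x y \<oplus>\<^sub>T pure x y'"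
  unfolding pure_proj proj.hom_add[OF b(1,2), symmetric] .
next
 fix c x y assume h: "c : carrier K" "x : carrier A" "y : carrier B"
 note b = bas_closed[OF h(2,3)] bas_closed[OF A.smult_closed[OF h(1,2)] h(3)]
  bas_closed[OF h(2) B.smult_closed[OF h(1,3)]]
 have "bas (c \<odot>\<^sub>A x) y \<ominus>\<^bsub>FP\<^esub> (c \<odot>\<^bsub>FP\<^esub> bas x y) : bilinear_relations K A B"
  unfolding bilinear_relations_def FP_eq using h by blast
 from proj_eqI[OF this b(2) FP_smult[OF h(1) b(1)]]
 show "pure (c \<odot>\<^sub>A x) y = c \<odot>\<^sub>T pure x y"
  unfolding pure_proj tensor_smult_coset[OF h(1) b(1)] .
 have "bas x (c \<odot>\<^sub>B y) \<ominus>\<^bsub>FP\<^esub> (c \<odot>\<^bsub>FP\<^esub> bas x y) : bilinear_relations K A B"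
  unfolding bilinear_relations_def FP_eq using h by blast
 from proj_eqI[OF this b(3) FP_smult[OF h(1) b(1)]]
 show "pure x (c \<odot>\<^sub>B y) = c \<odot>\<^sub>T pure x y"
  unfolding pure_proj tensor_smult_coset[OF h(1) b(1)] .
qed (rule pure_closed)

lemma pure_mult:
 assumes h: "x : carrier A" "y : carrier B" "x' : carrier A" "y' : carrier B"
 shows "pure x y \<otimes>\<^sub>T pure x' y' = pure (x \<otimes>\<^sub>A x') (y \<otimes>\<^sub>B y')"
proof -
 interpret S: monoid_alg_module K "A \<times>\<times> B" "self_module K" by(rule F.scalar_module)
 let ?l = "lin K (self_module K)"
 have "bas x y \<otimes>\<^bsub>FP\<^esub> bas x' y' = bas (x \<otimes>\<^sub>A x') (y \<otimes>\<^sub>B y')"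
 proof (rule F.P_ext)
  fix \<phi> :: "'a \<times> 'b => 'k" assume c: "!!x. \<phi> x : carrier K"
  have b: "?l (bas u w) \<psi> = \<psi> (u, w)" if "u : carrier A" "w : carrier B" "\<psi> (u, w) : carrier K" for u w \<psi>
   unfolding bas_eq using S.lin_basis[of "(u, w)" \<psi>] that by simp
  have "?l (bas x y \<otimes>\<^bsub>FP\<^esub> bas x' y') \<phi> = ?l (bas x y) (%p. ?l (bas x' y') (%q. \<phi> (p \<otimes>\<^bsub>A \<times>\<times> B\<^esub> q)))"
   using S.lin_mult[of "bas x y" "bas x' y'" \<phi>] h bas_closed c by simp
  also have "... = ?l (bas x y) (%p. \<phi> (p \<otimes>\<^bsub>A \<times>\<times> B\<^esub> (x', y')))"
   using b[OF h(3,4)] c by simp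
  also have "... = \<phi> (x \<otimes>\<^sub>A x', y \<otimes>\<^sub>B y')"
   using b[OF h(1,2), of "%p. \<phi> (p \<otimes>\<^bsub>A \<times>\<times> B\<^esub> (x', y'))"] c by simp
  also have "... = ?l (bas (x \<otimes>\<^sub>A x') (y \<otimes>\<^sub>B y')) \<phi>"
   using b[of "x \<otimes>\<^sub>A x'" "y \<otimes>\<^sub>B y'" \<phi>] h c by simp
  finally show "?l (bas x y \<otimes>\<^bsub>FP\<^esub> bas x' y') \<phi> = ?l (bas (x \<otimes>\<^sub>A x') (y \<otimes>\<^sub>B y')) \<phi>" .
 qed (use h bas_closed in auto)
 thus ?thesis unfolding pure_proj using h bas_closed by(metis proj.hom_mult)
qed

lemma tensor_decompose:
 assumes "t : carrier T"
 obtains I :: "nat set" and x y where "finite I" "!!i. i : I ==> x i : carrier A"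
  "!!i. i : I ==> y i : carrier B" "t = (\<Oplus>\<^bsub>T\<^esub>i\<in>I. pure (x i) (y i))"
proof -
 obtain f where f: "f : carrier FP" "t = proj f" using assms by(elim tensor_coset)
 note fv = f(1)[unfolded monoid_algebra_simps(1)]
 let ?S = "{p. f p ~= \<zero>\<^sub>K}"
 have S: "finite ?S" "?S <= carrier A \<times> carrier B" using fv by auto
 obtain e where e: "bij_betw e {0..<card ?S} ?S" using ex_bij_betw_nat_finite[OF S(1)] by blast
 have dec: "f = (\<Oplus>\<^bsub>FP\<^esub>m\<in>?S. f m \<odot>\<^bsub>FP\<^esub> bas (fst m) (snd m))"
  using F.P_decompose[OF f(1)] unfolding bas_eq by simp
 have b: "f m \<odot>\<^bsub>FP\<^esub> bas (fst m) (snd m) : carrier FP" if "m : ?S" for m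
  using that S fv by(intro FP_smult bas_closed) auto
 have pc: "pure (f m \<odot>\<^sub>A fst m) (snd m) : carrier T" if "m : ?S" for m
  using that S fv by(intro pure_closed) auto
 have "t = proj (\<Oplus>\<^bsub>FP\<^esub>m\<in>?S. f m \<odot>\<^bsub>FP\<^esub> bas (fst m) (snd m))" using f(2) dec by simp
 also have "... = (\<Oplus>\<^bsub>T\<^esub>m\<in>?S. (proj \<circ> (%m. f m \<odot>\<^bsub>FP\<^esub> bas (fst m) (snd m))) m)"
  by(rule proj.hom_finsum)(use b in auto)
 also have "... = (\<Oplus>\<^bsub>T\<^esub>m\<in>?S. pure (f m \<odot>\<^sub>A fst m) (snd m))"
 proof (rule T.finsum_cong'[OF refl])
  fix m assume m: "m : ?S"
  have "pure (f m \<odot>\<^sub>A fst m) (snd m) = f m \<odot>\<^sub>T pure (fst m) (snd m)"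
   by(rule bilinear_mapD(4)[OF pure_bilinear])(use m S fv in auto)
  also have "... = proj (f m \<odot>\<^bsub>FP\<^esub> bas (fst m) (snd m))"
   unfolding pure_proj by(rule tensor_smult_coset)(use m S fv bas_closed in auto)
  finally show "(proj \<circ> (%m. f m \<odot>\<^bsub>FP\<^esub> bas (fst m) (snd m))) m = pure (f m \<odot>\<^sub>A fst m) (snd m)"
   by simp
 qed (use pc in auto)
 also have "... = (\<Oplus>\<^bsub>T\<^esub>m\<in>e ` {0..<card ?S}. pure (f m \<odot>\<^sub>A fst m) (snd m))"
  using e by(simp add: bij_betw_def)
 also have "... = (\<Oplus>\<^bsub>T\<^esub>i\<in>{0..<card ?S}. pure (f (e i) \<odot>\<^sub>A fst (e i)) (snd (e i)))"
  by(rule T.finsum_reindex)(use e pc in "auto simp: bij_betw_def")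
 finally have t: "t = (\<Oplus>\<^bsub>T\<^esub>i\<in>{0..<card ?S}. pure (f (e i) \<odot>\<^sub>A fst (e i)) (snd (e i)))" .
 have eS: "e i : ?S" if "i : {0..<card ?S}" for i using e that by(auto simp: bij_betw_def)
 show thesis
 proof (rule that[OF _ _ _ t])
  show "f (e i) \<odot>\<^sub>A fst (e i) : carrier A" "snd (e i) : carrier B" if "i : {0..<card ?S}" for i
   using eS[OF that] S fv by auto
 qed auto
qed

end

context algebra_pair_module
begin

abbreviation "lift == tensor_lift K A B C"

context
 fixes \<phi> assumes bil: "bilinear_map K A B C \<phi>"
begin

lemma phi_closed: "!!x. x : carrier (A \<times>\<times> B) ==> \<phi> (fst x) (snd x) : carrier C"
 using bilinear_mapD(1)[OF bil] by auto

lemma lift_closed: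
 assumes "t : carrier T" shows "lift \<phi> t : carrier C"
proof -
 obtain f where f: "f : carrier FP" "t = proj f" using assms by(elim tensor_coset)
 show ?thesis unfolding f(2) lift_coset[OF bil f(1)] by(rule L.lin_closed[OF f(1) phi_closed])
qed

lemma lift_add:
 assumes "t : carrier T" "t' : carrier T"
 shows "lift \<phi> (t \<oplus>\<^sub>T t') = lift \<phi> t \<oplus>\<^sub>C lift \<phi> t'"
proof -
 obtain f where f: "f : carrier FP" "t = proj f" using assms(1) by(elim tensor_coset)
 obtain f' where f': "f' : carrier FP" "t' = proj f'" using assms(2) by(elim tensor_coset)
 show ?thesis
  unfolding f(2) f'(2) proj.hom_add[OF f(1) f'(1), symmetric] lift_coset[OF bil f(1)]
   lift_coset[OF bil f'(1)] lift_coset[OF bil F.P.a_closed[OF f(1) f'(1)]]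
  by(rule L.lin_add[OF f(1) f'(1) phi_closed])
qed

lemma lift_smult:
 assumes "c : carrier K" "t : carrier T"
 shows "lift \<phi> (c \<odot>\<^sub>T t) = c \<odot>\<^sub>C lift \<phi> t"
proof -
 obtain f where f: "f : carrier FP" "t = proj f" using assms(2) by(elim tensor_coset)
 show ?thesis
  unfolding f(2) tensor_smult_coset[OF assms(1) f(1)] lift_coset[OF bil f(1)]
   lift_coset[OF bil FP_smult[OF assms(1) f(1)]]
  by(rule L.lin_smult[OF assms(1) f(1) phi_closed])
qed

lemma lift_pure:
 assumes "x : carrier A" "y : carrier B" shows "lift \<phi> (pure x y) = \<phi> x y"
proof -
 have "lin K C (bas x y) (%p. \<phi> (fst p) (snd p)) = (%p. \<phi> (fst p) (snd p)) (x, y)"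
  by(rule lin_bas)(use assms bilinear_mapD(1)[OF bil] in simp_all)
 thus ?thesis unfolding pure_proj lift_coset[OF bil bas_closed[OF assms]] by simp
qed

lemma lift_finsum:
 assumes "finite I" "!!i. i : I ==> x i : carrier A" "!!i. i : I ==> y i : carrier B"
 shows "lift \<phi> (\<Oplus>\<^bsub>T\<^esub>i\<in>I. pure (x i) (y i)) = (\<Oplus>\<^bsub>C\<^esub>i\<in>I. \<phi> (x i) (y i))"
 using assms
proof (induction I)
 case empty
 have "lift \<phi> \<zero>\<^sub>T = lift \<phi> (proj \<zero>\<^bsub>FP\<^esub>)" by simp
 also have "... = lin K C \<zero>\<^bsub>FP\<^esub> (%p. \<phi> (fst p) (snd p))" by(rule lift_coset[OF bil]) simp
 also have "... = \<zero>\<^sub>C" by(rule L.lin_zero[OF phi_closed])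
 finally show ?case by simp
next
 case (insert a I)
 have c: "x i : carrier A" "y i : carrier B" if "i : insert a I" for i using insert.prems that by blast+
 have pc: "pure (x i) (y i) : carrier T" "\<phi> (x i) (y i) : carrier C" if "i : insert a I" for i
  using pure_closed bilinear_mapD(1)[OF bil] c[OF that] by blast+
 have "(\<Oplus>\<^bsub>T\<^esub>i\<in>I. pure (x i) (y i)) : carrier T"
  by(rule T.finsum_closed)(use pc in blast)
 moreover have "(\<Oplus>\<^bsub>T\<^esub>i\<in>insert a I. pure (x i) (y i)) = pure (x a) (y a) \<oplus>\<^sub>T (\<Oplus>\<^bsub>T\<^esub>i\<in>I. pure (x i) (y i))"
  by(rule T.finsum_insert)(use insert.hyps pc in blast)+
 moreover have "(\<Oplus>\<^bsub>C\<^esub>i\<in>insert a I. \<phi> (x i) (y i)) = \<phi> (x a) (y a) \<oplus>\<^sub>C (\<Oplus>\<^bsub>C\<^esub>i\<in>I. \<phi> (x i) (y i))"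
  by(rule C.M.finsum_insert)(use insert.hyps pc in blast)+
 moreover have "lift \<phi> (\<Oplus>\<^bsub>T\<^esub>i\<in>I. pure (x i) (y i)) = (\<Oplus>\<^bsub>C\<^esub>i\<in>I. \<phi> (x i) (y i))"
  by(rule insert.IH)(use c in blast)+
 ultimately show ?case
  using lift_add[OF pc(1)[of a]] lift_pure[OF c[of a]] by simp
qed

end

end

section \<open>Linear and bilinear maps\<close>

lemma k_linearD:
 assumes "k_linear K A B f"
 shows "x : carrier A ==> f x : carrier B"
  "[|x : carrier A; y : carrier A|] ==> f (x \<oplus>\<^sub>A y) = f x \<oplus>\<^sub>B f y"
  "[|c : carrier K; x : carrier A|] ==> f (c \<odot>\<^sub>A x) = c \<odot>\<^sub>B f x"
 using assms unfolding k_linear_def by blast+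

lemma k_linearI:
 assumes "!!x. x : carrier A ==> f x : carrier B"
  "!!x y. [|x : carrier A; y : carrier A|] ==> f (x \<oplus>\<^sub>A y) = f x \<oplus>\<^sub>B f y"
  "!!c x. [|c : carrier K; x : carrier A|] ==> f (c \<odot>\<^sub>A x) = c \<odot>\<^sub>B f x"
 shows "k_linear K A B f"
 using assms unfolding k_linear_def by blast

lemma k_linear_id: "k_linear K A A (%x. x)"
 by(rule k_linearI) simp_all

lemma k_linear_zero:
 assumes "module K A" "module K B" "k_linear K A B f"
 shows "f \<zero>\<^sub>A = \<zero>\<^sub>B"
proof -
 interpret A: module K A by fact
 interpret B: module K B by fact
 have "f \<zero>\<^sub>A \<oplus>\<^sub>B f \<zero>\<^sub>A = f \<zero>\<^sub>A"
  using k_linearD(2)[OF assms(3), of "\<zero>\<^sub>A" "\<zero>\<^sub>A"] by simp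
 thus ?thesis
  using k_linearD(1)[OF assms(3), of "\<zero>\<^sub>A"] B.M.add.l_cancel_one by simp
qed

lemma k_linear_finsum:
 assumes "module K A" "module K B" "k_linear K A B f" "finite I" "!!i. i : I ==> t i : carrier A"
 shows "f (\<Oplus>\<^bsub>A\<^esub>i\<in>I. t i) = (\<Oplus>\<^bsub>B\<^esub>i\<in>I. f (t i))"
 using assms(4,5)
proof (induction I)
 case empty
 interpret A: module K A by fact
 interpret B: module K B by fact
 show ?case using k_linear_zero[OF assms(1-3)] by simp
next
 case (insert a I)
 interpret A: module K A by fact
 interpret B: module K B by fact
 note l = k_linearD[OF assms(3)]
 have c: "(\<Oplus>\<^bsub>A\<^esub>i\<in>I. t i) : carrier A" using insert.prems by(intro A.M.finsum_closed) auto
 have "f (\<Oplus>\<^bsub>A\<^esub>i\<in>insert a I. t i) = f (t a \<oplus>\<^sub>A (\<Oplus>\<^bsub>A\<^esub>i\<in>I. t i))"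
  using insert by(subst A.M.finsum_insert) auto
 also have "... = f (t a) \<oplus>\<^sub>B (\<Oplus>\<^bsub>B\<^esub>i\<in>I. f (t i))"
  using l(2)[OF _ c, of "t a"] insert by simp
 also have "... = (\<Oplus>\<^bsub>B\<^esub>i\<in>insert a I. f (t i))"
  using insert l(1) by(subst B.M.finsum_insert) auto
 finally show ?case .
qed

lemma bilinear_compose:
 assumes "bilinear_map K A' B' C \<phi>" "k_linear K A A' f" "k_linear K B B' h"
 shows "bilinear_map K A B C (%x y. \<phi> (f x) (h y))"
 by(rule bilinear_mapI)
   (simp_all add: bilinear_mapD[OF assms(1)] k_linearD[OF assms(2)] k_linearD[OF assms(3)])

lemma bilinear_left:
 assumes "bilinear_map K A B C \<phi>" "y : carrier B"
 shows "k_linear K A C (%x. \<phi> x y)"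
 by(rule k_linearI) (simp_all add: bilinear_mapD[OF assms(1)] assms(2))

lemma bilinear_right:
 assumes "bilinear_map K A B C \<phi>" "x : carrier A"
 shows "k_linear K B C (\<phi> x)"
 by(rule k_linearI) (simp_all add: bilinear_mapD[OF assms(1)] assms(2))

lemma bilinear_mult:
 assumes "algebra K A" shows "bilinear_map K A A A (%x y. x \<otimes>\<^sub>A y)"
proof -
 interpret A: algebra K A by fact
 show ?thesis
 proof (rule bilinear_mapI)
  fix c x y assume "c : carrier K" "x : carrier A" "y : carrier A"
  thus "x \<otimes>\<^sub>A (c \<odot>\<^sub>A y) = c \<odot>\<^sub>A (x \<otimes>\<^sub>A y)"
   using A.smult_assoc2[of c y x] A.m_comm[of x] A.smult_closed by simp
 qed (simp_all add: A.l_distr A.r_distr A.smult_assoc2)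
qed

lemma bilinear_smult:
 assumes "module K C" shows "bilinear_map K (self_module K) C C (%c x. c \<odot>\<^sub>C x)"
proof -
 interpret C: module K C by fact
 show ?thesis
  by(rule bilinear_mapI)
    (simp_all add: C.smult_l_distr C.smult_r_distr C.smult_assoc1[symmetric] C.R.m_comm)
qed

lemma bilinear_flip:
 assumes "bilinear_map K A B C \<phi>" shows "bilinear_map K B A C (%x y. \<phi> y x)"
 by(rule bilinear_mapI) (simp_all add: bilinear_mapD[OF assms])

lemma bilinear_add:
 assumes "module K C" "bilinear_map K A B C \<phi>" "bilinear_map K A B C \<psi>"
 shows "bilinear_map K A B C (%x y. \<phi> x y \<oplus>\<^sub>C \<psi> x y)"
proof -
 interpret C: module K C by fact
 have four: "(p \<oplus>\<^sub>C q) \<oplus>\<^sub>C (r \<oplus>\<^sub>C s) = (p \<oplus>\<^sub>C r) \<oplus>\<^sub>C (q \<oplus>\<^sub>C s)"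
  if "p : carrier C" "q : carrier C" "r : carrier C" "s : carrier C" for p q r s
  using that by(simp add: C.M.a_ac)
 show ?thesis
  by(rule bilinear_mapI)
    (simp_all add: bilinear_mapD[OF assms(2)] bilinear_mapD[OF assms(3)] four C.smult_r_distr)
qed

lemma algebra_module: "algebra K A ==> module K A"
 by(rule algebra.axioms(1))

context
 fixes K :: "('k, 'm) ring_scheme" and A :: "('k, 'a, 'n) module_scheme"
  and B :: "('k, 'b, 'p) module_scheme" and C :: "('k, 'c, 'q) module_scheme"
 assumes A: "algebra K A" and B: "algebra K B" and C: "module K C"
begin

lemma tensor_pair: "algebra_pair K A B"
 by(intro algebra_pair.intro A B)

lemma tensor_pair_module: "algebra_pair_module K A B C"
 by(intro algebra_pair_module.intro tensor_pair C)

lemma lift_k_linear: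
 assumes "bilinear_map K A B C \<phi>"
 shows "k_linear K (tensor K A B) C (tensor_lift K A B C \<phi>)"
 by(rule k_linearI)
   (rule algebra_pair_module.lift_closed[OF tensor_pair_module assms]
    algebra_pair_module.lift_add[OF tensor_pair_module assms]
    algebra_pair_module.lift_smult[OF tensor_pair_module assms]; assumption)+

lemmas lift_pure_tensor = algebra_pair_module.lift_pure[OF tensor_pair_module]

lemmas lift_finsum_pure = algebra_pair_module.lift_finsum[OF tensor_pair_module]

text \<open>A bilinear map that depends linearly on a parameter has a lift that depends linearly on it.\<close>

lemma lift_parameter:
 fixes Z :: "('k, 'z, 'w) module_scheme"
 assumes bil: "!!z. z : carrier Z ==> bilinear_map K A B C (\<phi> z)"
  and lin: "!!x y. [|x : carrier A; y : carrier B|] ==> k_linear K Z C (%z. \<phi> z x y)"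
  and Z: "module K Z"
 shows "bilinear_map K Z (tensor K A B) C (%z t. tensor_lift K A B C (\<phi> z) t)"
proof -
 interpret C: module K C by(rule C)
 interpret Z: module K Z by(rule Z)
 have rep: "EX (I::nat set) x y. finite I & (ALL i:I. x i : carrier A & y i : carrier B) &
   (ALL z:carrier Z. tensor_lift K A B C (\<phi> z) t = (\<Oplus>\<^bsub>C\<^esub>i\<in>I. \<phi> z (x i) (y i)))"
  if t: "t : carrier (tensor K A B)" for t
 proof -
  obtain I :: "nat set" and x y where I: "finite I" "!!i. i : I ==> x i : carrier A"
   "!!i. i : I ==> y i : carrier B" "t = (\<Oplus>\<^bsub>tensor K A B\<^esub>i\<in>I. pure_tensor K A B (x i) (y i))"
   by(rule algebra_pair.tensor_decompose[OF tensor_pair t]) (rule that; assumption)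
  have "tensor_lift K A B C (\<phi> z) t = (\<Oplus>\<^bsub>C\<^esub>i\<in>I. \<phi> z (x i) (y i))" if "z : carrier Z" for z
   unfolding I(4) by(rule lift_finsum_pure[OF bil[OF that] I(1)])(use I(2,3) in blast)+
  thus ?thesis
   by(intro exI[of _ I] exI[of _ x] exI[of _ y] conjI ballI) (simp_all add: I(1-3))
 qed
 show ?thesis
 proof (rule bilinear_mapI)
  fix z z' t assume z: "z : carrier Z" "z' : carrier Z" and t: "t : carrier (tensor K A B)"
  obtain I :: "nat set" and x y where I: "finite I" "ALL i:I. x i : carrier A & y i : carrier B"
   "ALL z:carrier Z. tensor_lift K A B C (\<phi> z) t = (\<Oplus>\<^bsub>C\<^esub>i\<in>I. \<phi> z (x i) (y i))"
   using rep[OF t] by blast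
  have c: "\<phi> w (x i) (y i) : carrier C" if "w : carrier Z" "i : I" for w i
   using bilinear_mapD(1)[OF bil[OF that(1)]] I(2) that(2) by blast
  have "(\<Oplus>\<^bsub>C\<^esub>i\<in>I. \<phi> (z \<oplus>\<^sub>Z z') (x i) (y i)) = (\<Oplus>\<^bsub>C\<^esub>i\<in>I. \<phi> z (x i) (y i) \<oplus>\<^sub>C \<phi> z' (x i) (y i))"
   by(rule C.M.finsum_cong'[OF refl])(use c z k_linearD(2)[OF lin _ _] I(2) in "simp_all")
  also have "... = (\<Oplus>\<^bsub>C\<^esub>i\<in>I. \<phi> z (x i) (y i)) \<oplus>\<^sub>C (\<Oplus>\<^bsub>C\<^esub>i\<in>I. \<phi> z' (x i) (y i))"
   by(rule C.M.finsum_addf)(use c z in auto)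
  finally show "tensor_lift K A B C (\<phi> (z \<oplus>\<^sub>Z z')) t
    = tensor_lift K A B C (\<phi> z) t \<oplus>\<^sub>C tensor_lift K A B C (\<phi> z') t"
   unfolding I(3)[rule_format, OF z(1)] I(3)[rule_format, OF z(2)]
    I(3)[rule_format, OF Z.M.a_closed[OF z]] .
 next
  fix k z t assume k: "k : carrier K" and z: "z : carrier Z" and t: "t : carrier (tensor K A B)"
  obtain I :: "nat set" and x y where I: "finite I" "ALL i:I. x i : carrier A & y i : carrier B"
   "ALL z:carrier Z. tensor_lift K A B C (\<phi> z) t = (\<Oplus>\<^bsub>C\<^esub>i\<in>I. \<phi> z (x i) (y i))"
   using rep[OF t] by blast
  have c: "\<phi> w (x i) (y i) : carrier C" if "w : carrier Z" "i : I" for w i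
   using bilinear_mapD(1)[OF bil[OF that(1)]] I(2) that(2) by blast
  have "(\<Oplus>\<^bsub>C\<^esub>i\<in>I. \<phi> (k \<odot>\<^sub>Z z) (x i) (y i)) = (\<Oplus>\<^bsub>C\<^esub>i\<in>I. k \<odot>\<^sub>C \<phi> z (x i) (y i))"
   by(rule C.M.finsum_cong'[OF refl])(use c k z k_linearD(3)[OF lin _ _] I(2) in "simp_all")
  also have "... = k \<odot>\<^sub>C (\<Oplus>\<^bsub>C\<^esub>i\<in>I. \<phi> z (x i) (y i))"
   by(rule C.finsum_smult_ldistr[symmetric])(use c k z I in auto)
  finally show "tensor_lift K A B C (\<phi> (k \<odot>\<^sub>Z z)) t = k \<odot>\<^sub>C tensor_lift K A B C (\<phi> z) t"
   unfolding I(3)[rule_format, OF z] I(3)[rule_format, OF Z.smult_closed[OF k z]] .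
 next
  show "tensor_lift K A B C (\<phi> z) (k \<odot>\<^bsub>tensor K A B\<^esub> t) = k \<odot>\<^sub>C tensor_lift K A B C (\<phi> z) t"
   if "k : carrier K" "z : carrier Z" "t : carrier (tensor K A B)" for k z t
   by(rule k_linearD(3)[OF lift_k_linear[OF bil]])(use that in blast)+
  show "tensor_lift K A B C (\<phi> z) (t \<oplus>\<^bsub>tensor K A B\<^esub> t')
    = tensor_lift K A B C (\<phi> z) t \<oplus>\<^sub>C tensor_lift K A B C (\<phi> z) t'"
   if "z : carrier Z" "t : carrier (tensor K A B)" "t' : carrier (tensor K A B)" for z t t'
   by(rule k_linearD(2)[OF lift_k_linear[OF bil]])(use that in blast)+
  show "tensor_lift K A B C (\<phi> z) t : carrier C" if "z : carrier Z" "t : carrier (tensor K A B)" for z t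
   by(rule k_linearD(1)[OF lift_k_linear[OF bil]])(use that in blast)+
 qed
qed

end

section \<open>Linear functionals\<close>

definition subspace :: "('k, 'm) ring_scheme => ('k, 'a, 'n) module_scheme => 'a set => bool"
 where "subspace K A M \<longleftrightarrow> M <= carrier A & \<zero>\<^sub>A : M &
  (ALL x:M. ALL y:M. x \<oplus>\<^sub>A y : M) & (ALL c:carrier K. ALL x:M. c \<odot>\<^sub>A x : M)"

lemma subspaceD:
 assumes "subspace K A M"
 shows "x : M ==> x : carrier A" "\<zero>\<^sub>A : M" "[|x : M; y : M|] ==> x \<oplus>\<^sub>A y : M"
  "[|c : carrier K; x : M|] ==> c \<odot>\<^sub>A x : M"
 using assms unfolding subspace_def by blast+

text \<open>A subspace that is maximal among those avoiding \<open>v\<close> is a hyperplane complementary to the line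
  through \<open>v\<close>.\<close>

lemma exists_functional:
 assumes "field K" "module K A" and M: "subspace K A M" and v: "v : carrier A" "v ~: M"
 shows "EX f. k_linear K A (self_module K) f & (ALL x:M. f x = \<zero>\<^sub>K) & f v = \<one>\<^sub>K"
proof -
 interpret K: field K by fact
 interpret A: module K A by fact
 let ?S = "{N. subspace K A N & M <= N & v ~: N}"
 have "EX H:?S. ALL N:?S. H <= N --> N = H"
 proof (rule subset_Zorn_nonempty)
  show "?S ~= {}" using M v(2) by blast
  fix C assume ne: "C ~= {}" and C: "subset.chain ?S C"
  show "\<Union>C \<in> ?S"
  proof -
   have mem: "!!N. N : C ==> subspace K A N & M <= N & v ~: N"
    using C unfolding subset.chain_def by blast
   have tot: "!!N N'. [|N : C; N' : C|] ==> N <= N' \<or> N' <= N"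
    using C unfolding subset.chain_def by blast
   have "subspace K A (\<Union>C)"
    unfolding subspace_def
   proof (intro conjI ballI)
    show "\<Union>C <= carrier A" using mem unfolding subspace_def by blast
    show "\<zero>\<^sub>A : \<Union>C" using mem ne unfolding subspace_def by blast
    show "x \<oplus>\<^sub>A y : \<Union>C" if xy: "x : \<Union>C" "y : \<Union>C" for x y
    proof -
     obtain N N' where N: "N : C" "x : N" "N' : C" "y : N'" using xy by blast
     have "EX N'':C. x : N'' & y : N''" using tot[OF N(1,3)] N by blast
     then obtain N'' where "N'' : C" "x : N''" "y : N''" by blast
     have "x \<oplus>\<^sub>A y : N''" by(rule subspaceD(3))(use mem \<open>N'' : C\<close> \<open>x : N''\<close> \<open>y : N''\<close> in blast)+
     thus ?thesis using \<open>N'' : C\<close> by blast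
    qed
    show "c \<odot>\<^sub>A x : \<Union>C" if cx: "c : carrier K" "x : \<Union>C" for c x
    proof -
     obtain N where N: "N : C" "x : N" using cx(2) by blast
     have "c \<odot>\<^sub>A x : N" by(rule subspaceD(4)[OF _ cx(1) N(2)])(use mem N in blast)
     thus ?thesis using N(1) by blast
    qed
   qed
   moreover have "M <= \<Union>C" using mem ne by blast
   moreover have "v ~: \<Union>C" using mem by blast
   ultimately show ?thesis by blast
  qed
 qed
 then obtain H where HS: "H : ?S" and maxS: "ALL N:?S. H <= N --> N = H" by(elim bexE)
 have H: "subspace K A H" "M <= H" "v ~: H" using HS by simp_all
 have max: "N = H" if "subspace K A N" "M <= N" "v ~: N" "H <= N" for N
  using maxS[rule_format, of N] that by simp
 note Hs = subspaceD[OF H(1)]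
 have neg: "\<ominus>\<^sub>A x : H" if "x : H" for x
  using Hs(4)[of "\<ominus>\<^sub>K \<one>\<^sub>K" x] that A.smult_l_minus[of "\<one>\<^sub>K" x] Hs(1)[OF that] by simp
 have split: "EX c:carrier K. EX h:H. x = c \<odot>\<^sub>A v \<oplus>\<^sub>A h" if x: "x : carrier A" for x
 proof (cases "x : H")
  case True
  thus ?thesis using x v by(intro bexI[of _ "\<zero>\<^sub>K"] bexI[of _ x]) auto
 next
  case False
  define N where "N = {c \<odot>\<^sub>A x \<oplus>\<^sub>A h | c h. c : carrier K & h : H}"
  have NI: "c \<odot>\<^sub>A x \<oplus>\<^sub>A h : N" if "c : carrier K" "h : H" for c h using that unfolding N_def by blast
  have "subspace K A N"
   unfolding subspace_def
  proof (intro conjI ballI)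
   show "N <= carrier A" unfolding N_def using x Hs(1) by auto
   show "\<zero>\<^sub>A : N" using NI[of "\<zero>\<^sub>K" "\<zero>\<^sub>A"] Hs(2) x by simp
   fix p assume "p : N"
   then obtain c h where p: "p = c \<odot>\<^sub>A x \<oplus>\<^sub>A h" "c : carrier K" "h : H" unfolding N_def by blast
   have hc: "h : carrier A" using Hs(1) p by blast
   show "d \<odot>\<^sub>A p : N" if d: "d : carrier K" for d
   proof -
    have "d \<odot>\<^sub>A p = (d \<otimes>\<^sub>K c) \<odot>\<^sub>A x \<oplus>\<^sub>A d \<odot>\<^sub>A h"
     unfolding p(1) using d p(2) x hc by(simp add: A.smult_r_distr A.smult_assoc1)
    thus ?thesis using NI[of "d \<otimes>\<^sub>K c" "d \<odot>\<^sub>A h"] Hs(4) d p by simp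
   qed
   fix q assume "q : N"
   then obtain c' h' where q: "q = c' \<odot>\<^sub>A x \<oplus>\<^sub>A h'" "c' : carrier K" "h' : H" unfolding N_def by blast
   have hc': "h' : carrier A" using Hs(1) q by blast
   have "p \<oplus>\<^sub>A q = (c \<oplus>\<^sub>K c') \<odot>\<^sub>A x \<oplus>\<^sub>A (h \<oplus>\<^sub>A h')"
    unfolding p(1) q(1) using p(2) q(2) x hc hc' by(simp add: A.smult_l_distr A.M.a_ac)
   thus "p \<oplus>\<^sub>A q : N" using NI[of "c \<oplus>\<^sub>K c'" "h \<oplus>\<^sub>A h'"] Hs(3) p q by simp
  qed
  moreover have HN: "H <= N"
  proof
   fix h assume h: "h : H"
   thus "h : N" using NI[of "\<zero>\<^sub>K" h] Hs(1)[OF h] x by simp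
  qed
  moreover have "x : N" using NI[of "\<one>\<^sub>K" "\<zero>\<^sub>A"] Hs(2) x by simp
  ultimately have "v : N" using max[of N] subset_trans[OF H(2) HN] False by metis
  then obtain c h where ch: "v = c \<odot>\<^sub>A x \<oplus>\<^sub>A h" "c : carrier K" "h : H" unfolding N_def by blast
  have hc: "h : carrier A" using Hs(1) ch by blast
  have c0: "c ~= \<zero>\<^sub>K" using ch H(3) hc x by auto
  define i where "i = inv\<^bsub>K\<^esub> c"
  have i: "i : carrier K" "i \<otimes>\<^sub>K c = \<one>\<^sub>K"
   unfolding i_def using ch(2) c0 K.field_Units by auto
  have "i \<odot>\<^sub>A v = x \<oplus>\<^sub>A i \<odot>\<^sub>A h"
   unfolding ch(1) using i ch(2) x hc by(simp add: A.smult_r_distr A.smult_assoc1[symmetric])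
  hence "x = i \<odot>\<^sub>A v \<oplus>\<^sub>A (\<ominus>\<^sub>A (i \<odot>\<^sub>A h))"
   using i x hc by(simp add: A.M.a_assoc A.M.r_neg)
  thus ?thesis using i neg[OF Hs(4)[OF i(1) ch(3)]] by blast
 qed
 have unique: "c = c'" if e: "c \<odot>\<^sub>A v \<oplus>\<^sub>A h = c' \<odot>\<^sub>A v \<oplus>\<^sub>A h'"
  and ch: "c : carrier K" "c' : carrier K" "h : H" "h' : H" for c c' h h'
 proof (rule ccontr)
  assume ne: "c ~= c'"
  have hc: "h : carrier A" "h' : carrier A" using Hs(1) ch by blast+
  define d where "d = c \<ominus>\<^sub>K c'"
  have d: "d : carrier K" "d ~= \<zero>\<^sub>K" unfolding d_def using ch ne by auto
  define i where "i = inv\<^bsub>K\<^esub> d"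
  have i: "i : carrier K" "i \<otimes>\<^sub>K d = \<one>\<^sub>K" unfolding i_def using d K.field_Units by auto
  have "c \<odot>\<^sub>A v = d \<odot>\<^sub>A v \<oplus>\<^sub>A c' \<odot>\<^sub>A v"
  proof -
   have "d \<oplus>\<^sub>K c' = c" unfolding d_def a_minus_def using ch by(simp add: K.a_assoc K.l_neg)
   thus ?thesis using A.smult_l_distr[OF d(1) ch(2) v(1)] by simp
  qed
  hence "d \<odot>\<^sub>A v \<oplus>\<^sub>A h \<oplus>\<^sub>A c' \<odot>\<^sub>A v = h' \<oplus>\<^sub>A c' \<odot>\<^sub>A v"
   using e d ch v hc by(simp add: A.M.a_ac)
  hence "d \<odot>\<^sub>A v \<oplus>\<^sub>A h = h'"
   using d ch v hc by simp
  hence "d \<odot>\<^sub>A v = h' \<oplus>\<^sub>A (\<ominus>\<^sub>A h)"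
   using d v hc by(metis A.M.a_assoc A.M.a_inv_closed A.M.r_neg A.M.r_zero A.smult_closed)
  hence "d \<odot>\<^sub>A v : H" using Hs(3) neg ch by simp
  hence "i \<odot>\<^sub>A (d \<odot>\<^sub>A v) : H" using Hs(4) i by blast
  hence "v : H" using i d v by(simp add: A.smult_assoc1[symmetric])
  thus False using H(3) by simp
 qed
 define f where "f = (%x. THE c. c : carrier K & (EX h:H. x = c \<odot>\<^sub>A v \<oplus>\<^sub>A h))"
 have feq: "f (c \<odot>\<^sub>A v \<oplus>\<^sub>A h) = c" if "c : carrier K" "h : H" for c h
  unfolding f_def
 proof (rule the_equality)
  show "c : carrier K & (EX h':H. c \<odot>\<^sub>A v \<oplus>\<^sub>A h = c \<odot>\<^sub>A v \<oplus>\<^sub>A h')" using that by blast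
  fix c' assume "c' : carrier K & (EX h':H. c \<odot>\<^sub>A v \<oplus>\<^sub>A h = c' \<odot>\<^sub>A v \<oplus>\<^sub>A h')"
  then obtain h' where "c' : carrier K" "h' : H" "c \<odot>\<^sub>A v \<oplus>\<^sub>A h = c' \<odot>\<^sub>A v \<oplus>\<^sub>A h'" by blast
  thus "c' = c" using unique[of c h c' h'] that by simp
 qed
 have "k_linear K A (self_module K) f"
 proof (rule k_linearI)
  fix x assume x: "x : carrier A"
  obtain c h where ch: "c : carrier K" "h : H" "x = c \<odot>\<^sub>A v \<oplus>\<^sub>A h" using split[OF x] by blast
  have hc: "h : carrier A" using Hs(1) ch by blast
  show "f x : carrier (self_module K)" unfolding ch(3) feq[OF ch(1,2)] using ch by simp
  show "f (d \<odot>\<^sub>A x) = d \<odot>\<^bsub>self_module K\<^esub> f x" if d: "d : carrier K" for d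
  proof -
   have "d \<odot>\<^sub>A x = (d \<otimes>\<^sub>K c) \<odot>\<^sub>A v \<oplus>\<^sub>A d \<odot>\<^sub>A h"
    unfolding ch(3) using d ch v hc by(simp add: A.smult_r_distr A.smult_assoc1)
   hence "f (d \<odot>\<^sub>A x) = d \<otimes>\<^sub>K c" using feq[of "d \<otimes>\<^sub>K c" "d \<odot>\<^sub>A h"] d ch Hs(4) by simp
   moreover have "f x = c" unfolding ch(3) by(rule feq[OF ch(1,2)])
   ultimately show ?thesis by simp
  qed
  fix x' assume x': "x' : carrier A"
  obtain c' h' where ch': "c' : carrier K" "h' : H" "x' = c' \<odot>\<^sub>A v \<oplus>\<^sub>A h'" using split[OF x'] by blast
  have hc': "h' : carrier A" using Hs(1) ch' by blast
  have "x \<oplus>\<^sub>A x' = (c \<oplus>\<^sub>K c') \<odot>\<^sub>A v \<oplus>\<^sub>A (h \<oplus>\<^sub>A h')"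
   unfolding ch(3) ch'(3) using ch(1) ch'(1) v hc hc' by(simp add: A.smult_l_distr A.M.a_ac)
  hence "f (x \<oplus>\<^sub>A x') = c \<oplus>\<^sub>K c'"
   using feq[of "c \<oplus>\<^sub>K c'" "h \<oplus>\<^sub>A h'"] ch ch' Hs(3) by simp
  moreover have "f x = c" "f x' = c'" unfolding ch(3) ch'(3) by(rule feq[OF ch(1,2)], rule feq[OF ch'(1,2)])
  ultimately show "f (x \<oplus>\<^sub>A x') = f x \<oplus>\<^bsub>self_module K\<^esub> f x'" by simp
 qed
 moreover have "f x = \<zero>\<^sub>K" if "x : M" for x
 proof -
  have "x : H" using that H(2) by blast
  hence "\<zero>\<^sub>K \<odot>\<^sub>A v \<oplus>\<^sub>A x = x" using v Hs(1) by simp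
  thus ?thesis using feq[of "\<zero>\<^sub>K" x] \<open>x : H\<close> by simp
 qed
 moreover have "f v = \<one>\<^sub>K"
  using feq[of "\<one>\<^sub>K" "\<zero>\<^sub>A"] Hs(2) v by simp
 ultimately show ?thesis by blast
qed

lemma exists_dual_functional:
 assumes "field K" "module K A" "finite I" "i : I" and y: "!!j. j : I ==> y j : carrier A"
  and indep: "!!c j. [|!!j. j : I ==> c j : carrier K; (\<Oplus>\<^bsub>A\<^esub>j\<in>I. c j \<odot>\<^sub>A y j) = \<zero>\<^sub>A; j : I|] ==> c j = \<zero>\<^sub>K"
 shows "EX f. k_linear K A (self_module K) f & (ALL j:I. f (y j) = (if j = i then \<one>\<^sub>K else \<zero>\<^sub>K))"
proof -
 interpret K: field K by fact
 interpret A: module K A by fact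
 define M where "M = {\<Oplus>\<^bsub>A\<^esub>j\<in>I - {i}. c j \<odot>\<^sub>A y j | c. ALL j:I - {i}. c j : carrier K}"
 have fin: "finite (I - {i})" using assms(3) by simp
 have sub: "subspace K A M"
  unfolding subspace_def
 proof (intro conjI ballI)
  show "M <= carrier A" unfolding M_def using y by(auto intro!: A.M.finsum_closed)
  have "(\<Oplus>\<^bsub>A\<^esub>j\<in>I - {i}. \<zero>\<^sub>K \<odot>\<^sub>A y j) = (\<Oplus>\<^bsub>A\<^esub>j\<in>I - {i}. \<zero>\<^sub>A)"
   by(rule A.M.finsum_cong'[OF refl])(use y in auto)
  hence "\<zero>\<^sub>A = (\<Oplus>\<^bsub>A\<^esub>j\<in>I - {i}. \<zero>\<^sub>K \<odot>\<^sub>A y j)" by simp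
  thus "\<zero>\<^sub>A : M" unfolding M_def mem_Collect_eq
   by(intro exI[of _ "%_. \<zero>\<^sub>K"] conjI) auto
  fix p assume "p : M"
  then obtain c where c: "ALL j:I - {i}. c j : carrier K" "p = (\<Oplus>\<^bsub>A\<^esub>j\<in>I - {i}. c j \<odot>\<^sub>A y j)"
   unfolding M_def by blast
  show "d \<odot>\<^sub>A p : M" if d: "d : carrier K" for d
  proof -
   have "d \<odot>\<^sub>A p = (\<Oplus>\<^bsub>A\<^esub>j\<in>I - {i}. d \<odot>\<^sub>A (c j \<odot>\<^sub>A y j))"
    unfolding c(2) by(rule A.finsum_smult_ldistr)(use fin d c y in auto)
   also have "... = (\<Oplus>\<^bsub>A\<^esub>j\<in>I - {i}. (d \<otimes>\<^sub>K c j) \<odot>\<^sub>A y j)"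
    by(rule A.M.finsum_cong'[OF refl])(use d c y in "auto simp: A.smult_assoc1")
   finally show ?thesis unfolding M_def mem_Collect_eq
    by(intro exI[of _ "%j. d \<otimes>\<^sub>K c j"] conjI)(use d c in auto)
  qed
  fix q assume "q : M"
  then obtain c' where c': "ALL j:I - {i}. c' j : carrier K" "q = (\<Oplus>\<^bsub>A\<^esub>j\<in>I - {i}. c' j \<odot>\<^sub>A y j)"
   unfolding M_def by blast
  have "(\<Oplus>\<^bsub>A\<^esub>j\<in>I - {i}. (c j \<oplus>\<^sub>K c' j) \<odot>\<^sub>A y j) = (\<Oplus>\<^bsub>A\<^esub>j\<in>I - {i}. c j \<odot>\<^sub>A y j \<oplus>\<^sub>A c' j \<odot>\<^sub>A y j)"
   by(rule A.M.finsum_cong'[OF refl])(use c c' y in "auto simp: A.smult_l_distr")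
  also have "... = p \<oplus>\<^sub>A q"
   unfolding c(2) c'(2) by(rule A.M.finsum_addf)(use c c' y in auto)
  finally show "p \<oplus>\<^sub>A q : M" unfolding M_def mem_Collect_eq
   by(intro exI[of _ "%j. c j \<oplus>\<^sub>K c' j"] conjI)(use c c' in auto)
 qed
 have yM: "y j : M" if "j : I" "j ~= i" for j
 proof -
  have "(\<Oplus>\<^bsub>A\<^esub>k\<in>I - {i}. (if k = j then \<one>\<^sub>K else \<zero>\<^sub>K) \<odot>\<^sub>A y k)
    = (%k. (if k = j then \<one>\<^sub>K else \<zero>\<^sub>K) \<odot>\<^sub>A y k) j"
   by(rule A.M.finsum_single)(use that fin y in auto)
  hence "y j = (\<Oplus>\<^bsub>A\<^esub>k\<in>I - {i}. (if k = j then \<one>\<^sub>K else \<zero>\<^sub>K) \<odot>\<^sub>A y k)"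
   using y[OF that(1)] by simp
  thus ?thesis unfolding M_def mem_Collect_eq
   by(intro exI[of _ "%k. if k = j then \<one>\<^sub>K else \<zero>\<^sub>K"] conjI) auto
 qed
 have "y i ~: M"
 proof
  assume "y i : M"
  then obtain c where c: "ALL j:I - {i}. c j : carrier K" "y i = (\<Oplus>\<^bsub>A\<^esub>j\<in>I - {i}. c j \<odot>\<^sub>A y j)"
   unfolding M_def by blast
  define d where "d = (%j. if j = i then \<ominus>\<^sub>K \<one>\<^sub>K else c j)"
  have dc: "!!j. j : I ==> d j : carrier K" unfolding d_def using c by auto
  have I: "I = insert i (I - {i})" using assms(4) by auto
  have "(\<Oplus>\<^bsub>A\<^esub>j\<in>insert i (I - {i}). d j \<odot>\<^sub>A y j) = d i \<odot>\<^sub>A y i \<oplus>\<^sub>A (\<Oplus>\<^bsub>A\<^esub>j\<in>I - {i}. d j \<odot>\<^sub>A y j)"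
   by(rule A.M.finsum_insert)(use fin dc y assms(4) in auto)
  also have "(\<Oplus>\<^bsub>A\<^esub>j\<in>I - {i}. d j \<odot>\<^sub>A y j) = y i"
   unfolding c(2) by(rule A.M.finsum_cong'[OF refl])(use c y in "auto simp: d_def")
  also have "d i \<odot>\<^sub>A y i \<oplus>\<^sub>A y i = \<zero>\<^sub>A"
   unfolding d_def using y[OF assms(4)] A.smult_l_minus[of "\<one>\<^sub>K" "y i"] by(simp add: A.M.l_neg)
  finally have "(\<Oplus>\<^bsub>A\<^esub>j\<in>I. d j \<odot>\<^sub>A y j) = \<zero>\<^sub>A" using I by simp
  hence "d i = \<zero>\<^sub>K" using indep[of d i] dc assms(4) by blast
  hence "\<one>\<^sub>K = \<zero>\<^sub>K" unfolding d_def by(metis K.minus_minus K.minus_zero K.one_closed)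
  thus False by simp
 qed
 then obtain f where "k_linear K A (self_module K) f" "ALL x:M. f x = \<zero>\<^sub>K" "f (y i) = \<one>\<^sub>K"
  using exists_functional[OF assms(1,2) sub y[OF assms(4)]] by blast
 thus ?thesis using yM by auto
qed

section \<open>Comatrices in a Hopf algebra\<close>

lemma k_linear_compose:
 assumes "k_linear K A B f" "k_linear K B C h" shows "k_linear K A C (%x. h (f x))"
 by(rule k_linearI) (simp_all add: k_linearD[OF assms(1)] k_linearD[OF assms(2)])

lemma k_linear_scale:
 assumes "module K C" "c : carrier K" shows "k_linear K C C (%t. c \<odot>\<^sub>C t)"
proof -
 interpret C: module K C by fact
 show ?thesis
  by(rule k_linearI)
    (use assms(2) in "simp_all add: C.smult_r_distr C.smult_assoc1[symmetric] C.R.m_comm")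
qed

lemma k_linear_tensor_ext:
 assumes A: "algebra K A" and B: "algebra K B" and C: "module K C"
  and f: "k_linear K (tensor K A B) C f" and h: "k_linear K (tensor K A B) C h"
  and eq: "!!x y. [|x : carrier A; y : carrier B|] ==> f (pure_tensor K A B x y) = h (pure_tensor K A B x y)"
  and t: "t : carrier (tensor K A B)"
 shows "f t = h t"
proof -
 interpret P: algebra_pair K A B by(intro algebra_pair.intro A B)
 interpret C: module K C by(rule C)
 obtain I :: "nat set" and x y where I: "finite I" "!!i. i : I ==> x i : carrier A"
  "!!i. i : I ==> y i : carrier B" "t = (\<Oplus>\<^bsub>tensor K A B\<^esub>i\<in>I. pure_tensor K A B (x i) (y i))"
  by(rule P.tensor_decompose[OF t]) (rule that; assumption)
 have pc: "pure_tensor K A B (x i) (y i) : carrier (tensor K A B)" if "i : I" for i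
  by(rule P.pure_closed[OF I(2)[OF that] I(3)[OF that]])
 have "f t = (\<Oplus>\<^bsub>C\<^esub>i\<in>I. f (pure_tensor K A B (x i) (y i)))"
  unfolding I(4) by(rule k_linear_finsum[OF P.tensor_module C f I(1) pc])
 also have "... = (\<Oplus>\<^bsub>C\<^esub>i\<in>I. h (pure_tensor K A B (x i) (y i)))"
  by(rule C.M.finsum_cong'[OF refl])(use eq[OF I(2) I(3)] k_linearD(1)[OF h pc] in auto)
 also have "... = h t"
  unfolding I(4) by(rule k_linear_finsum[OF P.tensor_module C h I(1) pc, symmetric])
 finally show ?thesis .
qed

text \<open>A linear relation among the left factors lets one summand be absorbed by the others.\<close>

lemma bilinear_shorten:
 assumes K: "field K" and A: "module K A" and B: "module K B" and C: "module K C"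
  and bil: "bilinear_map K A B C \<phi>" and fin: "finite I" "m : I"
  and x: "!!i. i : I ==> x i : carrier A" and y: "!!i. i : I ==> y i : carrier B"
  and c: "!!i. i : I ==> c i : carrier K" "c m ~= \<zero>\<^sub>K"
  and dep: "(\<Oplus>\<^bsub>A\<^esub>i\<in>I. c i \<odot>\<^sub>A x i) = \<zero>\<^sub>A"
 shows "EX y'. (ALL i:I - {m}. y' i : carrier B) &
  (\<Oplus>\<^bsub>C\<^esub>i\<in>I. \<phi> (x i) (y i)) = (\<Oplus>\<^bsub>C\<^esub>i\<in>I - {m}. \<phi> (x i) (y' i))"
proof -
 interpret K: field K by(rule K)
 interpret A: module K A by(rule A)
 interpret B: module K B by(rule B)
 interpret C: module K C by(rule C)
 note b = bilinear_mapD[OF bil]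
 define J where "J = I - {m}"
 have J: "finite J" "m ~: J" "I = insert m J" "!!i. i : J ==> i : I" unfolding J_def using fin by auto
 define n where "n = \<ominus>\<^sub>K (inv\<^bsub>K\<^esub> c m)"
 have cm: "c m : Units K" using c fin(2) K.field_Units by auto
 hence n: "n : carrier K" "n \<otimes>\<^sub>K c m = \<ominus>\<^sub>K \<one>\<^sub>K"
  unfolding n_def using c fin(2) K.Units_l_inv[OF cm] K.Units_inv_closed[OF cm] by(simp_all add: K.l_minus)
 define e where "e = (%i. n \<otimes>\<^sub>K c i)"
 have e: "e i : carrier K" if "i : I" for i unfolding e_def using n c(1)[OF that] by simp
 have sc: "(\<Oplus>\<^bsub>A\<^esub>i\<in>J. e i \<odot>\<^sub>A x i) : carrier A"
  by(rule A.M.finsum_closed)(use e x J(4) in auto)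
 have "\<zero>\<^sub>A = n \<odot>\<^sub>A (\<Oplus>\<^bsub>A\<^esub>i\<in>I. c i \<odot>\<^sub>A x i)" unfolding dep using n by simp
 also have "... = (\<Oplus>\<^bsub>A\<^esub>i\<in>I. n \<odot>\<^sub>A (c i \<odot>\<^sub>A x i))"
  by(rule A.finsum_smult_ldistr)(use fin n c x in auto)
 also have "... = (\<Oplus>\<^bsub>A\<^esub>i\<in>I. e i \<odot>\<^sub>A x i)"
  by(rule A.M.finsum_cong'[OF refl])(use n c x e in "auto simp: e_def A.smult_assoc1")
 also have "... = e m \<odot>\<^sub>A x m \<oplus>\<^sub>A (\<Oplus>\<^bsub>A\<^esub>i\<in>J. e i \<odot>\<^sub>A x i)"
  unfolding J(3) by(rule A.M.finsum_insert)(use J e x fin(2) in auto)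
 also have "e m \<odot>\<^sub>A x m = \<ominus>\<^sub>A x m"
  unfolding e_def n(2) using x[OF fin(2)] A.smult_l_minus[of "\<one>\<^sub>K" "x m"] by simp
 finally have z: "\<ominus>\<^sub>A x m \<oplus>\<^sub>A (\<Oplus>\<^bsub>A\<^esub>i\<in>J. e i \<odot>\<^sub>A x i) = \<zero>\<^sub>A" by simp
 have xm: "x m = (\<Oplus>\<^bsub>A\<^esub>i\<in>J. e i \<odot>\<^sub>A x i)"
  using A.M.minus_equality[of "\<ominus>\<^sub>A x m" "\<Oplus>\<^bsub>A\<^esub>i\<in>J. e i \<odot>\<^sub>A x i"] z x[OF fin(2)] sc
  by(metis A.M.a_inv_closed A.M.minus_minus)
 have "\<phi> (x m) (y m) = (\<Oplus>\<^bsub>C\<^esub>i\<in>J. \<phi> (e i \<odot>\<^sub>A x i) (y m))"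
  unfolding xm by(rule k_linear_finsum[OF A C bilinear_left[OF bil y[OF fin(2)]] J(1)])
   (use e x J(4) in auto)
 also have "... = (\<Oplus>\<^bsub>C\<^esub>i\<in>J. \<phi> (x i) (e i \<odot>\<^sub>B y m))"
  by(rule C.M.finsum_cong'[OF refl])(use b e x y fin(2) J(4) in auto)
 finally have pm: "\<phi> (x m) (y m) = (\<Oplus>\<^bsub>C\<^esub>i\<in>J. \<phi> (x i) (e i \<odot>\<^sub>B y m))" .
 have pc: "\<phi> (x i) (y i) : carrier C" "\<phi> (x i) (e i \<odot>\<^sub>B y m) : carrier C" if "i : I" for i
  using b(1) e x y fin(2) that by auto
 have "(\<Oplus>\<^bsub>C\<^esub>i\<in>I. \<phi> (x i) (y i)) = \<phi> (x m) (y m) \<oplus>\<^sub>C (\<Oplus>\<^bsub>C\<^esub>i\<in>J. \<phi> (x i) (y i))"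
  unfolding J(3) by(rule C.M.finsum_insert)(use J pc fin(2) in auto)
 also have "... = (\<Oplus>\<^bsub>C\<^esub>i\<in>J. \<phi> (x i) (e i \<odot>\<^sub>B y m) \<oplus>\<^sub>C \<phi> (x i) (y i))"
  unfolding pm by(rule C.M.finsum_addf[symmetric])(use J(4) pc in auto)
 also have "... = (\<Oplus>\<^bsub>C\<^esub>i\<in>J. \<phi> (x i) (e i \<odot>\<^sub>B y m \<oplus>\<^sub>B y i))"
  by(rule C.M.finsum_cong'[OF refl])(use b e x y fin(2) J(4) in auto)
 finally have fe: "(\<Oplus>\<^bsub>C\<^esub>i\<in>I. \<phi> (x i) (y i)) = (\<Oplus>\<^bsub>C\<^esub>i\<in>I - {m}. \<phi> (x i) (e i \<odot>\<^sub>B y m \<oplus>\<^sub>B y i))"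
  unfolding J_def .
 have yc: "e i \<odot>\<^sub>B y m \<oplus>\<^sub>B y i : carrier B" if "i : I - {m}" for i
  using that e[of i] y[of i] y[OF fin(2)] by simp
 show ?thesis
  by(rule exI[of _ "%i. e i \<odot>\<^sub>B y m \<oplus>\<^sub>B y i"], rule conjI, rule ballI, erule yc, rule fe)
qed

locale hopf_domain =
 fixes K :: "('k, 'm) ring_scheme" and R :: "('k, 'r, 'n) module_scheme" (structure)
  and \<Delta> :: "'r => ('r \<times> 'r => 'k) set" and \<epsilon> :: "'r => 'k" and S :: "'r => 'r"
 assumes domain_R: "domain R" and hopf: "hopf_algebra K R \<Delta> \<epsilon> S"
begin

sublocale domain R by(rule domain_R)

lemma K_field: "field K" and algR: "algebra K R"
 and Delta_hom: "\<Delta> : ring_hom R (tensor K R R)" and Delta_linear: "k_linear K R (tensor K R R) \<Delta>"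
 and eps_hom: "\<epsilon> : ring_hom R K" and S_linear: "k_linear K R R S"
 using hopf unfolding hopf_algebra_def by blast+

sublocale K: field K by(rule K_field)
sublocale A: algebra K R by(rule algR)

abbreviation "TT == tensor K R R"
abbreviation "T2 == tensor K TT R"
abbreviation "pu == pure_tensor K R R"
abbreviation "pu2 == pure_tensor K TT R"

lemma modR: "module K R" by(rule algebra_module[OF algR])
lemma pairRR: "algebra_pair K R R" by(intro algebra_pair.intro algR)
lemma algTT: "algebra K TT" by(rule algebra_pair.tensor_algebra[OF pairRR])
lemma modTT: "module K TT" by(rule algebra_module[OF algTT])
lemma pairT2: "algebra_pair K TT R" by(intro algebra_pair.intro algR algTT)
lemma modT2: "module K T2" by(rule algebra_pair.tensor_module[OF pairT2])
lemma modK: "module K (self_module K)" by(rule self_module_module) (rule K.is_cring)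

sublocale TT: cring TT by(rule algebra_pair.tensor_cring[OF pairRR])

lemmas pu_bilinear = algebra_pair.pure_bilinear[OF pairRR]
lemmas pu2_bilinear = algebra_pair.pure_bilinear[OF pairT2]
lemmas pu_closed [simp] = algebra_pair.pure_closed[OF pairRR]
lemmas pu_mult = algebra_pair.pure_mult[OF pairRR]
lemmas lift_pu = algebra_pair_module.lift_pure[OF algebra_pair_module.intro[OF pairRR]]
lemmas lift_pu_finsum = algebra_pair_module.lift_finsum[OF algebra_pair_module.intro[OF pairRR]]
lemmas lift_pu2 = algebra_pair_module.lift_pure[OF algebra_pair_module.intro[OF pairT2]]

lemma Delta_closed [simp]: "r : carrier R ==> \<Delta> r : carrier TT"
 by(rule ring_hom_closed[OF Delta_hom])

lemma eps_closed [simp]: "r : carrier R ==> \<epsilon> r : carrier K"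
 by(rule ring_hom_closed[OF eps_hom])

lemma eps_linear: "k_linear K R (self_module K) \<epsilon>"
proof (rule k_linearI)
 have "ALL c:carrier K. ALL r:carrier R. \<epsilon> (c \<odot> r) = c \<otimes>\<^sub>K \<epsilon> r"
  using hopf unfolding hopf_algebra_def by(elim conjE) assumption
 thus "\<epsilon> (c \<odot> x) = c \<odot>\<^bsub>self_module K\<^esub> \<epsilon> x" if "c : carrier K" "x : carrier R" for c x
  using that by simp
qed (use ring_hom_add[OF eps_hom] in auto)

lemma S_closed [simp]: "r : carrier R ==> S r : carrier R"
 by(rule k_linearD(1)[OF S_linear])

definition rep :: "'r => 'i set => ('i => 'r) => ('i => 'r) => bool"
 where "rep r I x y \<longleftrightarrow> finite I & (ALL i:I. x i : carrier R & y i : carrier R) &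
  \<Delta> r = (\<Oplus>\<^bsub>TT\<^esub>i\<in>I. pu (x i) (y i))"

lemma repD:
 assumes "rep r I x y"
 shows "finite I" "i : I ==> x i : carrier R" "i : I ==> y i : carrier R"
  "\<Delta> r = (\<Oplus>\<^bsub>TT\<^esub>i\<in>I. pu (x i) (y i))"
 using assms unfolding rep_def by blast+

lemma rep_exists:
 assumes "r : carrier R" shows "EX (I::nat set) x y. rep r I x y"
proof -
 obtain I :: "nat set" and x y where I: "finite I" "!!i. i : I ==> x i : carrier R"
  "!!i. i : I ==> y i : carrier R" "\<Delta> r = (\<Oplus>\<^bsub>TT\<^esub>i\<in>I. pu (x i) (y i))"
  by(rule algebra_pair.tensor_decompose[OF pairRR Delta_closed[OF assms]]) (rule that; assumption)
 show ?thesis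
  unfolding rep_def by(intro exI[of _ I] exI[of _ x] exI[of _ y] conjI ballI) (simp_all add: I)
qed

lemma lift_rep:
 assumes "module K C" "bilinear_map K R R C \<phi>" "rep r I x y"
 shows "tensor_lift K R R C \<phi> (\<Delta> r) = (\<Oplus>\<^bsub>C\<^esub>i\<in>I. \<phi> (x i) (y i))"
 unfolding repD(4)[OF assms(3)]
 by(rule lift_pu_finsum[OF assms(1,2) repD(1)[OF assms(3)]])(use repD(2,3)[OF assms(3)] in blast)+

lemma bilinear_eps: "bilinear_map K R R R (%x y. \<epsilon> x \<odot> y)"
 by(rule bilinear_compose[OF bilinear_smult[OF modR] eps_linear k_linear_id])

lemma bilinear_S_left: "bilinear_map K R R R (%x y. S x \<otimes> y)"
 by(rule bilinear_compose[OF bilinear_mult[OF algR] S_linear k_linear_id])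

lemma bilinear_S_right: "bilinear_map K R R R (%x y. x \<otimes> S y)"
 by(rule bilinear_compose[OF bilinear_mult[OF algR] k_linear_id S_linear])

lemma counit:
 assumes r: "r : carrier R" and rep: "rep r I x y"
 shows "(\<Oplus>i\<in>I. \<epsilon> (x i) \<odot> y i) = r" "(\<Oplus>i\<in>I. \<epsilon> (y i) \<odot> x i) = r"
proof -
 have h: "ALL r:carrier R. tensor_lift K R R R (%x y. \<epsilon> x \<odot> y) (\<Delta> r) = r &
   tensor_lift K R R R (%x y. \<epsilon> y \<odot> x) (\<Delta> r) = r"
  using hopf unfolding hopf_algebra_def by(elim conjE) assumption
 show "(\<Oplus>i\<in>I. \<epsilon> (x i) \<odot> y i) = r"
  using lift_rep[OF modR bilinear_eps rep] conjunct1[OF bspec[OF h r]] by simp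
 show "(\<Oplus>i\<in>I. \<epsilon> (y i) \<odot> x i) = r"
  using lift_rep[OF modR bilinear_flip[OF bilinear_eps] rep] conjunct2[OF bspec[OF h r]] by simp
qed

lemma antipode:
 assumes r: "r : carrier R" and rep: "rep r I x y"
 shows "(\<Oplus>i\<in>I. S (x i) \<otimes> y i) = \<epsilon> r \<odot> \<one>" "(\<Oplus>i\<in>I. x i \<otimes> S (y i)) = \<epsilon> r \<odot> \<one>"
proof -
 have h: "ALL r:carrier R. tensor_lift K R R R (%x y. S x \<otimes> y) (\<Delta> r) = \<epsilon> r \<odot> \<one> &
   tensor_lift K R R R (%x y. x \<otimes> S y) (\<Delta> r) = \<epsilon> r \<odot> \<one>"
  using hopf unfolding hopf_algebra_def by(elim conjE) assumption
 show "(\<Oplus>i\<in>I. S (x i) \<otimes> y i) = \<epsilon> r \<odot> \<one>"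
  using lift_rep[OF modR bilinear_S_left rep] conjunct1[OF bspec[OF h r]] by simp
 show "(\<Oplus>i\<in>I. x i \<otimes> S (y i)) = \<epsilon> r \<odot> \<one>"
  using lift_rep[OF modR bilinear_S_right rep] conjunct2[OF bspec[OF h r]] by simp
qed

abbreviation "nest x == tensor_lift K R R T2 (%s t. pu2 (pu x s) t)"

lemma nest_bilinear: "x : carrier R ==> bilinear_map K R R T2 (%s t. pu2 (pu x s) t)"
 by(rule bilinear_compose[OF pu2_bilinear bilinear_right[OF pu_bilinear] k_linear_id])

lemma coassociative:
 assumes r: "r : carrier R" and rep: "rep r I x y" and Psi: "k_linear K T2 C \<Psi>" and C: "module K C"
 shows "(\<Oplus>\<^bsub>C\<^esub>i\<in>I. \<Psi> (pu2 (\<Delta> (x i)) (y i))) = (\<Oplus>\<^bsub>C\<^esub>i\<in>I. \<Psi> (nest (x i) (\<Delta> (y i))))"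
proof -
 have h: "ALL r:carrier R.
   tensor_lift K R R T2 (%x y. pu2 (\<Delta> x) y) (\<Delta> r) = tensor_lift K R R T2 (%x y. nest x (\<Delta> y)) (\<Delta> r)"
  using hopf unfolding hopf_algebra_def by(elim conjE) assumption
 have b1: "bilinear_map K R R T2 (%x y. pu2 (\<Delta> x) y)"
  by(rule bilinear_compose[OF pu2_bilinear Delta_linear k_linear_id])
 have b0: "bilinear_map K R TT T2 nest"
 proof (rule lift_parameter[OF algR algR modT2])
  show "k_linear K R T2 (%z. pu2 (pu z x) y)" if "x : carrier R" "y : carrier R" for x y
   by(rule k_linear_compose[OF bilinear_left[OF pu_bilinear that(1)] bilinear_left[OF pu2_bilinear that(2)]])
 qed (rule nest_bilinear modR; assumption?)+
 have b2: "bilinear_map K R R T2 (%x y. nest x (\<Delta> y))"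
  by(rule bilinear_compose[OF b0 k_linear_id Delta_linear])
 have e: "(\<Oplus>\<^bsub>T2\<^esub>i\<in>I. pu2 (\<Delta> (x i)) (y i)) = (\<Oplus>\<^bsub>T2\<^esub>i\<in>I. nest (x i) (\<Delta> (y i)))"
  using bspec[OF h r] unfolding lift_rep[OF modT2 b1 rep] lift_rep[OF modT2 b2 rep] .
 have c1: "pu2 (\<Delta> (x i)) (y i) : carrier T2" if "i : I" for i
  by(rule bilinear_mapD(1)[OF b1 repD(2)[OF rep that] repD(3)[OF rep that]])
 have c2: "nest (x i) (\<Delta> (y i)) : carrier T2" if "i : I" for i
  by(rule bilinear_mapD(1)[OF b2 repD(2)[OF rep that] repD(3)[OF rep that]])
 have "(\<Oplus>\<^bsub>C\<^esub>i\<in>I. \<Psi> (pu2 (\<Delta> (x i)) (y i))) = \<Psi> (\<Oplus>\<^bsub>T2\<^esub>i\<in>I. pu2 (\<Delta> (x i)) (y i))"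
  by(rule k_linear_finsum[OF modT2 C Psi repD(1)[OF rep] c1, symmetric])
 also have "... = \<Psi> (\<Oplus>\<^bsub>T2\<^esub>i\<in>I. nest (x i) (\<Delta> (y i)))" by(rule arg_cong[OF e])
 also have "... = (\<Oplus>\<^bsub>C\<^esub>i\<in>I. \<Psi> (nest (x i) (\<Delta> (y i))))"
  by(rule k_linear_finsum[OF modT2 C Psi repD(1)[OF rep] c2])
 finally show ?thesis .
qed

text \<open>The matrix coefficients of a finite-dimensional comodule in a basis.\<close>

definition comatrix :: "'i set => ('i => 'i => 'r) => bool"
 where "comatrix I g \<longleftrightarrow> finite I & (ALL i:I. ALL j:I. g i j : carrier R &
  rep (g i j) I (g i) (%k. g k j) & \<epsilon> (g i j) = (if i = j then \<one>\<^sub>K else \<zero>\<^sub>K))"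

lemma comatrixD:
 assumes "comatrix I g"
 shows "finite I" "[|i : I; j : I|] ==> g i j : carrier R"
  "[|i : I; j : I|] ==> rep (g i j) I (g i) (%k. g k j)"
  "[|i : I; j : I|] ==> \<epsilon> (g i j) = (if i = j then \<one>\<^sub>K else \<zero>\<^sub>K)"
 using assms unfolding comatrix_def by blast+

lemma comatrix_antipode:
 assumes g: "comatrix I g" and ij: "i : I" "j : I"
 shows "dot I (%k. S (g i k)) (%k. g k j) = (if i = j then \<one> else \<zero>)"
  "dot I (g i) (%k. S (g k j)) = (if i = j then \<one> else \<zero>)"
 unfolding dot_def
 using antipode[OF comatrixD(2,3)[OF g ij]] comatrixD(4)[OF g ij] by(simp_all split: if_splits)

text \<open>A comatrix is invertible, its inverse being its image under the antipode.\<close>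

lemma comatrix_cancel:
 assumes g: "comatrix I g" and x: "!!i. i : I ==> x i : carrier R" and y: "!!i. i : I ==> y i : carrier R"
  and eq: "!!j. j : I ==> dot I x (%k. g k j) = dot I y (%k. g k j)" and i: "i : I"
 shows "x i = y i"
proof -
 note gd = comatrixD[OF g]
 have key: "z i = dot I (%m. dot I z (%k. g k m)) (%m. S (g m i))"
  if z: "!!i. i : I ==> z i : carrier R" for z
 proof -
  have "dot I (%m. dot I z (%k. g k m)) (%m. S (g m i)) = dot I z (%k. dot I (g k) (%m. S (g m i)))"
   by(rule dot_assoc)(use z gd(1,2) i in auto)
  also have "... = dot I z (%k. if k = i then \<one> else \<zero>)"
   by(rule dot_cong)(use z i comatrix_antipode(2)[OF g] in auto)
  also have "... = z i \<otimes> \<one>" by(rule dot_single_right)(use z i gd(1) in auto)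
  finally show ?thesis using z[OF i] by simp
 qed
 have "dot I (%m. dot I x (%k. g k m)) (%m. S (g m i)) = dot I (%m. dot I y (%k. g k m)) (%m. S (g m i))"
  by(rule dot_cong)(use eq gd(2) i y in auto)
 thus ?thesis using key[of x] key[of y] x y by simp
qed

text \<open>Take an expression of \<open>\<Delta> q\<close> with as few summands \<open>x\<^sub>i \<otimes> y\<^sub>i\<close> as possible. Then the \<open>x\<^sub>i\<close> and the \<open>y\<^sub>i\<close>
 are linearly independent and have dual functionals. Contracting the coassociativity law with them
 shows that the \<open>y\<^sub>i\<close> span a comodule and that its coefficients form a comatrix.\<close>

theorem comatrix_expansion:
 assumes q: "q : carrier R"
 shows "EX (I::nat set) g l e. comatrix I g & (ALL i:I. l i : carrier K & e i : carrier K) &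
  q = (\<Oplus>i\<in>I. l i \<odot> (\<Oplus>j\<in>I. e j \<odot> g i j))"
proof -
 let ?P = "%t. rep q (fst t :: nat set) (fst (snd t)) (snd (snd t))"
 obtain I0 :: "nat set" and x0 y0 where "rep q I0 x0 y0" using rep_exists[OF q] by blast
 hence P0: "?P (I0, x0, y0)" by simp
 obtain t where t: "?P t" "ALL u. ?P u --> card (fst t) <= card (fst u)"
  using ex_has_least_nat[of ?P "(I0, x0, y0)" "%t. card (fst t)", OF P0] by(elim exE conjE)
 obtain I x y where tI: "t = (I, x, y)" by(cases t)
 have rq: "rep q I x y" using t(1) tI by simp
 have min: "card I <= card J" if "rep q J x' y'" for J :: "nat set" and x' y'
  using t(2)[rule_format, of "(J, x', y')"] that tI by simp
 note fin = repD(1)[OF rq] and xc = repD(2)[OF rq] and yc = repD(3)[OF rq] and Dq = repD(4)[OF rq]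
 have smaller: "card (I - {m}) < card I" if "m : I" for m
  by(rule card_Diff1_less[OF fin that])
 have indx: "c m = \<zero>\<^sub>K" if c: "!!j. j : I ==> c j : carrier K" and z: "(\<Oplus>j\<in>I. c j \<odot> x j) = \<zero>"
  and m: "m : I" for c m
 proof (rule ccontr)
  assume cm: "c m ~= \<zero>\<^sub>K"
  have "EX y'. (ALL i:I - {m}. y' i : carrier R) &
    (\<Oplus>\<^bsub>TT\<^esub>i\<in>I. pu (x i) (y i)) = (\<Oplus>\<^bsub>TT\<^esub>i\<in>I - {m}. pu (x i) (y' i))"
   by(rule bilinear_shorten[OF K_field modR modR modTT pu_bilinear fin m _ _ _ cm z]) (rule xc yc c; assumption)+
  then
  obtain y' where y': "ALL i:I - {m}. y' i : carrier R"
   "(\<Oplus>\<^bsub>TT\<^esub>i\<in>I. pu (x i) (y i)) = (\<Oplus>\<^bsub>TT\<^esub>i\<in>I - {m}. pu (x i) (y' i))" by(elim exE conjE)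
  have "rep q (I - {m}) x y'" unfolding rep_def trans[OF Dq y'(2)] using fin xc y'(1) by blast
  from min[OF this] show False using smaller[OF m] by linarith
 qed
 have indy: "c m = \<zero>\<^sub>K" if c: "!!j. j : I ==> c j : carrier K" and z: "(\<Oplus>j\<in>I. c j \<odot> y j) = \<zero>"
  and m: "m : I" for c m
 proof (rule ccontr)
  assume cm: "c m ~= \<zero>\<^sub>K"
  have "EX x'. (ALL i:I - {m}. x' i : carrier R) &
    (\<Oplus>\<^bsub>TT\<^esub>i\<in>I. pu (x i) (y i)) = (\<Oplus>\<^bsub>TT\<^esub>i\<in>I - {m}. pu (x' i) (y i))"
   by(rule bilinear_shorten[OF K_field modR modR modTT bilinear_flip[OF pu_bilinear] fin m _ _ _ cm z])
     (rule xc yc c; assumption)+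
  then
  obtain x' where x': "ALL i:I - {m}. x' i : carrier R"
   "(\<Oplus>\<^bsub>TT\<^esub>i\<in>I. pu (x i) (y i)) = (\<Oplus>\<^bsub>TT\<^esub>i\<in>I - {m}. pu (x' i) (y i))" by(elim exE conjE)
  have "rep q (I - {m}) x' y" unfolding rep_def trans[OF Dq x'(2)] using fin yc x'(1) by blast
  from min[OF this] show False using smaller[OF m] by linarith
 qed
 have "ALL i:I. EX f. k_linear K R (self_module K) f & (ALL j:I. f (x j) = (if j = i then \<one>\<^sub>K else \<zero>\<^sub>K))"
 proof
  fix i assume i: "i : I"
  show "EX f. k_linear K R (self_module K) f & (ALL j:I. f (x j) = (if j = i then \<one>\<^sub>K else \<zero>\<^sub>K))"
   by(rule exists_dual_functional[OF K_field modR fin i]) (erule xc, (rule indx; assumption))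
 qed
 hence "EX f. ALL i:I. k_linear K R (self_module K) (f i) & (ALL j:I. f i (x j) = (if j = i then \<one>\<^sub>K else \<zero>\<^sub>K))"
  by(rule bchoice)
 then obtain lam where lam: "!!i. i : I ==> k_linear K R (self_module K) (lam i)"
  "!!i j. [|i : I; j : I|] ==> lam i (x j) = (if j = i then \<one>\<^sub>K else \<zero>\<^sub>K)" by blast
 have "ALL i:I. EX f. k_linear K R (self_module K) f & (ALL j:I. f (y j) = (if j = i then \<one>\<^sub>K else \<zero>\<^sub>K))"
 proof
  fix i assume i: "i : I"
  show "EX f. k_linear K R (self_module K) f & (ALL j:I. f (y j) = (if j = i then \<one>\<^sub>K else \<zero>\<^sub>K))"
   by(rule exists_dual_functional[OF K_field modR fin i]) (erule yc, (rule indy; assumption))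
 qed
 hence "EX f. ALL i:I. k_linear K R (self_module K) (f i) & (ALL j:I. f i (y j) = (if j = i then \<one>\<^sub>K else \<zero>\<^sub>K))"
  by(rule bchoice)
 then obtain mu where mu: "!!i. i : I ==> k_linear K R (self_module K) (mu i)"
  "!!i j. [|i : I; j : I|] ==> mu i (y j) = (if j = i then \<one>\<^sub>K else \<zero>\<^sub>K)" by blast
 define Lam where "Lam = (%i. tensor_lift K R R R (%x y. lam i x \<odot> y))"
 have bL: "bilinear_map K R R R (%x y. lam i x \<odot> y)" if "i : I" for i
  by(rule bilinear_compose[OF bilinear_smult[OF modR] lam(1)[OF that] k_linear_id])
 have Lam: "k_linear K TT R (Lam i)" if "i : I" for i
  unfolding Lam_def by(rule lift_k_linear[OF algR algR modR bL[OF that]])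
 define g where "g = (%i j. Lam i (\<Delta> (x j)))"
 have gc: "g i j : carrier R" if "i : I" "j : I" for i j
  unfolding g_def by(rule k_linearD(1)[OF Lam[OF that(1)] Delta_closed[OF xc[OF that(2)]]])
 text \<open>The right factors span a right coideal.\<close>
 have stepA: "rep (y i) I (g i) y" if i: "i : I" for i
 proof -
  define Psi where "Psi = tensor_lift K TT R TT (%T z. pu (Lam i T) z)"
  have bP: "bilinear_map K TT R TT (%T z. pu (Lam i T) z)"
   by(rule bilinear_compose[OF pu_bilinear Lam[OF i] k_linear_id])
  have Psi: "k_linear K T2 TT Psi" unfolding Psi_def by(rule lift_k_linear[OF algTT algR modTT bP])
  have Psi_pure: "Psi (pu2 T z) = pu (Lam i T) z" if "T : carrier TT" "z : carrier R" for T z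
   unfolding Psi_def by(rule lift_pu2[OF modTT bP that])
  have inner: "Psi (nest (x j) T) = lam i (x j) \<odot>\<^bsub>TT\<^esub> T" if j: "j : I" and T: "T : carrier TT" for j T
  proof (rule k_linear_tensor_ext[OF algR algR modTT _ _ _ T])
   have lc: "lam i (x j) : carrier K" using k_linearD(1)[OF lam(1)[OF i] xc[OF j]] by simp
   show "k_linear K TT TT (%T. Psi (nest (x j) T))"
    by(rule k_linear_compose[OF lift_k_linear[OF algR algR modT2 nest_bilinear[OF xc[OF j]]] Psi])
   show "k_linear K TT TT (%T. lam i (x j) \<odot>\<^bsub>TT\<^esub> T)" by(rule k_linear_scale[OF modTT lc])
   fix s u assume su: "s : carrier R" "u : carrier R"
   have "Psi (nest (x j) (pu s u)) = Psi (pu2 (pu (x j) s) u)"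
    unfolding lift_pu[OF modT2 nest_bilinear[OF xc[OF j]] su] ..
   also have "... = pu (Lam i (pu (x j) s)) u" by(rule Psi_pure)(use xc[OF j] su in auto)
   also have "Lam i (pu (x j) s) = lam i (x j) \<odot> s"
    unfolding Lam_def by(rule lift_pu[OF modR bL[OF i] xc[OF j] su(1)])
   also have "pu (lam i (x j) \<odot> s) u = lam i (x j) \<odot>\<^bsub>TT\<^esub> pu s u"
    by(rule bilinear_mapD(4)[OF pu_bilinear lc su])
   finally show "Psi (nest (x j) (pu s u)) = lam i (x j) \<odot>\<^bsub>TT\<^esub> pu s u" .
  qed
  interpret M: module K TT by(rule modTT)
  have "(\<Oplus>\<^bsub>TT\<^esub>j\<in>I. pu (g i j) (y j)) = (\<Oplus>\<^bsub>TT\<^esub>j\<in>I. Psi (pu2 (\<Delta> (x j)) (y j)))"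
   by(rule TT.finsum_cong'[OF refl])(use Psi_pure xc yc gc[OF i] in "auto simp: g_def")
  also have "... = (\<Oplus>\<^bsub>TT\<^esub>j\<in>I. Psi (nest (x j) (\<Delta> (y j))))"
   by(rule coassociative[OF q rq Psi modTT])
  also have "... = (\<Oplus>\<^bsub>TT\<^esub>j\<in>I. lam i (x j) \<odot>\<^bsub>TT\<^esub> \<Delta> (y j))"
  proof (rule TT.finsum_cong'[OF refl])
   show "(%j. lam i (x j) \<odot>\<^bsub>TT\<^esub> \<Delta> (y j)) : I \<rightarrow> carrier TT" using lam(2)[OF i] yc by auto
   show "Psi (nest (x j) (\<Delta> (y j))) = lam i (x j) \<odot>\<^bsub>TT\<^esub> \<Delta> (y j)" if "j : I" for j
    by(rule inner[OF that])(use yc[OF that] in simp)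
  qed
  also have "... = (%j. lam i (x j) \<odot>\<^bsub>TT\<^esub> \<Delta> (y j)) i"
   by(rule TT.finsum_single[OF fin i])(use lam(2)[OF i] yc i in auto)
  also have "... = \<Delta> (y i)" using lam(2)[OF i i] yc[OF i] by simp
  finally show ?thesis unfolding rep_def using fin gc[OF i] yc by simp
 qed
 text \<open>The coefficients of that coaction form a comatrix.\<close>
 have stepB: "rep (g i l) I (g i) (%k. g k l)" if i: "i : I" and l: "l : I" for i l
 proof -
  define Phi where "Phi = tensor_lift K TT R TT (%T z. mu l z \<odot>\<^bsub>TT\<^esub> T)"
  have bP: "bilinear_map K TT R TT (%T z. mu l z \<odot>\<^bsub>TT\<^esub> T)"
   by(rule bilinear_flip[OF bilinear_compose[OF bilinear_smult[OF modTT] mu(1)[OF l] k_linear_id]])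
  have Phi: "k_linear K T2 TT Phi" unfolding Phi_def by(rule lift_k_linear[OF algTT algR modTT bP])
  have Phi_pure: "Phi (pu2 T z) = mu l z \<odot>\<^bsub>TT\<^esub> T" if "T : carrier TT" "z : carrier R" for T z
   unfolding Phi_def by(rule lift_pu2[OF modTT bP that])
  interpret M: module K TT by(rule modTT)
  have pick: "(\<Oplus>\<^bsub>TT\<^esub>j\<in>I. mu l (y j) \<odot>\<^bsub>TT\<^esub> f j) = f l" if f: "!!j. j : I ==> f j : carrier TT" for f
  proof -
   have "(\<Oplus>\<^bsub>TT\<^esub>j\<in>I. mu l (y j) \<odot>\<^bsub>TT\<^esub> f j) = (%j. mu l (y j) \<odot>\<^bsub>TT\<^esub> f j) l"
    by(rule TT.finsum_single[OF fin l])(use mu(2)[OF l] f l in auto)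
   thus ?thesis using mu(2)[OF l l] f[OF l] by simp
  qed
  have muc: "mu l (y j) : carrier K" if "j : I" for j using mu(2)[OF l that] by simp
  have nst: "nest (g i j) (\<Delta> (y j)) = (\<Oplus>\<^bsub>T2\<^esub>k\<in>I. pu2 (pu (g i j) (g j k)) (y k))" if j: "j : I" for j
   by(rule lift_rep[OF modT2 nest_bilinear[OF gc[OF i j]] stepA[OF j]])
  have Pn: "Phi (nest (g i j) (\<Delta> (y j))) = pu (g i j) (g j l)" if j: "j : I" for j
  proof -
   have "Phi (nest (g i j) (\<Delta> (y j))) = (\<Oplus>\<^bsub>TT\<^esub>k\<in>I. Phi (pu2 (pu (g i j) (g j k)) (y k)))"
    unfolding nst[OF j]
    by(rule k_linear_finsum[OF modT2 modTT Phi fin])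
      (rule bilinear_mapD(1)[OF pu2_bilinear], use gc i j yc in auto)
   also have "... = (\<Oplus>\<^bsub>TT\<^esub>k\<in>I. mu l (y k) \<odot>\<^bsub>TT\<^esub> pu (g i j) (g j k))"
    by(rule TT.finsum_cong'[OF refl])(use Phi_pure gc i j yc muc in auto)
   also have "... = pu (g i j) (g j l)" by(rule pick)(use gc i j in auto)
   finally show ?thesis .
  qed
  have "\<Delta> (g i l) = (\<Oplus>\<^bsub>TT\<^esub>j\<in>I. mu l (y j) \<odot>\<^bsub>TT\<^esub> \<Delta> (g i j))"
   by(rule pick[symmetric])(use gc i in auto)
  also have "... = (\<Oplus>\<^bsub>TT\<^esub>j\<in>I. Phi (pu2 (\<Delta> (g i j)) (y j)))"
  proof (rule TT.finsum_cong'[OF refl])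
   show "(%j. Phi (pu2 (\<Delta> (g i j)) (y j))) : I \<rightarrow> carrier TT"
    using Phi_pure gc i yc muc by auto
   show "mu l (y j) \<odot>\<^bsub>TT\<^esub> \<Delta> (g i j) = Phi (pu2 (\<Delta> (g i j)) (y j))" if "j : I" for j
    by(rule Phi_pure[symmetric])(use gc i yc that in auto)
  qed
  also have "... = (\<Oplus>\<^bsub>TT\<^esub>j\<in>I. Phi (nest (g i j) (\<Delta> (y j))))"
   by(rule coassociative[OF yc[OF i] stepA[OF i] Phi modTT])
  also have "... = (\<Oplus>\<^bsub>TT\<^esub>j\<in>I. pu (g i j) (g j l))"
   by(rule TT.finsum_cong'[OF refl])(use Pn gc i l in auto)
  finally show ?thesis unfolding rep_def using fin gc i l by simp
 qed
 have eps: "\<epsilon> (g i j) = (if i = j then \<one>\<^sub>K else \<zero>\<^sub>K)" if i: "i : I" and j: "j : I" for i j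
 proof -
  have "mu j (y i) = mu j (\<Oplus>k\<in>I. \<epsilon> (g i k) \<odot> y k)" using counit(1)[OF yc[OF i] stepA[OF i]] by simp
  also have "... = (\<Oplus>\<^bsub>self_module K\<^esub>k\<in>I. mu j (\<epsilon> (g i k) \<odot> y k))"
   by(rule k_linear_finsum[OF modR modK mu(1)[OF j] fin])(use gc i yc in auto)
  also have "... = (%k. mu j (\<epsilon> (g i k) \<odot> y k)) j"
  proof -
   interpret SK: module K "self_module K" by(rule modK)
   have v: "mu j (\<epsilon> (g i k) \<odot> y k) = \<epsilon> (g i k) \<otimes>\<^sub>K (if k = j then \<one>\<^sub>K else \<zero>\<^sub>K)" if "k : I" for k
    using k_linearD(3)[OF mu(1)[OF j], of "\<epsilon> (g i k)" "y k"] mu(2)[OF j that] gc[OF i that] yc[OF that] by simp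
   show ?thesis
    by(rule SK.M.finsum_single[OF fin j])(use v gc i j in auto)
  qed
  also have "... = \<epsilon> (g i j)"
   using k_linearD(3)[OF mu(1)[OF j], of "\<epsilon> (g i j)" "y j"] mu(2)[OF j j] gc[OF i j] yc[OF j] by simp
  finally show ?thesis using mu(2)[OF j i] by simp
 qed
 have com: "comatrix I g" unfolding comatrix_def using fin gc stepB eps by simp
 have ye: "y i = (\<Oplus>j\<in>I. \<epsilon> (y j) \<odot> g i j)" if "i : I" for i
  by(rule counit(2)[OF yc[OF that] stepA[OF that], symmetric])
 have "q = (\<Oplus>i\<in>I. \<epsilon> (x i) \<odot> y i)" by(rule counit(1)[OF q rq, symmetric])
 also have "... = (\<Oplus>i\<in>I. \<epsilon> (x i) \<odot> (\<Oplus>j\<in>I. \<epsilon> (y j) \<odot> g i j))"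
  by(rule finsum_cong'[OF refl])(use ye gc xc yc in "auto intro!: A.smult_closed finsum_closed")
 finally show ?thesis
  by(intro exI[of _ I] exI[of _ g] exI[of _ "%i. \<epsilon> (x i)"] exI[of _ "%i. \<epsilon> (y i)"] conjI ballI com)
    (use xc yc in auto)
qed

end

section \<open>The logarithmic derivative of a coderivation\<close>

lemma bilinear_post:
 assumes "bilinear_map K A B C \<phi>" "k_linear K C E f"
 shows "bilinear_map K A B E (%x y. f (\<phi> x y))"
 by(rule bilinear_mapI) (simp_all add: bilinear_mapD[OF assms(1)] k_linearD[OF assms(2)])

locale hopf_derivation = hopf_domain K R \<Delta> \<epsilon> S
 for K :: "('k, 'm) ring_scheme" and R :: "('k, 'r, 'n) module_scheme" (structure)
  and \<Delta> \<epsilon> S +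
 fixes a :: 'r and \<delta> :: "'r => 'r"
 assumes group_like_a: "group_like K R \<Delta> a" and k_der: "k_derivation K R \<delta>"
  and coder: "coderivation K R \<Delta> a \<delta>"
begin

lemma d_linear: "k_linear K R R \<delta>" using k_der unfolding k_derivation_def by blast

lemma d_closed [simp]: "x : carrier R ==> \<delta> x : carrier R" by(rule k_linearD(1)[OF d_linear])

lemma d_add: "[|x : carrier R; y : carrier R|] ==> \<delta> (x \<oplus> y) = \<delta> x \<oplus> \<delta> y"
 by(rule k_linearD(2)[OF d_linear])

lemma d_mult: "[|x : carrier R; y : carrier R|] ==> \<delta> (x \<otimes> y) = \<delta> x \<otimes> y \<oplus> x \<otimes> \<delta> y"
 using k_der unfolding k_derivation_def by blast

lemma d_one: "\<delta> \<one> = \<zero>"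
proof -
 have "\<delta> \<one> \<oplus> \<delta> \<one> = \<delta> \<one>" using d_mult[of \<one> \<one>] by simp
 thus ?thesis using add.l_cancel_one[of "\<delta> \<one>" "\<delta> \<one>"] by simp
qed

lemma d_dot:
 assumes "finite I" "!!i. i : I ==> x i : carrier R" "!!i. i : I ==> y i : carrier R"
 shows "\<delta> (dot I x y) = dot I (%i. \<delta> (x i)) y \<oplus> dot I x (%i. \<delta> (y i))"
proof -
 have "\<delta> (dot I x y) = (\<Oplus>i\<in>I. \<delta> (x i \<otimes> y i))"
  unfolding dot_def by(rule k_linear_finsum[OF modR modR d_linear assms(1)])(use assms in auto)
 also have "... = (\<Oplus>i\<in>I. \<delta> (x i) \<otimes> y i \<oplus> x i \<otimes> \<delta> (y i))"
  by(rule finsum_cong'[OF refl])(use assms in "auto simp: d_mult")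
 also have "... = dot I (%i. \<delta> (x i)) y \<oplus> dot I x (%i. \<delta> (y i))"
  unfolding dot_def by(rule finsum_addf)(use assms in auto)
 finally show ?thesis .
qed

text \<open>The logarithmic derivative of the comatrices, \<open>D(g) = \<delta>(g) S(g)\<close>.\<close>

definition D :: "'r => 'r"
 where "D r = tensor_lift K R R R (%x y. \<delta> x \<otimes> S y) (\<Delta> r)"

lemma D_bilinear: "bilinear_map K R R R (%x y. \<delta> x \<otimes> S y)"
 by(rule bilinear_compose[OF bilinear_mult[OF algR] d_linear S_linear])

lemma D_linear: "k_linear K R R D"
proof -
 have "D = (%r. tensor_lift K R R R (%x y. \<delta> x \<otimes> S y) (\<Delta> r))" by(rule ext) (rule D_def)
 thus ?thesis
  using k_linear_compose[OF Delta_linear lift_k_linear[OF algR algR modR D_bilinear]] by simp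
qed

lemma D_closed [simp]: "r : carrier R ==> D r : carrier R" by(rule k_linearD(1)[OF D_linear])

lemma D_rep: "rep r I x y ==> D r = dot I (%i. \<delta> (x i)) (%i. S (y i))"
 unfolding D_def dot_def by(rule lift_rep[OF modR D_bilinear])

lemma comatrix_d:
 assumes g: "comatrix I g" and i: "i : I" and j: "j : I"
 shows "\<delta> (g i j) = dot I (%k. D (g i k)) (%k. g k j)"
proof -
 note gd = comatrixD[OF g]
 have "dot I (%k. D (g i k)) (%k. g k j)
   = dot I (%k. dot I (%m. \<delta> (g i m)) (%m. S (g m k))) (%k. g k j)"
 proof (rule dot_cong)
  show "D (g i k) = dot I (%m. \<delta> (g i m)) (%m. S (g m k))" if "k : I" for k
   by(rule D_rep[OF gd(3)[OF i that]])
 qed (use gd(2) i j in auto)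
 also have "... = dot I (%m. \<delta> (g i m)) (%m. dot I (%k. S (g m k)) (%k. g k j))"
  by(rule dot_assoc)(use gd(1,2) i j in auto)
 also have "... = dot I (%m. \<delta> (g i m)) (%m. if m = j then \<one> else \<zero>)"
  by(rule dot_cong)(use comatrix_antipode(1)[OF g] gd(2) i j in auto)
 also have "... = \<delta> (g i j) \<otimes> \<one>" by(rule dot_single_right)(use gd(1,2) i j in auto)
 finally show ?thesis using gd(2)[OF i j] by simp
qed

text \<open>Entries of comatrices span \<open>R\<close>.\<close>

lemma linear_ext:
 assumes C: "module K C" and f: "k_linear K R C f" and h: "k_linear K R C h"
  and eq: "!!(I::nat set) g i j. [|comatrix I g; i : I; j : I|] ==> f (g i j) = h (g i j)"
  and q: "q : carrier R"
 shows "f q = h q"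
proof -
 interpret C: module K C by(rule C)
 obtain I :: "nat set" and g l e where g: "comatrix I g"
  and le: "ALL i:I. l i : carrier K & e i : carrier K"
  and qe: "q = (\<Oplus>i\<in>I. l i \<odot> (\<Oplus>j\<in>I. e j \<odot> g i j))"
  using comatrix_expansion[OF q] by(elim exE conjE)
 note gd = comatrixD[OF g]
 have inner: "(\<Oplus>j\<in>I. e j \<odot> g i j) : carrier R" if "i : I" for i
  by(rule finsum_closed)(use le gd(2)[OF that] in auto)
 have ex: "F q = (\<Oplus>\<^bsub>C\<^esub>i\<in>I. l i \<odot>\<^sub>C (\<Oplus>\<^bsub>C\<^esub>j\<in>I. e j \<odot>\<^sub>C F (g i j)))"
  if F: "k_linear K R C F" for F
 proof -
  note Fd = k_linearD[OF F]
  have "F q = (\<Oplus>\<^bsub>C\<^esub>i\<in>I. F (l i \<odot> (\<Oplus>j\<in>I. e j \<odot> g i j)))"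
   unfolding qe by(rule k_linear_finsum[OF modR C F gd(1)])(use le inner in auto)
  also have "... = (\<Oplus>\<^bsub>C\<^esub>i\<in>I. l i \<odot>\<^sub>C (\<Oplus>\<^bsub>C\<^esub>j\<in>I. e j \<odot>\<^sub>C F (g i j)))"
  proof (rule C.M.finsum_cong'[OF refl])
   fix i assume i: "i : I"
   have "F (\<Oplus>j\<in>I. e j \<odot> g i j) = (\<Oplus>\<^bsub>C\<^esub>j\<in>I. F (e j \<odot> g i j))"
    by(rule k_linear_finsum[OF modR C F gd(1)])(use le gd(2)[OF i] in auto)
   also have "... = (\<Oplus>\<^bsub>C\<^esub>j\<in>I. e j \<odot>\<^sub>C F (g i j))"
    by(rule C.M.finsum_cong'[OF refl])(use le gd(2)[OF i] Fd(1,3) in auto)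
   finally show "F (l i \<odot> (\<Oplus>j\<in>I. e j \<odot> g i j)) = l i \<odot>\<^sub>C (\<Oplus>\<^bsub>C\<^esub>j\<in>I. e j \<odot>\<^sub>C F (g i j))"
    using Fd(3)[of "l i"] le i inner[OF i] by simp
  qed (use le gd(2) Fd(1) in "auto intro!: C.smult_closed C.M.finsum_closed")
  finally show ?thesis .
 qed
 have "(\<Oplus>\<^bsub>C\<^esub>i\<in>I. l i \<odot>\<^sub>C (\<Oplus>\<^bsub>C\<^esub>j\<in>I. e j \<odot>\<^sub>C f (g i j)))
   = (\<Oplus>\<^bsub>C\<^esub>i\<in>I. l i \<odot>\<^sub>C (\<Oplus>\<^bsub>C\<^esub>j\<in>I. e j \<odot>\<^sub>C h (g i j)))"
 proof (rule C.M.finsum_cong'[OF refl])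
  fix i assume i: "i : I"
  have "(\<Oplus>\<^bsub>C\<^esub>j\<in>I. e j \<odot>\<^sub>C f (g i j)) = (\<Oplus>\<^bsub>C\<^esub>j\<in>I. e j \<odot>\<^sub>C h (g i j))"
   by(rule C.M.finsum_cong'[OF refl])(use eq[OF g i] le gd(2)[OF i] k_linearD(1)[OF h] in auto)
  thus "l i \<odot>\<^sub>C (\<Oplus>\<^bsub>C\<^esub>j\<in>I. e j \<odot>\<^sub>C f (g i j)) = l i \<odot>\<^sub>C (\<Oplus>\<^bsub>C\<^esub>j\<in>I. e j \<odot>\<^sub>C h (g i j))"
   by simp
 qed (use le gd(2) k_linearD(1)[OF h] in "auto intro!: C.smult_closed C.M.finsum_closed")
 thus ?thesis using ex[OF f] ex[OF h] by simp
qed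

lemma D_times_bilinear: "bilinear_map K R R R (%x y. D x \<otimes> y)"
 by(rule bilinear_compose[OF bilinear_mult[OF algR] D_linear k_linear_id])

lemma d_from_D:
 assumes q: "q : carrier R" shows "tensor_lift K R R R (%x y. D x \<otimes> y) (\<Delta> q) = \<delta> q"
proof (rule linear_ext[OF modR _ d_linear _ q])
 show "k_linear K R R (%q. tensor_lift K R R R (%x y. D x \<otimes> y) (\<Delta> q))"
  by(rule k_linear_compose[OF Delta_linear lift_k_linear[OF algR algR modR D_times_bilinear]])
 show "tensor_lift K R R R (%x y. D x \<otimes> y) (\<Delta> (g i j)) = \<delta> (g i j)"
  if "comatrix I g" "i : I" "j : I" for I :: "nat set" and g i j
  unfolding comatrix_d[OF that] dot_def
  by(rule lift_rep[OF modR D_times_bilinear comatrixD(3)[OF that]])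
qed

lemma rep_mult:
 assumes r: "r : carrier R" "r' : carrier R" and rp: "rep r I x y" and rp': "rep r' J x' y'"
 shows "rep (r \<otimes> r') (I \<times> J) (%p. x (fst p) \<otimes> x' (snd p)) (%p. y (fst p) \<otimes> y' (snd p))"
proof -
 note d = repD[OF rp] and d' = repD[OF rp']
 have "\<Delta> (r \<otimes> r') = \<Delta> r \<otimes>\<^bsub>TT\<^esub> \<Delta> r'" by(rule ring_hom_mult[OF Delta_hom r])
 also have "... = (\<Oplus>\<^bsub>TT\<^esub>i\<in>I. pu (x i) (y i)) \<otimes>\<^bsub>TT\<^esub> \<Delta> r'" by(simp only: d(4))
 also have "... = (\<Oplus>\<^bsub>TT\<^esub>i\<in>I. pu (x i) (y i) \<otimes>\<^bsub>TT\<^esub> \<Delta> r')"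
  by(rule TT.finsum_ldistr)(use d r in auto)
 also have "... = (\<Oplus>\<^bsub>TT\<^esub>i\<in>I. \<Oplus>\<^bsub>TT\<^esub>j\<in>J. pu (x i \<otimes> x' j) (y i \<otimes> y' j))"
 proof (rule TT.finsum_cong'[OF refl])
  fix i assume i: "i : I"
  have "pu (x i) (y i) \<otimes>\<^bsub>TT\<^esub> \<Delta> r' = pu (x i) (y i) \<otimes>\<^bsub>TT\<^esub> (\<Oplus>\<^bsub>TT\<^esub>j\<in>J. pu (x' j) (y' j))"
   by(simp only: d'(4))
  also have "... = (\<Oplus>\<^bsub>TT\<^esub>j\<in>J. pu (x i) (y i) \<otimes>\<^bsub>TT\<^esub> pu (x' j) (y' j))"
   by(rule TT.finsum_rdistr)(use d(2,3)[OF i] d'(1,2,3) in auto)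
  also have "... = (\<Oplus>\<^bsub>TT\<^esub>j\<in>J. pu (x i \<otimes> x' j) (y i \<otimes> y' j))"
   by(rule TT.finsum_cong'[OF refl])(use d(2,3)[OF i] d'(2,3) pu_mult in auto)
  finally show "pu (x i) (y i) \<otimes>\<^bsub>TT\<^esub> \<Delta> r' = (\<Oplus>\<^bsub>TT\<^esub>j\<in>J. pu (x i \<otimes> x' j) (y i \<otimes> y' j))" .
 qed (use d(2,3) d'(2,3) in "auto intro!: TT.finsum_closed")
 also have "... = (\<Oplus>\<^bsub>TT\<^esub>p\<in>I \<times> J. pu (x (fst p) \<otimes> x' (snd p)) (y (fst p) \<otimes> y' (snd p)))"
  by(subst TT.finsum_Times)(use d(1,2,3) d'(1,2,3) in auto)
 finally have e: "\<Delta> (r \<otimes> r') = ..." .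
 show ?thesis unfolding rep_def
  by(intro conjI ballI e)(use d(1,2,3) d'(1,2,3) in auto)
qed

text \<open>The Kronecker product of two comatrices is the comatrix of a tensor product of comodules.\<close>

lemma comatrix_Times:
 assumes g: "comatrix I g" and h: "comatrix J h"
 shows "comatrix (I \<times> J) (%p q. g (fst p) (fst q) \<otimes> h (snd p) (snd q))"
 unfolding comatrix_def
proof (intro conjI ballI)
 note gd = comatrixD[OF g] and hd = comatrixD[OF h]
 show "finite (I \<times> J)" using gd(1) hd(1) by simp
 fix p q assume "p : I \<times> J" "q : I \<times> J"
 hence m: "fst p : I" "fst q : I" "snd p : J" "snd q : J" by auto
 show "g (fst p) (fst q) \<otimes> h (snd p) (snd q) : carrier R" using gd(2) hd(2) m by simp
 show "rep (g (fst p) (fst q) \<otimes> h (snd p) (snd q)) (I \<times> J)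
   (%q. g (fst p) (fst q) \<otimes> h (snd p) (snd q)) (%k. g (fst k) (fst q) \<otimes> h (snd k) (snd q))"
  by(rule rep_mult[OF gd(2)[OF m(1,2)] hd(2)[OF m(3,4)] gd(3)[OF m(1,2)] hd(3)[OF m(3,4)]])
 have "\<epsilon> (g (fst p) (fst q) \<otimes> h (snd p) (snd q)) = \<epsilon> (g (fst p) (fst q)) \<otimes>\<^sub>K \<epsilon> (h (snd p) (snd q))"
  by(rule ring_hom_mult[OF eps_hom gd(2)[OF m(1,2)] hd(2)[OF m(3,4)]])
 thus "\<epsilon> (g (fst p) (fst q) \<otimes> h (snd p) (snd q)) = (if p = q then \<one>\<^sub>K else \<zero>\<^sub>K)"
  unfolding gd(4)[OF m(1,2)] hd(4)[OF m(3,4)] by(auto simp: prod_eq_iff)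
qed

text \<open>Both sides are rows that are carried to \<open>\<delta>(g h)\<close> by the Kronecker product of \<open>g\<close> and \<open>h\<close>, which can
  be cancelled.\<close>

lemma D_mult_comatrix:
 assumes g: "comatrix I g" and h: "comatrix J h" and i: "i : I" "k : I" and p: "p : J" "m : J"
 shows "D (g i k \<otimes> h p m) = \<epsilon> (h p m) \<odot> D (g i k) \<oplus> \<epsilon> (g i k) \<odot> D (h p m)"
proof -
 note gd = comatrixD[OF g] and hd = comatrixD[OF h]
 define E where "E = (%q. \<epsilon> (h p (snd q)) \<odot> D (g i (fst q)) \<oplus> \<epsilon> (g i (fst q)) \<odot> D (h p (snd q)))"
 let ?G = "%p q. g (fst p) (fst q) \<otimes> h (snd p) (snd q)"
 have G: "comatrix (I \<times> J) ?G" by(rule comatrix_Times[OF g h])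
 have ip: "(i, p) : I \<times> J" using i p by simp
 have Ec: "E q : carrier R" if "q : I \<times> J" for q unfolding E_def using gd(2) hd(2) i p that by auto
 have "(%q. D (?G (i, p) q)) (k, m) = E (k, m)"
 proof (rule comatrix_cancel[OF G])
  fix q assume q: "q : I \<times> J"
  hence q': "fst q : I" "snd q : J" by auto
  show "D (?G (i, p) q) : carrier R" "E q : carrier R" using gd(2) hd(2) i p q' Ec[OF q] by auto
  let ?j = "fst q" and ?r = "snd q"
  have c: "D (g i s) : carrier R" "g s ?j : carrier R" if "s : I" for s using gd(2) i q' that by auto
  have c': "D (h p t) : carrier R" "h t ?r : carrier R" if "t : J" for t using hd(2) p q' that by auto
  have first: "(\<Oplus>s\<in>I. \<Oplus>t\<in>J. (\<epsilon> (h p t) \<odot> D (g i s)) \<otimes> (g s ?j \<otimes> h t ?r)) = \<delta> (g i ?j) \<otimes> h p ?r"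
  proof -
   have "(\<Oplus>s\<in>I. \<Oplus>t\<in>J. (\<epsilon> (h p t) \<odot> D (g i s)) \<otimes> (g s ?j \<otimes> h t ?r))
     = (\<Oplus>s\<in>I. D (g i s) \<otimes> g s ?j \<otimes> h p ?r)"
   proof (rule finsum_cong'[OF refl])
    fix s assume s: "s : I"
    have "(\<Oplus>t\<in>J. (\<epsilon> (h p t) \<odot> D (g i s)) \<otimes> (g s ?j \<otimes> h t ?r))
      = (%t. (\<epsilon> (h p t) \<odot> D (g i s)) \<otimes> (g s ?j \<otimes> h t ?r)) p"
     by(rule finsum_single[OF hd(1) p(1)])(use hd(4)[OF p(1)] c[OF s] c' p in auto)
    thus "(\<Oplus>t\<in>J. (\<epsilon> (h p t) \<odot> D (g i s)) \<otimes> (g s ?j \<otimes> h t ?r)) = D (g i s) \<otimes> g s ?j \<otimes> h p ?r"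
     using hd(4)[OF p(1) p(1)] c[OF s] c'[OF p(1)] by(simp add: m_assoc)
   qed (use c c' p in auto)
   also have "... = (\<Oplus>s\<in>I. D (g i s) \<otimes> g s ?j) \<otimes> h p ?r"
    by(rule finsum_ldistr[symmetric])(use gd(1) c c' p in auto)
   finally show ?thesis using comatrix_d[OF g i(1) q'(1)] by(simp add: dot_def)
  qed
  have second: "(\<Oplus>s\<in>I. \<Oplus>t\<in>J. (\<epsilon> (g i s) \<odot> D (h p t)) \<otimes> (g s ?j \<otimes> h t ?r)) = g i ?j \<otimes> \<delta> (h p ?r)"
  proof -
   have "(\<Oplus>s\<in>I. \<Oplus>t\<in>J. (\<epsilon> (g i s) \<odot> D (h p t)) \<otimes> (g s ?j \<otimes> h t ?r))
     = (%s. \<Oplus>t\<in>J. (\<epsilon> (g i s) \<odot> D (h p t)) \<otimes> (g s ?j \<otimes> h t ?r)) i"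
   proof (rule finsum_single[OF gd(1) i(1)])
    show "(\<Oplus>t\<in>J. (\<epsilon> (g i i) \<odot> D (h p t)) \<otimes> (g i ?j \<otimes> h t ?r)) : carrier R"
     by(rule finsum_closed)(use gd(2) c c' i in auto)
    fix s assume s: "s : I" "s ~= i"
    have "(\<Oplus>t\<in>J. (\<epsilon> (g i s) \<odot> D (h p t)) \<otimes> (g s ?j \<otimes> h t ?r)) = (\<Oplus>t\<in>J. \<zero>)"
     by(rule finsum_cong'[OF refl])(use gd(4)[OF i(1) s(1)] s(2) c[OF s(1)] c' in auto)
    thus "(\<Oplus>t\<in>J. (\<epsilon> (g i s) \<odot> D (h p t)) \<otimes> (g s ?j \<otimes> h t ?r)) = \<zero>" by simp
   qed
   also have "... = (\<Oplus>t\<in>J. g i ?j \<otimes> (D (h p t) \<otimes> h t ?r))"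
    by(rule finsum_cong'[OF refl])(use gd(4)[OF i(1) i(1)] c[OF i(1)] c' in "auto simp: m_lcomm")
   also have "... = g i ?j \<otimes> (\<Oplus>t\<in>J. D (h p t) \<otimes> h t ?r)"
    by(rule finsum_rdistr[symmetric])(use hd(1) c i c' in auto)
   finally show ?thesis using comatrix_d[OF h p(1) q'(2)] by(simp add: dot_def)
  qed
  have "dot (I \<times> J) E (%u. ?G u q) = (\<Oplus>s\<in>I. \<Oplus>t\<in>J. E (s, t) \<otimes> (g s ?j \<otimes> h t ?r))"
   unfolding dot_def by(subst finsum_Times)(use gd(1) hd(1) Ec c c' in auto)
  also have "... = (\<Oplus>s\<in>I. (\<Oplus>t\<in>J. (\<epsilon> (h p t) \<odot> D (g i s)) \<otimes> (g s ?j \<otimes> h t ?r))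
    \<oplus> (\<Oplus>t\<in>J. (\<epsilon> (g i s) \<odot> D (h p t)) \<otimes> (g s ?j \<otimes> h t ?r)))"
  proof (rule finsum_cong'[OF refl])
   fix s assume s: "s : I"
   have ec: "\<epsilon> (h p t) : carrier K" "\<epsilon> (g i s) : carrier K" if "t : J" for t
    using gd(2)[OF i(1) s] hd(2)[OF p(1) that] by auto
   have "(\<Oplus>t\<in>J. E (s, t) \<otimes> (g s ?j \<otimes> h t ?r)) = (\<Oplus>t\<in>J. (\<epsilon> (h p t) \<odot> D (g i s)) \<otimes> (g s ?j \<otimes> h t ?r)
     \<oplus> (\<epsilon> (g i s) \<odot> D (h p t)) \<otimes> (g s ?j \<otimes> h t ?r))"
    by(rule finsum_cong'[OF refl])(use c[OF s] c' ec in "auto simp: E_def l_distr")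
   also have "... = (\<Oplus>t\<in>J. (\<epsilon> (h p t) \<odot> D (g i s)) \<otimes> (g s ?j \<otimes> h t ?r))
     \<oplus> (\<Oplus>t\<in>J. (\<epsilon> (g i s) \<odot> D (h p t)) \<otimes> (g s ?j \<otimes> h t ?r))"
    by(rule finsum_addf)(use c[OF s] c' ec in auto)
   finally show "(\<Oplus>t\<in>J. E (s, t) \<otimes> (g s ?j \<otimes> h t ?r))
    = (\<Oplus>t\<in>J. (\<epsilon> (h p t) \<odot> D (g i s)) \<otimes> (g s ?j \<otimes> h t ?r))
     \<oplus> (\<Oplus>t\<in>J. (\<epsilon> (g i s) \<odot> D (h p t)) \<otimes> (g s ?j \<otimes> h t ?r))" .
  qed (use c c' gd(2) hd(2) i p in "auto intro!: a_closed finsum_closed")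
  also have "... = (\<Oplus>s\<in>I. \<Oplus>t\<in>J. (\<epsilon> (h p t) \<odot> D (g i s)) \<otimes> (g s ?j \<otimes> h t ?r))
    \<oplus> (\<Oplus>s\<in>I. \<Oplus>t\<in>J. (\<epsilon> (g i s) \<odot> D (h p t)) \<otimes> (g s ?j \<otimes> h t ?r))"
   by(rule finsum_addf)(use c c' gd(2) hd(2) i p in "auto intro!: finsum_closed")
  also have "... = \<delta> (g i ?j \<otimes> h p ?r)"
   unfolding first second using d_mult gd(2) hd(2) i p q' by simp
  also have "... = dot (I \<times> J) (%u. D (?G (i, p) u)) (%u. ?G u q)"
   using comatrix_d[OF G ip q] by simp
  finally show "dot (I \<times> J) (%u. D (?G (i, p) u)) (%u. ?G u q) = dot (I \<times> J) E (%u. ?G u q)" ..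
 qed (use i p in auto)
 thus ?thesis by(simp add: E_def)
qed

text \<open>\<open>D\<close> is a derivation relative to the counit.\<close>

lemma D_mult:
 assumes x: "x : carrier R" and y: "y : carrier R"
 shows "D (x \<otimes> y) = \<epsilon> y \<odot> D x \<oplus> \<epsilon> x \<odot> D y"
proof -
 have b1: "bilinear_map K R R R (%x y. D (x \<otimes> y))"
  by(rule bilinear_post[OF bilinear_mult[OF algR] D_linear])
 have e: "bilinear_map K R R R (%x y. \<epsilon> x \<odot> D y)"
  by(rule bilinear_compose[OF bilinear_smult[OF modR] eps_linear D_linear])
 have b2: "bilinear_map K R R R (%x y. \<epsilon> y \<odot> D x \<oplus> \<epsilon> x \<odot> D y)"
  by(rule bilinear_add[OF modR bilinear_flip[OF e] e])
 have s: "D (x \<otimes> h p m) = \<epsilon> (h p m) \<odot> D x \<oplus> \<epsilon> x \<odot> D (h p m)"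
  if h: "comatrix J h" "p : J" "m : J" for J :: "nat set" and h p m
 proof -
  have hc: "h p m : carrier R" by(rule comatrixD(2)[OF h])
  show ?thesis
   by(rule linear_ext[OF modR bilinear_left[OF b1 hc] bilinear_left[OF b2 hc] _ x])
     (rule D_mult_comatrix[OF _ h(1) _ _ h(2,3)])
 qed
 show ?thesis
  by(rule linear_ext[OF modR bilinear_right[OF b1 x] bilinear_right[OF b2 x] _ y]) (rule s)
qed

lemma D_one: "D \<one> = \<zero>"
proof -
 have "D \<one> \<oplus> D \<one> = D \<one>" using D_mult[of \<one> \<one>] ring_hom_one[OF eps_hom] by simp
 thus ?thesis using add.l_cancel_one[of "D \<one>" "D \<one>"] by simp
qed

lemma a_closed' [simp]: "a : carrier R" and a_nz: "a ~= \<zero>" and Delta_a: "\<Delta> a = pu a a"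
 using group_like_a unfolding group_like_def by blast+

lemma rep_a: "rep a {0::nat} (%_. a) (%_. a)"
 unfolding rep_def Delta_a by simp

lemma eps_a: "\<epsilon> a = \<one>\<^sub>K"
proof -
 have "\<epsilon> a \<odot> a = a" using counit(1)[OF a_closed' rep_a] by simp
 hence "(\<epsilon> a \<odot> \<one>) \<otimes> a = \<one> \<otimes> a" using A.smult_assoc2[of "\<epsilon> a" \<one> a] by simp
 hence "\<epsilon> a \<odot> \<one> = \<one>" using m_rcancel[OF a_nz a_closed', of "\<epsilon> a \<odot> \<one>" \<one>] by simp
 hence "\<epsilon> (\<epsilon> a \<odot> \<one>) = \<epsilon> \<one>" by simp
 thus ?thesis
  using k_linearD(3)[OF eps_linear, of "\<epsilon> a" \<one>] ring_hom_one[OF eps_hom] by simp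
qed

lemma comatrix_a: "comatrix {0::nat} (%_ _. a)"
 unfolding comatrix_def using rep_a eps_a by simp

definition b :: 'r where "b = S a"

lemma b_closed [simp]: "b : carrier R" unfolding b_def by simp

lemma b_a: "b \<otimes> a = \<one>"
 using antipode(1)[OF a_closed' rep_a] eps_a unfolding b_def by simp

lemma d_a: "\<delta> a = D a \<otimes> a"
 using comatrix_d[OF comatrix_a, of 0 0] by(simp add: dot_def)

lemma d_b: "\<delta> b = \<ominus> (b \<otimes> D a)"
proof -
 have "(\<delta> b \<oplus> b \<otimes> D a) \<otimes> a = \<delta> (b \<otimes> a)" using d_mult[of b a] d_a by(simp add: l_distr m_assoc)
 hence "(\<delta> b \<oplus> b \<otimes> D a) \<otimes> a = \<zero>" unfolding b_a d_one .
 hence "\<delta> b \<oplus> b \<otimes> D a = \<zero>" using integral[of "\<delta> b \<oplus> b \<otimes> D a" a] a_nz by simp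
 thus ?thesis using minus_equality[of "\<delta> b" "b \<otimes> D a"] by simp
qed

text \<open>Differentiate \<open>\<delta> g = D(g) g\<close> once more and compare with the second derivative computed from the
  coderivation identity. The invertible matrix \<open>g\<close> can then be cancelled.\<close>

lemma d_D:
 assumes x: "x : carrier R" shows "\<delta> (D x) = D (\<delta> x) \<oplus> D a \<otimes> D x"
proof (rule linear_ext[OF modR _ _ _ x])
 show "k_linear K R R (%x. \<delta> (D x))" by(rule k_linear_compose[OF D_linear d_linear])
 have m: "k_linear K R R (%x. D a \<otimes> D x)"
  by(rule k_linear_compose[OF D_linear bilinear_right[OF bilinear_mult[OF algR]]]) simp
 have dm: "D a \<otimes> (c \<odot> z) = c \<odot> (D a \<otimes> z)" if "c : carrier K" "z : carrier R" for c z
  by(rule bilinear_mapD(5)[OF bilinear_mult[OF algR] that(1) _ that(2)]) simp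
 show "k_linear K R R (%x. D (\<delta> x) \<oplus> D a \<otimes> D x)"
  by(rule k_linearI)
    (simp_all add: dm r_distr k_linearD[OF D_linear] k_linearD[OF d_linear] A.smult_r_distr a_ac)
next
 fix I :: "nat set" and g i j assume g: "comatrix I g" and i: "i : I" and j: "j : I"
 note gd = comatrixD[OF g]
 have gc: "g s t : carrier R" if "s : I" "t : I" for s t by(rule gd(2)[OF that])
 have bc: "bilinear_map K R R TT (%x y. pu (\<delta> x) y \<oplus>\<^bsub>TT\<^esub> pu (a \<otimes> x) (\<delta> y))"
  by(rule bilinear_add[OF modTT bilinear_compose[OF pu_bilinear d_linear k_linear_id]
     bilinear_compose[OF pu_bilinear bilinear_right[OF bilinear_mult[OF algR] a_closed'] d_linear]])
 have L: "k_linear K TT R (tensor_lift K R R R (%x y. D x \<otimes> y))"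
  by(rule lift_k_linear[OF algR algR modR D_times_bilinear])
 have step: "dot I (%k. \<delta> (D (g p k))) (%k. g k q) = dot I (%k. D (\<delta> (g p k)) \<oplus> D a \<otimes> D (g p k)) (%k. g k q)"
  if p: "p : I" and q: "q : I" for p q
 proof -
  have cr: "ALL r:carrier R. \<Delta> (\<delta> r) = tensor_lift K R R TT
    (%x y. pu (\<delta> x) y \<oplus>\<^bsub>TT\<^esub> pu (a \<otimes> x) (\<delta> y)) (\<Delta> r)"
   using coder unfolding coderivation_def by blast
  have Dd: "\<Delta> (\<delta> (g p q)) = (\<Oplus>\<^bsub>TT\<^esub>k\<in>I. pu (\<delta> (g p k)) (g k q) \<oplus>\<^bsub>TT\<^esub> pu (a \<otimes> g p k) (\<delta> (g k q)))"
   using bspec[OF cr gc[OF p q]] unfolding lift_rep[OF modTT bc gd(3)[OF p q]] .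
  have one: "tensor_lift K R R R (%x y. D x \<otimes> y) (pu (\<delta> (g p k)) (g k q) \<oplus>\<^bsub>TT\<^esub> pu (a \<otimes> g p k) (\<delta> (g k q)))
    = D (\<delta> (g p k)) \<otimes> g k q \<oplus> D (a \<otimes> g p k) \<otimes> \<delta> (g k q)" if k: "k : I" for k
   using k_linearD(2)[OF L, of "pu (\<delta> (g p k)) (g k q)" "pu (a \<otimes> g p k) (\<delta> (g k q))"]
    lift_pu[OF modR D_times_bilinear, of "\<delta> (g p k)" "g k q"]
    lift_pu[OF modR D_times_bilinear, of "a \<otimes> g p k" "\<delta> (g k q)"] gc[OF p k] gc[OF k q] by simp
  have "\<delta> (\<delta> (g p q)) = tensor_lift K R R R (%x y. D x \<otimes> y) (\<Delta> (\<delta> (g p q)))"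
   by(rule d_from_D[symmetric])(use gc p q in simp)
  also have "... = (\<Oplus>k\<in>I. tensor_lift K R R R (%x y. D x \<otimes> y)
    (pu (\<delta> (g p k)) (g k q) \<oplus>\<^bsub>TT\<^esub> pu (a \<otimes> g p k) (\<delta> (g k q))))"
   unfolding Dd by(rule k_linear_finsum[OF modTT modR L gd(1)])(use gc p q in auto)
  also have "... = (\<Oplus>k\<in>I. D (\<delta> (g p k)) \<otimes> g k q \<oplus> D (a \<otimes> g p k) \<otimes> \<delta> (g k q))"
   by(rule finsum_cong'[OF refl])(use one gc p q in auto)
  also have "... = dot I (%k. D (\<delta> (g p k))) (%k. g k q) \<oplus> dot I (%k. D (a \<otimes> g p k)) (%k. \<delta> (g k q))"
   unfolding dot_def by(rule finsum_addf)(use gc p q in auto)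
  also have "dot I (%k. D (a \<otimes> g p k)) (%k. \<delta> (g k q))
    = dot I (%k. (if k = p then D a else \<zero>) \<oplus> D (g p k)) (%k. \<delta> (g k q))"
  proof (rule dot_cong)
   show "D (a \<otimes> g p k) = (if k = p then D a else \<zero>) \<oplus> D (g p k)" if k: "k : I" for k
    using D_mult[OF a_closed' gc[OF p k]] gd(4)[OF p k] eps_a gc[OF p k] by auto
  qed (use gc p q in auto)
  also have "... = D a \<otimes> \<delta> (g p q) \<oplus> dot I (%k. D (g p k)) (%k. \<delta> (g k q))"
  proof -
   have "dot I (%k. (if k = p then D a else \<zero>) \<oplus> D (g p k)) (%k. \<delta> (g k q))
     = dot I (%k. if k = p then D a else \<zero>) (%k. \<delta> (g k q)) \<oplus> dot I (%k. D (g p k)) (%k. \<delta> (g k q))"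
    by(rule dot_add_left)(use gc p q in auto)
   also have "dot I (%k. if k = p then D a else \<zero>) (%k. \<delta> (g k q)) = D a \<otimes> \<delta> (g p q)"
    by(rule dot_single_left)(use gd(1) gc p q in auto)
   finally show ?thesis .
  qed
  finally have e1: "\<delta> (\<delta> (g p q)) = dot I (%k. D (\<delta> (g p k))) (%k. g k q)
    \<oplus> (D a \<otimes> \<delta> (g p q) \<oplus> dot I (%k. D (g p k)) (%k. \<delta> (g k q)))" .
  have e2: "\<delta> (\<delta> (g p q)) = dot I (%k. \<delta> (D (g p k))) (%k. g k q) \<oplus> dot I (%k. D (g p k)) (%k. \<delta> (g k q))"
   unfolding comatrix_d[OF g p q] by(rule d_dot)(use gd(1) gc p q in auto)
  have e3: "D a \<otimes> \<delta> (g p q) = dot I (%k. D a \<otimes> D (g p k)) (%k. g k q)"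
   unfolding comatrix_d[OF g p q] by(rule dot_smult_left[symmetric])(use gd(1) gc p q in auto)
  have cl: "dot I (%k. \<delta> (D (g p k))) (%k. g k q) : carrier R" "dot I (%k. D (g p k)) (%k. \<delta> (g k q)) : carrier R"
   "dot I (%k. D (\<delta> (g p k))) (%k. g k q) : carrier R" "D a \<otimes> \<delta> (g p q) : carrier R"
   using gc p q by(auto intro!: dot_closed)
  have "dot I (%k. \<delta> (D (g p k))) (%k. g k q) \<oplus> dot I (%k. D (g p k)) (%k. \<delta> (g k q))
    = (dot I (%k. D (\<delta> (g p k))) (%k. g k q) \<oplus> D a \<otimes> \<delta> (g p q)) \<oplus> dot I (%k. D (g p k)) (%k. \<delta> (g k q))"
   unfolding e2[symmetric] e1 by(rule a_assoc[symmetric]) (rule cl)+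
  hence "dot I (%k. \<delta> (D (g p k))) (%k. g k q)
    = dot I (%k. D (\<delta> (g p k))) (%k. g k q) \<oplus> D a \<otimes> \<delta> (g p q)"
   using cl add.r_cancel by(meson a_closed)
  also have "... = dot I (%k. D (\<delta> (g p k)) \<oplus> D a \<otimes> D (g p k)) (%k. g k q)"
   unfolding e3 by(rule dot_add_left[symmetric])(use gc p q in auto)
  finally show ?thesis .
 qed
 show "\<delta> (D (g i j)) = D (\<delta> (g i j)) \<oplus> D a \<otimes> D (g i j)"
  by(rule comatrix_cancel[OF g _ _ step[OF i] j])(use gc i in auto)
qed

text \<open>The factor \<open>b = a\<^sup>-\<^sup>1\<close> removes the term with \<open>D a\<close>, so the span of the \<open>b D(x)\<close> is stable under \<open>\<delta>\<close>.\<close>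

lemma d_bD:
 assumes x: "x : carrier R" shows "\<delta> (b \<otimes> D x) = b \<otimes> D (\<delta> x)"
proof -
 have "\<delta> (b \<otimes> D x) = (\<ominus> (b \<otimes> D a \<otimes> D x)) \<oplus> (b \<otimes> D (\<delta> x) \<oplus> b \<otimes> D a \<otimes> D x)"
  using x d_mult[of b "D x"] by(simp add: d_b d_D l_minus r_distr m_assoc)
 also have "... = b \<otimes> D (\<delta> x) \<oplus> ((\<ominus> (b \<otimes> D a \<otimes> D x)) \<oplus> b \<otimes> D a \<otimes> D x)"
  by(rule a_lcomm)(use x in auto)
 also have "... = b \<otimes> D (\<delta> x)" using x by(simp add: l_neg)
 finally show ?thesis .
qed

lemma D_in_subspace:
 assumes U: "generate_ring R (scalars K R \<union> U) = carrier R" "U <= carrier R"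
  and N: "subspace K R N" and DU: "!!u. u : U ==> D u : N" and x: "x : carrier R"
 shows "D x : N"
proof -
 note Nd = subspaceD[OF N]
 have sc: "D (c \<odot> \<one>) = \<zero>" if "c : carrier K" for c
  using k_linearD(3)[OF D_linear that one_closed] that D_one by simp
 have sub: "scalars K R \<union> U <= carrier R" using U(2) by(auto simp: scalars_def)
 have "y : carrier R & D y : N" if "y : generate_ring R (scalars K R \<union> U)" for y
  using that
 proof (induction y)
  case one
  thus ?case using D_one Nd(2) by simp
 next
  case (incl h)
  thus ?case using DU sub sc Nd(2) by(auto simp: scalars_def)
 next
  case (a_inv h)
  have "D (\<ominus> h) = (\<ominus>\<^sub>K \<one>\<^sub>K) \<odot> D h"
   using k_linearD(3)[OF D_linear, of "\<ominus>\<^sub>K \<one>\<^sub>K" h] a_inv.IH A.smult_l_minus[of "\<one>\<^sub>K" h] by simp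
  thus ?case using a_inv.IH Nd(4) by simp
 next
  case (eng_add h1 h2)
  thus ?case using k_linearD(2)[OF D_linear] Nd(3) by simp
 next
  case (eng_mult h1 h2)
  thus ?case using D_mult Nd(3,4) by simp
 qed
 thus ?thesis using x U(1) by blast
qed

text \<open>Every element of \<open>R\<close> is a linear combination of the entries of a solution of a linear
  differential system with a fundamental matrix over \<open>R\<close>.\<close>

lemma linear_system:
 assumes q: "q : carrier R"
 shows "EX (I::nat set) l v g. comatrix I g & (ALL i:I. l i : carrier K & v i : carrier R &
   \<delta> (v i) = dot I (%k. D (g i k)) v) & q = (\<Oplus>i\<in>I. l i \<odot> v i)"
proof -
 obtain I :: "nat set" and g l e where g: "comatrix I g"
  and le: "ALL i:I. l i : carrier K & e i : carrier K"
  and qe: "q = (\<Oplus>i\<in>I. l i \<odot> (\<Oplus>j\<in>I. e j \<odot> g i j))"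
  using comatrix_expansion[OF q] by(elim exE conjE)
 note gd = comatrixD[OF g]
 define v where "v = (%i. dot I (%j. g i j) (%j. e j \<odot> \<one>))"
 have ec: "e j \<odot> \<one> : carrier R" if "j : I" for j using le that by simp
 have vc: "v i : carrier R" if "i : I" for i unfolding v_def by(rule dot_closed)(use gd(2) that ec in auto)
 have ve: "(\<Oplus>j\<in>I. e j \<odot> g i j) = v i" if i: "i : I" for i
  unfolding v_def dot_def
 proof (rule finsum_cong'[OF refl])
  fix j assume j: "j : I"
  show "e j \<odot> g i j = g i j \<otimes> (e j \<odot> \<one>)"
   using A.smult_assoc2[of "e j" \<one> "g i j"] m_comm[of "g i j" "e j \<odot> \<one>"] le j gd(2)[OF i j] by simp
 qed (use gd(2)[OF i] ec in auto)
 have de: "\<delta> (e j \<odot> \<one>) = \<zero>" if "j : I" for j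
  using k_linearD(3)[OF d_linear, of "e j" \<one>] le that d_one by simp
 have dv: "\<delta> (v i) = dot I (%k. D (g i k)) v" if i: "i : I" for i
 proof -
  have "\<delta> (v i) = dot I (%j. \<delta> (g i j)) (%j. e j \<odot> \<one>) \<oplus> dot I (%j. g i j) (%j. \<delta> (e j \<odot> \<one>))"
   unfolding v_def by(rule d_dot)(use gd(1,2) i ec in auto)
  also have "dot I (%j. g i j) (%j. \<delta> (e j \<odot> \<one>)) = dot I (%j. \<delta> (e j \<odot> \<one>)) (%j. g i j)"
   by(rule dot_comm)(use gd(2) i ec in auto)
  also have "... = \<zero>" by(rule dot_zero_left)(use gd(2) i de in auto)
  also have "dot I (%j. \<delta> (g i j)) (%j. e j \<odot> \<one>) = dot I (%j. dot I (%k. D (g i k)) (%k. g k j)) (%j. e j \<odot> \<one>)"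
   by(rule dot_cong)(use comatrix_d[OF g i] gd(2) i ec in auto)
  also have "... = dot I (%k. D (g i k)) (%k. dot I (g k) (%j. e j \<odot> \<one>))"
   by(rule dot_assoc)(use gd(1,2) i ec in auto)
  finally show ?thesis unfolding v_def using gd(2) i ec by(simp add: dot_closed)
 qed
 have "q = (\<Oplus>i\<in>I. l i \<odot> v i)"
  unfolding qe by(rule finsum_cong'[OF refl])(use ve le vc in auto)
 thus ?thesis
  by(intro exI[of _ I] exI[of _ l] exI[of _ v] exI[of _ g] conjI ballI g)(use le vc dv in auto)
qed

end

section \<open>Zariski's lemma\<close>

context field
begin

definition power_sum :: "'a => nat => (nat => 'a) => 'a"
 where "power_sum x n e = (\<Oplus>i\<in>{..n}. e i \<otimes> x [^] i)"

lemma power_sum_closed: "[|x : carrier R; !!i. e i : carrier R|] ==> power_sum x n e : carrier R"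
 unfolding power_sum_def by(rule finsum_closed) auto

lemma power_sum_add:
 assumes "x : carrier R" "!!i. e i : carrier R" "!!i. f i : carrier R"
 shows "power_sum x n (%i. e i \<oplus> f i) = power_sum x n e \<oplus> power_sum x n f"
proof -
 have "power_sum x n (%i. e i \<oplus> f i) = (\<Oplus>i\<in>{..n}. e i \<otimes> x [^] i \<oplus> f i \<otimes> x [^] i)"
  unfolding power_sum_def by(rule finsum_cong'[OF refl])(use assms in "auto simp: l_distr")
 also have "... = power_sum x n e \<oplus> power_sum x n f"
  unfolding power_sum_def by(rule finsum_addf)(use assms in auto)
 finally show ?thesis .
qed

lemma power_sum_smult:
 assumes "x : carrier R" "!!i. e i : carrier R" "c : carrier R"
 shows "power_sum x n (%i. c \<otimes> e i) = c \<otimes> power_sum x n e"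
proof -
 have "power_sum x n (%i. c \<otimes> e i) = (\<Oplus>i\<in>{..n}. c \<otimes> (e i \<otimes> x [^] i))"
  unfolding power_sum_def by(rule finsum_cong'[OF refl])(use assms in "auto simp: m_assoc")
 also have "... = c \<otimes> power_sum x n e"
  unfolding power_sum_def by(rule finsum_rdistr[symmetric])(use assms in auto)
 finally show ?thesis .
qed

lemma power_sum_Suc:
 assumes "x : carrier R" "!!i. e i : carrier R"
 shows "power_sum x (Suc n) e = e (Suc n) \<otimes> x [^] Suc n \<oplus> power_sum x n e"
 unfolding power_sum_def by(rule finsum_Suc)(use assms in auto)

lemma power_sum_shift:
 assumes "x : carrier R" "!!i. e i : carrier R"
 shows "power_sum x (Suc n) (%i. if i = 0 then \<zero> else e (i - 1)) = x \<otimes> power_sum x n e"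
proof -
 have "power_sum x (Suc n) (%i. if i = 0 then \<zero> else e (i - 1))
   = (\<Oplus>i\<in>{..n}. (if Suc i = 0 then \<zero> else e (Suc i - 1)) \<otimes> x [^] Suc i)
    \<oplus> (if (0::nat) = 0 then \<zero> else e (0 - 1)) \<otimes> x [^] (0::nat)"
  unfolding power_sum_def by(rule finsum_Suc2)(use assms in auto)
 also have "... = (\<Oplus>i\<in>{..n}. e i \<otimes> x [^] Suc i)" using assms by simp
 also have "... = (\<Oplus>i\<in>{..n}. x \<otimes> (e i \<otimes> x [^] i))"
 proof (rule finsum_cong'[OF refl])
  show "e i \<otimes> x [^] Suc i = x \<otimes> (e i \<otimes> x [^] i)" for i
   using assms(1) assms(2)[of i] by(simp add: m_ac)
 qed (use assms in auto)
 also have "... = x \<otimes> power_sum x n e"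
  unfolding power_sum_def by(rule finsum_rdistr[symmetric])(use assms in auto)
 finally show ?thesis .
qed

lemma power_sum_const:
 assumes "x : carrier R" "c : carrier R"
 shows "power_sum x n (%i. if i = 0 then c else \<zero>) = c"
proof -
 have "power_sum x n (%i. if i = 0 then c else \<zero>) = (%i. (if i = 0 then c else \<zero>) \<otimes> x [^] i) (0::nat)"
  unfolding power_sum_def by(rule finsum_single)(use assms in auto)
 thus ?thesis using assms by simp
qed

lemma eval_rev_map:
 assumes "x : carrier R" "!!i. e i : carrier R"
 shows "eval (rev (map e [0..<Suc n])) x = power_sum x n e"
proof (induction n)
 case 0
 show ?case using power_sum_Suc[OF assms] assms by(simp add: power_sum_def)
next
 case (Suc n)
 have "eval (rev (map e [0..<Suc (Suc n)])) x
   = e (Suc n) \<otimes> x [^] length (rev (map e [0..<Suc n])) \<oplus> eval (rev (map e [0..<Suc n])) x" by simp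
 thus ?case unfolding Suc.IH power_sum_Suc[OF assms] by simp
qed

lemma eval_power_sum:
 assumes "A <= carrier R" "\<zero> : A" "x : carrier R" "set q <= A" "c : A"
 shows "EX e. (ALL i. e i : A) & e (length q) = c & eval (c # q) x = power_sum x (length q) e"
 using assms(4,5)
proof (induction q arbitrary: c)
 case Nil
 hence "c : carrier R" using assms(1) by blast
 hence "eval [c] x = power_sum x 0 (%i. if i = 0 then c else \<zero>)"
  using power_sum_const[OF assms(3)] assms(3) by simp
 thus ?case using Nil assms(2) by(intro exI[of _ "%i. if i = 0 then c else \<zero>"]) auto
next
 case (Cons d q)
 then obtain e where e: "ALL i. e i : A" "e (length q) = d" "eval (d # q) x = power_sum x (length q) e"
  by fastforce
 define e' where "e' = (%i. if i = Suc (length q) then c else e i)"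
 have e'A: "e' i : A" for i unfolding e'_def using e(1) Cons.prems by simp
 have ec: "e i : carrier R" "e' i : carrier R" for i using e(1) e'A assms(1) by blast+
 have "power_sum x (length q) e' = power_sum x (length q) e"
  unfolding power_sum_def by(rule finsum_cong'[OF refl])(use ec assms(3) in "auto simp: e'_def")
 hence "power_sum x (Suc (length q)) e' = eval (c # d # q) x"
  unfolding power_sum_Suc[OF assms(3) ec(2)] using e(3) by(simp add: e'_def)
 thus ?case using e'A by(intro exI[of _ e']) (auto simp: e'_def)
qed

lemma algebraic_power_sum:
 assumes A: "subring A R" and x: "x : carrier R"
 shows "(algebraic over A) x \<longleftrightarrow> (EX n e. (ALL i. e i : A) & e n ~= \<zero> & power_sum x n e = \<zero>)"
proof
 note As = subringE[OF A]
 assume "(algebraic over A) x"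
 then obtain p where p: "p : carrier (A[X])" "p ~= []" "eval p x = \<zero>"
  using algebraicE[OF A x] by blast
 then obtain c q where cq: "p = c # q" by(cases p) auto
 have pp: "set p <= A" "c ~= \<zero>" using p(1) cq unfolding univ_poly_carrier[symmetric] polynomial_def by auto
 obtain e where "ALL i. e i : A" "e (length q) = c" "eval (c # q) x = power_sum x (length q) e"
  using eval_power_sum[OF As(1,2) x, of q c] pp(1) cq by auto
 thus "EX n e. (ALL i. e i : A) & e n ~= \<zero> & power_sum x n e = \<zero>"
  using p(3) cq pp(2) by(intro exI[of _ "length q"] exI[of _ e]) simp
next
 assume "EX n e. (ALL i. e i : A) & e n ~= \<zero> & power_sum x n e = \<zero>"
 then obtain n e where e: "ALL i. e i : A" "e n ~= \<zero>" "power_sum x n e = \<zero>" by blast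
 have ec: "e i : carrier R" for i using e(1) subringE(1)[OF A] by blast
 show "(algebraic over A) x"
 proof (rule algebraicI)
  show "rev (map e [0..<Suc n]) : carrier (A[X])"
   unfolding univ_poly_carrier[symmetric] polynomial_def using e(1,2) by auto
  show "eval (rev (map e [0..<Suc n])) x = \<zero>" unfolding eval_rev_map[OF x ec] by(rule e(3))
 qed simp
qed

text \<open>In Kaplansky's terminology a G-domain: inverting the single element \<open>b\<close> gives a field.\<close>

definition power_domain :: "'a set => bool"
 where "power_domain B \<longleftrightarrow> (EX b:B. b ~= \<zero> & (ALL c:B. c ~= \<zero> --> (EX n::nat. EX d:B. c \<otimes> d = b [^] n)))"

context
 fixes A x assumes A: "subring A R" and x: "x : carrier R"
begin

abbreviation "B == simple_extension A x"

lemma B_subring: "subring B R" by(rule simple_extension_is_subring[OF A x])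

lemma A_carrier: "c : A ==> c : carrier R" using subringE(1)[OF A] by blast
lemma B_carrier: "c : B ==> c : carrier R" using subringE(1)[OF B_subring] by blast
lemma A_B: "A <= B" by(rule simple_extension_incl[OF subringE(1)[OF A] x])
lemma x_B: "x : B" by(rule simple_extension_mem[OF A x])

lemma subring_pow: "[|subring H R; h : H|] ==> h [^] (n::nat) : H"
 by(induction n) (auto simp: subringE)

text \<open>The element \<open>c = 1 + b x\<close> divides a power of \<open>b\<close> and is coprime to \<open>b\<close>, so it is a unit. The resulting
  equation \<open>c w = 1\<close> is a nontrivial polynomial relation for \<open>x\<close>, because the degrees of \<open>c\<close> and \<open>w\<close> add up.\<close>

lemma power_domain_algebraic:
 assumes "power_domain B" shows "(algebraic over A) x"
proof -
 note Bs = subringE[OF B_subring]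
 obtain b where b: "b : B" "b ~= \<zero>" "ALL c:B. c ~= \<zero> --> (EX n::nat. EX d:B. c \<otimes> d = b [^] n)"
  using assms unfolding power_domain_def by blast
 have img: "B = (%p. eval p x) ` carrier (A[X])"
  by(rule simple_extension_as_eval_img[OF subringE(1)[OF A] x])
 obtain p where p: "p : carrier (A[X])" "b = eval p x" using b(1) img by blast
 have pne: "p ~= []" using p(2) b(2) by auto
 have ps: "set p <= A" "lead_coeff p ~= \<zero>"
  using p(1) pne unfolding univ_poly_carrier[symmetric] polynomial_def by auto
 have bc: "b : carrier R" by(rule B_carrier[OF b(1)])
 define q1 where "q1 = p @ [\<one>]"
 have q1: "polynomial A q1" "q1 ~= []"
  unfolding q1_def polynomial_def using ps pne subringE(3)[OF A] by auto
 define c where "c = b \<otimes> x \<oplus> \<one>"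
 have cB: "c : B" unfolding c_def using b(1) x_B Bs by simp
 have cc: "c : carrier R" by(rule B_carrier[OF cB])
 have ev1: "eval q1 x = c"
  unfolding q1_def c_def p(2) by(rule eval_append_aux)(use ps A_carrier x in auto)
 show ?thesis
 proof (cases "c = \<zero>")
  case True
  show ?thesis by(rule algebraicI[of q1])(use q1 ev1 True in "auto simp: univ_poly_carrier")
 next
  case False
  then obtain n :: nat and d where d: "d : B" "c \<otimes> d = b [^] n" using b(3) cB by blast
  have dc: "d : carrier R" by(rule B_carrier[OF d(1)])
  define y where "y = \<ominus> x \<otimes> b"
  have yB: "y : B" unfolding y_def using b(1) x_B Bs(5,6) by blast
  have yc: "y : carrier R" by(rule B_carrier[OF yB])
  have "y \<oplus> (b \<otimes> x \<oplus> \<one>) = \<one>"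
   unfolding y_def using bc x by(simp add: l_minus m_comm[of x b] a_assoc[symmetric] l_neg)
  hence one: "\<one> = c \<oplus> y" unfolding c_def using yc bc x by(simp add: a_comm)
  have pow: "EX u:B. \<one> = c \<otimes> u \<oplus> y [^] k" for k :: nat
  proof (induction k)
   case 0
   show ?case by(rule bexI[of _ \<zero>])(use cc Bs(2) in auto)
  next
   case (Suc k)
   then obtain u where u: "u : B" "\<one> = c \<otimes> u \<oplus> y [^] k" by blast
   have uc: "u : carrier R" by(rule B_carrier[OF u(1)])
   have ykB: "y [^] k : B" by(rule subring_pow[OF B_subring yB])
   have "y [^] k = y [^] k \<otimes> (c \<oplus> y)" unfolding one[symmetric] using yc by simp
   hence "\<one> = c \<otimes> u \<oplus> (y [^] k \<otimes> c \<oplus> y [^] k \<otimes> y)" using u(2) yc cc by(simp add: r_distr)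
   also have "... = c \<otimes> (u \<oplus> y [^] k) \<oplus> y [^] Suc k"
    using uc yc cc by(simp add: r_distr a_assoc m_comm)
   finally show ?case using u(1) ykB Bs(7) by blast
  qed
  obtain u where u: "u : B" "\<one> = c \<otimes> u \<oplus> y [^] n" using pow by blast
  have uc: "u : carrier R" by(rule B_carrier[OF u(1)])
  define w where "w = u \<oplus> (\<ominus> x) [^] n \<otimes> d"
  have mxB: "(\<ominus> x) [^] n : B" by(rule subring_pow[OF B_subring])(use x_B Bs(5) in blast)
  have wB: "w : B" unfolding w_def using u(1) mxB d(1) Bs(6,7) by blast
  have "y [^] n = (\<ominus> x) [^] n \<otimes> b [^] n" unfolding y_def by(rule nat_pow_distrib)(use x bc in auto)
  moreover have "c \<otimes> ((\<ominus> x) [^] n \<otimes> d) = (\<ominus> x) [^] n \<otimes> (c \<otimes> d)"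
   by(rule m_lcomm)(use cc x dc in auto)
  ultimately have cw: "c \<otimes> w = \<one>"
   unfolding w_def u(2) using uc cc dc x d(2) by(simp add: r_distr)
  obtain q2 where q2: "q2 : carrier (A[X])" "w = eval q2 x" using wB img by blast
  have q2ne: "q2 ~= []" using q2(2) cw cc by auto
  have q2p: "polynomial A q2" using q2(1) univ_poly_carrier by blast
  define Q where "Q = q1 \<otimes>\<^bsub>A[X]\<^esub> q2"
  have q1c: "q1 : carrier (A[X])" using q1(1) univ_poly_carrier by blast
  have hom: "(%p. eval p x) : ring_hom (A[X]) R" by(rule eval_is_hom[OF A x])
  have Qc: "Q : carrier (A[X])"
   unfolding Q_def by(rule ring.ring_simprules(5)[OF univ_poly_is_ring[OF A] q1c q2(1)])
  have Q1: "eval Q x = \<one>"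
   unfolding Q_def using ring_hom_mult[OF hom q1c q2(1)] ev1 q2(2) cw by simp
  have "degree Q = degree q1 + degree q2"
   unfolding Q_def univ_poly_mult using poly_mult_degree_eq[OF A q1(1) q2p] q1(2) q2ne by simp
  hence dQ: "degree Q > 0" unfolding q1_def using pne by(cases p) auto
  have one_c: "[\<one>] : carrier (A[X])"
   unfolding univ_poly_carrier[symmetric] polynomial_def using subringE(3)[OF A] by simp
  have "eval [\<one>] x = \<one>" using x by simp
  hence "\<not> inj_on (%p. eval p x) (carrier (A[X]))"
   using Qc one_c Q1 dQ unfolding inj_on_def by force
  thus ?thesis unfolding over_def transcendental_def .
 qed
qed

lemma fractions_subfield:
 "subfield {y : carrier R. EX s:A. s ~= \<zero> & s \<otimes> y : A} R" (is "subfield ?Q R")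
proof (rule subfieldI')
 note As = subringE[OF A]
 show "subring ?Q R"
 proof (rule subringI)
  show "?Q <= carrier R" by blast
  show "\<one> : ?Q" using As(3) by(auto intro!: bexI[of _ \<one>])
  fix y assume "y : ?Q"
  then obtain s where s: "y : carrier R" "s : A" "s ~= \<zero>" "s \<otimes> y : A" by blast
  have sc: "s : carrier R" by(rule A_carrier[OF s(2)])
  have "s \<otimes> (\<ominus> y) = \<ominus> (s \<otimes> y)" using s(1) sc by(simp add: r_minus)
  hence "s \<otimes> (\<ominus> y) : A" using As(5)[OF s(4)] by simp
  thus "\<ominus> y : ?Q" using s(1-3) by blast
  fix z assume "z : ?Q"
  then obtain t where t: "z : carrier R" "t : A" "t ~= \<zero>" "t \<otimes> z : A" by blast
  have tc: "t : carrier R" by(rule A_carrier[OF t(2)])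
  have st: "s \<otimes> t : A" "s \<otimes> t ~= \<zero>" using As(6) s t integral[OF _ sc tc] by blast+
  have "(s \<otimes> t) \<otimes> (y \<otimes> z) = (s \<otimes> y) \<otimes> (t \<otimes> z)" using s(1) t(1) sc tc by(simp add: m_ac)
  hence "(s \<otimes> t) \<otimes> (y \<otimes> z) : A" using As(6)[OF s(4) t(4)] by simp
  thus "y \<otimes> z : ?Q" using st s(1) t(1) by blast
  have "(s \<otimes> t) \<otimes> (y \<oplus> z) = t \<otimes> (s \<otimes> y) \<oplus> s \<otimes> (t \<otimes> z)"
   using s(1) t(1) sc tc by(simp add: r_distr m_ac)
  hence "(s \<otimes> t) \<otimes> (y \<oplus> z) : A" using As(6,7) s(2,4) t(2,4) by simp
  thus "y \<oplus> z : ?Q" using st s(1) t(1) by blast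
 qed
 fix y assume "y : ?Q - {\<zero>}"
 then obtain s where s: "y : carrier R" "y ~= \<zero>" "s : A" "s ~= \<zero>" "s \<otimes> y : A" by blast
 have sc: "s : carrier R" by(rule A_carrier[OF s(3)])
 have yu: "y : Units R" using s(1,2) field_Units by simp
 have "(s \<otimes> y) \<otimes> inv y = s" using sc s(1) yu by(simp add: m_assoc Units_r_inv)
 moreover have "s \<otimes> y ~= \<zero>" using integral[OF _ sc s(1)] s by blast
 ultimately show "inv y : ?Q" using s(3,5) yu by auto
qed

text \<open>The fractions of \<open>A\<close> form a field over which \<open>x\<close> generates a field. Clear the denominators of \<open>1/y\<close>.\<close>

lemma simple_extension_divides_scalar:
 assumes alg: "(algebraic over A) x" and y: "y : B" "y ~= \<zero>"
 shows "EX z:B. y \<otimes> z : A & y \<otimes> z ~= \<zero>"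
proof -
 note As = subringE[OF A] and Bs = subringE[OF B_subring]
 let ?Q = "{y : carrier R. EX s:A. s ~= \<zero> & s \<otimes> y : A}"
 have AQ: "A <= ?Q"
 proof
  fix c assume c: "c : A"
  thus "c : ?Q" using A_carrier[OF c] As(3) by(auto intro!: bexI[of _ \<one>])
 qed
 have sub: "subfield (simple_extension ?Q x) R"
  using simple_extension_is_subfield[OF fractions_subfield x] algebraic_mono[OF AQ alg] by blast
 have yc: "y : carrier R" by(rule B_carrier[OF y(1)])
 have "y : simple_extension ?Q x" using mono_simple_extension[OF AQ] y(1) by blast
 hence "inv y : simple_extension ?Q x" using subfield_m_inv(1)[OF sub] y(2) by blast
 moreover have "e : carrier R & (EX s:A. s ~= \<zero> & s \<otimes> e : B)" if "e : simple_extension ?Q x" for e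
  using that
 proof (induction e)
  case zero
  show ?case using As(3) Bs(2) by(auto intro!: bexI[of _ \<one>])
 next
  case (lin k1 k2)
  obtain s where s: "k1 : carrier R" "s : A" "s ~= \<zero>" "s \<otimes> k1 : B" using lin.IH by blast
  obtain t where t: "k2 : carrier R" "t : A" "t ~= \<zero>" "t \<otimes> k2 : A" using lin.hyps(2) by blast
  have c: "s : carrier R" "t : carrier R" using s(2) t(2) A_carrier by blast+
  have "(s \<otimes> t) \<otimes> (k1 \<otimes> x \<oplus> k2) = t \<otimes> ((s \<otimes> k1) \<otimes> x) \<oplus> s \<otimes> (t \<otimes> k2)"
   using s(1) t(1) c x by(simp add: r_distr m_ac)
  also have "... : B"
   by(rule Bs(7)) (rule Bs(6), (use s t A_B x_B Bs(6) in blast)+)+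
  finally have "(s \<otimes> t) \<otimes> (k1 \<otimes> x \<oplus> k2) : B" .
  moreover have "s \<otimes> t : A" "s \<otimes> t ~= \<zero>" using As(6) s t integral[OF _ c] by blast+
  moreover have "k1 \<otimes> x \<oplus> k2 : carrier R" using s(1) t(1) x by simp
  ultimately show ?case by blast
 qed
 ultimately obtain s where s: "s : A" "s ~= \<zero>" "s \<otimes> inv y : B" by blast
 have "y \<otimes> (s \<otimes> inv y) = s"
  using yc y(2) A_carrier[OF s(1)] field_Units by(simp add: m_lcomm Units_r_inv)
 thus ?thesis using s by(intro bexI[of _ "s \<otimes> inv y"]) auto
qed

text \<open>Let \<open>m + 1\<close> be the least degree of a relation for \<open>x\<close> over \<open>A\<close>. After inverting a suitable \<open>D\<close> in \<open>A\<close>,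
  the combinations of \<open>1, x, ..., x^m\<close> form a ring \<open>L'\<close> that contains \<open>x\<close> and \<open>1/b\<close>, hence also \<open>1/c\<close> for
  every nonzero \<open>c\<close> in \<open>A\<close>. Coordinates are unique, so \<open>1/c\<close> is already a fraction with denominator a
  power of \<open>D\<close>.\<close>

lemma power_domain_descends:
 assumes G: "power_domain B" shows "power_domain A"
proof -
 note As = subringE[OF A] and Bs = subringE[OF B_subring]
 have alg: "(algebraic over A) x" by(rule power_domain_algebraic[OF G])
 obtain b where b: "b : B" "b ~= \<zero>" "ALL c:B. c ~= \<zero> --> (EX n::nat. EX d:B. c \<otimes> d = b [^] n)"
  using G unfolding power_domain_def by blast
 have bc: "b : carrier R" by(rule B_carrier[OF b(1)])
 let ?P = "%n. EX e. (ALL i. e i : A) & e n ~= \<zero> & power_sum x n e = \<zero>"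
 have "EX n. ?P n" using alg algebraic_power_sum[OF A x] by blast
 then obtain n0 where n0: "?P n0" "ALL k<n0. \<not> ?P k" using exists_least_iff[of ?P] by blast
 obtain p where p: "ALL i. p i : A" "p n0 ~= \<zero>" "power_sum x n0 p = \<zero>" using n0(1) by blast
 have pc: "p i : carrier R" for i using p(1) A_carrier by blast
 have "n0 ~= 0"
 proof
  assume "n0 = 0"
  hence "p 0 \<otimes> x [^] (0::nat) = \<zero>" "p 0 ~= \<zero>" using p(2,3) pc x by(simp_all add: power_sum_def)
  thus False using pc[of 0] by simp
 qed
 then obtain m where m: "n0 = Suc m" by(cases n0) auto
 have uniq: "ALL i<=k. e i = \<zero>" if "ALL i. e i : A" "power_sum x k e = \<zero>" "k <= m" for k e
  using that(2,3)
 proof (induction k)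
  case 0
  hence "\<not> ?P 0" using n0(2) m by blast
  hence "e 0 = \<zero>" using that(1) 0(1) by blast
  thus ?case by simp
 next
  case (Suc k)
  have ec: "e i : carrier R" for i using that(1) A_carrier by blast
  have "\<not> ?P (Suc k)" using n0(2) m Suc.prems(2) by auto
  hence z: "e (Suc k) = \<zero>" using that(1) Suc.prems(1) by blast
  hence "power_sum x k e = \<zero>"
   using Suc.prems(1) power_sum_Suc[OF x ec, of k] power_sum_closed[OF x ec, of k] x by simp
  hence "ALL i<=k. e i = \<zero>" using Suc.IH Suc.prems(2) by simp
  thus ?case using z le_Suc_eq by metis
 qed
 obtain z where z: "z : B" "b \<otimes> z : A" "b \<otimes> z ~= \<zero>"
  using simple_extension_divides_scalar[OF alg b(1,2)] by blast
 define D where "D = p n0 \<otimes> (b \<otimes> z)"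
 have zc: "z : carrier R" by(rule B_carrier[OF z(1)])
 have DA: "D : A" unfolding D_def using As(6) p(1) z(2) by blast
 have Dc: "D : carrier R" by(rule A_carrier[OF DA])
 have Dnz: "D ~= \<zero>" unfolding D_def using integral[of "p n0" "b \<otimes> z"] pc p(2) z(2,3) A_carrier by blast
 define L where "L = {power_sum x m e | e. ALL i. e i : A}"
 define L' where "L' = {y : carrier R. EX n::nat. D [^] n \<otimes> y : L}"
 have Lc: "l : carrier R" if "l : L" for l
  using that A_carrier unfolding L_def by(auto intro!: power_sum_closed x)
 have LI: "power_sum x m e : L" if "!!i. e i : A" for e unfolding L_def using that by blast
 have L_add: "l \<oplus> l' : L" if "l : L" "l' : L" for l l'
 proof -
  obtain e e' where e: "ALL i. e i : A" "l = power_sum x m e" "ALL i. e' i : A" "l' = power_sum x m e'"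
   using \<open>l : L\<close> \<open>l' : L\<close> unfolding L_def by blast
  have "l \<oplus> l' = power_sum x m (%i. e i \<oplus> e' i)"
   unfolding e(2,4) by(rule power_sum_add[symmetric])(use x e(1,3) A_carrier in blast)+
  also have "... : L" by(rule LI)(use e(1,3) As(7) in blast)
  finally show ?thesis .
 qed
 have L_smult: "c \<otimes> l : L" if "c : A" "l : L" for c l
 proof -
  obtain e where e: "ALL i. e i : A" "l = power_sum x m e" using \<open>l : L\<close> unfolding L_def by blast
  have "c \<otimes> l = power_sum x m (%i. c \<otimes> e i)"
   unfolding e(2) by(rule power_sum_smult[symmetric])(use x e(1) A_carrier \<open>c : A\<close> in blast)+
  also have "... : L" by(rule LI)(use e(1) As(6) \<open>c : A\<close> in blast)
  finally show ?thesis .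
 qed
 have A_L: "c : L" if "c : A" for c
 proof -
  have "power_sum x m (%i. if i = 0 then c else \<zero>) : L" by(rule LI)(use that As(2) in auto)
  thus ?thesis using power_sum_const[OF x A_carrier[OF that]] by simp
 qed
 have L_x: "p n0 \<otimes> (x \<otimes> l) : L" if l: "l : L" for l
 proof -
  obtain e where e: "ALL i. e i : A" "l = power_sum x m e" using l unfolding L_def by blast
  have ec: "e i : carrier R" for i using e(1) A_carrier by blast
  define e' where "e' = (%i. if i = 0 then \<zero> else e (i - 1))"
  have e'A: "e' i : A" for i unfolding e'_def using e(1) As(2) by simp
  have e'c: "e' i : carrier R" for i by(rule A_carrier[OF e'A])
  define h where "h = (%i. p n0 \<otimes> e' i \<oplus> (\<ominus> e m) \<otimes> p i)"
  have hA: "h i : A" for i 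
   unfolding h_def by(rule As(7)[OF As(6)[OF p(1)[rule_format] e'A] As(6)[OF As(5)[OF e(1)[rule_format]] p(1)[rule_format]]])
  have hc: "h i : carrier R" for i by(rule A_carrier[OF hA])
  have "power_sum x (Suc m) h = p n0 \<otimes> power_sum x (Suc m) e' \<oplus> (\<ominus> e m) \<otimes> power_sum x (Suc m) p"
   unfolding h_def using power_sum_add[OF x, of "%i. p n0 \<otimes> e' i" "%i. (\<ominus> e m) \<otimes> p i"]
    power_sum_smult[OF x e'c pc] power_sum_smult[OF x pc, of "\<ominus> e m"] pc e'c ec by simp
  also have "... = p n0 \<otimes> (x \<otimes> l)"
  proof -
   have sh: "power_sum x (Suc m) e' = x \<otimes> l"
    unfolding e'_def e(2) by(rule power_sum_shift[OF x]) (rule ec)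
   have pz: "power_sum x (Suc m) p = \<zero>" using p(3) m by simp
   show ?thesis unfolding sh pz using pc ec x Lc[OF l] by simp
  qed
  finally have s: "p n0 \<otimes> (x \<otimes> l) = power_sum x (Suc m) h" ..
  have "h (Suc m) = \<zero>" unfolding h_def e'_def m
   using pc[of "Suc m"] ec[of m] by(simp add: l_minus m_comm[of "e m"] r_neg)
  hence "p n0 \<otimes> (x \<otimes> l) = power_sum x m h"
   unfolding s power_sum_Suc[OF x hc] using x power_sum_closed[OF x hc] by simp
  thus ?thesis using LI[OF hA] by simp
 qed
 have L'c: "y : carrier R" if "y : L'" for y using that unfolding L'_def by blast
 have L'I: "y : L'" if "y : carrier R" "D [^] n \<otimes> y : L" for y and n :: nat
  unfolding L'_def using that by blast
 have L'E: "EX n::nat. D [^] n \<otimes> y : L" if "y : L'" for y using that unfolding L'_def by blast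
 have DnA: "D [^] (n::nat) : A" for n by(rule subring_pow[OF A DA])
 have L_L': "y : L'" if "y : L" for y
  using L'I[of y 0] Lc[OF that] that by simp
 have L'_x: "x \<otimes> y : L'" if y: "y : L'" for y
 proof -
  obtain n :: nat where n: "D [^] n \<otimes> y : L" using L'E[OF y] by blast
  have yc: "y : carrier R" by(rule L'c[OF y])
  have "D [^] Suc n \<otimes> (x \<otimes> y) = (b \<otimes> z) \<otimes> (p n0 \<otimes> (x \<otimes> (D [^] n \<otimes> y)))"
   unfolding nat_pow_Suc using Dc bc zc pc yc x by(simp add: D_def m_ac)
  also have "... : L" by(rule L_smult[OF z(2) L_x[OF n]])
  finally show ?thesis using L'I[of "x \<otimes> y" "Suc n"] x yc by simp
 qed
 have L'_add: "y \<oplus> y' : L'" if y: "y : L'" and y': "y' : L'" for y y'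
 proof -
  obtain n n' :: nat where n: "D [^] n \<otimes> y : L" "D [^] n' \<otimes> y' : L" using L'E[OF y] L'E[OF y'] by blast
  have c: "y : carrier R" "y' : carrier R" using L'c y y' by blast+
  have "D [^] (n + n') \<otimes> (y \<oplus> y') = D [^] n' \<otimes> (D [^] n \<otimes> y) \<oplus> D [^] n \<otimes> (D [^] n' \<otimes> y')"
   using Dc c by(simp add: nat_pow_mult[symmetric] r_distr m_ac)
  also have "... : L" by(rule L_add[OF L_smult[OF DnA n(1)] L_smult[OF DnA n(2)]])
  finally show ?thesis using L'I c by blast
 qed
 have L'_smult: "c \<otimes> y : L'" if cA: "c : A" and y: "y : L'" for c y
 proof -
  obtain n :: nat where n: "D [^] n \<otimes> y : L" using L'E[OF y] by blast
  have c: "y : carrier R" "c : carrier R" using L'c[OF y] A_carrier[OF cA] by blast+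
  have "D [^] n \<otimes> (c \<otimes> y) = c \<otimes> (D [^] n \<otimes> y)" using Dc c by(simp add: m_lcomm)
  hence "D [^] n \<otimes> (c \<otimes> y) : L" using L_smult[OF cA n] by simp
  thus ?thesis using L'I c by blast
 qed
 have L'_B: "u \<otimes> y : L'" if u: "u : B" and y: "y : L'" for u y
  using u
 proof (induction u)
  case zero
  thus ?case using L'c[OF y] L_L'[OF A_L[OF As(2)]] by simp
 next
  case (lin k1 k2)
  have c: "k1 : carrier R" "k2 : carrier R" "y : carrier R"
   using lin.hyps B_carrier A_carrier L'c[OF y] by blast+
  have "(k1 \<otimes> x) \<otimes> y = x \<otimes> (k1 \<otimes> y)" using c x by(simp add: m_ac)
  hence "(k1 \<otimes> x \<oplus> k2) \<otimes> y = x \<otimes> (k1 \<otimes> y) \<oplus> k2 \<otimes> y"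
   using c x by(simp add: l_distr)
  thus ?case using L'_add[OF L'_x[OF lin.IH] L'_smult[OF lin.hyps(2) y]] by simp
 qed
 have bu: "b : Units R" using bc b(2) field_Units by simp
 have ib: "inv b : carrier R" "b \<otimes> inv b = \<one>" using bu by(auto simp: Units_r_inv)
 have L'_inv: "inv b \<otimes> y : L'" if y: "y : L'" for y
 proof -
  have yc: "y : carrier R" by(rule L'c[OF y])
  have "z \<otimes> y : L'" by(rule L'_B[OF z(1) y])
  then obtain n :: nat where n: "D [^] n \<otimes> (z \<otimes> y) : L" using L'E by blast
  have "b \<otimes> (inv b \<otimes> (z \<otimes> y)) = z \<otimes> y" using ib bc zc yc by(simp add: m_assoc[symmetric])
  hence e: "(b \<otimes> z) \<otimes> (inv b \<otimes> y) = z \<otimes> y" using ib bc zc yc by(simp add: m_ac)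
  have "D [^] Suc n \<otimes> (inv b \<otimes> y) = p n0 \<otimes> (D [^] n \<otimes> ((b \<otimes> z) \<otimes> (inv b \<otimes> y)))"
   unfolding nat_pow_Suc using Dc bc zc pc yc ib(1) by(simp add: D_def m_ac)
  also have "... : L" unfolding e using L_smult[OF _ n] p(1) by blast
  finally show ?thesis using L'I[of "inv b \<otimes> y" "Suc n"] ib(1) yc by simp
 qed
 have ibn: "(inv b) [^] (n::nat) : L'" for n
 proof (induction n)
  case 0
  show ?case using L_L'[OF A_L[OF As(3)]] by simp
 next
  case (Suc n)
  thus ?case using L'_inv[OF Suc] ib(1) by(simp add: m_comm)
 qed
 have "EX n::nat. EX d:A. c \<otimes> d = D [^] n" if c: "c : A" "c ~= \<zero>" for c
 proof -
  have cc: "c : carrier R" by(rule A_carrier[OF c(1)])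
  obtain n :: nat and d where d: "d : B" "c \<otimes> d = b [^] n" using b(3) c A_B by blast
  have dc: "d : carrier R" by(rule B_carrier[OF d(1)])
  define w where "w = d \<otimes> (inv b) [^] n"
  have w: "w : L'" unfolding w_def by(rule L'_B[OF d(1) ibn])
  have wc: "w : carrier R" by(rule L'c[OF w])
  have "c \<otimes> w = b [^] n \<otimes> (inv b) [^] n" unfolding w_def d(2)[symmetric] using cc dc ib by(simp add: m_assoc)
  also have "... = (b \<otimes> inv b) [^] n" by(rule nat_pow_distrib[symmetric])(use bc ib in auto)
  finally have cw: "c \<otimes> w = \<one>" using ib(2) by simp
  obtain N :: nat where N: "D [^] N \<otimes> w : L" using L'E[OF w] by blast
  obtain e where e: "ALL i. e i : A" "D [^] N \<otimes> w = power_sum x m e" using N unfolding L_def by blast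
  have ec: "e i : carrier R" for i using e(1) A_carrier by blast
  let ?f = "%i. if i = (0::nat) then \<ominus> (D [^] N) else \<zero>"
  have fc: "?f i : carrier R" for i using Dc by simp
  have "c \<otimes> (D [^] N \<otimes> w) = D [^] N \<otimes> (c \<otimes> w)" by(rule m_lcomm)(use cc wc Dc in auto)
  hence "c \<otimes> (D [^] N \<otimes> w) = D [^] N" using cw Dc by simp
  hence s: "c \<otimes> power_sum x m e = D [^] N" using e(2) by simp
  have "power_sum x m (%i. c \<otimes> e i \<oplus> ?f i) = c \<otimes> power_sum x m e \<oplus> power_sum x m ?f"
   using power_sum_add[OF x _ fc, of "%i. c \<otimes> e i" m] power_sum_smult[OF x ec cc, of m] cc ec by simp
  also have "... = \<zero>" unfolding s using power_sum_const[OF x, of "\<ominus> (D [^] N)" m] Dc by(simp add: r_neg)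
  finally have "ALL i<=m. c \<otimes> e i \<oplus> ?f i = \<zero>"
   by(rule uniq[rotated])(use e(1) c(1) As(2,5,6,7) DnA in auto)
  hence "c \<otimes> e 0 \<oplus> \<ominus> (D [^] N) = \<zero>" by force
  hence "c \<otimes> e 0 = D [^] N" using cc ec[of 0] Dc
   by(metis a_minus_def m_closed nat_pow_closed r_right_minus_eq)
  thus ?thesis using e(1) by blast
 qed
 thus ?thesis unfolding power_domain_def using DA Dnz by blast
qed

end

theorem power_domain_finite_extension_algebraic:
 assumes k: "subfield k R" and xs: "set xs <= carrier R" and G: "power_domain (finite_extension k xs)"
 shows "ALL y:finite_extension k xs. (algebraic over k) y"
 using xs G
proof (induction xs)
 case Nil
 show ?case using algebraic_self[OF subfieldE(1)[OF k]] by simp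
next
 case (Cons x xs)
 let ?A = "finite_extension k xs"
 have x: "x : carrier R" and xs: "set xs <= carrier R" using Cons.prems(1) by auto
 have A: "subring ?A R" by(rule finite_extension_is_subring[OF subfieldE(1)[OF k] xs])
 have e: "finite_extension k (x # xs) = simple_extension ?A x" by simp
 have G: "power_domain (simple_extension ?A x)" using Cons.prems(2) unfolding e .
 have alg: "ALL y:?A. (algebraic over k) y"
  by(rule Cons.IH[OF xs power_domain_descends[OF A x G]])
 have xsA: "!!y. y : set xs ==> (algebraic over k) y"
  using alg finite_extension_mem[OF subfieldE(1)[OF k] xs] by blast
 have Af: "subfield ?A R" by(rule finite_extension_is_subfield[OF k xs xsA])
 have d1: "finite_dimension k ?A" by(rule finite_extension_finite_dimension(1)[OF k xs xsA])
 have d2: "finite_dimension ?A (simple_extension ?A x)"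
  using finite_dimension_simple_extension[OF Af x] power_domain_algebraic[OF A x G] by blast
 have d: "finite_dimension k (simple_extension ?A x)" by(rule telescopic_base_dim(1)[OF k Af d1 d2])
 show ?case unfolding e
  using finite_dimension_imp_algebraic[OF k simple_extension_is_subring[OF A x] d] by blast
qed

end

section \<open>Ideals\<close>

context cring
begin

lemma ideal_by_closure:
 assumes "I <= carrier R" "\<zero> : I" "!!x y. [|x : I; y : I|] ==> x \<oplus> y : I"
  "!!r x. [|r : carrier R; x : I|] ==> r \<otimes> x : I"
 shows "ideal I R"
proof (rule idealI[OF ring_axioms])
 show "subgroup I (add_monoid R)"
 proof (rule add.subgroupI[OF assms(1)])
  fix x assume x: "x : I"
  hence "\<ominus> x = (\<ominus> \<one>) \<otimes> x" using assms(1) by(auto simp: l_minus)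
  thus "\<ominus> x : I" using assms(4)[OF _ x, of "\<ominus> \<one>"] by simp
 qed (use assms in auto)
 show "r \<otimes> x : I" "x \<otimes> r : I" if "x : I" "r : carrier R" for x r
  using assms(1) assms(4)[OF that(2,1)] that m_comm[of x r] by auto
qed

lemma ideal_facts:
 assumes "ideal I R"
 shows "x : I ==> x : carrier R" "\<zero> : I" "[|x : I; y : I|] ==> x \<oplus> y : I"
  "[|r : carrier R; x : I|] ==> r \<otimes> x : I" "x : I ==> \<ominus> x : I"
 using ideal.Icarr[OF assms] additive_subgroup.zero_closed[OF ideal.axioms(1)[OF assms]]
  additive_subgroup.a_closed[OF ideal.axioms(1)[OF assms]] ideal.I_l_closed[OF assms]
  additive_subgroup.a_inv_closed[OF ideal.axioms(1)[OF assms]] by blast+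

lemma adjoin_ideal:
 assumes I: "ideal I R" and c: "c : carrier R"
 shows "ideal {p \<oplus> c \<otimes> d | p d. p : I & d : carrier R} R" (is "ideal ?J R")
  "I <= {p \<oplus> c \<otimes> d | p d. p : I & d : carrier R}"
  "c : {p \<oplus> c \<otimes> d | p d. p : I & d : carrier R}"
proof -
 note If = ideal_facts[OF I]
 have JI: "p \<oplus> c \<otimes> d : ?J" if "p : I" "d : carrier R" for p d using that by blast
 show sub: "I <= ?J"
 proof
  fix p assume p: "p : I"
  thus "p : ?J" using JI[OF p zero_closed] If(1)[OF p] c by simp
 qed
 show "c : ?J" using JI[OF If(2) one_closed] c by simp
 show "ideal ?J R"
 proof (rule ideal_by_closure)
  show "?J <= carrier R" using If(1) c by auto
  show "\<zero> : ?J" using sub If(2) by blast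
  fix x assume "x : ?J"
  then obtain p d where x: "x = p \<oplus> c \<otimes> d" "p : I" "d : carrier R" by blast
  show "r \<otimes> x : ?J" if r: "r : carrier R" for r
  proof -
   have "r \<otimes> x = r \<otimes> p \<oplus> c \<otimes> (r \<otimes> d)"
    unfolding x(1) using If(1)[OF x(2)] x(3) r c by(simp add: r_distr m_lcomm)
   thus ?thesis using JI[OF If(4)[OF r x(2)]] x(3) r by simp
  qed
  fix y assume "y : ?J"
  then obtain q e where y: "y = q \<oplus> c \<otimes> e" "q : I" "e : carrier R" by blast
  have "x \<oplus> y = (p \<oplus> q) \<oplus> c \<otimes> (d \<oplus> e)"
   unfolding x(1) y(1) using If(1)[OF x(2)] If(1)[OF y(2)] x(3) y(3) c by(simp add: r_distr a_ac)
  thus "x \<oplus> y : ?J" using JI[OF If(3)[OF x(2) y(2)]] x(3) y(3) by simp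
 qed
qed

text \<open>For prime \<open>I\<close> this says that the residue ring becomes a field when \<open>f\<close> is inverted.\<close>

definition power_ideal :: "'a => 'a set => bool"
 where "power_ideal f I \<longleftrightarrow> f : carrier R & f ~: I &
  (ALL c:carrier R. c ~: I --> (EX n::nat. EX d:carrier R. EX p:I. f [^] n = p \<oplus> c \<otimes> d))"

lemma maximalideal_unit:
 assumes m: "maximalideal m R" and c: "c : carrier R" "c ~: m"
 shows "EX d:carrier R. EX p:m. \<one> = p \<oplus> c \<otimes> d"
proof -
 have mi: "ideal m R" by(rule maximalideal.axioms(1)[OF m])
 note J = adjoin_ideal[OF mi c(1)]
 have "{p \<oplus> c \<otimes> d | p d. p : m & d : carrier R} = carrier R"
  using maximalideal.I_maximal[OF m J(1,2)] ideal_facts(1)[OF J(1)] J(3) c(2) by blast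
 hence "\<one> : {p \<oplus> c \<otimes> d | p d. p : m & d : carrier R}" by simp
 thus ?thesis by blast
qed

lemma maximalideal_power_ideal:
 assumes m: "maximalideal m R" shows "power_ideal \<one> m"
proof -
 have "\<one> ~: m" using ideal.one_imp_carrier[OF maximalideal.axioms(1)[OF m]] maximalideal.I_notcarr[OF m] by blast
 moreover have "EX n::nat. EX d:carrier R. EX p:m. \<one> [^] n = p \<oplus> c \<otimes> d" if "c : carrier R" "c ~: m" for c
  using maximalideal_unit[OF m that] by(intro exI[of _ 0]) simp
 ultimately show ?thesis unfolding power_ideal_def by blast
qed

text \<open>An ideal that is maximal among the ideals above \<open>P\<close> without powers of \<open>f\<close>.\<close>

lemma exists_power_ideal:
 assumes P: "primeideal P R" and f: "f : carrier R" "f ~: P"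
 shows "EX I. primeideal I R & P <= I & power_ideal f I"
proof -
 have Pi: "ideal P R" by(rule primeideal.axioms(1)[OF P])
 let ?S = "{I. ideal I R & P <= I & (ALL n::nat. f [^] n ~: I)}"
 have fP: "f [^] n ~: P" for n :: nat
 proof (induction n)
  case 0
  thus ?case using ideal.one_imp_carrier[OF Pi] primeideal.I_notcarr[OF P] by auto
 next
  case (Suc n)
  thus ?case using primeideal.I_prime[OF P, of "f [^] n" f] f by auto
 qed
 have "EX I:?S. ALL J:?S. I <= J --> J = I"
 proof (rule subset_Zorn_nonempty)
  show "?S ~= {}" using Pi fP by blast
  fix C assume ne: "C ~= {}" and C: "subset.chain ?S C"
  have mem: "ideal I R" "P <= I" "ALL n::nat. f [^] n ~: I" if "I : C" for I
   using C that unfolding subset.chain_def by blast+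
  have tot: "I <= J \<or> J <= I" if "I : C" "J : C" for I J
   using C that unfolding subset.chain_def by blast
  have "ideal (\<Union>C) R"
  proof (rule ideal_by_closure)
   show "\<Union>C <= carrier R" using ideal_facts(1)[OF mem(1)] by blast
   show "\<zero> : \<Union>C" using ne ideal_facts(2)[OF mem(1)] by blast
   show "r \<otimes> x : \<Union>C" if rx: "r : carrier R" "x : \<Union>C" for r x
    using rx ideal_facts(4)[OF mem(1) rx(1)] by blast
   show "x \<oplus> y : \<Union>C" if xy: "x : \<Union>C" "y : \<Union>C" for x y
   proof -
    obtain I J where IJ: "I : C" "x : I" "J : C" "y : J" using xy by blast
    have "EX L:C. x : L & y : L" using tot[OF IJ(1,3)] IJ by blast
    then obtain L where L: "L : C" "x : L" "y : L" by blast
    thus ?thesis using ideal_facts(3)[OF mem(1)[OF L(1)] L(2,3)] by blast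
   qed
  qed
  thus "\<Union>C \<in> ?S" using mem ne by blast
 qed
 then obtain I where IS: "I : ?S" and maxS: "ALL J:?S. I <= J --> J = I" by(elim bexE)
 have I: "ideal I R" "P <= I" "!!n::nat. f [^] n ~: I" using IS by simp_all
 note If = ideal_facts[OF I(1)]
 have ad: "EX n::nat. EX d:carrier R. EX p:I. f [^] n = p \<oplus> c \<otimes> d" if c: "c : carrier R" "c ~: I" for c
 proof -
  note J = adjoin_ideal[OF I(1) c(1)]
  let ?J = "{p \<oplus> c \<otimes> d | p d. p : I & d : carrier R}"
  have "?J ~: ?S" using maxS J(2,3) c(2) by blast
  hence "EX n::nat. f [^] n : ?J" using J(1,2) I(2) by blast
  thus ?thesis by blast
 qed
 have "primeideal I R"
 proof (rule primeidealI[OF I(1) is_cring])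
  show "carrier R ~= I" using I(3)[of 0] by auto
  fix x y assume xy: "x : carrier R" "y : carrier R" "x \<otimes> y : I"
  show "x : I \<or> y : I"
  proof (rule ccontr)
   assume "\<not> (x : I \<or> y : I)"
   hence ni: "x ~: I" "y ~: I" by auto
   obtain n :: nat and d p where n: "d : carrier R" "p : I" "f [^] n = p \<oplus> x \<otimes> d" using ad[OF xy(1) ni(1)] by blast
   obtain n' :: nat and e q where n': "e : carrier R" "q : I" "f [^] n' = q \<oplus> y \<otimes> e" using ad[OF xy(2) ni(2)] by blast
   have pc: "p : carrier R" "q : carrier R" using If(1) n(2) n'(2) by blast+
   have "f [^] (n + n') = (q \<oplus> y \<otimes> e) \<otimes> p \<oplus> ((x \<otimes> d) \<otimes> q \<oplus> (d \<otimes> e) \<otimes> (x \<otimes> y))"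
    unfolding nat_pow_mult[OF f(1), symmetric] n(3) n'(3)
    using pc n(1) n'(1) xy(1,2) by(simp add: l_distr r_distr m_ac a_ac)
   also have "... : I" using If(3,4) pc n(1,2) n'(1,2) xy by simp
   finally show False using I(3) by blast
  qed
 qed
 moreover have "f ~: I" using I(3)[of 1] f by simp
 ultimately show ?thesis unfolding power_ideal_def using I(2) f(1) ad by blast
qed

end

section \<open>Residue fields\<close>

locale affine_derivation =
 fixes K :: "('k, 'm) ring_scheme" and R :: "('k, 'r, 'n) module_scheme" (structure)
  and \<delta> :: "'r => 'r"
 assumes char_K: "char_zero K" and affine: "affine_algebra K R" and der: "k_derivation K R \<delta>"
begin

lemma K_is_field: "field K" and R_algebra: "algebra K R" and R_domain: "domain R"
 using affine unfolding affine_algebra_def by blast+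

sublocale domain R by(rule R_domain)
sublocale K: field K by(rule K_is_field)
sublocale A: algebra K R by(rule R_algebra)

lemma del_linear: "k_linear K R R \<delta>" using der unfolding k_derivation_def by blast
lemma del_closed [simp]: "x : carrier R ==> \<delta> x : carrier R" by(rule k_linearD(1)[OF del_linear])
lemma del_add: "[|x : carrier R; y : carrier R|] ==> \<delta> (x \<oplus> y) = \<delta> x \<oplus> \<delta> y"
 by(rule k_linearD(2)[OF del_linear])
lemma del_mult: "[|x : carrier R; y : carrier R|] ==> \<delta> (x \<otimes> y) = \<delta> x \<otimes> y \<oplus> x \<otimes> \<delta> y"
 using der unfolding k_derivation_def by blast

lemma del_zero: "\<delta> \<zero> = \<zero>"
 by(rule k_linear_zero[OF algebra_module[OF R_algebra] algebra_module[OF R_algebra] del_linear])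

lemma del_scalar:
 assumes "s : scalars K R" shows "\<delta> s = \<zero>" "s : carrier R"
proof -
 obtain c where c: "c : carrier K" "s = c \<odot> \<one>" using assms unfolding scalars_def by blast
 have "\<delta> \<one> \<oplus> \<delta> \<one> = \<delta> \<one>" using del_mult[of \<one> \<one>] by simp
 hence "\<delta> \<one> = \<zero>" using add.l_cancel_one[of "\<delta> \<one>" "\<delta> \<one>"] by simp
 thus "\<delta> s = \<zero>" using k_linearD(3)[OF del_linear, of c \<one>] c by simp
 show "s : carrier R" using c by simp
qed

lemma del_pow_closed [simp]: "x : carrier R ==> (\<delta> ^^ n) x : carrier R"
 by(induction n) auto

text \<open>The structure map from \<open>R\<close> to the fraction field of \<open>R/P\<close>.\<close>

definition eta :: "'r set => 'r => ('r set \<times> 'r set) set"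
 where "eta P x = fraction (R Quot P) (P +> x) \<one>\<^bsub>R Quot P\<^esub>"

abbreviation "FF P == fraction_field (R Quot P)"
text \<open>A superscript \<open>P\<close> marks the operations of the fraction field of \<open>R/P\<close>.\<close>

abbreviation (input) FF_mult ("_ \<otimes>\<^sup>_ _" [70, 1000, 71] 70) where "x \<otimes>\<^sup>P y == x \<otimes>\<^bsub>FF P\<^esub> y"
abbreviation (input) FF_add ("_ \<oplus>\<^sup>_ _" [65, 1000, 66] 65) where "x \<oplus>\<^sup>P y == x \<oplus>\<^bsub>FF P\<^esub> y"
abbreviation (input) FF_uminus ("\<ominus>\<^sup>_ _" [1000, 81] 80) where "\<ominus>\<^sup>P x == \<ominus>\<^bsub>FF P\<^esub> x"
abbreviation (input) FF_zero ("\<zero>\<^sup>_" [1000] 1000) where "\<zero>\<^sup>P == \<zero>\<^bsub>FF P\<^esub>"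
abbreviation (input) FF_one ("\<one>\<^sup>_" [1000] 1000) where "\<one>\<^sup>P == \<one>\<^bsub>FF P\<^esub>"

abbreviation "dF P == frac_derivation (R Quot P) (quot_derivation R P \<delta>)"

context
 fixes P assumes P: "primeideal P R"
begin

lemma P_ideal: "ideal P R" by(rule primeideal.axioms(1)[OF P])
lemma Quot_domain: "domain (R Quot P)" by(rule primeideal.quotient_is_domain[OF P])
lemma FF_field: "field (FF P)" by(rule domain.Fr_field[OF Quot_domain])
lemma coset_hom: "(+>) P : ring_hom R (R Quot P)" by(rule ideal.rcos_ring_hom[OF P_ideal])

lemma eta_emb: "eta P = domain.emb (R Quot P) \<circ> (+>) P"
 by(rule ext) (simp add: eta_def domain.emb_def[OF Quot_domain])

lemma eta_hom: "eta P : ring_hom R (FF P)"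
 unfolding eta_emb by(rule ring_hom_trans[OF coset_hom domain.emb_hom[OF Quot_domain]])

lemma eta_cring_hom: "ring_hom_cring R (FF P) (eta P)"
 by(intro ring_hom_cring.intro ring_hom_cring_axioms.intro is_cring domain.axioms(1)[OF field.axioms(1)[OF FF_field]] eta_hom)

lemma coset_carrier: "x : carrier (R Quot P) \<longleftrightarrow> (EX r:carrier R. x = P +> r)"
 unfolding FactRing_def A_RCOSETS_def' by auto

lemma coset_zero_iff: "x : carrier R ==> P +> x = \<zero>\<^bsub>R Quot P\<^esub> \<longleftrightarrow> x : P"
 using ideal.rcos_const_imp_mem[OF P_ideal, of x] abelian_subgroup.a_rcos_const[OF abelian_subgroupI3[OF ideal.axioms(1)[OF P_ideal] abelian_group_axioms], of x]
 by(auto simp: FactRing_def)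

lemma eta_zero_iff: "x : carrier R ==> eta P x = \<zero>\<^sup>P \<longleftrightarrow> x : P"
 unfolding eta_emb using domain.emb_zero_iff[OF Quot_domain, of "P +> x"] coset_zero_iff[of x] coset_carrier by auto

lemma eta_eq_iff:
 assumes "x : carrier R" "y : carrier R" "eta P x = eta P y" shows "x \<ominus> y : P"
proof -
 interpret h: ring_hom_cring R "FF P" "eta P" by(rule eta_cring_hom)
 have "eta P (x \<ominus> y) = eta P y \<oplus>\<^sup>P (\<ominus>\<^sup>P eta P y)"
  unfolding a_minus_def using assms by simp
 also have "... = \<zero>\<^sup>P" using assms by(intro h.S.r_neg) simp
 finally show ?thesis using eta_zero_iff[of "x \<ominus> y"] assms by simp
qed

lemma eta_denominator:
 assumes "y : carrier (FF P)"
 shows "EX r:carrier R. EX s:carrier R. s ~: P & eta P s \<otimes>\<^sup>P y = eta P r"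
proof -
 obtain u v where uv: "u : carrier (R Quot P)" "v : carrier (R Quot P)" "v ~= \<zero>\<^bsub>R Quot P\<^esub>"
  "domain.emb (R Quot P) v \<otimes>\<^sup>P y = domain.emb (R Quot P) u"
  by(rule domain.Fr_denominator[OF Quot_domain assms])
 obtain r s where rs: "r : carrier R" "u = P +> r" "s : carrier R" "v = P +> s"
  using uv(1,2) unfolding coset_carrier by blast
 have "s ~: P" using uv(3) rs coset_zero_iff by blast
 moreover have "eta P s \<otimes>\<^sup>P y = eta P r" using uv(4) unfolding eta_emb rs by simp
 ultimately show ?thesis using rs by blast
qed

lemma scalar_subfield: "subfield (eta P ` scalars K R) (FF P)"
proof -
 interpret h: ring_hom_cring R "FF P" "eta P" by(rule eta_cring_hom)
 have hm: "(%c. eta P (c \<odot> \<one>)) : ring_hom K (FF P)"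
 proof (rule ring_hom_memI)
  fix c d assume c: "c : carrier K" "d : carrier K"
  have "(c \<otimes>\<^sub>K d) \<odot> \<one> = (c \<odot> \<one>) \<otimes> (d \<odot> \<one>)"
   using c by(simp add: A.smult_assoc1 A.smult_assoc2)
  thus "eta P ((c \<otimes>\<^sub>K d) \<odot> \<one>) = eta P (c \<odot> \<one>) \<otimes>\<^sup>P eta P (d \<odot> \<one>)" using c by simp
  show "eta P ((c \<oplus>\<^sub>K d) \<odot> \<one>) = eta P (c \<odot> \<one>) \<oplus>\<^sup>P eta P (d \<odot> \<one>)"
   using c by(simp add: A.smult_l_distr)
 qed auto
 have e: "eta P ` scalars K R = (%c. eta P (c \<odot> \<one>)) ` carrier K"
  unfolding scalars_def image_image ..
 have rr: "ring_hom_ring K (FF P) (%c. eta P (c \<odot> \<one>))"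
  by(intro ring_hom_ring.intro ring_hom_ring_axioms.intro K.ring_axioms h.S.ring_axioms hm)
 show ?thesis
  unfolding e by(rule ring_hom_ring.img_is_subfield(2)[OF rr K.carrier_is_subfield domain.one_not_zero[OF field.axioms(1)[OF FF_field]]])
qed

lemma image_subring: "subring (eta P ` carrier R) (FF P)"
proof -
 interpret h: ring_hom_cring R "FF P" "eta P" by(rule eta_cring_hom)
 show ?thesis
 proof (rule h.S.subringI)
  show "\<one>\<^sup>P : eta P ` carrier R" using imageI[OF one_closed, of "eta P"] by simp
  show "\<ominus>\<^sup>P u : eta P ` carrier R" if u: "u : eta P ` carrier R" for u
  proof -
   obtain x where "u = eta P x" "x : carrier R" using u by blast
   thus ?thesis using h.hom_a_inv[of x] by(intro image_eqI[of _ _ "\<ominus> x"]) simp_all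
  qed
  show "u \<otimes>\<^sup>P v : eta P ` carrier R" if uv: "u : eta P ` carrier R" "v : eta P ` carrier R" for u v
  proof -
   obtain x y where "u = eta P x" "x : carrier R" "v = eta P y" "y : carrier R" using uv by blast
   thus ?thesis by(intro image_eqI[of _ _ "x \<otimes> y"]) simp_all
  qed
  show "u \<oplus>\<^sup>P v : eta P ` carrier R" if uv: "u : eta P ` carrier R" "v : eta P ` carrier R" for u v
  proof -
   obtain x y where "u = eta P x" "x : carrier R" "v = eta P y" "y : carrier R" using uv by blast
   thus ?thesis by(intro image_eqI[of _ _ "x \<oplus> y"]) simp_all
  qed
 qed (use h.hom_closed in blast)
qed

lemma image_finite_extension:
 "EX xs. set xs <= carrier (FF P) & eta P ` carrier R = ring.finite_extension (FF P) (eta P ` scalars K R) xs"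
proof -
 interpret h: ring_hom_cring R "FF P" "eta P" by(rule eta_cring_hom)
 obtain U where U: "finite U" "U <= carrier R" "generate_ring R (scalars K R \<union> U) = carrier R"
  using affine unfolding affine_algebra_def by blast
 obtain us where us: "set us = U" using finite_list[OF U(1)] by blast
 define xs where "xs = map (eta P) us"
 have xs: "set xs <= carrier (FF P)" unfolding xs_def using us U(2) by auto
 note ks = subfieldE(1)[OF scalar_subfield]
 have dom: "domain (FF P)" by(rule field.axioms(1)[OF FF_field])
 let ?E = "ring.finite_extension (FF P) (eta P ` scalars K R) xs"
 have Es: "subring ?E (FF P)" by(rule domain.finite_extension_is_subring[OF dom ks xs])
 note Er = subringE[OF Es]
 have inc: "eta P ` scalars K R <= ?E"
  by(rule h.S.finite_extension_incl[OF subringE(1)[OF ks] xs])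
 have mem: "set xs <= ?E" by(rule domain.finite_extension_mem[OF dom ks xs])
 have sc: "scalars K R <= carrier R" using del_scalar(2) by blast
 have "x : carrier R & eta P x : ?E" if "x : generate_ring R (scalars K R \<union> U)" for x
  using that
 proof (induction x)
  case (incl h)
  thus ?case using inc mem sc U(2) us unfolding xs_def by auto
 qed (use Er in auto)
 hence "eta P ` carrier R <= ?E" unfolding U(3) by blast
 moreover have "?E <= eta P ` carrier R"
  by(rule h.S.finite_extension_subring_incl[OF image_subring])(use sc us U(2) xs_def in auto)
 ultimately show ?thesis using xs by blast
qed

lemma image_algebraic:
 assumes G: "power_ideal f P"
 shows "ALL y:eta P ` carrier R. (ring.algebraic (FF P) over (eta P ` scalars K R)) y"
proof -
 interpret h: ring_hom_cring R "FF P" "eta P" by(rule eta_cring_hom)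
 have rh: "ring_hom_ring R (FF P) (eta P)" by(rule ring_hom_ringI2[OF ring_axioms h.S.ring_axioms eta_hom])
 obtain xs where xs: "set xs <= carrier (FF P)"
  "eta P ` carrier R = ring.finite_extension (FF P) (eta P ` scalars K R) xs"
  using image_finite_extension by blast
 have f: "f : carrier R" "f ~: P" using G unfolding power_ideal_def by blast+
 have "field.power_domain (FF P) (eta P ` carrier R)"
  unfolding field.power_domain_def[OF FF_field]
 proof (intro bexI conjI ballI impI)
  show "eta P f ~= \<zero>\<^sup>P" using eta_zero_iff f by blast
  show "eta P f : eta P ` carrier R" using f by blast
  fix u assume "u : eta P ` carrier R" and nz: "u ~= \<zero>\<^sup>P"
  then obtain c where c: "c : carrier R" "u = eta P c" by blast
  have "c ~: P" using nz c eta_zero_iff by blast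
  then obtain n :: nat and d p where n: "d : carrier R" "p : P" "f [^] n = p \<oplus> c \<otimes> d"
   using G c(1) unfolding power_ideal_def by blast
  have pc: "p : carrier R" by(rule ideal_facts(1)[OF P_ideal n(2)])
  have "eta P f [^]\<^bsub>FF P\<^esub> n = eta P (p \<oplus> c \<otimes> d)"
   using ring_hom_ring.hom_nat_pow[OF rh f(1), of n] n(3) by simp
  also have "... = \<zero>\<^sup>P \<oplus>\<^sup>P eta P c \<otimes>\<^sup>P eta P d"
   using pc c(1) n(1) eta_zero_iff[OF pc] n(2) by simp
  finally have "u \<otimes>\<^sup>P eta P d = eta P f [^]\<^bsub>FF P\<^esub> n" using c n(1) by simp
  thus "EX n::nat. EX d:eta P ` carrier R. u \<otimes>\<^sup>P d = eta P f [^]\<^bsub>FF P\<^esub> n" using n(1) by blast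
 qed
 thus ?thesis
  using field.power_domain_finite_extension_algebraic[OF FF_field scalar_subfield xs(1)] unfolding xs(2) by blast
qed

lemma power_ideal_maximal:
 assumes G: "power_ideal f P" shows "maximalideal P R"
proof (rule maximalidealI[OF P_ideal])
 interpret h: ring_hom_cring R "FF P" "eta P" by(rule eta_cring_hom)
 show "carrier R ~= P" by(rule primeideal.I_notcarr[OF P])
 fix J assume J: "ideal J R" "P <= J" "J <= carrier R"
 show "J = P \<or> J = carrier R"
 proof (cases "J = P")
  case False
  then obtain c where c: "c : J" "c ~: P" using J(2) by blast
  have cc: "c : carrier R" using c(1) J(3) by blast
  obtain xs where xs: "set xs <= carrier (FF P)"
   "eta P ` carrier R = ring.finite_extension (FF P) (eta P ` scalars K R) xs"
   using image_finite_extension by blast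
  have dom: "domain (FF P)" by(rule field.axioms(1)[OF FF_field])
  have sf: "subfield (eta P ` carrier R) (FF P)"
   unfolding xs(2)
  proof (rule domain.finite_extension_is_subfield[OF dom scalar_subfield xs(1)])
   fix y assume "y : set xs"
   hence "y : eta P ` carrier R"
    unfolding xs(2) using domain.finite_extension_mem[OF dom subfieldE(1)[OF scalar_subfield] xs(1)] by blast
   thus "(ring.algebraic (FF P) over (eta P ` scalars K R)) y" using image_algebraic[OF G] by blast
  qed
  have nz: "eta P c ~= \<zero>\<^sup>P" using eta_zero_iff[OF cc] c(2) by blast
  have "inv\<^bsub>FF P\<^esub> eta P c : eta P ` carrier R" "eta P c \<otimes>\<^sup>P inv\<^bsub>FF P\<^esub> eta P c = \<one>\<^sup>P"
   using h.S.subfield_m_inv(1,2)[OF sf, of "eta P c"] nz cc by auto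
  then obtain d where d: "d : carrier R" "eta P c \<otimes>\<^sup>P eta P d = \<one>\<^sup>P" by force
  hence "eta P \<one> = eta P (c \<otimes> d)" using cc by simp
  hence p: "\<one> \<ominus> c \<otimes> d : P" using eta_eq_iff[of \<one> "c \<otimes> d"] cc d(1) by simp
  have "(\<one> \<ominus> c \<otimes> d) \<oplus> d \<otimes> c : J"
   using ideal_facts(3,4)[OF J(1)] p J(2) d(1) c(1) by blast
  moreover have "(\<one> \<ominus> c \<otimes> d) \<oplus> d \<otimes> c = \<one>"
   using cc d(1) by(simp add: a_minus_def a_assoc m_comm[of d c] l_neg)
  ultimately have "\<one> : J" by simp
  thus ?thesis using ideal.one_imp_carrier[OF J(1)] by blast
 qed simp
qed

end

end

section \<open>Differential primes\<close>

context affine_derivation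
begin

definition core :: "'r set => 'r set"
 where "core m = {x : carrier R. ALL n. (\<delta> ^^ n) x : m}"

text \<open>Here characteristic zero is used: a positive integer is an invertible scalar.\<close>

lemma add_pow_mem:
 assumes I: "ideal I R" and x: "x : carrier R" and n: "n > (0::nat)" and m: "[n] \<cdot> x : I"
 shows "x : I"
proof -
 define c where "c = add_pow K n \<one>\<^sub>K"
 have c: "c : carrier K" "c ~= \<zero>\<^sub>K" unfolding c_def using char_K n unfolding char_zero_def by auto
 have "[k] \<cdot> x = (add_pow K k \<one>\<^sub>K) \<odot> x" for k :: nat
  by(induction k)(use x in "simp_all add: A.smult_l_distr")
 hence cx: "[n] \<cdot> x = c \<odot> x" unfolding c_def .
 have cu: "c : Units K" using c K.field_Units by simp
 have i: "inv\<^bsub>K\<^esub> c : carrier K" "inv\<^bsub>K\<^esub> c \<otimes>\<^sub>K c = \<one>\<^sub>K" using cu K.Units_l_inv by auto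
 have "((inv\<^bsub>K\<^esub> c) \<odot> \<one>) \<otimes> (c \<odot> x) = x"
  using i c x by(simp add: A.smult_assoc2 A.smult_assoc1[symmetric])
 thus ?thesis using ideal_facts(4)[OF I _ m, of "(inv\<^bsub>K\<^esub> c) \<odot> \<one>"] i(1) cx by simp
qed

lemma core_low:
 assumes I: "ideal I R" and z: "z : carrier R" and y: "y : carrier R"
  and low: "!!j. j < M ==> (\<delta> ^^ j) y : I" and jk: "j + k < M"
 shows "(\<delta> ^^ k) (z \<otimes> (\<delta> ^^ j) y) : I"
 using z jk
proof (induction k arbitrary: z j)
 case 0
 thus ?case using ideal_facts(4)[OF I] low by simp
next
 case (Suc k)
 have dj: "(\<delta> ^^ j) y : carrier R" using y by simp
 have c: "(\<delta> ^^ k) u : carrier R" if "u : carrier R" for u using that by simp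
 have lin: "(\<delta> ^^ k) (u \<oplus> v) = (\<delta> ^^ k) u \<oplus> (\<delta> ^^ k) v" if "u : carrier R" "v : carrier R" for u v
  using that by(induction k) (simp_all add: del_add)
 have "(\<delta> ^^ Suc k) (z \<otimes> (\<delta> ^^ j) y) = (\<delta> ^^ k) (\<delta> (z \<otimes> (\<delta> ^^ j) y))"
  by(simp add: funpow_swap1)
 also have "\<delta> (z \<otimes> (\<delta> ^^ j) y) = \<delta> z \<otimes> (\<delta> ^^ j) y \<oplus> z \<otimes> (\<delta> ^^ Suc j) y"
  using del_mult[OF Suc.prems(1) dj] by simp
 also have "(\<delta> ^^ k) ... = (\<delta> ^^ k) (\<delta> z \<otimes> (\<delta> ^^ j) y) \<oplus> (\<delta> ^^ k) (z \<otimes> (\<delta> ^^ Suc j) y)"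
  by(rule lin)(use Suc.prems(1) y del_pow_closed[of y "Suc j"] in auto)
 also have "... : I"
  by(rule ideal_facts(3)[OF I Suc.IH Suc.IH])(use Suc.prems in auto)
 finally show ?case .
qed

lemma del_pow_add: "[|u : carrier R; v : carrier R|] ==> (\<delta> ^^ k) (u \<oplus> v) = (\<delta> ^^ k) u \<oplus> (\<delta> ^^ k) v"
 by(induction k) (simp_all add: del_add)

text \<open>This is the part of the Leibniz formula for the derivative of order \<open>N + M\<close> that survives modulo \<open>I\<close>.
  The value of \<open>C\<close> is a binomial coefficient, and its positivity is what counts.\<close>

lemma core_leading_term:
 assumes I: "ideal I R" and x: "x : carrier R" and y: "y : carrier R"
  and lowx: "!!i. i < N ==> (\<delta> ^^ i) x : I" and lowy: "!!j. j < M ==> (\<delta> ^^ j) y : I"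
  and ij: "i <= N" "j <= M" "i + j + k = N + M"
 shows "EX C>0. EX p:I. (\<delta> ^^ k) ((\<delta> ^^ i) x \<otimes> (\<delta> ^^ j) y) = p \<oplus> [(C::nat)] \<cdot> ((\<delta> ^^ N) x \<otimes> (\<delta> ^^ M) y)"
 using ij
proof (induction k arbitrary: i j)
 case 0
 hence e: "i = N" "j = M" by auto
 have "[Suc 0] \<cdot> ((\<delta> ^^ N) x \<otimes> (\<delta> ^^ M) y) = (\<delta> ^^ N) x \<otimes> (\<delta> ^^ M) y" using x y by simp
 thus ?case unfolding e using x y ideal_facts(2)[OF I]
  by(intro exI[of _ "Suc 0"] conjI bexI[of _ \<zero>]) simp_all
next
 case (Suc k)
 define w where "w = (\<delta> ^^ N) x \<otimes> (\<delta> ^^ M) y"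
 have wc: "w : carrier R" unfolding w_def using x y by simp
 have c: "(\<delta> ^^ n) x : carrier R" "(\<delta> ^^ n) y : carrier R" for n using x y by auto
 have e: "(\<delta> ^^ Suc k) ((\<delta> ^^ i) x \<otimes> (\<delta> ^^ j) y)
   = (\<delta> ^^ k) ((\<delta> ^^ Suc i) x \<otimes> (\<delta> ^^ j) y) \<oplus> (\<delta> ^^ k) ((\<delta> ^^ i) x \<otimes> (\<delta> ^^ Suc j) y)"
 proof -
  have "(\<delta> ^^ Suc k) ((\<delta> ^^ i) x \<otimes> (\<delta> ^^ j) y) = (\<delta> ^^ k) (\<delta> ((\<delta> ^^ i) x \<otimes> (\<delta> ^^ j) y))"
   by(simp add: funpow_swap1)
  also have "\<delta> ((\<delta> ^^ i) x \<otimes> (\<delta> ^^ j) y) = (\<delta> ^^ Suc i) x \<otimes> (\<delta> ^^ j) y \<oplus> (\<delta> ^^ i) x \<otimes> (\<delta> ^^ Suc j) y"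
   using del_mult[OF c(1)[of i] c(2)[of j]] by simp
  finally show ?thesis using del_pow_add c m_closed by presburger
 qed
 have first: "EX C. EX p:I. (\<delta> ^^ k) ((\<delta> ^^ Suc i) x \<otimes> (\<delta> ^^ j) y) = p \<oplus> [(C::nat)] \<cdot> w & (i < N --> C > 0)"
 proof (cases "i < N")
  case True
  thus ?thesis using Suc.IH[of "Suc i" j] Suc.prems unfolding w_def by auto
 next
  case False
  hence jk: "j + k < M" using Suc.prems by simp
  have "(\<delta> ^^ k) ((\<delta> ^^ Suc i) x \<otimes> (\<delta> ^^ j) y) : I"
   by(rule core_low[OF I c(1) y _ jk]) (erule lowy)
  thus ?thesis using False c ideal_facts(1)[OF I]
   by(intro exI[of _ 0] bexI[of _ "(\<delta> ^^ k) ((\<delta> ^^ Suc i) x \<otimes> (\<delta> ^^ j) y)"]) simp_all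
 qed
 have second: "EX C. EX p:I. (\<delta> ^^ k) ((\<delta> ^^ i) x \<otimes> (\<delta> ^^ Suc j) y) = p \<oplus> [(C::nat)] \<cdot> w & (j < M --> C > 0)"
 proof (cases "j < M")
  case True
  thus ?thesis using Suc.IH[of i "Suc j"] Suc.prems unfolding w_def by auto
 next
  case False
  hence ik: "i + k < N" using Suc.prems by simp
  have "(\<delta> ^^ k) ((\<delta> ^^ Suc j) y \<otimes> (\<delta> ^^ i) x) : I"
   by(rule core_low[OF I c(2) x _ ik]) (erule lowx)
  hence "(\<delta> ^^ k) ((\<delta> ^^ i) x \<otimes> (\<delta> ^^ Suc j) y) : I" using m_comm[OF c(1)[of i] c(2)[of "Suc j"]] by simp
  thus ?thesis using False c ideal_facts(1)[OF I]
   by(intro exI[of _ 0] bexI[of _ "(\<delta> ^^ k) ((\<delta> ^^ i) x \<otimes> (\<delta> ^^ Suc j) y)"]) simp_all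
 qed
 obtain C p where C: "p : I" "(\<delta> ^^ k) ((\<delta> ^^ Suc i) x \<otimes> (\<delta> ^^ j) y) = p \<oplus> [(C::nat)] \<cdot> w" "i < N --> C > 0"
  using first by blast
 obtain C' p' where C': "p' : I" "(\<delta> ^^ k) ((\<delta> ^^ i) x \<otimes> (\<delta> ^^ Suc j) y) = p' \<oplus> [(C'::nat)] \<cdot> w" "j < M --> C' > 0"
  using second by blast
 have pc: "p : carrier R" "p' : carrier R" using ideal_facts(1)[OF I] C(1) C'(1) by blast+
 have "(\<delta> ^^ Suc k) ((\<delta> ^^ i) x \<otimes> (\<delta> ^^ j) y) = (p \<oplus> p') \<oplus> [(C + C')] \<cdot> w"
  unfolding e C(2) C'(2) using pc wc by(simp add: add.nat_pow_mult[symmetric] a_ac)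
 moreover have "C + C' > 0" using C(3) C'(3) Suc.prems by auto
 ultimately show ?case unfolding w_def using ideal_facts(3)[OF I C(1) C'(1)] by blast
qed

lemma core_prime:
 assumes m: "primeideal m R" shows "prime_delta_ideal R \<delta> (core m)" "core m <= m"
proof -
 have mi: "ideal m R" by(rule primeideal.axioms(1)[OF m])
 note mf = ideal_facts[OF mi]
 show sub: "core m <= m"
 proof
  fix x assume "x : core m"
  hence "(\<delta> ^^ 0) x : m" unfolding core_def by blast
  thus "x : m" by simp
 qed
 have coreI: "x : core m" if "x : carrier R" "!!n. (\<delta> ^^ n) x : m" for x using that unfolding core_def by blast
 have coreD: "x : carrier R" "(\<delta> ^^ n) x : m" if "x : core m" for x n using that unfolding core_def by blast+
 have pm: "(\<delta> ^^ k) (z \<otimes> y) : m" if "z : carrier R" "y : core m" for z y k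
  using core_low[OF mi that(1) coreD(1)[OF that(2)], of "Suc k" 0 k] coreD(2)[OF that(2)] by simp
 have id: "ideal (core m) R"
 proof (rule ideal_by_closure)
  show "core m <= carrier R" using coreD(1) by blast
  have "(\<delta> ^^ n) \<zero> = \<zero>" for n by(induction n) (simp_all add: del_zero)
  thus "\<zero> : core m" using coreI[OF zero_closed] mf(2) by simp
  show "x \<oplus> y : core m" if "x : core m" "y : core m" for x y
   by(rule coreI)(use that coreD del_pow_add mf(3) in auto)
  show "r \<otimes> x : core m" if "r : carrier R" "x : core m" for r x
   by(rule coreI)(use that coreD(1)[OF that(2)] pm in auto)
 qed
 have "primeideal (core m) R"
 proof (rule primeidealI[OF id is_cring])
  show "carrier R ~= core m" using sub mf(1) primeideal.I_notcarr[OF m] by blast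
  fix x y assume xy: "x : carrier R" "y : carrier R" "x \<otimes> y : core m"
  show "x : core m \<or> y : core m"
  proof (rule ccontr)
   assume "\<not> (x : core m \<or> y : core m)"
   hence ex: "EX n. (\<delta> ^^ n) x ~: m" "EX n. (\<delta> ^^ n) y ~: m" using coreI xy by blast+
   obtain N where N: "(\<delta> ^^ N) x ~: m" "!!i. i < N ==> (\<delta> ^^ i) x : m"
    using exists_least_iff[of "%n. (\<delta> ^^ n) x ~: m"] ex(1) by blast
   obtain M where M: "(\<delta> ^^ M) y ~: m" "!!j. j < M ==> (\<delta> ^^ j) y : m"
    using exists_least_iff[of "%n. (\<delta> ^^ n) y ~: m"] ex(2) by blast
   let ?w = "(\<delta> ^^ N) x \<otimes> (\<delta> ^^ M) y"
   have "EX C>0. EX p:m. (\<delta> ^^ (N + M)) ((\<delta> ^^ 0) x \<otimes> (\<delta> ^^ 0) y) = p \<oplus> [(C::nat)] \<cdot> ?w"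
    by(rule core_leading_term[OF mi xy(1,2)])(use N(2) M(2) in auto)
   then obtain C p where C: "C > (0::nat)" "p : m" "(\<delta> ^^ (N + M)) (x \<otimes> y) = p \<oplus> [C] \<cdot> ?w" by auto
   have wc: "?w : carrier R" using xy by simp
   have pc: "p : carrier R" by(rule mf(1)[OF C(2)])
   have "\<ominus> p \<oplus> (p \<oplus> [C] \<cdot> ?w) : m"
    using mf(3)[OF mf(5)[OF C(2)] coreD(2)[OF xy(3), of "N + M"]] unfolding C(3) .
   hence "[C] \<cdot> ?w : m" using pc wc by(simp add: a_assoc[symmetric] l_neg)
   hence "?w : m" by(rule add_pow_mem[OF mi wc C(1)])
   thus False using primeideal.I_prime[OF m, of "(\<delta> ^^ N) x" "(\<delta> ^^ M) y"] N(1) M(1) xy by simp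
  qed
 qed
 moreover have "\<delta> ` core m <= core m"
 proof
  fix z assume "z : \<delta> ` core m"
  then obtain x where x: "x : core m" "z = \<delta> x" by blast
  have "(\<delta> ^^ n) z : m" for n using coreD(2)[OF x(1), of "Suc n"] unfolding x(2) by(simp add: funpow_swap1)
  thus "z : core m" using coreI[of z] x coreD(1)[OF x(1)] by simp
 qed
 ultimately show "prime_delta_ideal R \<delta> (core m)" unfolding prime_delta_ideal_def delta_ideal_def using id by blast
qed

context
 fixes P assumes Pd: "prime_delta_ideal R \<delta> P"
begin

lemma Pp: "primeideal P R" using Pd unfolding prime_delta_ideal_def by blast
lemma P_stable: "x : P ==> \<delta> x : P" using Pd unfolding prime_delta_ideal_def delta_ideal_def by blast

lemma quot_derivation_coset:
 assumes x: "x : carrier R" shows "quot_derivation R P \<delta> (P +> x) = P +> \<delta> x"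
proof -
 note Pi = P_ideal[OF Pp]
 interpret c: ring_hom_cring R "R Quot P" "(+>) P"
  by(intro ring_hom_cring.intro ring_hom_cring_axioms.intro is_cring domain.axioms(1)[OF Quot_domain[OF Pp]] coset_hom[OF Pp])
 have "P +> \<delta> y = P +> \<delta> x" if y: "y : P +> x" for y
 proof -
  obtain p where p: "p : P" "y = p \<oplus> x" using y unfolding a_r_coset_def' by blast
  have pc: "p : carrier R" by(rule ideal_facts(1)[OF Pi p(1)])
  have "P +> \<delta> p = \<zero>\<^bsub>R Quot P\<^esub>" using coset_zero_iff[OF Pp] P_stable[OF p(1)] pc by simp
  thus ?thesis unfolding p(2) del_add[OF pc x] using pc x c.hom_add[of "\<delta> p" "\<delta> x"] by simp
 qed
 moreover have "x : P +> x"
  by(rule abelian_subgroup.a_rcos_self[OF abelian_subgroupI3[OF ideal.axioms(1)[OF Pi] abelian_group_axioms] x])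
 ultimately show ?thesis unfolding quot_derivation_def by blast
qed

lemma quotient_diff_domain: "diff_domain (R Quot P) (quot_derivation R P \<delta>)"
proof (intro diff_domain.intro diff_domain_axioms.intro Quot_domain[OF Pp])
 interpret c: ring_hom_cring R "R Quot P" "(+>) P"
  by(intro ring_hom_cring.intro ring_hom_cring_axioms.intro is_cring domain.axioms(1)[OF Quot_domain[OF Pp]] coset_hom[OF Pp])
 note q = quot_derivation_coset
 fix u assume "u : carrier (R Quot P)"
 then obtain x where x: "x : carrier R" "u = P +> x" using coset_carrier[OF Pp] by blast
 show "quot_derivation R P \<delta> u : carrier (R Quot P)"
  unfolding x(2) q[OF x(1)] by(rule c.hom_closed)(use x in simp)
 fix v assume "v : carrier (R Quot P)"
 then obtain y where y: "y : carrier R" "v = P +> y" using coset_carrier[OF Pp] by blast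
 have dx: "\<delta> x : carrier R" "\<delta> y : carrier R" using x y by auto
 show "quot_derivation R P \<delta> (u \<oplus>\<^bsub>R Quot P\<^esub> v) = quot_derivation R P \<delta> u \<oplus>\<^bsub>R Quot P\<^esub> quot_derivation R P \<delta> v"
  unfolding x(2) y(2) c.hom_add[OF x(1) y(1), symmetric] q[OF x(1)] q[OF y(1)] q[OF a_closed[OF x(1) y(1)]]
   del_add[OF x(1) y(1)] by(rule c.hom_add[OF dx])
 show "quot_derivation R P \<delta> (u \<otimes>\<^bsub>R Quot P\<^esub> v)
   = quot_derivation R P \<delta> u \<otimes>\<^bsub>R Quot P\<^esub> v \<oplus>\<^bsub>R Quot P\<^esub> u \<otimes>\<^bsub>R Quot P\<^esub> quot_derivation R P \<delta> v"
  unfolding x(2) y(2) c.hom_mult[OF x(1) y(1), symmetric] q[OF x(1)] q[OF y(1)] q[OF m_closed[OF x(1) y(1)]]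
   del_mult[OF x(1) y(1)] c.hom_add[OF m_closed[OF dx(1) y(1)] m_closed[OF x(1) dx(2)]]
   c.hom_mult[OF dx(1) y(1)] c.hom_mult[OF x(1) dx(2)] ..
qed

lemma FF_diff_field: "diff_field (FF P) (dF P)" by(rule diff_domain.Fr_diff_field[OF quotient_diff_domain])

lemma dF_eta:
 assumes x: "x : carrier R" shows "dF P (eta P x) = eta P (\<delta> x)"
proof -
 have px: "P +> x : carrier (R Quot P)" using coset_carrier[OF Pp] x by blast
 show ?thesis
  unfolding eta_emb[OF Pp] comp_def diff_domain.D_emb[OF quotient_diff_domain px] quot_derivation_coset[OF x] ..
qed

end

section \<open>From primitive to rational\<close>

text \<open>Clearing denominators in a polynomial relation.\<close>

lemma homogenized_relation:
 assumes P: "primeideal P R" and pi: "!!i. \<pi> i : carrier R" and rs: "r : carrier R" "s : carrier R"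
  and y: "y : carrier (FF P)" "eta P s \<otimes>\<^sup>P y = eta P r"
 shows "eta P (\<Oplus>i\<in>{..n::nat}. \<pi> i \<otimes> (r [^] i \<otimes> s [^] (n - i)))
  = field.power_sum (FF P) y n (%i. eta P (\<pi> i)) \<otimes>\<^sup>P eta P (s [^] n)"
proof -
 interpret h: ring_hom_cring R "FF P" "eta P" by(rule eta_cring_hom[OF P])
 have rh: "ring_hom_ring R (FF P) (eta P)" by(rule ring_hom_ringI2[OF ring_axioms h.S.ring_axioms eta_hom[OF P]])
 note pw = ring_hom_ring.hom_nat_pow[OF rh]
 have c: "eta P (\<pi> i) : carrier (FF P)" "eta P s : carrier (FF P)" for i using pi rs by auto
 have "eta P (\<Oplus>i\<in>{..n}. \<pi> i \<otimes> (r [^] i \<otimes> s [^] (n - i)))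
   = (\<Oplus>\<^bsub>FF P\<^esub>i\<in>{..n}. (eta P \<circ> (%i. \<pi> i \<otimes> (r [^] i \<otimes> s [^] (n - i)))) i)"
  by(rule h.hom_finsum)(use pi rs in auto)
 also have "... = (\<Oplus>\<^bsub>FF P\<^esub>i\<in>{..n}. (eta P (\<pi> i) \<otimes>\<^sup>P y [^]\<^bsub>FF P\<^esub> i) \<otimes>\<^sup>P eta P (s [^] n))"
 proof (rule h.S.finsum_cong'[OF refl])
  fix i assume i: "i : {..n}"
  have yi: "y [^]\<^bsub>FF P\<^esub> i : carrier (FF P)" using y by simp
  have "eta P (r [^] i) = (eta P s \<otimes>\<^sup>P y) [^]\<^bsub>FF P\<^esub> i" unfolding y(2) by(rule pw[OF rs(1)])
  also have "... = eta P s [^]\<^bsub>FF P\<^esub> i \<otimes>\<^sup>P y [^]\<^bsub>FF P\<^esub> i" by(rule h.S.nat_pow_distrib[OF c(2) y(1)])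
  also have "eta P s [^]\<^bsub>FF P\<^esub> i = eta P (s [^] i)" by(rule pw[OF rs(2), symmetric])
  finally have ri: "eta P (r [^] i) = eta P (s [^] i) \<otimes>\<^sup>P y [^]\<^bsub>FF P\<^esub> i" .
  have sn: "s [^] i \<otimes> s [^] (n - i) = s [^] n" using nat_pow_mult[OF rs(2), of i "n - i"] i by simp
  have si: "eta P (s [^] i) : carrier (FF P)" "eta P (s [^] (n - i)) : carrier (FF P)" using rs by auto
  have "(eta P \<circ> (%i. \<pi> i \<otimes> (r [^] i \<otimes> s [^] (n - i)))) i
    = eta P (\<pi> i) \<otimes>\<^sup>P ((eta P (s [^] i) \<otimes>\<^sup>P y [^]\<^bsub>FF P\<^esub> i) \<otimes>\<^sup>P eta P (s [^] (n - i)))"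
   using pi[of i] rs by(simp add: ri)
  also have "... = (eta P (\<pi> i) \<otimes>\<^sup>P y [^]\<^bsub>FF P\<^esub> i) \<otimes>\<^sup>P (eta P (s [^] i) \<otimes>\<^sup>P eta P (s [^] (n - i)))"
   using si yi c(1)[of i] by(simp add: h.S.m_ac)
  also have "eta P (s [^] i) \<otimes>\<^sup>P eta P (s [^] (n - i)) = eta P (s [^] n)"
   using h.hom_mult[of "s [^] i" "s [^] (n - i)"] rs sn by simp
  finally show "(eta P \<circ> (%i. \<pi> i \<otimes> (r [^] i \<otimes> s [^] (n - i)))) i
    = (eta P (\<pi> i) \<otimes>\<^sup>P y [^]\<^bsub>FF P\<^esub> i) \<otimes>\<^sup>P eta P (s [^] n)" .
 qed (use c y rs in auto)
 also have "... = field.power_sum (FF P) y n (%i. eta P (\<pi> i)) \<otimes>\<^sup>P eta P (s [^] n)"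
  unfolding field.power_sum_def[OF FF_field[OF P]]
  by(rule h.S.finsum_ldistr[symmetric])(use c y rs in auto)
 finally show ?thesis .
qed

text \<open>The numerator \<open>t\<close> of \<open>q s^n\<close>, with the constant \<open>q = p(c)\<close>, satisfies \<open>s^n \<delta>\<^sup>j(t) = t \<delta>\<^sup>j(s^n)\<close> modulo \<open>P\<close>.
  Since \<open>t\<close> is in \<open>m\<close> and \<open>s\<close> is not, all derivatives of \<open>t\<close> are in \<open>m\<close>.\<close>

lemma primitive_rational:
 assumes Pd: "prime_delta_ideal R \<delta> P" and prim: "delta_primitive R \<delta> P"
 shows "delta_rational K R \<delta> P"
proof -
 obtain m where m: "maximalideal m R" "P <= m"
  and mx: "!!Q. [|prime_delta_ideal R \<delta> Q; P <= Q; Q <= m|] ==> Q = P"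
  using prim unfolding delta_primitive_def by blast
 have mp: "primeideal m R" by(rule maximalideal_prime[OF m(1)])
 note P = Pp[OF Pd] and mi = P_ideal[OF mp]
 note Pf = ideal_facts[OF P_ideal[OF P]] and mf = ideal_facts[OF mi]
 have "P <= core m"
 proof
  fix x assume x: "x : P"
  have "(\<delta> ^^ n) x : P" for n by(induction n)(use x P_stable[OF Pd] in auto)
  thus "x : core m" unfolding core_def using Pf(1)[OF x] m(2) by blast
 qed
 hence core: "core m = P" using mx core_prime[OF mp] by blast
 interpret h: ring_hom_cring R "FF P" "eta P" by(rule eta_cring_hom[OF P])
 interpret F: diff_field "FF P" "dF P" by(rule FF_diff_field[OF Pd])
 have "(ring.algebraic (FF P) over (eta P ` scalars K R)) c" if c: "c : F.Cst" for c
 proof -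
  have cc: "c : carrier (FF P)" "dF P c = \<zero>\<^sup>P" by(rule F.CstD[OF c])+
  obtain r0 s0 where rs0: "r0 : carrier R" "s0 : carrier R" "s0 ~: P" "eta P s0 \<otimes>\<^sup>P c = eta P r0"
   using eta_denominator[OF P cc(1)] by blast
  have dn: "eta P ((\<delta> ^^ n) s0) \<otimes>\<^sup>P c = eta P ((\<delta> ^^ n) r0)" for n
  proof (induction n)
   case 0
   show ?case using rs0(4) by simp
  next
   case (Suc n)
   have sc: "eta P ((\<delta> ^^ n) s0) : carrier (FF P)" "eta P ((\<delta> ^^ Suc n) s0) : carrier (FF P)"
    by(rule h.hom_closed, rule del_pow_closed[OF rs0(2)])+
   have "dF P (eta P ((\<delta> ^^ n) s0) \<otimes>\<^sup>P c) = dF P (eta P ((\<delta> ^^ n) r0))" by(rule arg_cong[OF Suc])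
   hence "eta P ((\<delta> ^^ Suc n) s0) \<otimes>\<^sup>P c \<oplus>\<^sup>P eta P ((\<delta> ^^ n) s0) \<otimes>\<^sup>P \<zero>\<^sup>P = eta P ((\<delta> ^^ Suc n) r0)"
    unfolding F.der_mult[OF sc(1) cc(1)] dF_eta[OF Pd del_pow_closed[OF rs0(2)]] dF_eta[OF Pd del_pow_closed[OF rs0(1)]] cc(2)
    by simp
   thus ?case unfolding h.S.r_null[OF sc(1)] h.S.r_zero[OF h.S.m_closed[OF sc(2) cc(1)]] .
  qed
  have "s0 ~: core m" using rs0(3) core by simp
  then obtain n0 where n0: "(\<delta> ^^ n0) s0 ~: m" unfolding core_def using rs0(2) by blast
  define s where "s = (\<delta> ^^ n0) s0"
  define r where "r = (\<delta> ^^ n0) r0"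
  have s: "s : carrier R" "s ~: m" unfolding s_def using rs0 n0 by auto
  have r: "r : carrier R" unfolding r_def using rs0 by simp
  have sr: "eta P s \<otimes>\<^sup>P c = eta P r" unfolding s_def r_def by(rule dn)
  obtain s' p where s': "s' : carrier R" "p : m" "\<one> = p \<oplus> s \<otimes> s'" using maximalideal_unit[OF m(1) s] by blast
  define y where "y = eta m (s' \<otimes> r)"
  interpret g: ring_hom_cring R "FF m" "eta m" by(rule eta_cring_hom[OF mp])
  have pc: "p : carrier R" by(rule mf(1)[OF s'(2)])
  have "eta m s \<otimes>\<^sup>m eta m s' = eta m (s \<otimes> s')" using g.hom_mult[OF s(1) s'(1)] ..
  also have "... = \<zero>\<^sup>m \<oplus>\<^sup>m eta m (s \<otimes> s')"
   by(rule g.S.l_zero[symmetric]) (rule g.hom_closed, use s s' in simp)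
  also have "\<zero>\<^sup>m = eta m p" using eta_zero_iff[OF mp pc] s'(2) by simp
  also have "eta m p \<oplus>\<^sup>m eta m (s \<otimes> s') = eta m \<one>"
   unfolding s'(3) by(rule g.hom_add[symmetric])(use pc s s' in auto)
  finally have ss: "eta m s \<otimes>\<^sup>m eta m s' = \<one>\<^sup>m" by simp
  have ec: "eta m s : carrier (FF m)" "eta m s' : carrier (FF m)" "eta m r : carrier (FF m)"
   using s s' r by auto
  have sy: "eta m s \<otimes>\<^sup>m y = eta m r"
   unfolding y_def g.hom_mult[OF s'(1) r] g.S.m_assoc[OF ec, symmetric] ss by(rule g.S.l_one[OF ec(3)])
  have yA: "y : eta m ` carrier R" unfolding y_def using s' r by blast
  have yc: "y : carrier (FF m)" unfolding y_def by(rule g.hom_closed)(use s' r in simp)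
  have "(ring.algebraic (FF m) over (eta m ` scalars K R)) y"
   using image_algebraic[OF mp maximalideal_power_ideal[OF m(1)]] yA by blast
  hence "EX n e. (ALL i. e i : eta m ` scalars K R) & e n ~= \<zero>\<^sup>m & field.power_sum (FF m) y n e = \<zero>\<^sup>m"
   using field.algebraic_power_sum[OF FF_field[OF mp] subfieldE(1)[OF scalar_subfield[OF mp]] yc] by blast
  then obtain n e where e: "ALL i. e i : eta m ` scalars K R" "e n ~= \<zero>\<^sup>m" "field.power_sum (FF m) y n e = \<zero>\<^sup>m"
   by(elim exE conjE)
  have "ALL i. EX w. w : scalars K R & e i = eta m w" using e(1) by blast
  hence "EX \<pi>. ALL i. \<pi> i : scalars K R & e i = eta m (\<pi> i)" by(rule choice)
  then obtain \<pi> where p0: "ALL i. \<pi> i : scalars K R & e i = eta m (\<pi> i)" by(elim exE)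
  have p1: "\<pi> i : scalars K R" "\<pi> i : carrier R" for i using p0 del_scalar(2) by blast+
  have ee: "e = (%i. eta m (\<pi> i))" by(rule ext)(use p0 in blast)
  define t where "t = (\<Oplus>i\<in>{..n}. \<pi> i \<otimes> (r [^] i \<otimes> s [^] (n - i)))"
  have tc: "t : carrier R" unfolding t_def by(rule finsum_closed)(use p1(2) r s in auto)
  have snc: "s [^] n : carrier R" using s by simp
  have "eta m t = field.power_sum (FF m) y n (%i. eta m (\<pi> i)) \<otimes>\<^sup>m eta m (s [^] n)"
   unfolding t_def by(rule homogenized_relation[OF mp p1(2) r s(1) yc sy])
  also have "... = \<zero>\<^sup>m" using e(3) g.S.l_null[OF g.hom_closed[OF snc]] unfolding ee by simp
  finally have tm: "t : m" using eta_zero_iff[OF mp tc] by simp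
  define q where "q = field.power_sum (FF P) c n (%i. eta P (\<pi> i))"
  have etac: "eta P (\<pi> i) : carrier (FF P)" for i by(rule h.hom_closed[OF p1(2)])
  have qF: "q : carrier (FF P)"
   unfolding q_def by(rule field.power_sum_closed[OF FF_field[OF P] cc(1)]) (rule etac)
  have pic: "eta P (\<pi> i) : F.Cst" for i
  proof (rule F.CstI[OF etac])
   have "eta P \<zero> = \<zero>\<^sup>P" by simp
   thus "dF P (eta P (\<pi> i)) = \<zero>\<^sup>P" unfolding dF_eta[OF Pd p1(2)] del_scalar(1)[OF p1(1)] .
  qed
  have cp: "c [^]\<^bsub>FF P\<^esub> i : F.Cst" for i :: nat
  proof (induction i)
   case 0
   have "c [^]\<^bsub>FF P\<^esub> (0::nat) = \<one>\<^sup>P" by simp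
   thus ?case using F.Cst_1 by simp
  next
   case (Suc i)
   have "c [^]\<^bsub>FF P\<^esub> Suc i = c [^]\<^bsub>FF P\<^esub> i \<otimes>\<^sup>P c" by simp
   thus ?case using F.Cst_mult[OF Suc c] by simp
  qed
  have qC: "q : F.Cst"
   unfolding q_def field.power_sum_def[OF FF_field[OF P]]
   by(rule F.Cst_finsum) (auto intro: F.Cst_mult[OF pic cp])
  have et: "eta P t = q \<otimes>\<^sup>P eta P (s [^] n)"
   unfolding t_def q_def by(rule homogenized_relation[OF P p1(2) r s(1) cc(1) sr])
  have dt: "eta P ((\<delta> ^^ j) t) = q \<otimes>\<^sup>P eta P ((\<delta> ^^ j) (s [^] n))" for j
  proof (induction j)
   case 0
   show ?case using et by simp
  next
   case (Suc j)
   have sc: "eta P ((\<delta> ^^ j) (s [^] n)) : carrier (FF P)" "eta P ((\<delta> ^^ Suc j) (s [^] n)) : carrier (FF P)"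
    by(rule h.hom_closed, rule del_pow_closed[OF snc])+
   have "dF P (eta P ((\<delta> ^^ j) t)) = dF P (q \<otimes>\<^sup>P eta P ((\<delta> ^^ j) (s [^] n)))" by(rule arg_cong[OF Suc])
   hence "eta P ((\<delta> ^^ Suc j) t) = \<zero>\<^sup>P \<otimes>\<^sup>P eta P ((\<delta> ^^ j) (s [^] n)) \<oplus>\<^sup>P q \<otimes>\<^sup>P eta P ((\<delta> ^^ Suc j) (s [^] n))"
    unfolding F.der_mult[OF qF sc(1)] dF_eta[OF Pd del_pow_closed[OF tc]] dF_eta[OF Pd del_pow_closed[OF snc]] F.CstD(2)[OF qC]
    by simp
   thus ?case unfolding h.S.l_null[OF sc(1)] h.S.l_zero[OF h.S.m_closed[OF qF sc(2)]] .
  qed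
  have "s [^] n ~: m" for n :: nat
  proof (induction n)
   case 0
   show ?case using ideal.one_imp_carrier[OF mi] primeideal.I_notcarr[OF mp] by auto
  next
   case (Suc n)
   thus ?case using primeideal.I_prime[OF mp, of "s [^] n" s] s by auto
  qed
  hence snm: "s [^] n ~: m" .
  have "(\<delta> ^^ j) t : m" for j
  proof -
   define z where "z = (\<delta> ^^ j) (s [^] n)"
   define w where "w = (\<delta> ^^ j) t"
   have zc: "z : carrier R" "w : carrier R" unfolding z_def w_def using snc tc by auto
   have ez: "eta P z : carrier (FF P)" "eta P (s [^] n) : carrier (FF P)" by(rule h.hom_closed, fact)+
   have "eta P (s [^] n \<otimes> w) = eta P (s [^] n) \<otimes>\<^sup>P (q \<otimes>\<^sup>P eta P z)"
    unfolding h.hom_mult[OF snc zc(2)] unfolding w_def z_def dt ..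
   also have "... = eta P z \<otimes>\<^sup>P (q \<otimes>\<^sup>P eta P (s [^] n))"
    using ez qF by(simp add: h.S.m_ac)
   also have "... = eta P (z \<otimes> t)" unfolding h.hom_mult[OF zc(1) tc] et ..
   finally have "s [^] n \<otimes> w \<ominus> z \<otimes> t : P" by(rule eta_eq_iff[OF P m_closed[OF snc zc(2)] m_closed[OF zc(1) tc]])
   hence "(s [^] n \<otimes> w \<ominus> z \<otimes> t) \<oplus> z \<otimes> t : m" using mf(3)[OF _ mf(4)[OF zc(1) tm]] m(2) by blast
   moreover have "(s [^] n \<otimes> w \<ominus> z \<otimes> t) \<oplus> z \<otimes> t = s [^] n \<otimes> w"
    using snc zc tc by(simp add: a_minus_def a_assoc l_neg)
   ultimately have "s [^] n \<otimes> w : m" by simp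
   thus ?thesis using primeideal.I_prime[OF mp snc zc(2)] snm unfolding w_def by blast
  qed
  hence "t : P" using core tc unfolding core_def by blast
  hence "q \<otimes>\<^sup>P eta P (s [^] n) = \<zero>\<^sup>P" using et eta_zero_iff[OF P tc] by simp
  moreover have "eta P (s [^] n) ~= \<zero>\<^sup>P" using eta_zero_iff[OF P snc] snm m(2) by blast
  ultimately have q0: "q = \<zero>\<^sup>P"
   using domain.integral[OF field.axioms(1)[OF FF_field[OF P]] _ qF h.hom_closed[OF snc]] by blast
  have "\<pi> n ~: P" using e(2) eta_zero_iff[OF mp p1(2)] m(2) unfolding ee by blast
  hence "eta P (\<pi> n) ~= \<zero>\<^sup>P" using eta_zero_iff[OF P p1(2)] by blast
  hence "EX n e. (ALL i. e i : eta P ` scalars K R) & e n ~= \<zero>\<^sup>P & field.power_sum (FF P) c n e = \<zero>\<^sup>P"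
   using q0 p1(1) unfolding q_def by(intro exI[of _ n] exI[of _ "%i. eta P (\<pi> i)"]) simp
  thus ?thesis
   using field.algebraic_power_sum[OF FF_field[OF P] subfieldE(1)[OF scalar_subfield[OF P]] cc(1)] by blast
 qed
 thus ?thesis unfolding delta_rational_def eta_def by blast
qed

section \<open>From locally closed to primitive\<close>

lemma locally_closed_primitive:
 assumes Pd: "prime_delta_ideal R \<delta> P" and lc: "delta_locally_closed R \<delta> P"
 shows "delta_primitive R \<delta> P"
proof -
 note P = Pp[OF Pd]
 obtain f where fm: "f : carrier R \<inter> \<Inter>{Q. prime_delta_ideal R \<delta> Q & P \<subset> Q} - P"
  using psubset_imp_ex_mem[OF lc[unfolded delta_locally_closed_def]] by(elim exE)
 have f: "f : carrier R" "f ~: P" using fm by simp_all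
 have fQ: "f : Q" if "prime_delta_ideal R \<delta> Q" "P \<subset> Q" for Q using fm that by simp
 obtain I where I: "primeideal I R" "P <= I" "power_ideal f I" using exists_power_ideal[OF P f(1,2)] by blast
 have "f ~: I" using I(3) unfolding power_ideal_def by blast
 hence mx: "Q = P" if "prime_delta_ideal R \<delta> Q" "P <= Q" "Q <= I" for Q
  using fQ[OF that(1)] that(2,3) by(metis psubsetI subsetD)
 show ?thesis unfolding delta_primitive_def
  by(rule exI[of _ I])(use power_ideal_maximal[OF I(1,3)] Pd I(2) mx in simp)
qed

end

section \<open>From rational to locally closed\<close>

context affine_derivation
begin

lemma eta_dot:
 assumes P: "primeideal P R" and "finite I" "!!i. i : I ==> x i : carrier R" "!!i. i : I ==> y i : carrier R"
 shows "eta P (dot I x y) = cring.dot (FF P) I (%i. eta P (x i)) (%i. eta P (y i))"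
proof -
 interpret h: ring_hom_cring R "FF P" "eta P" by(rule eta_cring_hom[OF P])
 have "eta P (dot I x y) = (\<Oplus>\<^bsub>FF P\<^esub>i\<in>I. (eta P \<circ> (%i. x i \<otimes> y i)) i)"
  unfolding dot_def by(rule h.hom_finsum)(use assms in auto)
 also have "... = cring.dot (FF P) I (%i. eta P (x i)) (%i. eta P (y i))"
  unfolding h.S.dot_def by(rule h.S.finsum_cong'[OF refl])(use assms in auto)
 finally show ?thesis .
qed

text \<open>The element \<open>b\<close> serves as the common denominator of the coefficients \<open>D(g\<^sub>i\<^sub>j)\<close> of the linear systems, and
  a prime \<open>\<delta>\<close>-ideal above \<open>P\<close> is carried to a prime \<open>\<delta>\<close>-ideal of the image of \<open>R\<close>.\<close>

lemma rational_locally_closed: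
 assumes H: "hopf_derivation K R \<Delta> \<epsilon> S a \<delta>" and Pd: "prime_delta_ideal R \<delta> P"
  and rat: "delta_rational K R \<delta> P"
 shows "delta_locally_closed R \<delta> P"
proof -
 interpret H: hopf_derivation K R \<Delta> \<epsilon> S a \<delta> by(rule H)
 note P = Pp[OF Pd]
 interpret h: ring_hom_cring R "FF P" "eta P" by(rule eta_cring_hom[OF P])
 interpret F: diff_field "FF P" "dF P" by(rule FF_diff_field[OF Pd])
 note hc = h.hom_closed
 obtain U where U: "finite U" "U <= carrier R" "generate_ring R (scalars K R \<union> U) = carrier R"
  using affine unfolding affine_algebra_def by blast
 define A where "A = eta P ` carrier R"
 define W where "W = insert \<one>\<^sup>P (insert (eta P H.b) ((%u. eta P (H.b \<otimes> H.D u)) ` U))"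
 have AI: "eta P x : A" if "x : carrier R" for x unfolding A_def using that by blast
 have bDc: "H.b \<otimes> H.D u : carrier R" if "u : carrier R" for u using that by simp
 have Wfin: "finite W" unfolding W_def using U(1) by simp
 have oneA: "\<one>\<^sup>P : A" using AI[OF one_closed] h.hom_one by simp
 have W_A: "W <= A"
  unfolding W_def using oneA AI[OF H.b_closed] AI[OF bDc] U(2) by blast
 have Wc: "W <= carrier (FF P)" using W_A hc unfolding A_def by blast
 have WI: "eta P H.b : F.Cspan W" "\<one>\<^sup>P : F.Cspan W"
  by(rule F.Cspan_incl[OF Wfin Wc], simp add: W_def)+
 have WU: "eta P (H.b \<otimes> H.D u) : F.Cspan W" if "u : U" for u
  by(rule F.Cspan_incl[OF Wfin Wc])(use that in "simp add: W_def")
 have sC: "eta P s : F.Cst" if s: "s : scalars K R" for s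
 proof (rule F.CstI[OF hc[OF del_scalar(2)[OF s]]])
  have "eta P \<zero> = \<zero>\<^sup>P" by simp
  thus "dF P (eta P s) = \<zero>\<^sup>P" unfolding dF_eta[OF Pd del_scalar(2)[OF s]] del_scalar(1)[OF s] .
 qed
 have scI: "c \<odot> \<one> : scalars K R" "c \<odot> \<one> : carrier R" if "c : carrier K" for c
  using that unfolding scalars_def by auto
 define N where "N = {y : carrier R. eta P (H.b \<otimes> y) : F.Cspan W}"
 have N: "subspace K R N"
  unfolding subspace_def
 proof (intro conjI ballI)
  show "N <= carrier R" unfolding N_def by blast
  show "\<zero> : N" unfolding N_def using F.Cspan_zero[OF Wc] by simp
  fix x assume "x : N"
  hence x: "x : carrier R" "eta P (H.b \<otimes> x) : F.Cspan W" unfolding N_def by blast+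
  show "c \<odot> x : N" if c: "c : carrier K" for c
  proof -
   have "H.b \<otimes> (c \<odot> x) = (c \<odot> \<one>) \<otimes> (H.b \<otimes> x)"
    using bilinear_mapD(5)[OF bilinear_mult[OF R_algebra] c H.b_closed x(1)] A.smult_assoc2[OF c one_closed, of "H.b \<otimes> x"] x(1) by simp
   hence "eta P (H.b \<otimes> (c \<odot> x)) = eta P (c \<odot> \<one>) \<otimes>\<^sup>P eta P (H.b \<otimes> x)"
    using h.hom_mult[OF scI(2)[OF c], of "H.b \<otimes> x"] x(1) by simp
   thus ?thesis unfolding N_def using F.Cspan_smult[OF Wfin Wc x(2) sC[OF scI(1)[OF c]]] x(1) c by simp
  qed
  fix y assume "y : N"
  hence y: "y : carrier R" "eta P (H.b \<otimes> y) : F.Cspan W" unfolding N_def by blast+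
  have "eta P (H.b \<otimes> (x \<oplus> y)) = eta P (H.b \<otimes> x) \<oplus>\<^sup>P eta P (H.b \<otimes> y)"
   using x(1) y(1) by(simp add: r_distr)
  thus "x \<oplus> y : N" unfolding N_def using F.Cspan_add[OF Wc x(2) y(2)] x(1) y(1) by simp
 qed
 have bD: "eta P (H.b \<otimes> H.D x) : F.Cspan W" if x: "x : carrier R" for x
 proof -
  have "H.D x : N"
  proof (rule H.D_in_subspace[OF U(3) U(2) N _ x])
   fix u assume u: "u : U"
   have "u : carrier R" using u U(2) by blast
   hence "H.D u : carrier R" by(rule H.D_closed)
   thus "H.D u : N" unfolding N_def using WU[OF u] by blast
  qed
  thus ?thesis unfolding N_def by blast
 qed
 interpret T: diff_tower "FF P" "dF P" A "eta P ` scalars K R" W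
 proof (rule diff_tower.intro[OF F.diff_field_axioms], rule diff_tower_axioms.intro)
  show "subring A (FF P)" unfolding A_def by(rule image_subring[OF P])
  show "dF P x : A" if "x : A" for x
  proof -
   have "EX r:carrier R. x = eta P r" using \<open>x : A\<close> unfolding A_def by blast
   then obtain r where r: "r : carrier R" "x = eta P r" by blast
   show ?thesis unfolding r(2) dF_eta[OF Pd r(1)] by(rule AI[OF del_closed[OF r(1)]])
  qed
  show "EX s:A. s ~= \<zero>\<^sup>P & s \<otimes>\<^sup>P x : A" if x: "x : carrier (FF P)" for x
  proof -
   obtain r s where rs: "r : carrier R" "s : carrier R" "s ~: P" "eta P s \<otimes>\<^sup>P x = eta P r"
    using eta_denominator[OF P x] by blast
   have "eta P s ~= \<zero>\<^sup>P" using eta_zero_iff[OF P rs(2)] rs(3) by blast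
   thus ?thesis
    by(intro bexI[of _ "eta P s"] conjI)(use rs AI in auto)
  qed
  show "subfield (eta P ` scalars K R) (FF P)" by(rule scalar_subfield[OF P])
  show "eta P ` scalars K R <= A" unfolding A_def using del_scalar(2) by blast
  show "(ring.algebraic (FF P) over (eta P ` scalars K R)) c" if "c : F.Cst" for c
   using rat that unfolding delta_rational_def eta_def by blast
  show "finite W" by(rule Wfin)
  show "W <= A" by(rule W_A)
  show "\<one>\<^sup>P : W" unfolding W_def by blast
  show "dF P w : F.Cspan W" if w: "w : W" for w
  proof -
   consider "w = \<one>\<^sup>P" | "w = eta P H.b" | u where "u : U" "w = eta P (H.b \<otimes> H.D u)"
    using w unfolding W_def by blast
   thus ?thesis
   proof cases
    case 1
    show ?thesis unfolding 1 F.der_one by(rule F.Cspan_zero[OF Wc])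
   next
    case 2
    have c: "eta P (H.b \<otimes> H.D a) : carrier (FF P)" by(rule hc[OF bDc[OF H.a_closed']])
    have "dF P w = eta P (\<ominus> (H.b \<otimes> H.D a))" unfolding 2 dF_eta[OF Pd H.b_closed] H.d_b ..
    also have "... = (\<ominus>\<^sup>P \<one>\<^sup>P) \<otimes>\<^sup>P eta P (H.b \<otimes> H.D a)"
     unfolding h.hom_a_inv[OF bDc[OF H.a_closed']] using c by(simp add: h.S.l_minus)
    also have "... : F.Cspan W"
     by(rule F.Cspan_smult[OF Wfin Wc bD[OF H.a_closed'] F.Cst_minus[OF F.Cst_1]])
    finally show ?thesis .
   next
    case 3
    have u: "u : carrier R" using 3(1) U(2) by blast
    show ?thesis unfolding 3(2) dF_eta[OF Pd bDc[OF u]] H.d_bD[OF u] by(rule bD[OF del_closed[OF u]])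
   qed
  qed
  show "EX (I::nat set) l v g s u. finite I &
   (ALL i:I. l i : F.Cst & v i : A & dF P (v i) = h.S.dot I (u i) v) & q = h.S.dot I l v &
   (ALL i:I. ALL j:I. g i j : A & s i j : A & u i j : carrier (FF P) &
    (EX w:F.Cspan W. w ~= \<zero>\<^sup>P & w \<otimes>\<^sup>P u i j : F.Cspan W) &
    dF P (g i j) = h.S.dot I (u i) (%k. g k j) &
    h.S.dot I (s i) (%k. g k j) = (if i = j then \<one>\<^sup>P else \<zero>\<^sup>P) &
    h.S.dot I (g i) (%k. s k j) = (if i = j then \<one>\<^sup>P else \<zero>\<^sup>P))" if q: "q : A" for q
  proof -
   have "EX r:carrier R. q = eta P r" using q unfolding A_def by blast
   then obtain r where r: "r : carrier R" "q = eta P r" by blast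
   obtain I :: "nat set" and l v g where g: "H.comatrix I g"
    and lv: "ALL i:I. l i : carrier K & v i : carrier R & \<delta> (v i) = dot I (%k. H.D (g i k)) v"
    and re: "r = (\<Oplus>i\<in>I. l i \<odot> v i)"
    using H.linear_system[OF r(1)] by(elim exE conjE)
   note gd = H.comatrixD(1,2)[OF g]
   have lc: "l i : carrier K" and vc: "v i : carrier R" and dv: "\<delta> (v i) = dot I (%k. H.D (g i k)) v"
    if "i : I" for i using lv that by blast+
   have Dc: "H.D (g i j) : carrier R" and Sc: "S (g i j) : carrier R" if "i : I" "j : I" for i j
    using gd(2)[OF that] by auto
   have "r = dot I (%i. l i \<odot> \<one>) v"
    unfolding re dot_def by(rule finsum_cong'[OF refl])(use lc vc in "auto simp: A.smult_assoc2")
   hence qe: "q = h.S.dot I (%i. eta P (l i \<odot> \<one>)) (%i. eta P (v i))"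
    unfolding r(2) using eta_dot[OF P gd(1), of "%i. l i \<odot> \<one>" v] lc vc by simp
   have dve: "dF P (eta P (v i)) = h.S.dot I (%k. eta P (H.D (g i k))) (%k. eta P (v k))" if i: "i : I" for i
    unfolding dF_eta[OF Pd vc[OF i]] dv[OF i] by(rule eta_dot[OF P gd(1)])(use Dc[OF i] vc in auto)
   have dge: "dF P (eta P (g i j)) = h.S.dot I (%k. eta P (H.D (g i k))) (%k. eta P (g k j))"
    if ij: "i : I" "j : I" for i j
    unfolding dF_eta[OF Pd gd(2)[OF ij]] H.comatrix_d[OF g ij]
    by(rule eta_dot[OF P gd(1)])(use Dc[OF ij(1)] gd(2) ij in auto)
   have e01: "eta P (if i = j then \<one> else \<zero>) = (if i = j then \<one>\<^sup>P else \<zero>\<^sup>P)" for i j :: nat by simp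
   have sg: "h.S.dot I (%k. eta P (S (g i k))) (%k. eta P (g k j)) = (if i = j then \<one>\<^sup>P else \<zero>\<^sup>P)"
    if ij: "i : I" "j : I" for i j
    unfolding e01[symmetric] H.comatrix_antipode(1)[OF g ij, symmetric]
    by(rule eta_dot[OF P gd(1), symmetric])(use Sc[OF ij(1)] gd(2) ij in auto)
   have gs: "h.S.dot I (%k. eta P (g i k)) (%k. eta P (S (g k j))) = (if i = j then \<one>\<^sup>P else \<zero>\<^sup>P)"
    if ij: "i : I" "j : I" for i j
    unfolding e01[symmetric] H.comatrix_antipode(2)[OF g ij, symmetric]
    by(rule eta_dot[OF P gd(1), symmetric])(use Sc gd(2) ij in auto)
   have b0: "eta P H.b ~= \<zero>\<^sup>P"
   proof
    assume "eta P H.b = \<zero>\<^sup>P"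
    hence "H.b : P" using eta_zero_iff[OF P H.b_closed] by blast
    hence "a \<otimes> H.b : P" by(rule ideal_facts(4)[OF P_ideal[OF P] H.a_closed'])
    hence "\<one> : P" using H.b_a m_comm[OF H.a_closed' H.b_closed] by simp
    thus False using ideal.one_imp_carrier[OF P_ideal[OF P]] primeideal.I_notcarr[OF P] by blast
   qed
   have wu: "EX w:F.Cspan W. w ~= \<zero>\<^sup>P & w \<otimes>\<^sup>P eta P (H.D (g i j)) : F.Cspan W"
    if ij: "i : I" "j : I" for i j
   proof (intro bexI[of _ "eta P H.b"] conjI b0 WI(1))
    show "eta P H.b \<otimes>\<^sup>P eta P (H.D (g i j)) : F.Cspan W"
     unfolding h.hom_mult[OF H.b_closed Dc[OF ij], symmetric] by(rule bD[OF gd(2)[OF ij]])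
   qed
   have lC: "eta P (l i \<odot> \<one>) : F.Cst" if "i : I" for i by(rule sC[OF scI(1)[OF lc[OF that]]])
   show ?thesis
    by(rule exI[of _ I], rule exI[of _ "%i. eta P (l i \<odot> \<one>)"], rule exI[of _ "%i. eta P (v i)"],
      rule exI[of _ "%i j. eta P (g i j)"], rule exI[of _ "%i j. eta P (S (g i j))"],
      rule exI[of _ "%i j. eta P (H.D (g i j))"],
      intro conjI ballI gd(1) lC AI vc dve qe gd(2) Sc hc Dc wu dge sg gs; assumption)
  qed
 qed
 obtain f where f: "f : A" "f ~= \<zero>\<^sup>P"
  and generic: "!!Q. [|subring_prime (FF P) A Q; ALL x:Q. dF P x : Q; f ~: Q|] ==> Q = {\<zero>\<^sup>P}"
  using T.generic_point_locally_closed by blast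
 have "EX r:carrier R. f = eta P r" using f(1) unfolding A_def by blast
 then obtain f0 where f0: "f0 : carrier R" "f = eta P f0" by blast
 have f0P: "f0 ~: P" using f(2) eta_zero_iff[OF P f0(1)] f0(2) by blast
 have "f0 : Q" if Qd: "prime_delta_ideal R \<delta> Q" and PQ: "P \<subset> Q" for Q
 proof (rule ccontr)
  assume f0Q: "f0 ~: Q"
  note Qp = Pp[OF Qd] and Qst = P_stable[OF Qd]
  note Qf = ideal_facts[OF P_ideal[OF Qp]]
  have contract: "x : Q" if x: "x : carrier R" "eta P x : eta P ` Q" for x
  proof -
   have "EX y:Q. eta P x = eta P y" using x(2) by blast
   then obtain y where y: "y : Q" "eta P x = eta P y" by blast
   have yc: "y : carrier R" by(rule Qf(1)[OF y(1)])
   have "x \<ominus> y : Q" using eta_eq_iff[OF P x(1) yc y(2)] PQ by blast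
   hence "(x \<ominus> y) \<oplus> y : Q" by(rule Qf(3)[OF _ y(1)])
   thus ?thesis using x(1) yc by(simp add: a_minus_def a_assoc l_neg)
  qed
  have AE: "EX r:carrier R. x = eta P r" if "x : A" for x using that unfolding A_def by blast
  have QE: "EX r:Q. x = eta P r" if "x : eta P ` Q" for x using that by blast
  have QI: "eta P r : eta P ` Q" if "r : Q" for r using that by blast
  have "subring_prime (FF P) A (eta P ` Q)"
  proof (intro subring_prime.intro subring_prime_axioms.intro field.axioms(1)[OF FF_field[OF P]])
   show "subring A (FF P)" unfolding A_def by(rule image_subring[OF P])
   show "eta P ` Q <= A" using AI Qf(1) by blast
   show "\<zero>\<^sup>P : eta P ` Q" using QI[OF Qf(2)] by simp
   show "x \<oplus>\<^sup>P y : eta P ` Q" if xy: "x : eta P ` Q" "y : eta P ` Q" for x y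
   proof -
    obtain r s where rs: "r : Q" "x = eta P r" "s : Q" "y = eta P s" using QE[OF xy(1)] QE[OF xy(2)] by blast
    show ?thesis unfolding rs(2,4) h.hom_add[OF Qf(1)[OF rs(1)] Qf(1)[OF rs(3)], symmetric]
     by(rule QI[OF Qf(3)[OF rs(1,3)]])
   qed
   show "x \<otimes>\<^sup>P y : eta P ` Q" if xy: "x : A" "y : eta P ` Q" for x y
   proof -
    obtain r s where rs: "r : carrier R" "x = eta P r" "s : Q" "y = eta P s" using AE[OF xy(1)] QE[OF xy(2)] by blast
    show ?thesis unfolding rs(2,4) h.hom_mult[OF rs(1) Qf(1)[OF rs(3)], symmetric]
     by(rule QI[OF Qf(4)[OF rs(1,3)]])
   qed
   show "\<one>\<^sup>P ~: eta P ` Q"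
   proof
    assume "\<one>\<^sup>P : eta P ` Q"
    hence "\<one> : Q" using contract[OF one_closed] by simp
    thus False using ideal.one_imp_carrier[OF P_ideal[OF Qp]] primeideal.I_notcarr[OF Qp] by blast
   qed
   show "x : eta P ` Q \<or> y : eta P ` Q" if xy: "x : A" "y : A" "x \<otimes>\<^sup>P y : eta P ` Q" for x y
   proof -
    obtain r s where rs: "r : carrier R" "x = eta P r" "s : carrier R" "y = eta P s" using AE[OF xy(1)] AE[OF xy(2)] by blast
    have "r \<otimes> s : Q"
     by(rule contract[OF m_closed[OF rs(1,3)]])(use xy(3) in "simp only: rs(2,4) h.hom_mult[OF rs(1,3)]")
    hence "r : Q \<or> s : Q" by(rule primeideal.I_prime[OF Qp rs(1,3)])
    thus ?thesis unfolding rs(2,4) using QI by blast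
   qed
  qed
  moreover have "ALL x:eta P ` Q. dF P x : eta P ` Q"
  proof
   fix x assume "x : eta P ` Q"
   then obtain r where r: "r : Q" "x = eta P r" by blast
   show "dF P x : eta P ` Q" unfolding r(2) dF_eta[OF Pd Qf(1)[OF r(1)]] by(rule QI[OF Qst[OF r(1)]])
  qed
  moreover have "f ~: eta P ` Q" using contract[OF f0(1)] f0Q unfolding f0(2) by blast
  ultimately have z: "eta P ` Q = {\<zero>\<^sup>P}" by(rule generic)
  have "Q <= P"
  proof
   fix x assume x: "x : Q"
   have "eta P x = \<zero>\<^sup>P" using QI[OF x] unfolding z by blast
   thus "x : P" using eta_zero_iff[OF P Qf(1)[OF x]] by blast
  qed
  thus False using PQ by blast
 qed
 hence "f0 : carrier R \<inter> \<Inter>{Q. prime_delta_ideal R \<delta> Q & P \<subset> Q}" using f0(1) by blast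
 moreover have "P <= carrier R \<inter> \<Inter>{Q. prime_delta_ideal R \<delta> Q & P \<subset> Q}"
  using ideal_facts(1)[OF P_ideal[OF P]] by blast
 ultimately show ?thesis unfolding delta_locally_closed_def using f0P by blast
qed

end

theorem theorem3p1:
  fixes K :: "('k, 'm) ring_scheme"
    and R :: "('k, 'r, 'n) module_scheme"
    and \<Delta> :: "'r \<Rightarrow> ('r \<times> 'r \<Rightarrow> 'k) set"
    and \<epsilon> :: "'r \<Rightarrow> 'k"
    and S :: "'r \<Rightarrow> 'r"
    and a :: 'r
    and \<delta> :: "'r \<Rightarrow> 'r"
  assumes "field K" and "char_zero K"
    and "affine_algebra K R"
    and "hopf_algebra K R \<Delta> \<epsilon> S"
    and "group_like K R \<Delta> a"
    and "k_derivation K R \<delta>"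
    and "coderivation K R \<Delta> a \<delta>"
  shows "delta_DME K R \<delta>"
proof -
 have aff: "affine_derivation K R \<delta>" by (intro affine_derivation.intro assms)
 have dom: "domain R" using assms(3) unfolding affine_algebra_def by blast
 have H: "hopf_derivation K R \<Delta> \<epsilon> S a \<delta>"
  by (intro hopf_derivation.intro hopf_domain.intro hopf_derivation_axioms.intro dom assms)
 show ?thesis unfolding delta_DME_def
  using affine_derivation.primitive_rational[OF aff] affine_derivation.rational_locally_closed[OF aff H]
   affine_derivation.locally_closed_primitive[OF aff] by blast
qed

end
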